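(* Let $\Omega$ be an open, bounded, convex subset of $\mathbb{R}^d$, $d\geq 1$. Let $\mathcal{A}$ be a (nonempty) compact metric space, let $a\in C(\overline{\Omega}\times\mathcal{A};\mathbb{R}^{d\times d}_{\mathrm{sym},+})$ be such that there exist constants $\overline{\nu}\geq\underline{\nu}>0$ and $\varepsilon\in(0,1]$ with $a(x,\alpha)\in\mathcal{C}(\underline{\nu},\overline{\nu},\varepsilon)$ for all $x\in\overline{\Omega}$ and $\alpha\in\mathcal{A}$, and let $f\in C(\overline{\Omega}\times\mathcal{A})$. Let $F\colon L^2(\Omega)\to L^2(\Omega)$ be an operator. Let $G\in V^*$ be nonnegative in the sense of distributions. Then a pair $(u,m)$ is a solution of the PDI problem if and only if $(u,m)$ is a solution of the VI problem.
   Context: Notation: $\mathbb{R}^{d\times d}_{\mathrm{sym}}$ is the space of real symmetric $d\times d$ matrices, $\mathbb{R}^{d\times d}_{\mathrm{sym},+}$ its subset of positive semidefinite matrices; $A:B=\sum_{i,j}A_{ij}B_{ij}$; $|\cdot|$ is the Frobenius norm. $(\cdot,\cdot)_\Omega$ is the inner product of $L^2(\Omega)$ and $L^2_+(\Omega)$ is the set of functions in $L^2(\Omega)$ that are nonnegative a.e. in $\Omega$. $V:=H^2(\Omega)\cap H^1_0(\Omega)$ with the norm and inner product of $H^2(\Omega)$; $V^*$ is its dual, with duality pairing $\langle\cdot,\cdot\rangle_{V^*\times V}$. $G\in V^*$ is nonnegative in the sense of distributions if $\langle G,v\rangle_{V^*\times V}\geq 0$ for all $v\in V$ with $v\ge 0$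 a.e. in $\Omega$. Cordes class: for $\overline{\nu}\geq\underline{\nu}>0$ and $\varepsilon\in(0,1]$, $\mathcal{C}(\underline{\nu},\overline{\nu},\varepsilon)$ is the set of all $\overline{a}\in\mathbb{R}^{d\times d}_{\mathrm{sym},+}$ such that $\underline{\nu}|\xi|^2\leq\xi^T\overline{a}\xi\leq\overline{\nu}|\xi|^2$ for all $\xi\in\mathbb{R}^d$ and $\frac{|\overline{a}|}{\mathrm{Tr}\,\overline{a}}\leq\frac{1}{\sqrt{d-1+\varepsilon}}$. Hamiltonian: $H(x,M):=\sup_{\alpha\in\mathcal{A}}\{-a(x,\alpha):M-f(x,\alpha)\}$ for $(x,M)\in\overline{\Omega}\times\mathbb{R}^{d\times d}_{\mathrm{sym}}$. For $v\in V$, $H[v]\in L^2(\Omega)$ is given by $H[v](x):=H(x,D^2v(x))$ for a.e. $x\in\Omega$. The partial subdifferential is $\partial_M H(x,M):=\{A\in\mathbb{R}^{d\times d}_{\mathrm{sym}}: H(x,M)+A:(\widetilde M-M)\leq H(x,\widetilde M)\ \forall \widetilde M\in\mathbb{R}^{d\times d}_{\mathrm{sym}}\}$. For $v\in V$, $\mathcal{D}H[v]:=\{A\in L^\infty(\Omega;\mathbb{R}^{d\times d}_{\mathrm{sym}}): A(x)\in\partial_M H(x,D^2v(x))\text{ for a.e. }x\in\Omega\}$. PDI problem: $(u,m)\in V\times L^2(\Omega)$ is a solution of the PDI problem if $H[u]=F[m]$ a.e. in $\Omega$ and there exists $-\overline{a}\in\mathcal{D}H[u]$ such that $(m,-\overline{a}:D^2v)_\Omega=\langle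 G,v\rangle_{V^*\times V}$ for all $v\in V$. VI problem: $(u,m)\in V\times L^2_+(\Omega)$ is a solution of the VI problem if $H[u]=F[m]$ a.e. in $\Omega$ and $\langle G,v-u\rangle_{V^*\times V}\leq (m,H[v]-H[u])_\Omega$ for all $v\in V$. *)

theory Defs
  imports "HOL-Analysis.Analysis"
begin

(* Function spaces on Omega are sets of representatives of type real^'d => real;
   their elements are identified when equal a.e. in Omega, and values outside
   Omega play no role.

   On real^'d^'d the library inner product is A \<bullet> B = sum_ij A_ij B_ij, i.e. A : B,
   and norm is the induced Frobenius norm. *)

definition sym_mats :: "(real^'d^'d) set" where
  "sym_mats = {M. transpose M = M}"

definition sym_psd_mats :: "(real^'d^'d) set" where
  "sym_psd_mats = {M \<in> sym_mats. \<forall>\<xi>. 0 \<le> \<xi> \<bullet> (M *v \<xi>)}"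

definition cordes :: "real \<Rightarrow> real \<Rightarrow> real \<Rightarrow> (real^'d^'d) set" where
  "cordes \<nu>l \<nu>u \<epsilon> =
     {b \<in> sym_psd_mats.
        (\<forall>\<xi>. \<nu>l * (norm \<xi>)\<^sup>2 \<le> \<xi> \<bullet> (b *v \<xi>) \<and> \<xi> \<bullet> (b *v \<xi>) \<le> \<nu>u * (norm \<xi>)\<^sup>2) \<and>
        norm b / trace b \<le> 1 / sqrt (real CARD('d) - 1 + \<epsilon>)}"


section \<open>Lebesgue spaces\<close>

definition L2 :: "(real^'d) set \<Rightarrow> ((real^'d) \<Rightarrow> real) set" where
  "L2 \<Omega> = {g. g \<in> borel_measurable (lebesgue_on \<Omega>) \<and> integrable (lebesgue_on \<Omega>) (\<lambda>x. (g x)\<^sup>2)}"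

definition L2_nonneg :: "(real^'d) set \<Rightarrow> ((real^'d) \<Rightarrow> real) set" where
  "L2_nonneg \<Omega> = {g \<in> L2 \<Omega>. AE x in lebesgue_on \<Omega>. 0 \<le> g x}"

definition L2_inner :: "(real^'d) set \<Rightarrow> ((real^'d) \<Rightarrow> real) \<Rightarrow> ((real^'d) \<Rightarrow> real) \<Rightarrow> real" where
  "L2_inner \<Omega> g h = (LINT x|lebesgue_on \<Omega>. g x * h x)"

definition L2_operator ::
  "(real^'d) set \<Rightarrow> (((real^'d) \<Rightarrow> real) \<Rightarrow> ((real^'d) \<Rightarrow> real)) \<Rightarrow> bool" where
  "L2_operator \<Omega> F \<longleftrightarrow>
     (\<forall>g \<in> L2 \<Omega>. F g \<in> L2 \<Omega>) \<and>
     (\<forall>g \<in> L2 \<Omega>. \<forall>h \<in> L2 \<Omega>.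
        (AE x in lebesgue_on \<Omega>. g x = h x) \<longrightarrow> (AE x in lebesgue_on \<Omega>. F g x = F h x))"

definition Linf_sym :: "(real^'d) set \<Rightarrow> ((real^'d) \<Rightarrow> real^'d^'d) set" where
  "Linf_sym \<Omega> =
     {B. B \<in> borel_measurable (lebesgue_on \<Omega>) \<and>
         (AE x in lebesgue_on \<Omega>. B x \<in> sym_mats) \<and>
         (\<exists>C. AE x in lebesgue_on \<Omega>. norm (B x) \<le> C)}"


section \<open>Weak derivatives and Sobolev spaces\<close>

definition partial :: "'d \<Rightarrow> ((real^'d) \<Rightarrow> real) \<Rightarrow> (real^'d) \<Rightarrow> real" where
  "partial i \<phi> x = frechet_derivative \<phi> (at x) (axis i 1)"

primrec C_k :: "nat \<Rightarrow> ((real^'d) \<Rightarrow> real) \<Rightarrow> bool" where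
  "C_k 0 \<phi> \<longleftrightarrow> continuous_on UNIV \<phi>"
| "C_k (Suc k) \<phi> \<longleftrightarrow> (\<forall>x. \<phi> differentiable (at x)) \<and> (\<forall>i. C_k k (partial i \<phi>))"

definition test_functions :: "(real^'d) set \<Rightarrow> ((real^'d) \<Rightarrow> real) set" where
  "test_functions \<Omega> =
     {\<phi>. (\<forall>k. C_k k \<phi>) \<and> compact (closure {x. \<phi> x \<noteq> 0}) \<and> closure {x. \<phi> x \<noteq> 0} \<subseteq> \<Omega>}"

definition locally_integrable :: "(real^'d) set \<Rightarrow> ((real^'d) \<Rightarrow> real) \<Rightarrow> bool" where
  "locally_integrable \<Omega> g \<longleftrightarrow> (\<forall>K. compact K \<and> K \<subseteq> \<Omega> \<longrightarrow> g absolutely_integrable_on K)"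

definition has_weak_partial ::
  "(real^'d) set \<Rightarrow> 'd \<Rightarrow> ((real^'d) \<Rightarrow> real) \<Rightarrow> ((real^'d) \<Rightarrow> real) \<Rightarrow> bool" where
  "has_weak_partial \<Omega> i v g \<longleftrightarrow>
     locally_integrable \<Omega> v \<and> locally_integrable \<Omega> g \<and>
     (\<forall>\<phi> \<in> test_functions \<Omega>.
        (LINT x|lebesgue_on \<Omega>. v x * partial i \<phi> x) = - (LINT x|lebesgue_on \<Omega>. g x * \<phi> x))"

(* A representative of the weak derivative, which is unique up to a.e. equality;
   meaningful only if a weak derivative in L2 exists. *)
definition weak_partial :: "(real^'d) set \<Rightarrow> 'd \<Rightarrow> ((real^'d) \<Rightarrow> real) \<Rightarrow> (real^'d) \<Rightarrow> real" where
  "weak_partial \<Omega> i v = (SOME g. g \<in> L2 \<Omega> \<and> has_weak_partial \<Omega> i v g)"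

definition weak_hessian :: "(real^'d) set \<Rightarrow> ((real^'d) \<Rightarrow> real) \<Rightarrow> (real^'d) \<Rightarrow> real^'d^'d" where
  "weak_hessian \<Omega> v x = (\<chi> i j. weak_partial \<Omega> i (weak_partial \<Omega> j v) x)"

definition sobolev_H1 :: "(real^'d) set \<Rightarrow> ((real^'d) \<Rightarrow> real) set" where
  "sobolev_H1 \<Omega> = {v \<in> L2 \<Omega>. \<forall>i. \<exists>g \<in> L2 \<Omega>. has_weak_partial \<Omega> i v g}"

definition sobolev_H2 :: "(real^'d) set \<Rightarrow> ((real^'d) \<Rightarrow> real) set" where
  "sobolev_H2 \<Omega> = {v \<in> sobolev_H1 \<Omega>. \<forall>i. weak_partial \<Omega> i v \<in> sobolev_H1 \<Omega>}"

definition H1_norm :: "(real^'d) set \<Rightarrow> ((real^'d) \<Rightarrow> real) \<Rightarrow> real" where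
  "H1_norm \<Omega> v =
     sqrt (L2_inner \<Omega> v v + (\<Sum>i\<in>UNIV. L2_inner \<Omega> (weak_partial \<Omega> i v) (weak_partial \<Omega> i v)))"

definition H2_norm :: "(real^'d) set \<Rightarrow> ((real^'d) \<Rightarrow> real) \<Rightarrow> real" where
  "H2_norm \<Omega> v =
     sqrt (L2_inner \<Omega> v v
         + (\<Sum>i\<in>UNIV. L2_inner \<Omega> (weak_partial \<Omega> i v) (weak_partial \<Omega> i v))
         + (\<Sum>i\<in>UNIV. \<Sum>j\<in>UNIV. L2_inner \<Omega> (weak_partial \<Omega> i (weak_partial \<Omega> j v))
                                          (weak_partial \<Omega> i (weak_partial \<Omega> j v))))"

definition sobolev_H10 :: "(real^'d) set \<Rightarrow> ((real^'d) \<Rightarrow> real) set" where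
  "sobolev_H10 \<Omega> =
     {v \<in> sobolev_H1 \<Omega>. \<exists>\<phi> :: nat \<Rightarrow> (real^'d) \<Rightarrow> real.
        (\<forall>k. \<phi> k \<in> test_functions \<Omega>) \<and> (\<lambda>k. H1_norm \<Omega> (\<lambda>x. v x - \<phi> k x)) \<longlonglongrightarrow> 0}"

definition V_space :: "(real^'d) set \<Rightarrow> ((real^'d) \<Rightarrow> real) set" where
  "V_space \<Omega> = sobolev_H2 \<Omega> \<inter> sobolev_H10 \<Omega>"

(* Linearity together with the bound forces G to agree on representatives that are
   equal a.e., so G is a functional on the space of equivalence classes. *)
definition V_dual :: "(real^'d) set \<Rightarrow> (((real^'d) \<Rightarrow> real) \<Rightarrow> real) set" where
  "V_dual \<Omega> =
     {G. (\<forall>v \<in> V_space \<Omega>. \<forall>w \<in> V_space \<Omega>. G (\<lambda>x. v x + w x) = G v + G w) \<and>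
         (\<forall>c. \<forall>v \<in> V_space \<Omega>. G (\<lambda>x. c * v x) = c * G v) \<and>
         (\<exists>C. \<forall>v \<in> V_space \<Omega>. \<bar>G v\<bar> \<le> C * H2_norm \<Omega> v)}"

definition nonneg_distr :: "(real^'d) set \<Rightarrow> (((real^'d) \<Rightarrow> real) \<Rightarrow> real) \<Rightarrow> bool" where
  "nonneg_distr \<Omega> G \<longleftrightarrow>
     (\<forall>v \<in> V_space \<Omega>. (AE x in lebesgue_on \<Omega>. 0 \<le> v x) \<longrightarrow> 0 \<le> G v)"


section \<open>The Hamiltonian\<close>

(* The supremum is a real Sup; it is a genuine (finite) supremum when x lies in the
   closure of Omega, the controls A are compact nonempty and a, f are continuous. *)
definition hamiltonian ::
  "'c set \<Rightarrow> (real^'d \<Rightarrow> 'c \<Rightarrow> real^'d^'d) \<Rightarrow> (real^'d \<Rightarrow> 'c \<Rightarrow> real)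
     \<Rightarrow> real^'d \<Rightarrow> real^'d^'d \<Rightarrow> real" where
  "hamiltonian A a f x M = (SUP \<alpha>\<in>A. - (a x \<alpha> \<bullet> M) - f x \<alpha>)"

definition hamiltonian_op ::
  "(real^'d) set \<Rightarrow> 'c set \<Rightarrow> (real^'d \<Rightarrow> 'c \<Rightarrow> real^'d^'d) \<Rightarrow> (real^'d \<Rightarrow> 'c \<Rightarrow> real)
     \<Rightarrow> ((real^'d) \<Rightarrow> real) \<Rightarrow> (real^'d) \<Rightarrow> real" where
  "hamiltonian_op \<Omega> A a f v x = hamiltonian A a f x (weak_hessian \<Omega> v x)"

definition subdiff_M ::
  "'c set \<Rightarrow> (real^'d \<Rightarrow> 'c \<Rightarrow> real^'d^'d) \<Rightarrow> (real^'d \<Rightarrow> 'c \<Rightarrow> real)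
     \<Rightarrow> real^'d \<Rightarrow> real^'d^'d \<Rightarrow> (real^'d^'d) set" where
  "subdiff_M A a f x M =
     {B \<in> sym_mats. \<forall>M' \<in> sym_mats.
        hamiltonian A a f x M + B \<bullet> (M' - M) \<le> hamiltonian A a f x M'}"

definition DH ::
  "(real^'d) set \<Rightarrow> 'c set \<Rightarrow> (real^'d \<Rightarrow> 'c \<Rightarrow> real^'d^'d) \<Rightarrow> (real^'d \<Rightarrow> 'c \<Rightarrow> real)
     \<Rightarrow> ((real^'d) \<Rightarrow> real) \<Rightarrow> ((real^'d) \<Rightarrow> real^'d^'d) set" where
  "DH \<Omega> A a f v =
     {B \<in> Linf_sym \<Omega>. AE x in lebesgue_on \<Omega>. B x \<in> subdiff_M A a f x (weak_hessian \<Omega> v x)}"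


section \<open>The two problems\<close>

definition PDI_solution ::
  "(real^'d) set \<Rightarrow> 'c set \<Rightarrow> (real^'d \<Rightarrow> 'c \<Rightarrow> real^'d^'d) \<Rightarrow> (real^'d \<Rightarrow> 'c \<Rightarrow> real)
     \<Rightarrow> (((real^'d) \<Rightarrow> real) \<Rightarrow> ((real^'d) \<Rightarrow> real)) \<Rightarrow> (((real^'d) \<Rightarrow> real) \<Rightarrow> real)
     \<Rightarrow> ((real^'d) \<Rightarrow> real) \<Rightarrow> ((real^'d) \<Rightarrow> real) \<Rightarrow> bool" where
  "PDI_solution \<Omega> A a f F G u m \<longleftrightarrow>
     u \<in> V_space \<Omega> \<and> m \<in> L2 \<Omega> \<and>
     (AE x in lebesgue_on \<Omega>. hamiltonian_op \<Omega> A a f u x = F m x) \<and>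
     (\<exists>b. (\<lambda>x. - b x) \<in> DH \<Omega> A a f u \<and>
        (\<forall>v \<in> V_space \<Omega>. L2_inner \<Omega> m (\<lambda>x. - b x \<bullet> weak_hessian \<Omega> v x) = G v))"

definition VI_solution ::
  "(real^'d) set \<Rightarrow> 'c set \<Rightarrow> (real^'d \<Rightarrow> 'c \<Rightarrow> real^'d^'d) \<Rightarrow> (real^'d \<Rightarrow> 'c \<Rightarrow> real)
     \<Rightarrow> (((real^'d) \<Rightarrow> real) \<Rightarrow> ((real^'d) \<Rightarrow> real)) \<Rightarrow> (((real^'d) \<Rightarrow> real) \<Rightarrow> real)
     \<Rightarrow> ((real^'d) \<Rightarrow> real) \<Rightarrow> ((real^'d) \<Rightarrow> real) \<Rightarrow> bool" where
  "VI_solution \<Omega> A a f F G u m \<longleftrightarrow>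
     u \<in> V_space \<Omega> \<and> m \<in> L2_nonneg \<Omega> \<and>
     (AE x in lebesgue_on \<Omega>. hamiltonian_op \<Omega> A a f u x = F m x) \<and>
     (\<forall>v \<in> V_space \<Omega>.
        G (\<lambda>x. v x - u x) \<le>
        L2_inner \<Omega> m (\<lambda>x. hamiltonian_op \<Omega> A a f v x - hamiltonian_op \<Omega> A a f u x))"

end

theory Submission
 imports Defs
begin

text \<open>If \<open>-b\<close> is a measurable selection of the subdifferential, then \<open>b\<close> is uniformly elliptic and satisfies
 the Cordes condition, so \<open>\<gamma> b\<close> with \<open>\<gamma> = tr b / |b|\<^sup>2\<close> is near the identity. By the Miranda--Talenti
 estimate on smooth convex subdomains, and by deformation of the domain from a ball, smooth
 uniformly elliptic Cordes operators have dense range there. A comparison principle makes the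
 approximate solutions nonnegative for nonnegative data. In the limit, for each measurable \<open>g\<close> with values
 in \<open>[0, 1]\<close> there is \<open>v \<ge> 0\<close> in \<open>V\<close> with \<open>(m / \<gamma>, - \<gamma> b : D\<^sup>2v) = (m / \<gamma>, g)\<close>; for a PDI solution the left-hand side
 is \<open>\<langle>G, v\<rangle> \<ge> 0\<close>, and with \<open>g\<close> the indicator of \<open>{m < 0}\<close> this gives \<open>m \<ge> 0\<close>. The VI then follows from the
 subdifferential inequality.

 Conversely, for a VI solution let \<open>\<mu> = m\<close> where \<open>m > 0\<close> and \<open>\<mu> = 1\<close> elsewhere. As a function of \<open>D\<^sup>2v\<close>,
 cut off to \<open>{m > 0}\<close>, \<open>G\<close> is dominated by the convex Lipschitz functional
 \<open>N \<mapsto> (\<mu>, H(\<cdot>, D\<^sup>2u + N) - H(\<cdot>, D\<^sup>2u))\<close> on \<open>L\<^sup>2\<close>. A Hahn--Banach argument extends \<open>G\<close> to a dominated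
 element \<open>R\<close> of \<open>L\<^sup>2\<close>, and localisation to indicators of measurable sets shows that \<open>R / \<mu>\<close> is
 pointwise a subgradient.\<close>

section \<open>Smooth functions\<close>

text \<open>The coefficient picked from the subdifferential is merely measurable. Its approximations
  are smooth, but their comparison constants involve derivatives that may blow up along the
  sequence; this is harmless because, for each approximation separately, the residual and the
  negative part are made as small as desired, and only the bound coming from the Cordes condition
  has to be uniform. On a smooth subdomain \<open>{x. \<rho> x < 0}\<close> every function has the
  form \<open>\<rho> x * l x\<close> with \<open>l\<close> smooth: the boundary condition is built
  in, and boundary terms appear as multiples of \<open>\<rho>\<close>. Solvability on these
  subdomains means density of the range. The deformation starts at a ball because there the
  Laplacians of \<open>(|x|^2 - 1) p\<close> with \<open>p\<close> a polynomial already exhaust the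
  polynomials, and it runs through convex domains, so that one a priori constant serves all
  parameters. For the converse, the equation sees \<open>b\<close> only where \<open>m > 0\<close>,
  but membership in \<open>DH\<close> is required a.e. in all of \<open>\<Omega>\<close>. The value
  1 of \<open>\<mu>\<close> on the rest keeps the domination informative there, so a single
  \<open>R\<close> yields the subgradient everywhere, and it is measurable by construction.\<close>

definition smooth :: "((real^'d) => real) => bool" where
 "smooth \<phi> \<longleftrightarrow> (\<forall>k. C_k k \<phi>)"

lemma partial_eqI:
 "(\<phi> has_derivative D) (at x) ==> partial i \<phi> x = D (axis i 1)"
 unfolding partial_def using frechet_derivative_at by metis

lemma has_derivative_frechet:
 "\<phi> differentiable (at x) ==> (\<phi> has_derivative frechet_derivative \<phi> (at x)) (at x)"
 by (simp add: frechet_derivative_works)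

lemma smooth_C_k: "smooth \<phi> ==> C_k k \<phi>"
 by (simp add: smooth_def)

lemma smooth_differentiable: "smooth \<phi> ==> \<phi> differentiable (at x)"
 unfolding smooth_def by (metis C_k.simps(2))

lemma smooth_partial [simp, intro]: "smooth \<phi> ==> smooth (partial i \<phi>)"
 unfolding smooth_def by (metis C_k.simps(2))

lemma smooth_continuous_on: "smooth \<phi> ==> continuous_on S \<phi>"
 by (meson C_k.simps(1) continuous_on_subset smooth_def subset_UNIV)

lemma smooth_isCont: "smooth \<phi> ==> isCont \<phi> x"
 using smooth_continuous_on[of \<phi> UNIV] continuous_on_eq_continuous_at by blast

lemma differentiable_imp_C_k_0: "(\<And>x. \<phi> differentiable (at x)) ==> C_k 0 \<phi>"
 by (simp add: differentiable_imp_continuous_on differentiable_on_def differentiable_at_withinI)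

lemma C_k_Suc_imp: "C_k (Suc k) \<phi> ==> C_k k \<phi>"
proof (induction k arbitrary: \<phi>)
 case 0
 then show ?case using differentiable_imp_C_k_0 by (metis C_k.simps(2))
qed (metis C_k.simps(2))

lemma partial_const [simp]: "partial i (\<lambda>x. c) = (\<lambda>x. 0)"
 by (rule ext, rule partial_eqI[of _ "\<lambda>_. 0"]) auto

lemma partial_coord [simp]: "partial i (\<lambda>x. x $ j) = (\<lambda>x. if i = j then 1 else 0)"
 by (rule ext, subst partial_eqI[OF bounded_linear_imp_has_derivative[OF bounded_linear_vec_nth]])
   (auto simp: axis_def)

lemma partial_add:
 assumes "f differentiable (at x)" "g differentiable (at x)"
 shows "partial i (\<lambda>x. f x + g x) x = partial i f x + partial i g x"
 unfolding partial_def[of i f] partial_def[of i g]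
 by (rule partial_eqI) (use assms has_derivative_frechet in \<open>auto intro!: derivative_eq_intros\<close>)

lemma partial_diff:
 assumes "f differentiable (at x)" "g differentiable (at x)"
 shows "partial i (\<lambda>x. f x - g x) x = partial i f x - partial i g x"
 unfolding partial_def[of i f] partial_def[of i g]
 by (rule partial_eqI) (use assms has_derivative_frechet in \<open>auto intro!: derivative_eq_intros\<close>)

lemma partial_mult:
 assumes "f differentiable (at x)" "g differentiable (at x)"
 shows "partial i (\<lambda>x. f x * g x) x = partial i f x * g x + f x * partial i g x"
 unfolding partial_def[of i f] partial_def[of i g]
 by (subst partial_eqI[OF has_derivative_mult[OF assms[THEN has_derivative_frechet]]])
   (simp add: algebra_simps)

lemma partial_compose_real:
 fixes h :: "real => real"
 assumes "(h has_real_derivative h') (at (g x))" "g differentiable (at x)"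
 shows "partial i (\<lambda>x. h (g x)) x = h' * partial i g x"
proof -
 have "((\<lambda>x. h (g x)) has_derivative (\<lambda>y. h' * frechet_derivative g (at x) y)) (at x)"
  using has_derivative_compose[OF has_derivative_frechet[OF assms(2)]]
   assms(1) by (auto simp: has_field_derivative_def mult.commute)
 then show ?thesis by (simp add: partial_eqI partial_def[of i g])
qed

lemma differentiable_compose_real:
 fixes h :: "real => real"
 assumes "(h has_real_derivative h') (at (g x))" "g differentiable (at x)"
 shows "(\<lambda>x. h (g x)) differentiable (at x)"
 using differentiable_chain_at[OF assms(2), of h] assms(1)
 by (auto simp: o_def has_field_derivative_def differentiable_def)

lemma C_k_const [simp]: "C_k k (\<lambda>x. c)"
 by (induction k arbitrary: c) auto

lemma C_k_coord [simp]: "C_k k (\<lambda>x::real^'d. x $ i)"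
proof (cases k)
 case 0 then show ?thesis by (auto intro!: continuous_intros)
next
 case (Suc n)
 have "(\<lambda>x. x $ i) differentiable at x" for x :: "real^'d"
  using bounded_linear_imp_differentiable[OF bounded_linear_vec_nth] .
 moreover have "C_k n (\<lambda>x::real^'d. if j = i then 1 else 0)" for j
  by (cases "j = i") auto
 ultimately show ?thesis using Suc by auto
qed

lemma C_k_add: "C_k k f ==> C_k k g ==> C_k k (\<lambda>x. f x + g x)"
proof (induction k arbitrary: f g)
 case 0 then show ?case by (auto intro!: continuous_intros)
next
 case (Suc k)
 have "partial i (\<lambda>x. f x + g x) = (\<lambda>x. partial i f x + partial i g x)" for i
  using Suc.prems by (auto intro!: ext partial_add)
 then show ?case using Suc by auto
qed

lemma C_k_mult: "C_k k f ==> C_k k g ==> C_k k (\<lambda>x. f x * g x)"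
proof (induction k arbitrary: f g)
 case 0 then show ?case by (auto intro!: continuous_intros)
next
 case (Suc k)
 have "partial i (\<lambda>x. f x * g x) = (\<lambda>x. partial i f x * g x + f x * partial i g x)" for i
  using Suc.prems by (auto intro!: ext partial_mult)
 moreover have "C_k k (\<lambda>x. partial i f x * g x + f x * partial i g x)" for i
  using Suc.prems C_k_Suc_imp[OF Suc.prems(1)] C_k_Suc_imp[OF Suc.prems(2)]
  by (intro C_k_add Suc.IH) auto
 ultimately show ?case using Suc.prems by auto
qed

named_theorems smooth_intros

lemma smooth_const [smooth_intros, simp]: "smooth (\<lambda>x. c)"
 by (simp add: smooth_def)
lemma smooth_coord [smooth_intros, simp]: "smooth (\<lambda>x. x $ i)"
 by (simp add: smooth_def)
lemma smooth_add [smooth_intros]: "smooth f ==> smooth g ==> smooth (\<lambda>x. f x + g x)"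
 by (simp add: smooth_def C_k_add)
lemma smooth_mult [smooth_intros]: "smooth f ==> smooth g ==> smooth (\<lambda>x. f x * g x)"
 by (simp add: smooth_def C_k_mult)
lemma smooth_uminus [smooth_intros]: "smooth f ==> smooth (\<lambda>x. - f x)"
 using smooth_mult[OF smooth_const[of "-1"], of f] by simp
lemma smooth_diff [smooth_intros]: "smooth f ==> smooth g ==> smooth (\<lambda>x. f x - g x)"
 using smooth_add[of f "\<lambda>x. - g x"] smooth_uminus[of g] by simp
lemma smooth_power [smooth_intros]: "smooth f ==> smooth (\<lambda>x. f x ^ n)"
 by (induction n) (auto intro: smooth_intros)
lemma smooth_sum [smooth_intros]: "(\<And>i. i \<in> I ==> smooth (f i)) ==> smooth (\<lambda>x. \<Sum>i\<in>I. f i x)"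
 by (induction I rule: infinite_finite_induct) (auto intro: smooth_intros)
lemma smooth_divide_const [smooth_intros]: "smooth f ==> smooth (\<lambda>x. f x / c)"
 using smooth_mult[OF _ smooth_const[of "1/c"], of f] by simp

lemma smooth_inner_left [smooth_intros]: "smooth (\<lambda>x. l \<bullet> x)"
 unfolding inner_vec_def by (auto intro!: smooth_intros)

lemma partial_smooth_add: "smooth f ==> smooth g ==>
  partial i (\<lambda>x. f x + g x) = (\<lambda>x. partial i f x + partial i g x)"
 by (auto intro!: ext partial_add smooth_differentiable)
lemma partial_smooth_diff: "smooth f ==> smooth g ==>
  partial i (\<lambda>x. f x - g x) = (\<lambda>x. partial i f x - partial i g x)"
 by (auto intro!: ext partial_diff smooth_differentiable)
lemma partial_smooth_mult: "smooth f ==> smooth g ==>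
  partial i (\<lambda>x. f x * g x) = (\<lambda>x. partial i f x * g x + f x * partial i g x)"
 by (auto intro!: ext partial_mult smooth_differentiable)
lemma partial_smooth_cmult: "smooth g ==> partial i (\<lambda>x. c * g x) = (\<lambda>x. c * partial i g x)"
 by (simp add: partial_smooth_mult)
lemma partial_smooth_sum: "(\<And>j. j \<in> I ==> smooth (f j)) ==>
  partial i (\<lambda>x. \<Sum>j\<in>I. f j x) = (\<lambda>x. \<Sum>j\<in>I. partial i (f j) x)"
 by (induction I rule: infinite_finite_induct) (simp_all add: partial_smooth_add smooth_sum)

lemma partial_inner_left [simp]: "partial i (\<lambda>x. l \<bullet> x) = (\<lambda>x. l $ i)"
 by (rule ext, subst partial_eqI[of _ "\<lambda>h. l \<bullet> h"])
   (auto simp: inner_axis intro!: derivative_eq_intros)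

lemmas partial_simps = partial_smooth_add partial_smooth_diff partial_smooth_mult partial_smooth_sum

text \<open>The functions \<open>exp (-1/t) / t ^ n\<close>, extended by zero to \<open>t \<le> 0\<close>, form a family
 that is closed under differentiation up to linear combinations.\<close>

definition flat :: "nat => real => real" where
 "flat n t = (if t > 0 then exp (-1/t) / t ^ n else 0)"

lemma flat_nonneg: "0 \<le> flat n t"
 by (simp add: flat_def)

lemma flat_tendsto_0: "(flat n \<longlongrightarrow> 0) (at 0)"
proof -
 have "((\<lambda>u::real. u ^ n / exp u) \<longlongrightarrow> 0) at_top"
  by (rule tendsto_power_div_exp_0)
 then have "((\<lambda>t::real. (inverse t) ^ n / exp (inverse t)) \<longlongrightarrow> 0) (at_right 0)"
  using filterlim_inverse_at_top_right filterlim_compose by blast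
 then have "(flat n \<longlongrightarrow> 0) (at_right 0)"
  by (rule tendsto_cong[THEN iffD1, rotated])
    (auto simp: flat_def eventually_at_filter exp_minus field_simps)
 moreover have "(flat n \<longlongrightarrow> 0) (at_left 0)"
  by (rule tendsto_cong[THEN iffD2, of _ "\<lambda>_. 0"]) (auto simp: flat_def eventually_at_filter)
 ultimately show ?thesis
  by (simp add: filterlim_at_split)
qed

lemma flat_has_derivative:
 "(flat n has_real_derivative (flat (n + 2) t - n * flat (n + 1) t)) (at t)"
proof -
 consider "t > 0" | "t < 0" | "t = 0" by linarith
 then show ?thesis
 proof cases
  case 1
  have "((\<lambda>t. exp (-1/t) / t ^ n) has_real_derivative (flat (n + 2) t - n * flat (n + 1) t)) (at t)"
   using 1 by (auto intro!: derivative_eq_intros simp: flat_def divide_simps power2_eq_square)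
     (cases n; auto simp: field_simps)
  moreover have "eventually (\<lambda>s. exp (-1/s) / s ^ n = flat n s) (nhds t)"
   using eventually_nhds_in_open[of "{0<..}" t] 1 by (auto elim!: eventually_mono simp: flat_def)
  ultimately show ?thesis using DERIV_cong_ev[of t t "\<lambda>t. exp (-1/t) / t ^ n" "flat n" _ _ ] by auto
 next
  case 2
  have "eventually (\<lambda>s. 0 = flat n s) (nhds t)"
   using eventually_nhds_in_open[of "{..<0}" t] 2 by (auto elim!: eventually_mono simp: flat_def)
  moreover have "((\<lambda>t. 0) has_real_derivative (flat (n + 2) t - n * flat (n + 1) t)) (at t)"
   using 2 by (simp add: flat_def)
  ultimately show ?thesis using DERIV_cong_ev[of t t "\<lambda>t. 0" "flat n"] by auto
 next
  case 3
  have "(\<lambda>h. flat n h / h) = flat (n+1)"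
   by (auto simp: flat_def fun_eq_iff)
  then show ?thesis using flat_tendsto_0[of "n+1"] 3 
   by (simp add: DERIV_def) (simp add: flat_def)
 qed
qed

lemma flat_isCont: "isCont (flat n) t"
 using DERIV_isCont flat_has_derivative by blast

lemma flat_continuous_on: "continuous_on S (flat n)"
 using continuous_at_imp_continuous_on flat_isCont by blast

lemma C_k_flat: "smooth g ==> C_k k (\<lambda>x. flat n (g x))"
proof (induction k arbitrary: n)
 case 0 then show ?case 
  by (simp add: continuous_on_compose2[OF flat_continuous_on[of UNIV]] smooth_continuous_on)
next
 case (Suc k)
 have d: "(\<lambda>x. flat n (g x)) differentiable at x" for x
  using differentiable_compose_real[OF flat_has_derivative smooth_differentiable[OF Suc.prems]] .
 have "partial i (\<lambda>x. flat n (g x)) = (\<lambda>x. (flat (n + 2) (g x) + (- real n) * flat (n + 1) (g x)) * partial i g x)" for i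
  unfolding minus_mult_left[symmetric] add_uminus_conv_diff
  using partial_compose_real[OF flat_has_derivative smooth_differentiable[OF Suc.prems]] by auto
 moreover have "C_k k (\<lambda>x. (flat (n + 2) (g x) + (- real n) * flat (n + 1) (g x)) * partial i g x)" for i
  by (intro C_k_mult C_k_add C_k_const smooth_C_k[of "partial _ g"] smooth_partial Suc.prems Suc.IH)
 ultimately show ?case using d by simp
qed

lemma smooth_flat [smooth_intros]: "smooth g ==> smooth (\<lambda>x. flat n (g x))"
 by (simp add: smooth_def[of "\<lambda>x. flat n (g x)"] C_k_flat)

lemma C_k_powr: "smooth g ==> (\<And>x. g x > 0) ==> C_k k (\<lambda>x. g x powr a)"
proof (induction k arbitrary: a)
 case 0 
 have "g x \<noteq> 0" for x using 0(2)[of x] by simp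
 then show ?case using 0 by (auto intro!: continuous_intros simp: smooth_continuous_on)
next
 case (Suc k)
 have D: "((\<lambda>z. z powr a) has_real_derivative (a * g x powr (a - 1))) (at (g x))" for x
  using has_real_derivative_powr[OF Suc.prems(2)] by auto
 have d: "(\<lambda>x. g x powr a) differentiable at x" for x
  using differentiable_compose_real[OF D smooth_differentiable[OF Suc.prems(1)]] .
 have "partial i (\<lambda>x. g x powr a) = (\<lambda>x. (a * g x powr (a - 1)) * partial i g x)" for i
  using partial_compose_real[OF D smooth_differentiable[OF Suc.prems(1)]] by auto
 then show ?case using d Suc.IH[OF Suc.prems]
  by (simp only: C_k.simps) (auto intro!: C_k_mult C_k_const smooth_C_k[of "partial _ g"] Suc.prems)
qed

lemma smooth_powr [smooth_intros]: "smooth g ==> (\<And>x. g x > 0) ==> smooth (\<lambda>x. g x powr a)"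
 by (simp add: smooth_def[of "\<lambda>x. g x powr a"] C_k_powr)

lemma smooth_partial_powr:
 assumes "smooth g" "\<And>x. g x > 0"
 shows "partial i (\<lambda>x. g x powr a) = (\<lambda>x. a * g x powr (a - 1) * partial i g x)"
proof
 fix x
 have D: "((\<lambda>z. z powr a) has_real_derivative (a * g x powr (a - 1))) (at (g x))"
  using has_real_derivative_powr[OF assms(2)] by auto
 show "partial i (\<lambda>x. g x powr a) x = a * g x powr (a - 1) * partial i g x"
  using partial_compose_real[OF D smooth_differentiable[OF assms(1)]] .
qed

section \<open>Symmetry of second derivatives\<close>

lemma smooth_has_line_derivative:
 assumes "smooth \<phi>"
 shows "((\<lambda>t. \<phi> (x + t *\<^sub>R axis i 1)) has_real_derivative partial i \<phi> (x + t *\<^sub>R axis i 1)) (at t)"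
proof -
 have "((\<lambda>t. \<phi> (x + t *\<^sub>R axis i 1)) has_derivative
   (\<lambda>h. frechet_derivative \<phi> (at (x + t *\<^sub>R axis i 1)) (h *\<^sub>R axis i 1))) (at t)"
  by (rule has_derivative_compose[OF _ has_derivative_frechet[OF smooth_differentiable[OF assms]]])
    (auto intro!: derivative_eq_intros)
 moreover have "linear (frechet_derivative \<phi> (at (x + t *\<^sub>R axis i 1)))"
  by (simp add: linear_frechet_derivative smooth_differentiable assms)
 ultimately show ?thesis
  by (simp add: has_field_derivative_def partial_def linear_cmul mult.commute[of _ "frechet_derivative _ _ _"])
qed

text \<open>Two applications of the mean value theorem, along \<open>axis i 1\<close> and then along
  \<open>axis j 1\<close>. The left-hand side is symmetric in \<open>i\<close> and \<open>j\<close>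
  although the right-hand side is not; comparing the two orders yields the symmetry of second
  derivatives.\<close>

lemma second_difference_mvt:
 assumes "smooth \<phi>" "h > 0"
 obtains s t where "0 < s" "s < h" "0 < t" "t < h"
  "\<phi> (x + h *\<^sub>R axis i 1 + h *\<^sub>R axis j 1) - \<phi> (x + h *\<^sub>R axis i 1) - \<phi> (x + h *\<^sub>R axis j 1) + \<phi> x
   = h\<^sup>2 * partial j (partial i \<phi>) (x + s *\<^sub>R axis i 1 + t *\<^sub>R axis j 1)"
proof -
 define g where "g = (\<lambda>s. \<phi> (x + h *\<^sub>R axis j 1 + s *\<^sub>R axis i 1) - \<phi> (x + s *\<^sub>R axis i 1))"
 have "\<exists>s>0. s < h \<and> g h - g 0 = (h - 0) * (partial i \<phi> (x + h *\<^sub>R axis j 1 + s *\<^sub>R axis i 1) - partial i \<phi> (x + s *\<^sub>R axis i 1))"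
  unfolding g_def
  by (rule MVT2[OF assms(2)]) (intro DERIV_diff smooth_has_line_derivative assms)
 then obtain s where s: "0 < s" "s < h" "g h - g 0 = h * (partial i \<phi> (x + h *\<^sub>R axis j 1 + s *\<^sub>R axis i 1) - partial i \<phi> (x + s *\<^sub>R axis i 1))"
  by auto
 have "\<exists>t>0. t < h \<and> partial i \<phi> (x + s *\<^sub>R axis i 1 + h *\<^sub>R axis j 1) - partial i \<phi> (x + s *\<^sub>R axis i 1 + 0 *\<^sub>R axis j 1)
    = (h - 0) * partial j (partial i \<phi>) (x + s *\<^sub>R axis i 1 + t *\<^sub>R axis j 1)"
  by (rule MVT2[OF assms(2)]) (intro smooth_has_line_derivative smooth_partial assms)
 then obtain t where t: "0 < t" "t < h" "partial i \<phi> (x + s *\<^sub>R axis i 1 + h *\<^sub>R axis j 1) - partial i \<phi> (x + s *\<^sub>R axis i 1)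
    = h * partial j (partial i \<phi>) (x + s *\<^sub>R axis i 1 + t *\<^sub>R axis j 1)"
  by auto
 show ?thesis
 proof (rule that[OF s(1,2) t(1,2)])
  show "\<phi> (x + h *\<^sub>R axis i 1 + h *\<^sub>R axis j 1) - \<phi> (x + h *\<^sub>R axis i 1) - \<phi> (x + h *\<^sub>R axis j 1) + \<phi> x
   = h\<^sup>2 * partial j (partial i \<phi>) (x + s *\<^sub>R axis i 1 + t *\<^sub>R axis j 1)"
   using s(3) t(3) unfolding g_def by (simp add: algebra_simps power2_eq_square)
 qed
qed

text \<open>Both mixed derivatives, at suitable points within distance \<open>2 * h n\<close> of
  \<open>x\<close>, equal the same second difference divided by \<open>(h n)^2\<close>; continuity
  allows \<open>h n\<close> to tend to zero.\<close>

lemma partial_commute: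
 assumes "smooth \<phi>"
 shows "partial i (partial j \<phi>) = partial j (partial i \<phi>)"
proof
 fix x
 define h :: "nat => real" where "h n = 1 / Suc n" for n
 have h: "h n > 0" for n by (simp add: h_def)
 have h0: "h \<longlonglongrightarrow> 0" unfolding h_def by (rule LIMSEQ_Suc[OF lim_1_over_n])
 have "\<exists>y z. norm (y - x) \<le> 2 * h n \<and> norm (z - x) \<le> 2 * h n \<and>
   partial j (partial i \<phi>) y = partial i (partial j \<phi>) z" for n
 proof -
  obtain s t where A: "0 < s" "s < h n" "0 < t" "t < h n"
   "\<phi> (x + h n *\<^sub>R axis i 1 + h n *\<^sub>R axis j 1) - \<phi> (x + h n *\<^sub>R axis i 1) - \<phi> (x + h n *\<^sub>R axis j 1) + \<phi> x
   = (h n)\<^sup>2 * partial j (partial i \<phi>) (x + s *\<^sub>R axis i 1 + t *\<^sub>R axis j 1)"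
   using second_difference_mvt[OF assms h] by metis
  obtain s' t' where B: "0 < s'" "s' < h n" "0 < t'" "t' < h n"
   "\<phi> (x + h n *\<^sub>R axis j 1 + h n *\<^sub>R axis i 1) - \<phi> (x + h n *\<^sub>R axis j 1) - \<phi> (x + h n *\<^sub>R axis i 1) + \<phi> x
   = (h n)\<^sup>2 * partial i (partial j \<phi>) (x + s' *\<^sub>R axis j 1 + t' *\<^sub>R axis i 1)"
   using second_difference_mvt[OF assms h] by metis
  have "(h n)\<^sup>2 * partial j (partial i \<phi>) (x + s *\<^sub>R axis i 1 + t *\<^sub>R axis j 1)
   = (h n)\<^sup>2 * partial i (partial j \<phi>) (x + s' *\<^sub>R axis j 1 + t' *\<^sub>R axis i 1)"
   using A(5) B(5) by (simp add: algebra_simps)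
  then have e: "partial j (partial i \<phi>) (x + s *\<^sub>R axis i 1 + t *\<^sub>R axis j 1)
   = partial i (partial j \<phi>) (x + s' *\<^sub>R axis j 1 + t' *\<^sub>R axis i 1)"
   using h[of n] by simp
  have nr: "norm (a *\<^sub>R axis i (1::real) + b *\<^sub>R axis j 1 :: real^'a) \<le> 2 * h n" if "0 < a" "a < h n" "0 < b" "b < h n" for a b i j
   using norm_triangle_ineq[of "a *\<^sub>R axis i (1::real) :: real^'a" "b *\<^sub>R axis j 1"] that by simp
  show ?thesis
   by (rule exI[of _ "x + s *\<^sub>R axis i 1 + t *\<^sub>R axis j 1"], rule exI[of _ "x + s' *\<^sub>R axis j 1 + t' *\<^sub>R axis i 1"])
    (use e nr A B in \<open>auto simp: add.assoc\<close>)
 qed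
 then obtain y z where yz: "\<And>n. norm (y n - x) \<le> 2 * h n" "\<And>n. norm (z n - x) \<le> 2 * h n"
   "\<And>n. partial j (partial i \<phi>) (y n) = partial i (partial j \<phi>) (z n)" by metis
 have lim: "u \<longlonglongrightarrow> x" if "\<And>n. norm (u n - x) \<le> 2 * h n" for u :: "nat => real^'a"
  by (rule Lim_transform_bound[of _ "\<lambda>n. 2 * h n", THEN Lim_null[THEN iffD2]])
    (use that h tendsto_mult_right_zero[OF h0] in \<open>auto simp: abs_of_pos\<close>)
 have "(\<lambda>n. partial j (partial i \<phi>) (y n)) \<longlonglongrightarrow> partial j (partial i \<phi>) x"
  by (rule isCont_tendsto_compose[OF smooth_isCont lim]) (use yz assms in auto)
 moreover have "(\<lambda>n. partial i (partial j \<phi>) (z n)) \<longlonglongrightarrow> partial i (partial j \<phi>) x"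
  by (rule isCont_tendsto_compose[OF smooth_isCont lim]) (use yz assms in auto)
 ultimately show "partial i (partial j \<phi>) x = partial j (partial i \<phi>) x"
  using yz(3) LIMSEQ_unique by simp
qed

section \<open>Square-integrable functions\<close>

text \<open>Values lie in an arbitrary Euclidean space, so that functions, gradients, Hessians and
  tuples of them fall under one theory. Since the integral of a non-integrable function is 0 by
  default, \<open>l2\<close> is meaningful only together with \<open>sqint\<close>.\<close>

definition sqint :: "'a measure => ('a => 'b::euclidean_space) => bool" where
 "sqint M f \<longleftrightarrow> f \<in> borel_measurable M \<and> integrable M (\<lambda>x. (norm (f x))\<^sup>2)"

definition l2 :: "'a measure => ('a => 'b::euclidean_space) => real" where
 "l2 M f = sqrt (LINT x|M. (norm (f x))\<^sup>2)"

lemma sqintD: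
 assumes "sqint M f"
 shows "f \<in> borel_measurable M" "integrable M (\<lambda>x. (norm (f x))\<^sup>2)"
 using assms by (auto simp: sqint_def)

declare sqintD(1) [measurable_dest, dest] sqintD(2) [dest]

lemma l2_nonneg [simp]: "0 \<le> l2 M f"
 by (simp add: l2_def)

lemma l2_square: "(l2 M f)\<^sup>2 = (LINT x|M. (norm (f x))\<^sup>2)"
 by (simp add: l2_def)

lemma l2_minus_commute: "l2 M (\<lambda>x. f x - g x) = l2 M (\<lambda>x. g x - f x)"
 by (simp add: l2_def norm_minus_commute)

lemma sqint_mono:
 assumes "sqint M g" "f \<in> borel_measurable M" "AE x in M. norm (f x) \<le> norm (g x)"
 shows "sqint M f"
proof -
 have "integrable M (\<lambda>x. (norm (f x))\<^sup>2)"
  by (rule Bochner_Integration.integrable_bound[OF sqintD(2)[OF assms(1)]])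
    (use assms in \<open>auto intro!: power_mono elim!: eventually_mono\<close>)
 then show ?thesis using assms by (simp add: sqint_def)
qed

lemma l2_mono:
 assumes "sqint M g" "f \<in> borel_measurable M" "AE x in M. norm (f x) \<le> norm (g x)"
 shows "l2 M f \<le> l2 M g"
 unfolding l2_def
proof (intro real_sqrt_le_mono integral_mono_AE sqintD(2))
 show "AE x in M. (norm (f x))\<^sup>2 \<le> (norm (g x))\<^sup>2"
  using assms(3) by eventually_elim (simp add: power_mono)
qed (rule sqint_mono[OF assms] assms(1))+

lemma l2_cong_AE:
 assumes "f \<in> borel_measurable M" "g \<in> borel_measurable M" "AE x in M. f x = g x"
 shows "l2 M f = l2 M g"
 unfolding l2_def
 by (rule arg_cong[where f = sqrt], rule integral_cong_AE)
   (use assms in \<open>auto elim!: eventually_mono\<close>)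

lemma sqint_scaleR: "sqint M f ==> sqint M (\<lambda>x. c *\<^sub>R f x)"
 unfolding sqint_def by (auto simp: power_mult_distrib)

lemma l2_scaleR: "l2 M (\<lambda>x. c *\<^sub>R f x) = \<bar>c\<bar> * l2 M f"
 by (simp add: l2_def power_mult_distrib real_sqrt_mult)

lemma sqint_add:
 assumes "sqint M f" "sqint M g"
 shows "sqint M (\<lambda>x. f x + g x)"
proof -
 have "(norm (f x + g x))\<^sup>2 \<le> 2 * (norm (f x))\<^sup>2 + 2 * (norm (g x))\<^sup>2" for x
  using power_mono[OF norm_triangle_ineq[of "f x" "g x"], of 2]
   sum_squares_bound[of "norm (f x)" "norm (g x)"] by (simp add: power2_sum)
 then have "integrable M (\<lambda>x. (norm (f x + g x))\<^sup>2)"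
  by (intro Bochner_Integration.integrable_bound[where g = "\<lambda>x. (norm (f x + g x))\<^sup>2" and
     f = "\<lambda>x. 2 * (norm (f x))\<^sup>2 + 2 * (norm (g x))\<^sup>2"] borel_measurable_power borel_measurable_norm
     borel_measurable_add Bochner_Integration.integrable_add integrable_mult_right) (use assms in auto)
 then show ?thesis using assms unfolding sqint_def by auto
qed

lemma sqint_uminus: "sqint M f ==> sqint M (\<lambda>x. - f x)"
 by (simp add: sqint_def)

lemma sqint_diff: "sqint M f ==> sqint M g ==> sqint M (\<lambda>x. f x - g x)"
 using sqint_add[of M f "\<lambda>x. - g x"] sqint_uminus[of M g] by simp

lemma sqint_zero [simp]: "sqint M (\<lambda>x. 0)"
 by (simp add: sqint_def)

lemma sqint_sum: "(\<And>i. i \<in> I ==> sqint M (f i)) ==> sqint M (\<lambda>x. \<Sum>i\<in>I. f i x)"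
 by (induction I rule: infinite_finite_induct) (auto intro: sqint_add)

lemma sqint_norm: "sqint M f ==> sqint M (\<lambda>x. norm (f x))"
 unfolding sqint_def by auto

lemma sqint_integrable_norms:
 assumes "sqint M f" "sqint M g"
 shows "integrable M (\<lambda>x. norm (f x) * norm (g x))"
proof (rule Bochner_Integration.integrable_bound)
 show "integrable M (\<lambda>x. (norm (f x))\<^sup>2 + (norm (g x))\<^sup>2)" using assms by auto
 show "AE x in M. norm (norm (f x) * norm (g x)) \<le> norm ((norm (f x))\<^sup>2 + (norm (g x))\<^sup>2)"
 proof (intro AE_I2)
  fix x
  have "2 * (norm (f x) * norm (g x)) \<le> (norm (f x))\<^sup>2 + (norm (g x))\<^sup>2"
   using sum_squares_bound[of "norm (f x)" "norm (g x)"] by simp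
  moreover have "0 \<le> norm (f x) * norm (g x)" by simp
  ultimately show "norm (norm (f x) * norm (g x)) \<le> norm ((norm (f x))\<^sup>2 + (norm (g x))\<^sup>2)"
   by (simp only: real_norm_def abs_of_nonneg sum_power2_ge_zero)
 qed
qed (use assms in auto)

lemma sqint_integrable_inner:
 assumes "sqint M f" "sqint M g"
 shows "integrable M (\<lambda>x. f x \<bullet> g x)"
 by (rule Bochner_Integration.integrable_bound[OF sqint_integrable_norms[OF assms]])
   (use assms Cauchy_Schwarz_ineq2 in \<open>auto simp: abs_mult intro!: borel_measurable_inner\<close>)

lemma sqint_integrable_mult:
 fixes f g :: "'a => real"
 shows "sqint M f ==> sqint M g ==> integrable M (\<lambda>x. f x * g x)"
 using sqint_integrable_inner[of M f g] by simp

text \<open>The infimum over \<open>t\<close> of \<open>t * a^2 + b^2 / t\<close> is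
  \<open>2 * a * b\<close>. It is attained at \<open>t = b / a\<close>; if exactly one of
  \<open>a\<close> and \<open>b\<close> vanishes it is only approached, hence the explicit values of
  \<open>t\<close> in the degenerate cases.\<close>

lemma young_imp_le_mult:
 fixes a b c :: real
 assumes "0 \<le> a" "0 \<le> b" and *: "\<And>t. 0 < t ==> 2 * c \<le> t * a\<^sup>2 + b\<^sup>2 / t"
 shows "c \<le> a * b"
proof (rule ccontr)
 assume "\<not> c \<le> a * b"
 then have c: "a * b < c" by simp
 have c0: "0 < c" using c assms mult_nonneg_nonneg[of a b] by linarith
 consider "a = 0" | "b = 0" | "a > 0" "b > 0" using assms by linarith
 then show False
 proof cases
  case 1
  have "2 * c \<le> b\<^sup>2 / ((b\<^sup>2 + 1) / c)" using *[of "(b\<^sup>2 + 1) / c"] c0 1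
   by (simp add: add_nonneg_pos)
  also have "\<dots> \<le> c" using c0 by (simp add: divide_simps add_nonneg_pos)
  finally show False using c0 by simp
 next
  case 2
  have "2 * c \<le> c / (a\<^sup>2 + 1) * a\<^sup>2" using *[of "c / (a\<^sup>2 + 1)"] c0 2
   by (simp add: add_nonneg_pos)
  also have "\<dots> \<le> c" using c0 by (simp add: divide_simps add_nonneg_pos)
  finally show False using c0 by simp
 next
  case 3
  then show False using *[of "b / a"] c by (simp add: power2_eq_square)
 qed
qed

lemma l2_Cauchy_Schwarz_norm:
 assumes "sqint M f" "sqint M g"
 shows "(LINT x|M. norm (f x) * norm (g x)) \<le> l2 M f * l2 M g"
proof (rule young_imp_le_mult)
 fix t :: real assume t: "0 < t"
 have "2 * (LINT x|M. norm (f x) * norm (g x)) = (LINT x|M. 2 * (norm (f x) * norm (g x)))"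
  by simp
 also have "\<dots> \<le> (LINT x|M. t * (norm (f x))\<^sup>2 + (norm (g x))\<^sup>2 / t)"
 proof (rule integral_mono)
  fix x
  have "2 * (sqrt t * norm (f x)) * (norm (g x) / sqrt t) \<le> (sqrt t * norm (f x))\<^sup>2 + (norm (g x) / sqrt t)\<^sup>2"
   by (rule sum_squares_bound)
  then show "2 * (norm (f x) * norm (g x)) \<le> t * (norm (f x))\<^sup>2 + (norm (g x))\<^sup>2 / t"
   using t by (simp add: power_mult_distrib power_divide)
 qed (use assms sqint_integrable_norms[OF assms] in \<open>auto intro!: Bochner_Integration.integrable_add\<close>)
 also have "\<dots> = t * (l2 M f)\<^sup>2 + (l2 M g)\<^sup>2 / t"
  unfolding l2_square using assms by (subst Bochner_Integration.integral_add) auto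
 finally show "2 * (LINT x|M. norm (f x) * norm (g x)) \<le> t * (l2 M f)\<^sup>2 + (l2 M g)\<^sup>2 / t" .
qed auto

lemma l2_Cauchy_Schwarz:
 assumes "sqint M f" "sqint M g"
 shows "\<bar>LINT x|M. f x \<bullet> g x\<bar> \<le> l2 M f * l2 M g"
proof -
 have "\<bar>LINT x|M. f x \<bullet> g x\<bar> \<le> (LINT x|M. \<bar>f x \<bullet> g x\<bar>)"
  by (rule integral_abs_bound)
 also have "\<dots> \<le> (LINT x|M. norm (f x) * norm (g x))"
  using sqint_integrable_inner[OF assms] sqint_integrable_norms[OF assms]
  by (intro integral_mono) (auto simp: Cauchy_Schwarz_ineq2)
 also have "\<dots> \<le> l2 M f * l2 M g" by (rule l2_Cauchy_Schwarz_norm[OF assms])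
 finally show ?thesis .
qed

lemma l2_Cauchy_Schwarz_real:
 fixes f g :: "'a => real"
 assumes "sqint M f" "sqint M g"
 shows "\<bar>LINT x|M. f x * g x\<bar> \<le> l2 M f * l2 M g"
 using l2_Cauchy_Schwarz[OF assms] by simp

lemma l2_add_square:
 assumes "sqint M f" "sqint M g"
 shows "(l2 M (\<lambda>x. f x + g x))\<^sup>2 = (l2 M f)\<^sup>2 + 2 * (LINT x|M. f x \<bullet> g x) + (l2 M g)\<^sup>2"
proof -
 have "(norm (f x + g x))\<^sup>2 = (norm (f x))\<^sup>2 + 2 * (f x \<bullet> g x) + (norm (g x))\<^sup>2" for x
  by (simp add: power2_norm_eq_inner inner_add_left inner_add_right inner_commute)
 then show ?thesis unfolding l2_square
  using assms sqint_integrable_inner[OF assms] by (simp add: sqintD)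
qed

lemma l2_triangle:
 assumes "sqint M f" "sqint M g"
 shows "l2 M (\<lambda>x. f x + g x) \<le> l2 M f + l2 M g"
proof (rule power2_le_imp_le)
 show "(l2 M (\<lambda>x. f x + g x))\<^sup>2 \<le> (l2 M f + l2 M g)\<^sup>2"
  using l2_add_square[OF assms] l2_Cauchy_Schwarz[OF assms] by (simp add: power2_sum)
qed auto

lemma l2_uminus [simp]: "l2 M (\<lambda>x. - f x) = l2 M f"
 by (simp add: l2_def)

lemma l2_triangle_diff:
 assumes "sqint M f" "sqint M g"
 shows "l2 M (\<lambda>x. f x - g x) \<le> l2 M f + l2 M g"
 using l2_triangle[OF assms(1) sqint_uminus[OF assms(2)]] by simp

lemma l2_triangle_rev:
 assumes "sqint M f" "sqint M g"
 shows "l2 M f \<le> l2 M g + l2 M (\<lambda>x. f x - g x)"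
 using l2_triangle[OF assms(2) sqint_diff[OF assms]] by simp

lemma l2_triangle_mid:
 assumes "sqint M f" "sqint M g" "sqint M h"
 shows "l2 M (\<lambda>x. f x - g x) \<le> l2 M (\<lambda>x. f x - h x) + l2 M (\<lambda>x. h x - g x)"
 using l2_triangle[OF sqint_diff[OF assms(1,3)] sqint_diff[OF assms(3,2)]] by simp

text \<open>The negative term is the uniform convexity of the squared norm; it is what makes
  minimising sequences and nearly norm-minimal convex combinations Cauchy.\<close>

lemma l2_parallelogram:
 assumes "sqint M f" "sqint M g"
 shows "(l2 M (\<lambda>x. (1/2) *\<^sub>R (f x + g x)))\<^sup>2
  = ((l2 M f)\<^sup>2 + (l2 M g)\<^sup>2) / 2 - (l2 M (\<lambda>x. f x - g x))\<^sup>2 / 4"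
proof -
 have "(l2 M (\<lambda>x. f x - g x))\<^sup>2 = (l2 M f)\<^sup>2 - 2 * (LINT x|M. f x \<bullet> g x) + (l2 M g)\<^sup>2"
  using l2_add_square[OF assms(1) sqint_uminus[OF assms(2)]] by simp
 moreover have "(l2 M (\<lambda>x. (1/2) *\<^sub>R (f x + g x)))\<^sup>2 = (l2 M (\<lambda>x. f x + g x))\<^sup>2 / 4"
  by (simp only: l2_scaleR power_mult_distrib) (simp add: power_divide)
 ultimately show ?thesis using l2_add_square[OF assms] by argo
qed

lemma sqint_Pair:
 assumes "sqint M f" "sqint M g"
 shows "sqint M (\<lambda>x. (f x, g x))" "(l2 M (\<lambda>x. (f x, g x)))\<^sup>2 = (l2 M f)\<^sup>2 + (l2 M g)\<^sup>2"
proof -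
 have n: "(norm (f x, g x))\<^sup>2 = (norm (f x))\<^sup>2 + (norm (g x))\<^sup>2" for x by (simp add: norm_Pair)
 show "sqint M (\<lambda>x. (f x, g x))" unfolding sqint_def n using assms by auto
 show "(l2 M (\<lambda>x. (f x, g x)))\<^sup>2 = (l2 M f)\<^sup>2 + (l2 M g)\<^sup>2"
  unfolding l2_square n using assms by (simp add: sqintD)
qed

lemma sqint_Pair_iff: "sqint M (\<lambda>x. (f x, g x)) \<longleftrightarrow> sqint M f \<and> sqint M g"
proof
 assume a: "sqint M (\<lambda>x. (f x, g x))"
 have m: "f \<in> borel_measurable M" "g \<in> borel_measurable M"
  using borel_measurable_continuous_on[OF continuous_on_fst[OF continuous_on_id] sqintD(1)[OF a]]
   borel_measurable_continuous_on[OF continuous_on_snd[OF continuous_on_id] sqintD(1)[OF a]] by simp_all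
 show "sqint M f \<and> sqint M g"
  using sqint_mono[OF a m(1)] sqint_mono[OF a m(2)] by (simp add: norm_fst_le norm_snd_le)
qed (auto intro: sqint_Pair)

lemma l2_Pair_le:
 assumes "sqint M f" "sqint M g"
 shows "l2 M f \<le> l2 M (\<lambda>x. (f x, g x))" "l2 M g \<le> l2 M (\<lambda>x. (f x, g x))"
  "l2 M (\<lambda>x. (f x, g x)) \<le> l2 M f + l2 M g"
proof -
 note e = sqint_Pair(2)[OF assms]
 show "l2 M f \<le> l2 M (\<lambda>x. (f x, g x))" "l2 M g \<le> l2 M (\<lambda>x. (f x, g x))"
  by (rule power2_le_imp_le; simp add: e)+
 show "l2 M (\<lambda>x. (f x, g x)) \<le> l2 M f + l2 M g"
  by (rule power2_le_imp_le) (auto simp: e power2_sum)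
qed

lemma sqint_integrable:
 assumes "finite_measure M" "sqint M f"
 shows "integrable M f"
proof -
 interpret finite_measure M by fact
 have "norm (f x) \<le> 1 + (norm (f x))\<^sup>2" for x
  using sum_squares_bound[of 1 "norm (f x)"] norm_ge_zero[of "f x"] by (simp del: norm_ge_zero)
 then show ?thesis
  by (intro Bochner_Integration.integrable_bound[where g = f and f = "\<lambda>x. 1 + (norm (f x))\<^sup>2"])
    (use assms in auto)
qed

lemma sqint_bounded:
 assumes "finite_measure M" "f \<in> borel_measurable M" "AE x in M. norm (f x) \<le> B"
 shows "sqint M f"
proof -
 interpret finite_measure M by fact
 have "integrable M (\<lambda>x. (norm (f x))\<^sup>2)"
  by (rule integrable_const_bound[where B = "B\<^sup>2"])
    (use assms in \<open>auto intro!: power_mono elim!: eventually_mono\<close>)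
 then show ?thesis using assms by (simp add: sqint_def)
qed

lemma sqint_bounded_mult:
 fixes f :: "'a => real" and g :: "'a => 'b::euclidean_space"
 assumes "f \<in> borel_measurable M" "AE x in M. \<bar>f x\<bar> \<le> B" "sqint M g"
 shows "sqint M (\<lambda>x. f x *\<^sub>R g x)"
proof (rule sqint_mono[OF sqint_scaleR[OF assms(3), of B]])
 show "AE x in M. norm (f x *\<^sub>R g x) \<le> norm (B *\<^sub>R g x)"
  using assms(2) by eventually_elim (simp add: mult_right_mono)
qed (use assms in auto)

lemma l2_le_imp_norms:
 assumes "finite_measure M" "sqint M f"
 shows "(LINT x|M. norm (f x)) \<le> l2 M f * sqrt (measure M (space M))"
proof -
 interpret finite_measure M by fact
 have "sqint M (\<lambda>x. 1::real)" by (rule sqint_bounded[OF assms(1), of _ 1]) auto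
 from l2_Cauchy_Schwarz_norm[OF assms(2) this] show ?thesis
  by (simp add: l2_def)
qed

text \<open>On a finite measure space a Cauchy sequence in \<open>l2\<close> is Cauchy in
  \<open>L^1\<close>, hence a subsequence converges a.e.; Fatou's lemma carries the Cauchy bound
  over to the distance from that limit.\<close>

lemma l2_complete:
 fixes F :: "nat => 'a => 'b::euclidean_space"
 assumes "finite_measure M" and F: "\<And>n. sqint M (F n)"
  and C: "\<And>e. 0 < e ==> \<exists>N. \<forall>i\<ge>N. \<forall>j\<ge>N. l2 M (\<lambda>x. F i x - F j x) < e"
 obtains f where "sqint M f" "(\<lambda>n. l2 M (\<lambda>x. F n x - f x)) \<longlonglongrightarrow> 0"
proof -
 interpret finite_measure M by fact
 \<comment> \<open>The added 1 keeps the divisor positive when the measure is zero.\<close>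
 define m where "m = sqrt (measure M (space M)) + 1"
 have m: "m > 0" by (simp add: m_def add_nonneg_pos)
 have FD: "sqint M (\<lambda>x. F i x - F j x)" for i j by (intro sqint_diff F)
 have [measurable]: "F n \<in> borel_measurable M" for n using F by auto
 have "\<exists>N. \<forall>i\<ge>N. \<forall>j\<ge>N. LINT x|M. norm (F i x - F j x) < e" if "e > 0" for e
 proof -
  obtain N where N: "\<And>i j. i \<ge> N ==> j \<ge> N ==> l2 M (\<lambda>x. F i x - F j x) < e / m"
   using C[of "e / m"] m \<open>e > 0\<close> by auto
  have "LINT x|M. norm (F i x - F j x) < e" if "i \<ge> N" "j \<ge> N" for i j
  proof -
   have "(LINT x|M. norm (F i x - F j x)) \<le> l2 M (\<lambda>x. F i x - F j x) * sqrt (measure M (space M))"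
    by (rule l2_le_imp_norms[OF assms(1) FD])
   also have "\<dots> \<le> l2 M (\<lambda>x. F i x - F j x) * m"
    by (rule mult_left_mono) (auto simp: m_def)
   also have "\<dots> < e" using N[OF that] m by (simp add: field_simps)
   finally show ?thesis .
  qed
  then show ?thesis by blast
 qed
 then obtain r where r: "strict_mono r" "AE x in M. Cauchy (\<lambda>i. F (r i) x)"
  using cauchy_L1_AE_cauchy_subseq[of M F] sqint_integrable[OF assms(1) F] by blast
 define f where "f x = lim (\<lambda>i. F (r i) x)" for x
 have fm [measurable]: "f \<in> borel_measurable M" unfolding f_def by measurable
 have lim: "AE x in M. (\<lambda>i. F (r i) x) \<longlonglongrightarrow> f x"
  using r(2) by eventually_elim (simp add: f_def Cauchy_convergent_iff convergent_LIMSEQ_iff)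
 have main: "sqint M (\<lambda>x. F n x - f x) \<and> l2 M (\<lambda>x. F n x - f x) \<le> e"
  if "e > 0" and N: "\<And>i j. i \<ge> N ==> j \<ge> N ==> l2 M (\<lambda>x. F i x - F j x) < e" "n \<ge> N" for e N n
 proof -
  have "(\<integral>\<^sup>+x. ennreal ((norm (F n x - f x))\<^sup>2) \<partial>M)
    = (\<integral>\<^sup>+x. liminf (\<lambda>i. ennreal ((norm (F n x - F (r i) x))\<^sup>2)) \<partial>M)"
  proof (rule nn_integral_cong_AE)
   show "AE x in M. ennreal ((norm (F n x - f x))\<^sup>2) = liminf (\<lambda>i. ennreal ((norm (F n x - F (r i) x))\<^sup>2))"
    using lim
   proof eventually_elim
    case (elim x)
    have "(\<lambda>i. ennreal ((norm (F n x - F (r i) x))\<^sup>2)) \<longlonglongrightarrow> ennreal ((norm (F n x - f x))\<^sup>2)"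
     by (intro tendsto_intros elim)
    from lim_imp_Liminf[OF sequentially_bot this] show ?case by (rule sym)
   qed
  qed
  also have "\<dots> \<le> liminf (\<lambda>i. \<integral>\<^sup>+x. ennreal ((norm (F n x - F (r i) x))\<^sup>2) \<partial>M)"
   by (rule nn_integral_liminf) measurable
  also have "\<dots> \<le> ennreal (e\<^sup>2)"
  proof -
   have ev: "\<forall>\<^sub>F i in sequentially. (\<integral>\<^sup>+x. ennreal ((norm (F n x - F (r i) x))\<^sup>2) \<partial>M) \<le> ennreal (e\<^sup>2)"
    using eventually_ge_at_top[of N]
   proof eventually_elim
    case (elim i)
    then have "r i \<ge> N" using seq_suble[OF r(1), of i] by linarith
    have "(\<integral>\<^sup>+x. ennreal ((norm (F n x - F (r i) x))\<^sup>2) \<partial>M) = ennreal ((l2 M (\<lambda>x. F n x - F (r i) x))\<^sup>2)"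
     unfolding l2_square using FD by (intro nn_integral_eq_integral) auto
    also have "\<dots> \<le> ennreal (e\<^sup>2)"
     using N(1)[OF N(2) \<open>r i \<ge> N\<close>] by (intro ennreal_leI power_mono) auto
    finally show ?case .
   qed
   show ?thesis by (rule Liminf_le[OF sequentially_bot ev])
  qed
  finally have *: "(\<integral>\<^sup>+x. ennreal ((norm (F n x - f x))\<^sup>2) \<partial>M) \<le> ennreal (e\<^sup>2)" .
  then have i: "integrable M (\<lambda>x. (norm (F n x - f x))\<^sup>2)"
   by (intro integrableI_bounded) (auto simp: le_less_trans)
  have "(LINT x|M. (norm (F n x - f x))\<^sup>2) \<le> e\<^sup>2"
   using * nn_integral_eq_integral[OF i] by (simp add: ennreal_le_iff)
  then have "l2 M (\<lambda>x. F n x - f x) \<le> e"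
   unfolding l2_def using \<open>e > 0\<close> real_le_lsqrt by auto
  with i show ?thesis by (simp add: sqint_def)
 qed
 show ?thesis
 proof (rule that)
  obtain N where "\<And>i j. i \<ge> N ==> j \<ge> N ==> l2 M (\<lambda>x. F i x - F j x) < 1" using C[of 1] by auto
  then have "sqint M (\<lambda>x. F N x - f x)" using main[of 1 N N] by auto
  from sqint_diff[OF F[of N] this] show "sqint M f" by simp
  show "(\<lambda>n. l2 M (\<lambda>x. F n x - f x)) \<longlonglongrightarrow> 0"
  proof (rule LIMSEQ_I)
   fix e :: real assume "e > 0"
   obtain N where N: "\<And>i j. i \<ge> N ==> j \<ge> N ==> l2 M (\<lambda>x. F i x - F j x) < e/2"
    using C[of "e/2"] \<open>e > 0\<close> by auto
   have "norm (l2 M (\<lambda>x. F n x - f x) - 0) < e" if "n \<ge> N" for n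
    using main[of "e/2" N n] N \<open>e > 0\<close> that by auto
   then show "\<exists>no. \<forall>n\<ge>no. norm (l2 M (\<lambda>x. F n x - f x) - 0) < e" by blast
  qed
 qed
qed

text \<open>The midpoint of two near-minimisers has a value not below the infimum, so the convexity
  gap bounds their distance. \<open>J\<close> is not assumed semicontinuous, therefore the sequence
  is returned along with its limit.\<close>

lemma l2_minimizing_sequence:
 fixes C :: "('a => 'b::euclidean_space) set"
 assumes "finite_measure M" and C: "C \<noteq> {}" "\<And>f. f \<in> C ==> sqint M f"
  and bdd: "\<And>f. f \<in> C ==> L \<le> J f" and "0 < c"
  and mid: "\<And>f g. f \<in> C ==> g \<in> C ==> (\<lambda>x. (1/2) *\<^sub>R (f x + g x)) \<in> C"
  and J: "\<And>f g. f \<in> C ==> g \<in> C ==>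
   J (\<lambda>x. (1/2) *\<^sub>R (f x + g x)) \<le> (J f + J g) / 2 - c * (l2 M (\<lambda>x. f x - g x))\<^sup>2"
 obtains F f where "\<And>n. F n \<in> C" "(\<lambda>n. J (F n)) \<longlonglongrightarrow> Inf (J ` C)"
  "sqint M f" "(\<lambda>n. l2 M (\<lambda>x. F n x - f x)) \<longlonglongrightarrow> 0"
proof -
 define a where "a = Inf (J ` C)"
 have bb: "bdd_below (J ` C)" using bdd by (auto intro!: bdd_belowI)
 have a_le: "a \<le> J f" if "f \<in> C" for f unfolding a_def using that bb by (auto intro: cInf_lower)
 have "\<exists>f\<in>C. J f < a + 1 / Suc n" for n
  using cInf_lessD[of "J ` C" "a + 1 / Suc n"] C(1) unfolding a_def by auto
 then obtain F where F: "\<And>n. F n \<in> C" "\<And>n. J (F n) < a + 1 / Suc n" by metis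
 have lim: "(\<lambda>n. J (F n)) \<longlonglongrightarrow> a"
 proof (rule real_tendsto_sandwich[of "\<lambda>_. a"])
  show "(\<lambda>n. a + 1 / Suc n) \<longlonglongrightarrow> a"
   using LIMSEQ_Suc[OF lim_1_over_n] tendsto_add[OF tendsto_const[of a]] by fastforce
 qed (use F a_le in \<open>auto intro!: always_eventually less_imp_le\<close>)
 have bound: "c * (l2 M (\<lambda>x. F i x - F j x))\<^sup>2 \<le> 1 / Suc N" if "i \<ge> N" "j \<ge> N" for i j N
 proof -
  have "1 / real (Suc i) \<le> 1 / Suc N" "1 / real (Suc j) \<le> 1 / Suc N"
   using that by (auto intro!: divide_left_mono)
  then show ?thesis
   using J[OF F(1) F(1), of i j] a_le[OF mid[OF F(1) F(1), of i j]] F(2)[of i] F(2)[of j] by argo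
 qed
 have "\<exists>N. \<forall>i\<ge>N. \<forall>j\<ge>N. l2 M (\<lambda>x. F i x - F j x) < e" if "e > 0" for e
 proof -
  obtain N where N: "1 / Suc N < c * e\<^sup>2"
   using nat_approx_posE[of "c * e\<^sup>2"] \<open>0 < c\<close> \<open>e > 0\<close> by auto
  have "l2 M (\<lambda>x. F i x - F j x) < e" if "i \<ge> N" "j \<ge> N" for i j
  proof -
   have "c * (l2 M (\<lambda>x. F i x - F j x))\<^sup>2 < c * e\<^sup>2" using bound[OF that] N by linarith
   then have "(l2 M (\<lambda>x. F i x - F j x))\<^sup>2 < e\<^sup>2" using \<open>0 < c\<close> by simp
   then show ?thesis using \<open>e > 0\<close> by (simp add: power2_less_imp_less)
  qed
  then show ?thesis by blast
 qed
 from l2_complete[OF assms(1) C(2)[OF F(1)] this] obtain f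
  where "sqint M f" "(\<lambda>n. l2 M (\<lambda>x. F n x - f x)) \<longlonglongrightarrow> 0" by blast
 then show ?thesis using that F lim a_def by blast
qed

text \<open>Midpoints are all that the parallelogram law involves, and every property stable under
  sums and halving can be proved by induction on the hull; limits of hull elements then inherit
  closed convex conditions imposed on the sequence.\<close>

inductive_set tail_hull :: "(nat => 'a => 'b::real_vector) => nat => ('a => 'b) set"
 for X :: "nat => 'a => 'b" and k :: nat where
 base: "k \<le> n ==> X n \<in> tail_hull X k"
| mid: "f \<in> tail_hull X k ==> g \<in> tail_hull X k ==> (\<lambda>x. (1/2) *\<^sub>R (f x + g x)) \<in> tail_hull X k"

lemma tail_hull_antimono: "j \<le> k ==> f \<in> tail_hull X k ==> f \<in> tail_hull X j"
 by (rotate_tac, induction rule: tail_hull.induct) (auto intro: tail_hull.intros)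

lemma tail_hull_sqint:
 "f \<in> tail_hull X k ==> (\<And>n. sqint M (X n)) ==> sqint M f"
 by (induction rule: tail_hull.induct) (auto intro!: sqint_scaleR sqint_add)

lemma tail_hull_inner:
 assumes "f \<in> tail_hull X k" "\<And>n. sqint M (X n)" "sqint M R"
  "\<And>n. k \<le> n ==> \<bar>(LINT x|M. R x \<bullet> X n x) - c\<bar> \<le> e"
 shows "\<bar>(LINT x|M. R x \<bullet> f x) - c\<bar> \<le> e"
 using assms(1)
proof (induction rule: tail_hull.induct)
 case (mid f g)
 have *: "sqint M f" "sqint M g" using mid tail_hull_sqint assms by blast+
 have "(LINT x|M. R x \<bullet> ((1/2) *\<^sub>R (f x + g x))) = ((LINT x|M. R x \<bullet> f x) + (LINT x|M. R x \<bullet> g x)) / 2"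
  using sqint_integrable_inner[OF assms(3) *(1)] sqint_integrable_inner[OF assms(3) *(2)]
  by (simp add: inner_add_right)
 then show ?case using mid.IH by (simp only: abs_le_iff) argo
qed (use assms in auto)

text \<open>The elements of almost minimal norm in the convex hulls of the tails of a bounded sequence
 form a Cauchy sequence, so that a weak cluster point is reached as a strong limit.\<close>

lemma l2_cluster_point:
 fixes X :: "nat => 'a => 'b::euclidean_space"
 assumes "finite_measure M" and X: "\<And>n. sqint M (X n)" "\<And>n. l2 M (X n) \<le> B"
 obtains Z Y where "sqint M Z" "\<And>k. Y k \<in> tail_hull X k" "(\<lambda>k. l2 M (\<lambda>x. Y k x - Z x)) \<longlonglongrightarrow> 0"
proof -
 define J where "J f = (l2 M f)\<^sup>2" for f :: "'a => 'b"
 define a where "a k = Inf (J ` tail_hull X k)" for k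
 have ne: "J ` tail_hull X k \<noteq> {}" for k using tail_hull.base[of k k X] by blast
 have bb: "bdd_below (J ` tail_hull X k)" for k by (auto intro!: bdd_belowI[of _ 0] simp: J_def)
 have a_le: "a k \<le> J f" if "f \<in> tail_hull X k" for f k
  unfolding a_def using that bb by (auto intro: cInf_lower)
 have incr: "a j \<le> a k" if "j \<le> k" for j k
  unfolding a_def by (rule cInf_superset_mono[OF ne bb]) (use tail_hull_antimono[OF that] in blast)
 have "a k \<le> B\<^sup>2" for k
  using a_le[OF tail_hull.base[of k k X]] power_mono[OF X(2) l2_nonneg, of k 2] by (simp add: J_def)
 then have "Bseq a" using incr[of 0]
  by (intro BseqI'[of _ "max \<bar>a 0\<bar> (B\<^sup>2)"]) (smt (verit) le0 real_norm_def)
 then have "Cauchy a" using incr by (intro convergent_Cauchy Bseq_mono_convergent) auto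
 have "\<exists>f\<in>tail_hull X n. J f < a n + 1 / Suc n" for n
  using cInf_lessD[OF ne, of n "a n + 1 / Suc n"] unfolding a_def by auto
 then obtain Y where Y: "\<And>n. Y n \<in> tail_hull X n" "\<And>n. J (Y n) < a n + 1 / Suc n" by metis
 have Ys: "sqint M (Y n)" for n using tail_hull_sqint[OF Y(1)] X by blast
 \<comment> \<open>For \<open>i \<le> j\<close> both elements lie in the hull of the tail at
   \<open>i\<close>, so \<open>J\<close> at their midpoint is at least \<open>a i\<close>.\<close>
 have bound: "(l2 M (\<lambda>x. Y i x - Y j x))\<^sup>2 \<le> 2 * (a j - a i) + 4 / Suc i" if "i \<le> j" for i j
 proof -
  have "Y j \<in> tail_hull X i" using tail_hull_antimono[OF that Y(1)] .
  from a_le[OF tail_hull.mid[OF Y(1) this]] l2_parallelogram[OF Ys Ys, of i j]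
  have "a i \<le> (J (Y i) + J (Y j)) / 2 - (l2 M (\<lambda>x. Y i x - Y j x))\<^sup>2 / 4" by (simp add: J_def)
  moreover have "1 / real (Suc j) \<le> 1 / Suc i" using that by (auto intro!: divide_left_mono)
  ultimately show ?thesis using Y(2)[of i] Y(2)[of j] by argo
 qed
 have key: "\<exists>N. \<forall>i\<ge>N. \<forall>j\<ge>i. l2 M (\<lambda>x. Y i x - Y j x) < e" if "e > 0" for e
 proof -
  obtain N1 where N1: "\<And>i j. i \<ge> N1 ==> j \<ge> N1 ==> \<bar>a i - a j\<bar> < e\<^sup>2 / 4"
   using \<open>Cauchy a\<close> \<open>e > 0\<close> unfolding Cauchy_def dist_real_def by (metis zero_less_divide_iff zero_less_numeral zero_less_power)
  obtain N2 where N2: "1 / Suc N2 < e\<^sup>2 / 8" using nat_approx_posE[of "e\<^sup>2/8"] \<open>e > 0\<close> by auto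
  have "l2 M (\<lambda>x. Y i x - Y j x) < e" if "i \<ge> max N1 N2" "j \<ge> i" for i j
  proof -
   have "1 / real (Suc i) \<le> 1 / Suc N2" using that by (auto intro!: divide_left_mono)
   then have "(l2 M (\<lambda>x. Y i x - Y j x))\<^sup>2 < e\<^sup>2"
    using bound[OF that(2)] N1[of i j] N2 that by (simp add: abs_if split: if_splits)
   then show ?thesis using \<open>e > 0\<close> by (simp add: power2_less_imp_less)
  qed
  then show ?thesis by blast
 qed
 have "\<exists>N. \<forall>i\<ge>N. \<forall>j\<ge>N. l2 M (\<lambda>x. Y i x - Y j x) < e" if e: "e > 0" for e
  using key[OF e] l2_minus_commute[of M "Y _" "Y _"] by (metis nle_le)
 from l2_complete[OF assms(1) Ys this] that Y(1) show ?thesis by blast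
qed

lemma l2_tendsto_inner:
 assumes "\<And>n. sqint M (Y n)" "sqint M Z" "sqint M R" "(\<lambda>k. l2 M (\<lambda>x. Y k x - Z x)) \<longlonglongrightarrow> 0"
 shows "(\<lambda>n. LINT x|M. R x \<bullet> Y n x) \<longlonglongrightarrow> (LINT x|M. R x \<bullet> Z x)"
proof (rule Lim_null[THEN iffD2], rule Lim_null_comparison)
 show "\<forall>\<^sub>F n in sequentially. norm ((LINT x|M. R x \<bullet> Y n x) - (LINT x|M. R x \<bullet> Z x)) \<le> l2 M R * l2 M (\<lambda>x. Y n x - Z x)"
 proof (intro always_eventually allI)
  fix n
  have "(LINT x|M. R x \<bullet> Y n x) - (LINT x|M. R x \<bullet> Z x) = (LINT x|M. R x \<bullet> (Y n x - Z x))"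
   using assms by (simp add: inner_diff_right sqint_integrable_inner)
  then show "norm ((LINT x|M. R x \<bullet> Y n x) - (LINT x|M. R x \<bullet> Z x)) \<le> l2 M R * l2 M (\<lambda>x. Y n x - Z x)"
   using l2_Cauchy_Schwarz[OF assms(3) sqint_diff[OF assms(1,2)], of n] by simp
 qed
 show "(\<lambda>n. l2 M R * l2 M (\<lambda>x. Y n x - Z x)) \<longlonglongrightarrow> 0"
  using tendsto_mult_right_zero[OF assms(4)] .
qed

text \<open>The cluster point is identified through scalar products: averaging over tails does not
  change the limit of a convergent numerical sequence.\<close>

lemma cluster_point_inner:
 assumes "\<And>n. sqint M (X n)" "\<And>k. Y k \<in> tail_hull X k" "sqint M Z" "sqint M R"
  "(\<lambda>k. l2 M (\<lambda>x. Y k x - Z x)) \<longlonglongrightarrow> 0" "(\<lambda>n. LINT x|M. R x \<bullet> X n x) \<longlonglongrightarrow> c"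
 shows "(LINT x|M. R x \<bullet> Z x) = c"
proof -
 have Ys: "sqint M (Y n)" for n using tail_hull_sqint[OF assms(2)] assms by blast
 have "(\<lambda>n. LINT x|M. R x \<bullet> Y n x) \<longlonglongrightarrow> c"
 proof (rule LIMSEQ_I)
  fix e :: real assume "e > 0"
  then obtain N where N: "\<And>n. n \<ge> N ==> norm ((LINT x|M. R x \<bullet> X n x) - c) < e / 2"
   using LIMSEQ_D[OF assms(6), of "e/2"] by auto
  have "\<bar>(LINT x|M. R x \<bullet> Y k x) - c\<bar> \<le> e / 2" if "k \<ge> N" for k
   by (rule tail_hull_inner[OF assms(2) assms(1) assms(4)]) (use N that in \<open>auto intro: less_imp_le\<close>)
  then show "\<exists>no. \<forall>n\<ge>no. norm ((LINT x|M. R x \<bullet> Y n x) - c) < e"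
   using \<open>e > 0\<close> by (intro exI[of _ N]) fastforce
 qed
 then show ?thesis using l2_tendsto_inner[OF Ys assms(3,4,5)] LIMSEQ_unique by blast
qed

section \<open>Integrals over bounded open sets and the divergence theorem\<close>

lemma continuous_bounded_on:
 fixes f :: "real^'d => 'b::real_normed_vector"
 assumes "continuous_on UNIV f" "bounded D"
 obtains B where "0 \<le> B" "\<And>x. x \<in> D ==> norm (f x) \<le> B"
proof -
 have "compact (closure D)" using assms(2) by simp
 then have "bounded (f ` closure D)"
  using assms(1) by (meson compact_continuous_image compact_imp_bounded continuous_on_subset top_greatest)
 then obtain B where "\<And>y. y \<in> f ` closure D ==> norm y \<le> B" by (auto simp: bounded_iff)
 then have "norm (f x) \<le> max B 0" if "x \<in> D" for x using that closure_subset by fastforce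
 then show ?thesis using that[of "max B 0"] by auto
qed

lemma lebesgue_on_open_finite:
 fixes D :: "(real^'d) set"
 assumes "open D" "bounded D"
 shows "finite_measure (lebesgue_on D)"
 using assms by (intro finite_measure_lebesgue_on lmeasurable_open) auto

lemma continuous_borel_measurable_lebesgue_on:
 fixes f :: "real^'d => 'b::euclidean_space"
 assumes "continuous_on UNIV f"
 shows "f \<in> borel_measurable (lebesgue_on D)"
 using borel_measurable_continuous_onI[OF assms]
 by (intro measurable_restrict_space1 measurable_completion) simp

lemma continuous_sqint:
 fixes f :: "real^'d => 'b::euclidean_space"
 assumes "continuous_on UNIV f" "open D" "bounded D"
 shows "sqint (lebesgue_on D) f"
proof -
 obtain B where "\<And>x. x \<in> D ==> norm (f x) \<le> B" using continuous_bounded_on[OF assms(1,3)] by blast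
 then show ?thesis
  by (intro sqint_bounded[of _ f B] lebesgue_on_open_finite assms continuous_borel_measurable_lebesgue_on AE_I2)
    auto
qed

lemma continuous_integrable:
 fixes f :: "real^'d => 'b::euclidean_space"
 assumes "continuous_on UNIV f" "open D" "bounded D"
 shows "integrable (lebesgue_on D) f"
 using sqint_integrable[OF lebesgue_on_open_finite continuous_sqint] assms by blast

lemma lebesgue_on_integral_vanishing:
 fixes h :: "real^'d => real"
 assumes "D \<in> sets lebesgue" "h \<in> borel_measurable borel" "\<And>x. x \<notin> D ==> h x = 0"
 shows "(LINT x|lebesgue_on D. h x) = (LINT x|lborel. h x)"
proof -
 have "(LINT x|lebesgue_on D. h x) = (LINT x|lebesgue. indicator D x *\<^sub>R h x)"
  using assms(1) by (intro integral_restrict_space) auto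
 also have "(\<lambda>x. indicator D x *\<^sub>R h x) = h" using assms(3) by (auto simp: fun_eq_iff indicator_def)
 also have "(LINT x|lebesgue. h x) = (LINT x|lborel. h x)" using assms(2) by (intro integral_completion) simp
 finally show ?thesis .
qed

lemma has_line_derivative:
 assumes "\<And>x. \<phi> differentiable (at x)"
 shows "((\<lambda>t. \<phi> (x + t *\<^sub>R axis i 1)) has_real_derivative partial i \<phi> (x + t *\<^sub>R axis i 1)) (at t)"
proof -
 have "((\<lambda>t. \<phi> (x + t *\<^sub>R axis i 1)) has_derivative
   (\<lambda>h. frechet_derivative \<phi> (at (x + t *\<^sub>R axis i 1)) (h *\<^sub>R axis i 1))) (at t)"
  by (rule has_derivative_compose[OF _ has_derivative_frechet[OF assms]])
    (auto intro!: derivative_eq_intros)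
 moreover have "linear (frechet_derivative \<phi> (at (x + t *\<^sub>R axis i 1)))"
  by (simp add: linear_frechet_derivative assms)
 ultimately show ?thesis
  by (simp add: has_field_derivative_def partial_def linear_cmul mult.commute[of _ "frechet_derivative _ _ _"])
qed

text \<open>Difference quotients integrate to zero by translation invariance.\<close>

lemma integral_partial_compact_support:
 fixes Y :: "real^'d => real"
 assumes d: "\<And>x. Y differentiable (at x)" and c: "continuous_on UNIV (partial i Y)"
  and s: "\<And>x. Y x \<noteq> 0 ==> norm x \<le> R"
 shows "(LINT x|lborel. partial i Y x) = 0"
proof -
 define e :: "real^'d" where "e = axis i 1"
 define h where "h n = 1 / real (Suc n)" for n
 have h: "0 < h n" "h n \<le> 1" for n by (auto simp: h_def)
 have Yc: "continuous_on UNIV Y"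
  using d by (simp add: differentiable_imp_continuous_on differentiable_on_def differentiable_at_withinI)
 have [measurable]: "Y \<in> borel_measurable borel" "partial i Y \<in> borel_measurable borel"
  using Yc c by (auto intro: borel_measurable_continuous_onI)
 \<comment> \<open>The increments are at most 1, so the difference quotients vanish outside the ball
   of radius \<open>R + 1\<close>; inside, the mean value theorem bounds them by
   \<open>B\<close>.\<close>
 obtain B where B: "0 \<le> B" "\<And>x. x \<in> cball 0 (R + 1) ==> norm (partial i Y x) \<le> B"
  using continuous_bounded_on[OF c, of "cball 0 (R+1)"] by auto
 have Yi: "integrable lborel Y"
 proof -
  have "integrable lborel (\<lambda>x. indicator (cball 0 R) x *\<^sub>R Y x)"
   by (rule borel_integrable_compact) (use Yc continuous_on_subset in auto)
  moreover have "(\<lambda>x. indicator (cball 0 R) x *\<^sub>R Y x) = Y" 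
   using s by (auto simp: fun_eq_iff indicator_def)
  ultimately show ?thesis by simp
 qed
 have partial_0: "partial i Y x = 0" if "norm x > R" for x
 proof -
  have "\<forall>\<^sub>F y in nhds x. 0 = Y y"
   using eventually_nhds_in_open[OF open_Compl[OF closed_cball], of x 0 R] that s
   by (auto elim!: eventually_mono)
  then have "(Y has_derivative (\<lambda>_. 0)) (at x)"
   using has_derivative_transform_eventually[of "\<lambda>_. 0" "\<lambda>_. 0" x UNIV Y] eventually_nhds_x_imp_x
   by (auto simp: eventually_at_filter eventually_mono)
  then show ?thesis by (simp add: partial_eqI)
 qed
 have tr: "(LINT x|lborel. Y (x + h n *\<^sub>R e)) = (LINT x|lborel. Y x)"
   "integrable lborel (\<lambda>x. Y (x + h n *\<^sub>R e))" for n
 proof -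
  have "(LINT x|lborel. Y x) = (LINT x|distr lborel borel ((+) (h n *\<^sub>R e)). Y x)"
   by (simp add: lborel_distr_plus)
  also have "\<dots> = (LINT x|lborel. Y (h n *\<^sub>R e + x))" by (rule integral_distr) measurable
  finally show "(LINT x|lborel. Y (x + h n *\<^sub>R e)) = (LINT x|lborel. Y x)" by (simp add: add.commute)
  have "integrable (distr lborel borel ((+) (h n *\<^sub>R e))) Y" using Yi by (simp add: lborel_distr_plus)
  then have "integrable lborel (\<lambda>x. Y (h n *\<^sub>R e + x))" by (subst (asm) integrable_distr_eq) auto
  then show "integrable lborel (\<lambda>x. Y (x + h n *\<^sub>R e))" by (simp add: add.commute)
 qed
 have z: "(LINT x|lborel. (Y (x + h n *\<^sub>R e) - Y x) / h n) = 0" for n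
  using tr[of n] Yi by simp
 have "(\<lambda>n. LINT x|lborel. (Y (x + h n *\<^sub>R e) - Y x) / h n) \<longlonglongrightarrow> (LINT x|lborel. partial i Y x)"
 proof (rule integral_dominated_convergence[where w = "\<lambda>x. indicator (cball 0 (R + 1)) x *\<^sub>R B"])
  show "integrable lborel (\<lambda>x. indicator (cball 0 (R + 1)) x *\<^sub>R B :: real)"
   by (rule borel_integrable_compact) auto
  show "AE x in lborel. (\<lambda>n. (Y (x + h n *\<^sub>R e) - Y x) / h n) \<longlonglongrightarrow> partial i Y x"
  proof (rule AE_I2)
   fix x
   have "((\<lambda>k. (Y (x + k *\<^sub>R e) - Y x) / k) \<longlongrightarrow> partial i Y x) (at 0)"
    using has_line_derivative[OF d, of x i 0] by (simp add: DERIV_def e_def)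
   moreover have "filterlim h (at 0) sequentially"
    unfolding filterlim_at using h LIMSEQ_Suc[OF lim_1_over_n] by (auto simp: h_def[abs_def] less_imp_neq[THEN not_sym])
   ultimately show "(\<lambda>n. (Y (x + h n *\<^sub>R e) - Y x) / h n) \<longlonglongrightarrow> partial i Y x"
    by (rule filterlim_compose)
  qed
  show "AE x in lborel. norm ((Y (x + h n *\<^sub>R e) - Y x) / h n) \<le> indicator (cball 0 (R + 1)) x *\<^sub>R B" for n
  proof (rule AE_I2)
   fix x
   have "\<exists>t>0. t < h n \<and> Y (x + h n *\<^sub>R e) - Y (x + 0 *\<^sub>R e) = (h n - 0) * partial i Y (x + t *\<^sub>R e)"
    unfolding e_def by (rule MVT2[OF h(1)]) (rule has_line_derivative[OF d])
   then obtain t where t: "0 < t" "t < h n" "Y (x + h n *\<^sub>R e) - Y x = h n * partial i Y (x + t *\<^sub>R e)"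
    by auto
   have q: "(Y (x + h n *\<^sub>R e) - Y x) / h n = partial i Y (x + t *\<^sub>R e)" using t(3) h(1)[of n] by simp
   show "norm ((Y (x + h n *\<^sub>R e) - Y x) / h n) \<le> indicator (cball 0 (R + 1)) x *\<^sub>R B"
   proof (cases "norm (x + t *\<^sub>R e) \<le> R")
    case True
    have "norm x \<le> norm (x + t *\<^sub>R e) + norm (t *\<^sub>R e)" using norm_triangle_sub[of x "x + t *\<^sub>R e"] by simp
    also have "norm (t *\<^sub>R e) \<le> 1" using t h(2)[of n] by (simp add: e_def)
    finally have "norm x \<le> R + 1" using True by simp
    then show ?thesis using q B(2)[of "x + t *\<^sub>R e"] True by simp
   next
    case False
    then show ?thesis unfolding q using partial_0[of "x + t *\<^sub>R e"] B(1) by (simp add: indicator_def)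
   qed
  qed
 qed measurable
 then show ?thesis unfolding z by (simp add: LIMSEQ_const_iff)
qed

lemma flat_le_one: "n \<le> 1 ==> flat n t \<le> 1"
proof (cases "t > 0")
 case True
 assume "n \<le> 1"
 then consider "n = 0" | "n = 1" by linarith
 then show ?thesis
 proof cases
  case 2
  have "1 / t \<le> exp (1 / t)" using exp_ge_add_one_self[of "1/t"] by linarith
  then show ?thesis using True 2 by (simp add: flat_def exp_minus field_simps)
 qed (use True in \<open>simp add: flat_def\<close>)
qed (simp add: flat_def)

lemma flat_0_at_top: "(flat 0 \<longlongrightarrow> 1) at_top"
proof -
 have "((\<lambda>t::real. exp (- inverse t)) \<longlongrightarrow> exp (- 0)) at_top"
  by (intro tendsto_intros tendsto_inverse_0_at_top filterlim_ident)
 then show ?thesis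
  by (rule tendsto_cong[THEN iffD1, rotated, THEN tendsto_eq_rhs])
    (auto intro!: eventually_mono[OF eventually_gt_at_top[of 0]] simp: flat_def field_simps)
qed

lemma flat_1_at_top: "(flat 1 \<longlongrightarrow> 0) at_top"
proof -
 have "((\<lambda>t::real. exp (- inverse t) * inverse t) \<longlongrightarrow> exp (- 0) * 0) at_top"
  by (intro tendsto_intros tendsto_inverse_0_at_top filterlim_ident)
 then show ?thesis
  by (rule tendsto_cong[THEN iffD1, rotated, THEN tendsto_eq_rhs])
    (auto intro!: eventually_mono[OF eventually_gt_at_top[of 0]] simp: flat_def field_simps)
qed

lemma filterlim_scaled_at_top:
 assumes "(0::real) < a" shows "filterlim (\<lambda>n. real n * a) at_top sequentially"
 using filterlim_tendsto_pos_mult_at_top[OF tendsto_const assms filterlim_real_sequentially]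
 by (simp add: mult.commute)

lemma smooth_sublevel_open: "smooth \<rho> ==> open {x. \<rho> x < 0}"
 by (intro open_Collect_less smooth_continuous_on continuous_on_const)

text \<open>A divergence inequality on sublevel sets: only the sign of the outward normal component of
 the field matters, and it enters through \<open>\<nabla>\<rho> \<bullet> X \<ge> C \<rho>\<close> instead of a boundary integral.
 The proof tests with the cut-off functions \<open>flat 0 (- n \<rho>)\<close>, which tend to \<open>1\<close> on the domain,
 while \<open>n \<rho> flat 2 (- n \<rho>) = - flat 1 (- n \<rho>)\<close> tends to \<open>0\<close> boundedly.\<close>

lemma divergence_nonneg:
 fixes X :: "'d::finite => real^'d => real" and \<rho> :: "real^'d => real"
 defines "D \<equiv> {x. \<rho> x < 0}"
 assumes \<rho>: "smooth \<rho>" "bounded D"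
  and X: "\<And>k x. X k differentiable (at x)" "\<And>k. continuous_on UNIV (partial k (X k))"
  and flux: "\<And>x. \<rho> x < 0 ==> (\<Sum>k\<in>UNIV. partial k \<rho> x * X k x) \<ge> C * \<rho> x"
 shows "0 \<le> (LINT x|lebesgue_on D. (\<Sum>k\<in>UNIV. partial k (X k) x))"
proof -
 have oD: "open D" unfolding D_def using \<rho>(1) by (rule smooth_sublevel_open)
 then have mD: "D \<in> sets lebesgue" by simp
 interpret finite_measure "lebesgue_on D" using lebesgue_on_open_finite[OF oD \<rho>(2)] .
 obtain R where R: "\<And>x. x \<in> D ==> norm x \<le> R" using \<rho>(2) by (auto simp: bounded_iff)
 have Xc: "continuous_on UNIV (X k)" for k
  using X(1) by (simp add: differentiable_imp_continuous_on differentiable_on_def differentiable_at_withinI)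
 have pc: "continuous_on UNIV (partial k \<rho>)" for k using \<rho>(1) smooth_continuous_on by blast
 have rc: "continuous_on UNIV \<rho>" using \<rho>(1) smooth_continuous_on by blast
 have fc: "continuous_on UNIV (\<lambda>x. flat n (- real j * \<rho> x))" for n j
  by (rule continuous_on_compose2[OF flat_continuous_on[of UNIV]]) (auto intro!: continuous_intros rc)
 define dv where "dv x = (\<Sum>k\<in>UNIV. partial k (X k) x)" for x
 define fl where "fl x = (\<Sum>k\<in>UNIV. partial k \<rho> x * X k x)" for x
 have dvc: "continuous_on UNIV dv" unfolding dv_def by (intro continuous_intros X)
 have flc: "continuous_on UNIV fl" unfolding fl_def by (intro continuous_intros pc Xc)
 define Y where "Y n k x = flat 0 (- real n * \<rho> x) * X k x" for n k x
 have fd: "((\<lambda>x. flat 0 (- real n * \<rho> x)) differentiable at x) \<and>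
   partial k (\<lambda>x. flat 0 (- real n * \<rho> x)) x = flat 2 (- real n * \<rho> x) * (- real n * partial k \<rho> x)" for n k x
 proof -
  have s: "smooth (\<lambda>x. - real n * \<rho> x)" by (intro smooth_intros \<rho>)
  have D: "(flat 0 has_real_derivative flat 2 (- real n * \<rho> x)) (at (- real n * \<rho> x))"
   using flat_has_derivative[of 0] by (simp add: numeral_2_eq_2)
  show ?thesis
   using partial_compose_real[OF D smooth_differentiable[OF s], of k] 
    differentiable_compose_real[OF D smooth_differentiable[OF s]] partial_smooth_cmult[OF \<rho>(1), of k "- real n"]
   by simp
 qed
 have pY: "partial k (Y n k) x = flat 0 (- real n * \<rho> x) * partial k (X k) x
   - real n * flat 2 (- real n * \<rho> x) * (partial k \<rho> x * X k x)" for n k x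
  unfolding Y_def using fd[of n x k] X(1) by (subst partial_mult) auto
 have Yd: "Y n k differentiable (at x)" for n k x
  unfolding Y_def using fd[of n x k] X(1) by (intro differentiable_mult) auto
 have pYc: "continuous_on UNIV (partial k (Y n k))" for n k
  unfolding pY[abs_def] by (intro continuous_intros fc X Xc pc)
 have Y0: "(LINT x|lborel. partial k (Y n k) x) = 0" if "n > 0" for n k
 proof (rule integral_partial_compact_support[OF Yd pYc])
  fix x assume "Y n k x \<noteq> 0"
  then have "- real n * \<rho> x > 0" unfolding Y_def flat_def by (auto split: if_splits)
  then show "norm x \<le> R" using R that by (auto simp: D_def mult_less_0_iff)
 qed
 have pY0: "partial k (Y n k) x = 0" if "x \<notin> D" for n k x
 proof -
  have "\<not> (- real n * \<rho> x > 0)" using that by (simp add: D_def mult_less_0_iff)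
  then show ?thesis unfolding pY by (simp add: flat_def)
 qed
 have YD: "(LINT x|lebesgue_on D. partial k (Y n k) x) = 0" if "n > 0" for n k
  using lebesgue_on_integral_vanishing[OF mD borel_measurable_continuous_onI[OF pYc] pY0] Y0[OF that] by simp
 have eq: "(LINT x|lebesgue_on D. flat 0 (- real n * \<rho> x) * dv x) = 
    (LINT x|lebesgue_on D. real n * flat 2 (- real n * \<rho> x) * fl x)" if "n > 0" for n
 proof -
  have "0 = (\<Sum>k\<in>UNIV. LINT x|lebesgue_on D. partial k (Y n k) x)" using YD[OF that] by simp
  also have "\<dots> = (LINT x|lebesgue_on D. (\<Sum>k\<in>UNIV. partial k (Y n k) x))"
   by (rule Bochner_Integration.integral_sum[symmetric]) (rule continuous_integrable[OF pYc oD \<rho>(2)])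
  also have "\<dots> = (LINT x|lebesgue_on D. flat 0 (- real n * \<rho> x) * dv x - real n * flat 2 (- real n * \<rho> x) * fl x)"
   unfolding pY dv_def fl_def by (simp add: sum_subtractf sum_distrib_left)
  also have "\<dots> = (LINT x|lebesgue_on D. flat 0 (- real n * \<rho> x) * dv x) - (LINT x|lebesgue_on D. real n * flat 2 (- real n * \<rho> x) * fl x)"
   by (rule Bochner_Integration.integral_diff; rule continuous_integrable[OF _ oD \<rho>(2)])
     (intro continuous_intros fc dvc flc)+
  finally show ?thesis by simp
 qed
 have ge: "- \<bar>C\<bar> * (LINT x|lebesgue_on D. flat 1 (- real n * \<rho> x)) \<le> (LINT x|lebesgue_on D. flat 0 (- real n * \<rho> x) * dv x)"
  if "n > 0" for n
 proof -
  have "- \<bar>C\<bar> * (LINT x|lebesgue_on D. flat 1 (- real n * \<rho> x)) = (LINT x|lebesgue_on D. - \<bar>C\<bar> * flat 1 (- real n * \<rho> x))" by simp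
  also have "\<dots> \<le> (LINT x|lebesgue_on D. real n * flat 2 (- real n * \<rho> x) * fl x)"
  proof (rule integral_mono)
   fix x assume "x \<in> space (lebesgue_on D)"
   then have x: "\<rho> x < 0" by (simp add: D_def)
   then have pos: "- real n * \<rho> x > 0" using that by (simp add: mult_pos_neg)
   have "- \<bar>C\<bar> * flat 1 (- real n * \<rho> x) = real n * flat 2 (- real n * \<rho> x) * (\<bar>C\<bar> * \<rho> x)"
    using pos x that by (simp add: flat_def power2_eq_square field_simps)
   also have "\<dots> \<le> real n * flat 2 (- real n * \<rho> x) * (C * \<rho> x)"
    using x by (intro mult_left_mono mult_right_mono_neg mult_nonneg_nonneg flat_nonneg) auto
   also have "\<dots> \<le> real n * flat 2 (- real n * \<rho> x) * fl x"
    unfolding fl_def using flux[OF x] by (intro mult_left_mono mult_nonneg_nonneg flat_nonneg) auto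
   finally show "- \<bar>C\<bar> * flat 1 (- real n * \<rho> x) \<le> real n * flat 2 (- real n * \<rho> x) * fl x" .
  qed ((rule continuous_integrable[OF _ oD \<rho>(2)], intro continuous_intros fc flc)+)
  also have "\<dots> = (LINT x|lebesgue_on D. flat 0 (- real n * \<rho> x) * dv x)" using eq[OF that] by simp
  finally show ?thesis .
 qed
 have lim: "filterlim (\<lambda>n. - real n * \<rho> x) at_top sequentially" if "x \<in> D" for x
  using filterlim_scaled_at_top[of "- \<rho> x"] that by (simp add: D_def)
 have "(\<lambda>n. LINT x|lebesgue_on D. flat 1 (- real n * \<rho> x)) \<longlonglongrightarrow> (LINT x|lebesgue_on D. 0)"
 proof (rule integral_dominated_convergence[where w = "\<lambda>_. 1"])
  show "AE x in lebesgue_on D. (\<lambda>n. flat 1 (- real n * \<rho> x)) \<longlonglongrightarrow> 0"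
   using filterlim_compose[OF flat_1_at_top lim] by (intro AE_I2) auto
  show "AE x in lebesgue_on D. norm (flat 1 (- real n * \<rho> x)) \<le> 1" for n
   by (intro AE_I2) (simp add: flat_nonneg flat_le_one)
 qed (rule continuous_borel_measurable_lebesgue_on fc integrable_const borel_measurable_const)+
 then have A: "(\<lambda>n. - \<bar>C\<bar> * (LINT x|lebesgue_on D. flat 1 (- real n * \<rho> x))) \<longlonglongrightarrow> - \<bar>C\<bar> * 0"
  by (intro tendsto_intros) simp
 have B: "(\<lambda>n. LINT x|lebesgue_on D. flat 0 (- real n * \<rho> x) * dv x) \<longlonglongrightarrow> (LINT x|lebesgue_on D. dv x)"
 proof (rule integral_dominated_convergence[where w = "\<lambda>x. norm (dv x)"])
  show "AE x in lebesgue_on D. (\<lambda>n. flat 0 (- real n * \<rho> x) * dv x) \<longlonglongrightarrow> dv x"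
   using tendsto_mult[OF filterlim_compose[OF flat_0_at_top lim] tendsto_const] by (intro AE_I2) auto
  show "AE x in lebesgue_on D. norm (flat 0 (- real n * \<rho> x) * dv x) \<le> norm (dv x)" for n
   using flat_le_one[of 0] by (intro AE_I2) (simp add: abs_mult flat_nonneg mult_left_le_one_le)
 qed (rule continuous_borel_measurable_lebesgue_on continuous_integrable continuous_on_norm continuous_on_mult fc dvc oD \<rho>(2))+
 have "- \<bar>C\<bar> * 0 \<le> (LINT x|lebesgue_on D. dv x)"
  by (rule tendsto_le[OF _ B A]) (simp, rule eventually_mono[OF eventually_gt_at_top[of 0]], rule ge)
 then show ?thesis unfolding dv_def by simp
qed

text \<open>A two-sided bound on the flux allows the inequality to be applied to \<open>X\<close>
  and to \<open>- X\<close>.\<close>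

lemma divergence_zero:
 fixes X :: "'d::finite => real^'d => real" and \<rho> :: "real^'d => real"
 assumes \<rho>: "smooth \<rho>" "bounded {x. \<rho> x < 0}"
  and X: "\<And>k x. X k differentiable (at x)" "\<And>k. continuous_on UNIV (partial k (X k))"
  and flux: "\<And>x. \<rho> x < 0 ==> \<bar>\<Sum>k\<in>UNIV. partial k \<rho> x * X k x\<bar> \<le> C * \<bar>\<rho> x\<bar>"
 shows "(LINT x|lebesgue_on {x. \<rho> x < 0}. (\<Sum>k\<in>UNIV. partial k (X k) x)) = 0"
proof (rule antisym)
 show "0 \<le> (LINT x|lebesgue_on {x. \<rho> x < 0}. (\<Sum>k\<in>UNIV. partial k (X k) x))"
  by (rule divergence_nonneg[OF \<rho> X, of C]) (use flux in \<open>fastforce simp: abs_le_iff\<close>)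
 have eq: "partial k (\<lambda>x. - X k x) = (\<lambda>x. - partial k (X k) x)" for k
  using partial_diff[of "\<lambda>x. 0" _ "X k" k] X(1) by (simp add: fun_eq_iff)
 have "0 \<le> (LINT x|lebesgue_on {x. \<rho> x < 0}. (\<Sum>k\<in>UNIV. partial k (\<lambda>x. - X k x) x))"
 proof (rule divergence_nonneg[OF \<rho>, of "\<lambda>k x. - X k x" C])
  fix x assume "\<rho> x < 0"
  then show "C * \<rho> x \<le> (\<Sum>k\<in>UNIV. partial k \<rho> x * - X k x)"
   using flux[of x] by (simp add: sum_negf abs_le_iff)
 qed (use X in \<open>auto simp: eq intro!: continuous_intros differentiable_minus\<close>)
 then show "(LINT x|lebesgue_on {x. \<rho> x < 0}. (\<Sum>k\<in>UNIV. partial k (X k) x)) \<le> 0"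
  unfolding eq by (simp add: sum_negf)
qed

section \<open>Gradient, Hessian, Laplacian and traces of semidefinite matrices\<close>

definition lap :: "((real^'d) => real) => real^'d => real" where
 "lap w x = (\<Sum>k\<in>UNIV. partial k (partial k w) x)"

definition hess :: "((real^'d) => real) => real^'d => real^'d^'d" where
 "hess w x = (\<chi> i j. partial i (partial j w) x)"

definition grad :: "((real^'d) => real) => real^'d => real^'d" where
 "grad w x = (\<chi> i. partial i w x)"

lemma norm_vec_square: "(norm (v::real^'d))\<^sup>2 = (\<Sum>i\<in>UNIV. (v $ i)\<^sup>2)"
 unfolding power2_norm_eq_inner inner_vec_def by (simp add: power2_eq_square)

lemma norm_mat_square: "(norm (A::real^'n^'d))\<^sup>2 = (\<Sum>i\<in>UNIV. \<Sum>j\<in>UNIV. (A $ i $ j)\<^sup>2)"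
 unfolding power2_norm_eq_inner inner_vec_def by (simp add: power2_eq_square)

lemma inner_mat: "(A::real^'n^'d) \<bullet> B = (\<Sum>i\<in>UNIV. \<Sum>j\<in>UNIV. A $ i $ j * B $ i $ j)"
 by (simp add: inner_vec_def)

lemma smooth_lap [smooth_intros]: "smooth w ==> smooth (lap w)"
 unfolding lap_def[abs_def] by (intro smooth_intros smooth_partial)

lemma continuous_on_hess: "smooth w ==> continuous_on S (hess w)"
 unfolding hess_def[abs_def] by (intro continuous_intros smooth_continuous_on smooth_partial)

lemma continuous_on_grad: "smooth w ==> continuous_on S (grad w)"
 unfolding grad_def[abs_def] by (intro continuous_intros smooth_continuous_on smooth_partial)

lemma lap_inner: "lap w x = mat 1 \<bullet> hess w x"
 by (simp add: inner_mat lap_def hess_def mat_def if_distrib[of "\<lambda>c. c * _"] sum.delta cong: if_cong)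

lemma partial_lap: "smooth w ==> partial k (lap w) x = (\<Sum>j\<in>UNIV. partial k (partial j (partial j w)) x)"
 unfolding lap_def[abs_def] by (subst partial_smooth_sum) auto

text \<open>The quadratic form is evaluated at the vector with entry \<open>g $ k\<close> at
  \<open>j\<close>, entry \<open>- g $ j\<close> at \<open>k\<close>, and zeros elsewhere.\<close>

lemma minor_nonneg:
 fixes A :: "real^'d^'d" and g :: "real^'d"
 assumes psd: "\<And>\<xi>. 0 \<le> (\<Sum>i\<in>UNIV. \<Sum>j\<in>UNIV. A $ i $ j * \<xi> $ i * \<xi> $ j)"
  and sym: "\<And>i j. A $ i $ j = A $ j $ i"
 shows "0 \<le> (g $ k)\<^sup>2 * A $ j $ j + (g $ j)\<^sup>2 * A $ k $ k - 2 * g $ k * g $ j * A $ k $ j"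
proof (cases "k = j")
 case True then show ?thesis by (simp add: power2_eq_square)
next
 case False
 define \<xi> :: "real^'d" where "\<xi> = (\<chi> i. if i = j then g $ k else if i = k then - g $ j else 0)"
 have s: "(\<Sum>i\<in>UNIV. F i * \<xi> $ i) = F j * g $ k - F k * g $ j" for F
 proof -
  have "F i * \<xi> $ i = (if i = j then F j * g $ k else 0) + (if i = k then - F k * g $ j else 0)" for i
   using False by (simp add: \<xi>_def)
  then show ?thesis by (simp add: sum.distrib)
 qed
 have "(\<Sum>i\<in>UNIV. \<Sum>l\<in>UNIV. A $ i $ l * \<xi> $ i * \<xi> $ l) = (\<Sum>i\<in>UNIV. (\<Sum>l\<in>UNIV. A $ i $ l * \<xi> $ l) * \<xi> $ i)"
  by (simp add: sum_distrib_left sum_distrib_right algebra_simps)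
 also have "\<dots> = (A $ j $ j * g $ k - A $ j $ k * g $ j) * g $ k - (A $ k $ j * g $ k - A $ k $ k * g $ j) * g $ j"
  by (simp only: s)
 finally show ?thesis using psd[of \<xi>] sym[of j k] by (simp add: algebra_simps power2_eq_square)
qed

text \<open>Symmetrising the double sum presents twice its value as a sum of the terms in
  \<open>minor_nonneg\<close>. The quantity is \<open>|g|^2 tr A - g \<bullet> A g\<close>; with the
  Hessian and the gradient of \<open>\<rho>\<close> it is the curvature term of the
  boundary.\<close>

lemma trace_minus_quadratic_nonneg:
 fixes A :: "real^'d^'d" and g :: "real^'d"
 assumes psd: "\<And>\<xi>. 0 \<le> (\<Sum>i\<in>UNIV. \<Sum>j\<in>UNIV. A $ i $ j * \<xi> $ i * \<xi> $ j)"
  and sym: "\<And>i j. A $ i $ j = A $ j $ i"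
 shows "0 \<le> (\<Sum>k\<in>UNIV. \<Sum>j\<in>UNIV. (g $ k)\<^sup>2 * A $ j $ j - g $ k * g $ j * A $ k $ j)"
proof -
 have "(\<Sum>k\<in>UNIV. \<Sum>j\<in>UNIV. (g $ k)\<^sup>2 * A $ j $ j) = (\<Sum>k\<in>UNIV. \<Sum>j\<in>UNIV. (g $ j)\<^sup>2 * A $ k $ k)"
  by (subst sum.swap) simp
 then have "2 * (\<Sum>k\<in>UNIV. \<Sum>j\<in>UNIV. (g $ k)\<^sup>2 * A $ j $ j - g $ k * g $ j * A $ k $ j)
   = (\<Sum>k\<in>UNIV. \<Sum>j\<in>UNIV. (g $ k)\<^sup>2 * A $ j $ j + (g $ j)\<^sup>2 * A $ k $ k - 2 * g $ k * g $ j * A $ k $ j)"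
  by (simp add: sum.distrib sum_subtractf sum_distrib_left algebra_simps)
 moreover have "0 \<le> \<dots>" by (intro sum_nonneg minor_nonneg assms)
 ultimately show ?thesis by linarith
qed

section \<open>Sublevel domains\<close>

locale sublevel_domain =
 fixes \<rho> :: "real^'d => real"
 assumes smooth_\<rho>: "smooth \<rho>" and bounded_sublevel: "bounded {x. \<rho> x < 0}"
begin

definition D where "D = {x. \<rho> x < 0}"

abbreviation M where "M \<equiv> lebesgue_on D"

lemma open_D: "open D" unfolding D_def using smooth_\<rho> by (rule smooth_sublevel_open)
lemma bounded_D: "bounded D" unfolding D_def by (rule bounded_sublevel)
lemma finite_M: "finite_measure M" using open_D bounded_D by (rule lebesgue_on_open_finite)

lemma sqint_continuous: "continuous_on UNIV (f :: real^'d => 'b::euclidean_space) ==> sqint M f"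
 using continuous_sqint open_D bounded_D by blast

lemma integrable_continuous: "continuous_on UNIV (f :: real^'d => 'b::euclidean_space) ==> integrable M f"
 using continuous_integrable open_D bounded_D by blast

lemma sqint_smooth: "smooth f ==> sqint M f"
 by (intro sqint_continuous smooth_continuous_on)

lemma integrable_smooth: "smooth f ==> integrable M f"
 by (intro integrable_continuous smooth_continuous_on)

lemma sqint_hess: "smooth w ==> sqint M (hess w)"
 by (intro sqint_continuous continuous_on_hess)

lemma sqint_grad: "smooth w ==> sqint M (grad w)"
 by (intro sqint_continuous continuous_on_grad)

lemma smooth_divergence_nonneg:
 assumes "\<And>k. smooth (X k)" "smooth S" "\<And>x. x \<in> D ==> (\<Sum>k\<in>UNIV. partial k \<rho> x * X k x) \<ge> \<rho> x * S x"
 shows "0 \<le> (LINT x|M. (\<Sum>k\<in>UNIV. partial k (X k) x))"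
proof -
 obtain C where C: "0 \<le> C" "\<And>x. x \<in> D ==> norm (S x) \<le> C"
  using continuous_bounded_on[OF smooth_continuous_on[OF assms(2)] bounded_D] by blast
 show ?thesis
  unfolding D_def
 proof (rule divergence_nonneg[OF smooth_\<rho> bounded_sublevel, of X C])
  fix x assume "\<rho> x < 0"
  then have "\<rho> x * C \<le> \<rho> x * S x" using C(2)[of x] by (intro mult_left_mono_neg) (auto simp: D_def)
  then show "C * \<rho> x \<le> (\<Sum>k\<in>UNIV. partial k \<rho> x * X k x)"
   using order_trans[of "\<rho> x * C" "\<rho> x * S x"] assms(3)[of x] \<open>\<rho> x < 0\<close>
   by (simp add: D_def mult.commute[of C])
 qed (use assms in \<open>auto intro: smooth_differentiable smooth_continuous_on\<close>)
qed

lemma smooth_divergence_zero: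
 assumes "\<And>k. smooth (X k)" "smooth S" "\<And>x. x \<in> D ==> (\<Sum>k\<in>UNIV. partial k \<rho> x * X k x) = \<rho> x * S x"
 shows "(LINT x|M. (\<Sum>k\<in>UNIV. partial k (X k) x)) = 0"
proof -
 obtain C where C: "0 \<le> C" "\<And>x. x \<in> D ==> norm (S x) \<le> C"
  using continuous_bounded_on[OF smooth_continuous_on[OF assms(2)] bounded_D] by blast
 show ?thesis
  unfolding D_def
 proof (rule divergence_zero[OF smooth_\<rho> bounded_sublevel, of X C])
  fix x assume "\<rho> x < 0"
  then show "\<bar>\<Sum>k\<in>UNIV. partial k \<rho> x * X k x\<bar> \<le> C * \<bar>\<rho> x\<bar>"
   using assms(3)[of x] C(2)[of x] by (simp add: D_def abs_mult mult.commute[of C] mult_left_mono)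
 qed (use assms in \<open>auto intro: smooth_differentiable smooth_continuous_on\<close>)
qed

text \<open>The flux of the field \<open>w \<nabla>w\<close> is divisible by \<open>\<rho>\<close>
  because \<open>w\<close> is, so its divergence integrates to zero.\<close>

lemma energy_identity:
 assumes "smooth l" defines "w \<equiv> \<lambda>x. \<rho> x * l x"
 shows "(l2 M (grad w))\<^sup>2 = - (LINT x|M. w x * lap w x)"
proof -
 have w: "smooth w" unfolding w_def by (intro smooth_intros smooth_\<rho> assms)
 have "(LINT x|M. (\<Sum>k\<in>UNIV. partial k (\<lambda>x. w x * partial k w x) x)) = 0"
 proof (rule smooth_divergence_zero)
  show "smooth (\<lambda>x. l x * (\<Sum>k\<in>UNIV. partial k \<rho> x * partial k w x))"
   by (intro smooth_intros w assms smooth_partial smooth_\<rho>)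
  fix x
  have "w x = \<rho> x * l x" by (simp add: w_def)
  then show "(\<Sum>k\<in>UNIV. partial k \<rho> x * (w x * partial k w x)) = \<rho> x * (l x * (\<Sum>k\<in>UNIV. partial k \<rho> x * partial k w x))"
   by (simp add: sum_distrib_left algebra_simps)
 qed (intro smooth_intros smooth_partial w)
 moreover have "(\<Sum>k\<in>UNIV. partial k (\<lambda>x. w x * partial k w x) x) = (norm (grad w x))\<^sup>2 + w x * lap w x" for x
  unfolding norm_vec_square using w
  by (simp add: partial_smooth_mult sum.distrib grad_def lap_def sum_distrib_left power2_eq_square)
 ultimately have "(LINT x|M. (norm (grad w x))\<^sup>2 + w x * lap w x) = 0" by simp
 moreover have "integrable M (\<lambda>x. w x * lap w x)" by (intro integrable_smooth smooth_intros w)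
 ultimately show ?thesis using sqint_grad[OF w] by (simp add: l2_square sqintD)
qed

text \<open>The field \<open>x $ k0 * (w x)^2\<close> in one fixed coordinate direction
  \<open>k0\<close> has a divergence with zero integral, and the coordinate is bounded by
  \<open>R\<close> on the domain.\<close>

lemma poincare:
 assumes "smooth l" "\<And>x. x \<in> D ==> norm x \<le> R" defines "w \<equiv> \<lambda>x. \<rho> x * l x"
 shows "l2 M w \<le> 2 * R * l2 M (grad w)"
proof -
 have w: "smooth w" unfolding w_def by (intro smooth_intros smooth_\<rho> assms)
 have lw: "(l2 M w)\<^sup>2 \<le> 2 * R * (l2 M w * l2 M (grad w))"
 proof -
  fix k0 :: 'd
  define X where "X k x = (if k = k0 then x $ k0 * (w x)\<^sup>2 else 0)" for k :: 'd and x :: "real^'d"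
  have Xs: "smooth (X k)" for k unfolding X_def by (cases "k = k0") (auto intro!: smooth_intros w)
  have "(LINT x|M. (\<Sum>k\<in>UNIV. partial k (X k) x)) = 0"
  proof (rule smooth_divergence_zero[OF Xs])
   show "smooth (\<lambda>x. partial k0 \<rho> x * (x $ k0 * (w x * l x)))" by (intro smooth_intros w assms smooth_partial smooth_\<rho>)
   show "(\<Sum>k\<in>UNIV. partial k \<rho> x * X k x) = \<rho> x * (partial k0 \<rho> x * (x $ k0 * (w x * l x)))" for x
    by (simp add: X_def if_distrib[of "\<lambda>c. _ * c"] cong: if_cong) (simp add: w_def power2_eq_square)
  qed
  moreover have "(\<Sum>k\<in>UNIV. partial k (X k) x) = (w x)\<^sup>2 + 2 * (x $ k0 * w x * partial k0 w x)" for x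
  proof -
   have "partial k (X k) x = (if k = k0 then (w x)\<^sup>2 + 2 * (x $ k0 * w x * partial k0 w x) else 0)" for k
   proof (cases "k = k0")
    case True
    then have "X k = (\<lambda>x. x $ k0 * (w x * w x))" by (auto simp: X_def power2_eq_square)
    then show ?thesis using True w
     by (simp add: partial_smooth_mult smooth_mult) (simp add: algebra_simps power2_eq_square)
   next
    case False then have "X k = (\<lambda>x. 0)" by (auto simp: X_def)
    then show ?thesis using False by simp
   qed
   then show ?thesis by simp
  qed
  moreover have "integrable M (\<lambda>x. x $ k0 * w x * partial k0 w x)" by (intro integrable_smooth smooth_intros w smooth_partial)
  moreover have "integrable M (\<lambda>x. (w x)\<^sup>2)" by (intro integrable_smooth smooth_intros w)
  ultimately have e: "(l2 M w)\<^sup>2 = - 2 * (LINT x|M. x $ k0 * w x * partial k0 w x)"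
   by (simp add: l2_square)
  have "- (LINT x|M. x $ k0 * w x * partial k0 w x) = (LINT x|M. - (x $ k0 * w x * partial k0 w x))" by simp
  also have "\<dots> \<le> (LINT x|M. R * (norm (w x) * norm (grad w x)))"
  proof (rule integral_mono)
   fix x assume "x \<in> space M"
   then have x: "\<bar>x $ k0\<bar> \<le> R" using assms(2)[of x] component_le_norm_cart[of x k0] by simp
   have g: "\<bar>partial k0 w x\<bar> \<le> norm (grad w x)" using component_le_norm_cart[of "grad w x" k0] by (simp add: grad_def)
   have "- (x $ k0 * w x * partial k0 w x) \<le> \<bar>x $ k0\<bar> * (\<bar>w x\<bar> * \<bar>partial k0 w x\<bar>)"
    by (simp flip: abs_mult add: mult.assoc)
   also have "\<dots> \<le> R * (\<bar>w x\<bar> * norm (grad w x))"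
    using x g by (intro mult_mono mult_left_mono) auto
   finally show "- (x $ k0 * w x * partial k0 w x) \<le> R * (norm (w x) * norm (grad w x))" by simp
  qed (use sqint_integrable_norms[OF sqint_smooth[OF w] sqint_grad[OF w]] in
    \<open>auto intro!: integrable_smooth smooth_intros w smooth_partial\<close>)
  also have "\<dots> = R * (LINT x|M. norm (w x) * norm (grad w x))" by simp
  also have "\<dots> \<le> \<bar>R\<bar> * (l2 M w * l2 M (grad w))"
   by (intro mult_mono l2_Cauchy_Schwarz_norm sqint_smooth sqint_grad w) auto
  \<comment> \<open>A negative \<open>R\<close> is possible only for an empty domain, where the
    norms vanish.\<close>
  also have "\<bar>R\<bar> * (l2 M w * l2 M (grad w)) = R * (l2 M w * l2 M (grad w))"
  proof (cases "D = {}")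
   case True
   then have "l2 M w = 0" by (simp add: l2_def)
   then show ?thesis by simp
  next
   case False
   then have "R \<ge> 0" using assms(2) norm_ge_zero order_trans by blast
   then show ?thesis by simp
  qed
  finally show ?thesis unfolding e by simp
 qed
 show ?thesis
 proof (cases "l2 M w = 0")
  case True
  have "0 \<le> R \<or> l2 M (grad w) = 0"
  proof (cases "D = {}")
   case True then show ?thesis by (simp add: l2_def)
  next
   case False then show ?thesis using assms(2) norm_ge_zero order_trans by blast
  qed
  then show ?thesis using True by auto
 next
  case False
  then have "l2 M w > 0" by (simp add: order_less_le)
  then show ?thesis using lw by (simp add: power2_eq_square)
 qed
qed

text \<open>The energy identity bounds the squared norm of the gradient by the norms of
  \<open>w\<close> and of its Laplacian; the Poincare inequality replaces the former by the
  gradient, and one factor cancels.\<close>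

lemma gradient_estimate:
 assumes "smooth l" "\<And>x. x \<in> D ==> norm x \<le> R" "0 \<le> R" defines "w \<equiv> \<lambda>x. \<rho> x * l x"
 shows "l2 M (grad w) \<le> 2 * R * l2 M (lap w)"
proof -
 have w: "smooth w" unfolding w_def by (intro smooth_intros smooth_\<rho> assms)
 have "(l2 M (grad w))\<^sup>2 \<le> l2 M w * l2 M (lap w)"
  using energy_identity[OF assms(1)] l2_Cauchy_Schwarz_real[OF sqint_smooth[OF w] sqint_smooth[OF smooth_lap[OF w]]]
  unfolding w_def by linarith
 also have "\<dots> \<le> 2 * R * l2 M (grad w) * l2 M (lap w)"
  using poincare[OF assms(1,2)] unfolding w_def by (intro mult_right_mono) auto
 finally have "l2 M (grad w) * l2 M (grad w) \<le> (2 * R * l2 M (lap w)) * l2 M (grad w)"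
  by (simp add: power2_eq_square algebra_simps)
 then show ?thesis
  using assms(3) by (cases "l2 M (grad w) = 0") (auto simp: order_less_le)
qed

text \<open>After expanding the square on the right, the mixed term is \<open>2 * \<mu>\<close>
  times the Dirichlet energy, hence nonnegative.\<close>

lemma lap_le_resolvent:
 assumes "smooth l" "0 \<le> \<mu>" defines "w \<equiv> \<lambda>x. \<rho> x * l x"
 shows "l2 M (lap w) \<le> l2 M (\<lambda>x. \<mu> * w x - lap w x)"
proof -
 have w: "smooth w" unfolding w_def by (intro smooth_intros smooth_\<rho> assms)
 have lw: "smooth (lap w)" using w by (rule smooth_lap)
 have s: "sqint M (\<lambda>x. \<mu> * w x)" by (intro sqint_smooth smooth_intros w)
 have "(l2 M (\<lambda>x. \<mu> * w x - lap w x))\<^sup>2 = (l2 M (\<lambda>x. \<mu> * w x))\<^sup>2 + 2 * (LINT x|M. \<mu> * w x * (- lap w x)) + (l2 M (lap w))\<^sup>2"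
  using l2_add_square[OF s sqint_uminus[OF sqint_smooth[OF lw]]] by simp
 also have "(LINT x|M. \<mu> * w x * (- lap w x)) = \<mu> * (l2 M (grad w))\<^sup>2"
  using energy_identity[OF assms(1)] unfolding w_def by (simp add: mult.assoc)
 finally have "(l2 M (lap w))\<^sup>2 \<le> (l2 M (\<lambda>x. \<mu> * w x - lap w x))\<^sup>2" using assms(2) by simp
 then show ?thesis using power2_le_imp_le l2_nonneg by blast
qed

text \<open>The multiplier is \<open>l\<close> and not the function itself. The field
  \<open>\<rho> l \<nabla>l + l^2 \<nabla>\<rho> / 2\<close> has divergence \<open>l \<Delta>(\<rho>
  l) + \<rho> |\<nabla>l|^2 - l^2 \<Delta>\<rho> / 2\<close>, and its flux is
  \<open>l^2 |\<nabla>\<rho>|^2 / 2\<close>, which is nonnegative, up to a multiple of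
  \<open>\<rho>\<close>.\<close>

lemma lap_coercive:
 assumes "smooth l" "\<And>x. x \<in> D ==> 2 * c \<le> lap \<rho> x"
 shows "c * (l2 M l)\<^sup>2 \<le> (LINT x|M. l x * lap (\<lambda>x. \<rho> x * l x) x)"
proof -
 note s = assms(1) smooth_\<rho>
 define X where "X k = (\<lambda>x. \<rho> x * (l x * partial k l x) + (l x * l x) * partial k \<rho> x / 2)" for k
 have Xs: "smooth (X k)" for k unfolding X_def by (intro smooth_intros s smooth_partial)
 have "0 \<le> (LINT x|M. (\<Sum>k\<in>UNIV. partial k (X k) x))"
 proof (rule smooth_divergence_nonneg[OF Xs])
  show "smooth (\<lambda>x. \<Sum>k\<in>UNIV. partial k \<rho> x * (l x * partial k l x))" by (intro smooth_intros s smooth_partial)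
  fix x
  have "(\<Sum>k\<in>UNIV. partial k \<rho> x * X k x) = \<rho> x * (\<Sum>k\<in>UNIV. partial k \<rho> x * (l x * partial k l x)) + (l x * l x) / 2 * (\<Sum>k\<in>UNIV. (partial k \<rho> x)\<^sup>2)"
   by (simp add: X_def sum.distrib sum_distrib_left algebra_simps power2_eq_square)
  moreover have "0 \<le> (l x * l x) / 2 * (\<Sum>k\<in>UNIV. (partial k \<rho> x)\<^sup>2)" by (intro mult_nonneg_nonneg sum_nonneg) auto
  ultimately show "\<rho> x * (\<Sum>k\<in>UNIV. partial k \<rho> x * (l x * partial k l x)) \<le> (\<Sum>k\<in>UNIV. partial k \<rho> x * X k x)" by simp
 qed
 also have "\<dots> \<le> (LINT x|M. l x * lap (\<lambda>x. \<rho> x * l x) x - c * (l x * l x))"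
 proof (rule integral_mono)
  show "integrable M (\<lambda>x. \<Sum>k\<in>UNIV. partial k (X k) x)" by (intro integrable_smooth smooth_intros smooth_partial Xs)
  show "integrable M (\<lambda>x. l x * lap (\<lambda>x. \<rho> x * l x) x - c * (l x * l x))" by (intro integrable_smooth smooth_intros s)
  fix x assume "x \<in> space M"
  then have x: "\<rho> x < 0" "2 * c \<le> lap \<rho> x" using assms(2)[of x] by (auto simp: D_def)
  have pX: "partial k (X k) x = partial k \<rho> x * (l x * partial k l x) + \<rho> x * (partial k l x * partial k l x + l x * partial k (partial k l) x)
    + (partial k l x * l x) * partial k \<rho> x + (l x * l x) * partial k (partial k \<rho>) x / 2" for k
  proof -
   have "X k = (\<lambda>x. \<rho> x * (l x * partial k l x) + (1/2) * ((l x * l x) * partial k \<rho> x))" by (simp add: X_def)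
   then show ?thesis
    using s by (simp only: partial_simps smooth_mult smooth_partial smooth_const partial_const) (simp add: algebra_simps)
  qed
  have pp: "partial k (partial k (\<lambda>x. \<rho> x * l x)) x = partial k (partial k \<rho>) x * l x + 2 * (partial k \<rho> x * partial k l x) + \<rho> x * partial k (partial k l) x" for k
   using s by (simp add: partial_simps smooth_mult smooth_partial)
  have "(\<Sum>k\<in>UNIV. partial k (X k) x) = l x * lap (\<lambda>x. \<rho> x * l x) x + (\<Sum>k\<in>UNIV. \<rho> x * (partial k l x)\<^sup>2) - (l x * l x) * lap \<rho> x / 2"
   unfolding lap_def pX pp sum_distrib_left sum_divide_distrib sum_subtractf[symmetric] sum.distrib[symmetric]
   by (rule sum.cong) (auto simp: algebra_simps power2_eq_square)
  moreover have "(\<Sum>k\<in>UNIV. \<rho> x * (partial k l x)\<^sup>2) \<le> 0"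
   using x(1) by (intro sum_nonpos) (simp add: mult_nonpos_nonneg)
  moreover have "c * (l x * l x) \<le> (l x * l x) * lap \<rho> x / 2"
   using mult_left_mono[OF x(2), of "l x * l x"] by (simp add: mult.commute[of c])
  ultimately show "(\<Sum>k\<in>UNIV. partial k (X k) x) \<le> l x * lap (\<lambda>x. \<rho> x * l x) x - c * (l x * l x)" by linarith
 qed
 also have "\<dots> = (LINT x|M. l x * lap (\<lambda>x. \<rho> x * l x) x) - (LINT x|M. c * (l x * l x))"
  by (intro Bochner_Integration.integral_diff integrable_smooth smooth_intros s)
 also have "(LINT x|M. c * (l x * l x)) = c * (l2 M l)\<^sup>2" unfolding l2_square by (simp add: power2_eq_square)
 finally show ?thesis by simp
qed

end

locale convex_sublevel = sublevel_domain +
 assumes convex_\<rho>: "\<And>x \<xi>. 0 \<le> (\<Sum>i\<in>UNIV. \<Sum>j\<in>UNIV. partial i (partial j \<rho>) x * \<xi> $ i * \<xi> $ j)"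
begin

text \<open>The Miranda--Talenti estimate. The field \<open>\<nabla>w \<Delta>w - D\<^sup>2w \<nabla>w\<close> has divergence
 \<open>(\<Delta>w)\<^sup>2 - |D\<^sup>2w|\<^sup>2\<close>; modulo \<open>\<rho>\<close> its flux is
 \<open>l\<^sup>2 (|\<nabla>\<rho>|\<^sup>2 \<Delta>\<rho> - D\<^sup>2\<rho> \<nabla>\<rho> \<bullet> \<nabla>\<rho>)\<close>.\<close>

lemma miranda_talenti:
 assumes "smooth l" defines "w \<equiv> \<lambda>x. \<rho> x * l x"
 shows "l2 M (hess w) \<le> l2 M (lap w)"
proof -
 note s = assms(1) smooth_\<rho>
 have w: "smooth w" unfolding w_def by (intro smooth_intros smooth_\<rho> assms)
 define X where "X k = (\<lambda>x. partial k w x * lap w x - (\<Sum>j\<in>UNIV. partial k (partial j w) x * partial j w x))" for k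
 have Xs: "smooth (X k)" for k unfolding X_def by (intro smooth_intros w smooth_partial)
 have div: "(\<Sum>k\<in>UNIV. partial k (X k) x) = (lap w x)\<^sup>2 - (norm (hess w x))\<^sup>2" for x
 proof -
  have pX: "partial k (X k) x = partial k (partial k w) x * lap w x + (\<Sum>j\<in>UNIV. partial k w x * partial k (partial j (partial j w)) x)
    - (\<Sum>j\<in>UNIV. partial k (partial k (partial j w)) x * partial j w x) - (\<Sum>j\<in>UNIV. (partial k (partial j w) x)\<^sup>2)" for k
   unfolding X_def using w
   by (simp add: partial_simps smooth_mult smooth_partial smooth_sum smooth_lap partial_lap
     sum.distrib sum_distrib_left power2_eq_square)
  have cm: "partial k (partial k (partial j w)) = partial j (partial k (partial k w))" for k j
   using partial_commute[OF w, of k j] partial_commute[OF smooth_partial[OF w], of k j k] by simp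
  have "(\<Sum>k\<in>UNIV. \<Sum>j\<in>UNIV. partial k (partial k (partial j w)) x * partial j w x)
    = (\<Sum>k\<in>UNIV. \<Sum>j\<in>UNIV. partial k w x * partial k (partial j (partial j w)) x)"
  proof -
   have "(\<Sum>k\<in>UNIV. \<Sum>j\<in>UNIV. partial k (partial k (partial j w)) x * partial j w x)
    = (\<Sum>k\<in>UNIV. \<Sum>j\<in>UNIV. partial j w x * partial j (partial k (partial k w)) x)"
    by (intro sum.cong refl) (subst cm, rule mult.commute)
   also have "\<dots> = (\<Sum>k\<in>UNIV. \<Sum>j\<in>UNIV. partial k w x * partial k (partial j (partial j w)) x)"
    by (rule sum.swap)
   finally show ?thesis .
  qed
  moreover have "(\<Sum>k\<in>UNIV. partial k (partial k w) x * lap w x) = (lap w x)\<^sup>2"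
   by (simp only: sum_distrib_right[symmetric] lap_def power2_eq_square)
  ultimately show ?thesis unfolding pX norm_mat_square
   by (simp add: sum.distrib sum_subtractf hess_def)
 qed
 \<comment> \<open>\<open>p\<close> and \<open>q\<close> are what remains of the first and second
   derivatives of \<open>w\<close> when the multiples of \<open>\<rho>\<close> with derivatives of
   \<open>l\<close> are split off; \<open>T\<close> collects the coefficient of
   \<open>\<rho>\<close> in the field.\<close>
 define p where "p k x = l x * partial k \<rho> x" for k x
 define q where "q k j x = l x * partial k (partial j \<rho>) x + partial k l x * partial j \<rho> x + partial j l x * partial k \<rho> x" for k j x
 define T where "T k j x = partial k l x * (q j j x + \<rho> x * partial j (partial j l) x) + p k x * partial j (partial j l) x
   - partial k (partial j l) x * (p j x + \<rho> x * partial j l x) - q k j x * partial j l x" for k j x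
 have Ts: "smooth (T k j)" for k j unfolding T_def p_def q_def by (intro smooth_intros s smooth_partial)
 have w1: "partial k w x = p k x + \<rho> x * partial k l x" for k x
  unfolding w_def p_def using s by (simp add: partial_simps)
 have w2: "partial k (partial j w) x = q k j x + \<rho> x * partial k (partial j l) x" for k j x
  unfolding w_def q_def using s by (simp add: partial_simps smooth_mult smooth_partial)
 have "0 \<le> (LINT x|M. (\<Sum>k\<in>UNIV. partial k (X k) x))"
 proof (rule smooth_divergence_nonneg[OF Xs])
  show "smooth (\<lambda>x. \<Sum>k\<in>UNIV. \<Sum>j\<in>UNIV. partial k \<rho> x * T k j x)" by (intro smooth_intros Ts smooth_partial s)
  fix x
  let ?g = "\<lambda>k. partial k \<rho> x"
  have "(\<Sum>k\<in>UNIV. ?g k * X k x) = (\<Sum>k\<in>UNIV. \<Sum>j\<in>UNIV. ?g k * (partial k w x * partial j (partial j w) x - partial k (partial j w) x * partial j w x))"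
   unfolding X_def lap_def by (simp add: sum_distrib_left sum_subtractf right_diff_distrib)
  also have "\<dots> = (\<Sum>k\<in>UNIV. \<Sum>j\<in>UNIV. ?g k * (p k x * q j j x - q k j x * p j x) + \<rho> x * (?g k * T k j x))"
   unfolding w1 w2 T_def by (intro sum.cong refl) (simp add: algebra_simps)
  also have "\<dots> = (\<Sum>k\<in>UNIV. \<Sum>j\<in>UNIV. ?g k * (p k x * q j j x - q k j x * p j x)) + \<rho> x * (\<Sum>k\<in>UNIV. \<Sum>j\<in>UNIV. ?g k * T k j x)"
   by (simp add: sum.distrib sum_distrib_left)
  also have "(\<Sum>k\<in>UNIV. \<Sum>j\<in>UNIV. ?g k * (p k x * q j j x - q k j x * p j x)) 
    = (\<Sum>k\<in>UNIV. \<Sum>j\<in>UNIV. (l x)\<^sup>2 * ((?g k)\<^sup>2 * partial j (partial j \<rho>) x - ?g k * ?g j * partial k (partial j \<rho>) x))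
     + ((\<Sum>k\<in>UNIV. \<Sum>j\<in>UNIV. l x * (?g k)\<^sup>2 * (partial j l x * ?g j)) - (\<Sum>k\<in>UNIV. \<Sum>j\<in>UNIV. l x * (?g j)\<^sup>2 * (partial k l x * ?g k)))"
   unfolding sum.distrib[symmetric] sum_subtractf[symmetric] p_def q_def
   by (intro sum.cong refl) (simp add: algebra_simps power2_eq_square)
  also have "(\<Sum>k\<in>UNIV. \<Sum>j\<in>UNIV. l x * (?g k)\<^sup>2 * (partial j l x * ?g j)) - (\<Sum>k\<in>UNIV. \<Sum>j\<in>UNIV. l x * (?g j)\<^sup>2 * (partial k l x * ?g k)) = 0"
   by (subst sum.swap) simp
  also have "(\<Sum>k\<in>UNIV. \<Sum>j\<in>UNIV. (l x)\<^sup>2 * ((?g k)\<^sup>2 * partial j (partial j \<rho>) x - ?g k * ?g j * partial k (partial j \<rho>) x)) =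
     (l x)\<^sup>2 * (\<Sum>k\<in>UNIV. \<Sum>j\<in>UNIV. ((?g k)\<^sup>2 * partial j (partial j \<rho>) x - ?g k * ?g j * partial k (partial j \<rho>) x))"
   by (simp add: sum_distrib_left)
  finally have "(\<Sum>k\<in>UNIV. ?g k * X k x) = (l x)\<^sup>2 * (\<Sum>k\<in>UNIV. \<Sum>j\<in>UNIV. ((?g k)\<^sup>2 * partial j (partial j \<rho>) x - ?g k * ?g j * partial k (partial j \<rho>) x))
    + \<rho> x * (\<Sum>k\<in>UNIV. \<Sum>j\<in>UNIV. ?g k * T k j x)" by simp
  moreover have "0 \<le> (\<Sum>k\<in>UNIV. \<Sum>j\<in>UNIV. ((?g k)\<^sup>2 * partial j (partial j \<rho>) x - ?g k * ?g j * partial k (partial j \<rho>) x))"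
   using trace_minus_quadratic_nonneg[of "hess \<rho> x" "grad \<rho> x"] convex_\<rho>[of x] partial_commute[OF smooth_\<rho>]
   by (simp add: hess_def grad_def)
  ultimately show "\<rho> x * (\<Sum>k\<in>UNIV. \<Sum>j\<in>UNIV. ?g k * T k j x) \<le> (\<Sum>k\<in>UNIV. ?g k * X k x)"
   by simp
 qed
 also have "\<dots> = (l2 M (lap w))\<^sup>2 - (l2 M (hess w))\<^sup>2"
  unfolding div l2_square using sqintD(2)[OF sqint_hess[OF w]] sqintD(2)[OF sqint_smooth[OF smooth_lap[OF w]]]
  by simp
 finally have "(l2 M (hess w))\<^sup>2 \<le> (l2 M (lap w))\<^sup>2" by simp
 then show ?thesis using power2_le_imp_le l2_nonneg by blast
qed

end

section \<open>The comparison principle\<close>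

lemma quadratic_nonneg:
 fixes a b c g :: real
 assumes "0 \<le> a" "0 \<le> c" "b\<^sup>2 \<le> 4 * a * c"
 shows "0 \<le> a * g\<^sup>2 - b * g + c"
proof (cases "a = 0")
 case True
 then show ?thesis using assms by simp
next
 case False
 then have "0 < 4 * a" using assms by simp
 have "4 * a * (a * g\<^sup>2 - b * g + c) = (2 * a * g - b)\<^sup>2 + (4 * a * c - b\<^sup>2)"
  by (simp add: algebra_simps power2_eq_square)
 also have "\<dots> \<ge> 0" using assms(3) by simp
 finally show ?thesis using \<open>0 < 4 * a\<close> by (simp add: zero_le_mult_iff)
qed

text \<open>A \<open>C\<^sup>1\<close> substitute \<open>\<psi>\<close> of the positive part with \<open>\<psi>\<^sup>2 \<le> \<psi>' t \<psi>\<close>: this inequality allows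
 the first-order term in the energy estimate to be absorbed.\<close>

definition reg_pos :: "real => real => real" where
 "reg_pos \<delta> t = (max t 0)\<^sup>2 / (max t 0 + \<delta>)"

definition reg_pos' :: "real => real => real" where
 "reg_pos' \<delta> t = ((max t 0)\<^sup>2 + 2 * max t 0 * \<delta>) / (max t 0 + \<delta>)\<^sup>2"

lemma reg_pos_has_derivative:
 assumes "0 < \<delta>"
 shows "(reg_pos \<delta> has_real_derivative reg_pos' \<delta> t) (at t)"
proof -
 consider "t > 0" | "t < 0" | "t = 0" by linarith
 then show ?thesis
 proof cases
  case 1
  have "((\<lambda>t. t\<^sup>2 / (t + \<delta>)) has_real_derivative reg_pos' \<delta> t) (at t)"
   using 1 assms by (auto intro!: derivative_eq_intros simp: reg_pos'_def field_simps power2_eq_square)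
  moreover have "eventually (\<lambda>s. s\<^sup>2 / (s + \<delta>) = reg_pos \<delta> s) (nhds t)"
   using eventually_nhds_in_open[of "{0<..}" t] 1 by (auto elim!: eventually_mono simp: reg_pos_def)
  ultimately show ?thesis using DERIV_cong_ev[of t t "\<lambda>t. t\<^sup>2 / (t + \<delta>)" "reg_pos \<delta>"] by auto
 next
  case 2
  have "eventually (\<lambda>s. 0 = reg_pos \<delta> s) (nhds t)"
   using eventually_nhds_in_open[of "{..<0}" t] 2 by (auto elim!: eventually_mono simp: reg_pos_def)
  moreover have "((\<lambda>t. 0) has_real_derivative reg_pos' \<delta> t) (at t)"
   using 2 by (simp add: reg_pos'_def)
  ultimately show ?thesis using DERIV_cong_ev[of t t "\<lambda>t. 0" "reg_pos \<delta>"] by auto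
 next
  case 3
  have "((\<lambda>h. max h 0 / (max h 0 + \<delta>)) \<longlongrightarrow> max 0 0 / (max 0 0 + \<delta>)) (at 0)"
   using assms by (intro tendsto_intros) auto
  moreover have "reg_pos \<delta> h / h = max h 0 / (max h 0 + \<delta>)" if "h \<noteq> 0" for h
   using that by (auto simp: reg_pos_def max_def power2_eq_square)
  ultimately have "((\<lambda>h. reg_pos \<delta> h / h) \<longlongrightarrow> 0) (at 0)"
   by (subst tendsto_cong[where g = "\<lambda>h. max h 0 / (max h 0 + \<delta>)"]) (auto simp: eventually_at_filter)
  then show ?thesis using 3 by (simp add: DERIV_def reg_pos'_def) (simp add: reg_pos_def)
 qed
qed

lemma reg_pos'_continuous: "0 < \<delta> ==> continuous_on UNIV (reg_pos' \<delta>)"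
 unfolding reg_pos'_def[abs_def]
 by (intro continuous_intros) (auto simp: add_nonneg_eq_0_iff)

lemma reg_pos_bounds:
 assumes "0 < \<delta>"
 shows "0 \<le> reg_pos \<delta> t" "reg_pos \<delta> t \<le> max t 0" "0 \<le> reg_pos' \<delta> t"
  "(reg_pos \<delta> t)\<^sup>2 \<le> reg_pos' \<delta> t * (max t 0 * reg_pos \<delta> t)"
  "(max t 0)\<^sup>2 - \<delta> * max t 0 \<le> max t 0 * reg_pos \<delta> t" "reg_pos \<delta> t * t = reg_pos \<delta> t * max t 0"
proof -
 define s where "s = max t 0"
 have s: "0 \<le> s" "0 < s + \<delta>" using assms by (auto simp: s_def)
 show "0 \<le> reg_pos \<delta> t" "0 \<le> reg_pos' \<delta> t"
  unfolding reg_pos_def reg_pos'_def s_def[symmetric] using s assms by auto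
 show "reg_pos \<delta> t \<le> max t 0"
  unfolding reg_pos_def s_def[symmetric] using s assms by (simp add: divide_le_eq power2_eq_square algebra_simps)
 define u where "u = s + \<delta>"
 have u: "u \<noteq> 0" using s by (simp add: u_def)
 have "(s\<^sup>2 + 2 * s * \<delta>) / u\<^sup>2 * (s * (s\<^sup>2 / u)) = s ^ 3 * (s\<^sup>2 + 2 * s * \<delta>) / u ^ 3"
  by (simp add: power2_eq_square power3_eq_cube)
 moreover have "(s\<^sup>2 / u)\<^sup>2 = s ^ 4 * u / u ^ 3"
  using u by (simp add: power_divide power2_eq_square power3_eq_cube power4_eq_xxxx)
 ultimately have "(s\<^sup>2 + 2 * s * \<delta>) / u\<^sup>2 * (s * (s\<^sup>2 / u)) - (s\<^sup>2 / u)\<^sup>2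
   = (s ^ 3 * (s\<^sup>2 + 2 * s * \<delta>) - s ^ 4 * u) / u ^ 3"
  by (simp only: diff_divide_distrib)
 also have "s ^ 3 * (s\<^sup>2 + 2 * s * \<delta>) - s ^ 4 * u = s ^ 4 * \<delta>"
  by (simp add: u_def algebra_simps power2_eq_square power3_eq_cube power4_eq_xxxx)
 finally have "(s\<^sup>2 + 2 * s * \<delta>) / (s + \<delta>)\<^sup>2 * (s * (s\<^sup>2 / (s + \<delta>))) - (s\<^sup>2 / (s + \<delta>))\<^sup>2 = s ^ 4 * \<delta> / (s + \<delta>) ^ 3"
  unfolding u_def .
 also have "\<dots> \<ge> 0" using s assms by auto
 finally show "(reg_pos \<delta> t)\<^sup>2 \<le> reg_pos' \<delta> t * (max t 0 * reg_pos \<delta> t)"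
  unfolding reg_pos_def reg_pos'_def s_def[symmetric] by simp
 have "s * (s\<^sup>2 / (s + \<delta>)) - (s\<^sup>2 - \<delta> * s) = \<delta>\<^sup>2 * s / (s + \<delta>)"
  using s by (simp add: field_simps power2_eq_square)
 also have "\<dots> \<ge> 0" using s assms by auto
 finally show "(max t 0)\<^sup>2 - \<delta> * max t 0 \<le> max t 0 * reg_pos \<delta> t"
  unfolding reg_pos_def s_def[symmetric] by simp
 show "reg_pos \<delta> t * t = reg_pos \<delta> t * max t 0" by (auto simp: reg_pos_def max_def)
qed

context sublevel_domain
begin

text \<open>Testing with a regularised positive part of \<open>- z\<close> brings the operator into
  divergence form at the price of a first-order term with coefficient at most \<open>K\<close>.
  Ellipticity absorbs that term up to \<open>K^2 / (4 * \<nu>)\<close>, which \<open>\<mu>\<close>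
  pays for, and the extra 1 in \<open>\<mu>\<close> leaves the squared norm to be estimated.\<close>

lemma comparison:
 fixes b :: "'d => 'd => real^'d => real"
 assumes b: "\<And>i j. smooth (b i j)" and "0 < \<nu>"
  and ell: "\<And>x \<xi>. x \<in> D ==> \<nu> * (norm \<xi>)\<^sup>2 \<le> (\<Sum>i\<in>UNIV. \<Sum>j\<in>UNIV. b i j x * \<xi> $ i * \<xi> $ j)"
  and K: "\<And>x. x \<in> D ==> norm (\<chi> j. \<Sum>i\<in>UNIV. partial i (b i j) x) \<le> K"
  and z: "smooth z" "smooth S" "\<And>x. x \<in> D ==> \<rho> x * S x \<le> z x"
  and r: "sqint M r" and \<mu>: "\<mu> = K\<^sup>2 / (4 * \<nu>) + 1"
  and ineq: "\<And>x. x \<in> D ==> - \<bar>r x\<bar> \<le> \<mu> * z x - (\<Sum>i\<in>UNIV. \<Sum>j\<in>UNIV. b i j x * partial i (partial j z) x)"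
 shows "l2 M (\<lambda>x. max (- z x) 0) \<le> l2 M r"
proof -
 define t where "t x = max (- z x) 0" for x
 have tc: "continuous_on UNIV t" unfolding t_def by (intro continuous_intros smooth_continuous_on z)
 have ts: "sqint M t" using tc by (rule sqint_continuous)
 have ti: "integrable M t" using tc by (rule integrable_continuous)
 have trI: "integrable M (\<lambda>x. t x * \<bar>r x\<bar>)"
  using sqint_integrable_norms[OF ts r] by (simp add: t_def)
 define q where "q i x = (\<Sum>j\<in>UNIV. b i j x * partial j z x)" for i x
 have qs: "smooth (q i)" for i unfolding q_def by (intro smooth_intros b smooth_partial z)
 have pq: "partial i (q i) x = (\<Sum>j\<in>UNIV. partial i (b i j) x * partial j z x) + (\<Sum>j\<in>UNIV. b i j x * partial i (partial j z) x)" for i x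
  unfolding q_def using b z by (simp add: partial_simps smooth_mult smooth_partial sum.distrib)
 have step: "(l2 M t)\<^sup>2 \<le> (LINT x|M. t x * \<bar>r x\<bar>) + \<delta> * (LINT x|M. t x)" if \<delta>: "0 < \<delta>" for \<delta>
 proof -
  define p where "p x = reg_pos \<delta> (- z x)" for x
  have sz: "smooth (\<lambda>x. - z x)" by (intro smooth_intros z)
  have pz: "partial i (\<lambda>x. - z x) x = - partial i z x" for i x
   using partial_smooth_diff[OF smooth_const[of 0] z(1)] by simp
  have pd: "p differentiable at x" "partial i p x = - (reg_pos' \<delta> (- z x) * partial i z x)" for x i
   unfolding p_def using differentiable_compose_real[OF reg_pos_has_derivative[OF \<delta>] smooth_differentiable[OF sz]]
    partial_compose_real[OF reg_pos_has_derivative[OF \<delta>] smooth_differentiable[OF sz]] pz by auto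
  have r'c: "continuous_on UNIV (\<lambda>x. reg_pos' \<delta> (- z x))"
   by (rule continuous_on_compose2[OF reg_pos'_continuous[OF \<delta>]]) (auto intro: smooth_continuous_on sz)
  have pc: "continuous_on UNIV p"
   using pd(1) by (simp add: differentiable_imp_continuous_on differentiable_on_def differentiable_at_withinI)
  define X where "X i x = p x * q i x" for i x
  have pX: "partial i (X i) x = - (reg_pos' \<delta> (- z x) * partial i z x) * q i x + p x * partial i (q i) x" for i x
   unfolding X_def using pd qs by (simp add: partial_mult smooth_differentiable)
  have pXc: "continuous_on UNIV (partial i (X i))" for i
   unfolding pX[abs_def] by (intro continuous_intros r'c pc smooth_continuous_on smooth_partial z qs)
  define E where "E x = (\<Sum>i\<in>UNIV. partial i (X i) x)" for x
  have Ei: "integrable M E" unfolding E_def by (intro integrable_continuous continuous_intros pXc)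
  obtain C1 where C1: "0 \<le> C1" "\<And>x. x \<in> D ==> norm (\<Sum>i\<in>UNIV. partial i \<rho> x * q i x) \<le> C1"
   using continuous_bounded_on[OF smooth_continuous_on bounded_D, of "\<lambda>x. \<Sum>i\<in>UNIV. partial i \<rho> x * q i x"]
    smooth_sum[of UNIV "\<lambda>i x. partial i \<rho> x * q i x"] smooth_mult[OF smooth_partial[OF smooth_\<rho>] qs] by blast
  obtain C2 where C2: "0 \<le> C2" "\<And>x. x \<in> D ==> norm (S x) \<le> C2"
   using continuous_bounded_on[OF smooth_continuous_on[OF z(2)] bounded_D] by blast
  have E0: "(LINT x|M. E x) = 0"
   unfolding E_def D_def
  proof (rule divergence_zero[OF smooth_\<rho> bounded_sublevel, where C = "C1 * C2"])
   show "X k differentiable at x" for k x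
    unfolding X_def using pd(1) smooth_differentiable[OF qs] by (intro differentiable_mult)
   show "continuous_on UNIV (partial k (X k))" for k by (rule pXc)
   fix x assume "\<rho> x < 0"
   then have x: "x \<in> D" "\<rho> x < 0" by (auto simp: D_def)
   \<comment> \<open>The lower barrier \<open>\<rho> x * S x\<close> takes the place of a boundary
     condition on \<open>z\<close>: it makes the test function, and with it the flux, of order
     \<open>\<rho>\<close>.\<close>
   have "p x \<le> max (- z x) 0" unfolding p_def by (rule reg_pos_bounds[OF \<delta>])
   also have "\<dots> \<le> \<bar>\<rho> x\<bar> * \<bar>S x\<bar>" using z(3)[OF x(1)] abs_le_D2[of "\<rho> x * S x"] by (auto simp: abs_mult[symmetric])
   also have "\<dots> \<le> \<bar>\<rho> x\<bar> * C2" using C2(2)[OF x(1)] by (intro mult_left_mono) auto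
   finally have p: "p x \<le> \<bar>\<rho> x\<bar> * C2" .
   have p0: "0 \<le> p x" unfolding p_def by (rule reg_pos_bounds[OF \<delta>])
   have "(\<Sum>k\<in>UNIV. partial k \<rho> x * X k x) = p x * (\<Sum>i\<in>UNIV. partial i \<rho> x * q i x)"
    by (simp add: X_def sum_distrib_left mult.left_commute)
   then have "\<bar>\<Sum>k\<in>UNIV. partial k \<rho> x * X k x\<bar> = p x * \<bar>\<Sum>i\<in>UNIV. partial i \<rho> x * q i x\<bar>"
    using p0 by (simp only: abs_mult abs_of_nonneg)
   also have "\<dots> \<le> (\<bar>\<rho> x\<bar> * C2) * C1"
    using p C1(2)[OF x(1)] C2(1) by (intro mult_mono) auto
   finally show "\<bar>\<Sum>k\<in>UNIV. partial k \<rho> x * X k x\<bar> \<le> C1 * C2 * \<bar>\<rho> x\<bar>" by (simp add: algebra_simps)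
  qed
  have pw: "(t x)\<^sup>2 \<le> t x * \<bar>r x\<bar> + \<delta> * t x - E x" if x: "x \<in> D" for x
  proof -
   let ?L = "\<Sum>i\<in>UNIV. \<Sum>j\<in>UNIV. b i j x * partial i (partial j z) x"
   let ?\<beta> = "\<chi> j. \<Sum>i\<in>UNIV. partial i (b i j) x"
   define g where "g = norm (grad z x)"
   have p0: "0 \<le> p x" "p x \<le> t x" "0 \<le> t x" unfolding p_def t_def using reg_pos_bounds[OF \<delta>] by auto
   have "(\<Sum>i\<in>UNIV. \<Sum>j\<in>UNIV. partial i (b i j) x * partial j z x) = ?\<beta> \<bullet> grad z x"
    by (subst sum.swap) (simp add: inner_vec_def grad_def sum_distrib_right)
   moreover have "E x = (\<Sum>i\<in>UNIV. - (reg_pos' \<delta> (- z x) * (partial i z x * q i x)) + (p x * (\<Sum>j\<in>UNIV. partial i (b i j) x * partial j z x)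
      + p x * (\<Sum>j\<in>UNIV. b i j x * partial i (partial j z) x)))"
    unfolding E_def pX pq by (intro sum.cong refl) (simp add: distrib_left mult.assoc)
   ultimately have Eeq: "E x = - (reg_pos' \<delta> (- z x) * (\<Sum>i\<in>UNIV. partial i z x * q i x)) + (p x * (?\<beta> \<bullet> grad z x) + p x * ?L)"
    by (simp only: sum.distrib sum_negf sum_distrib_left[symmetric])
   have e1: "\<nu> * g\<^sup>2 \<le> (\<Sum>i\<in>UNIV. partial i z x * q i x)"
    using ell[OF x, of "grad z x"] unfolding g_def q_def by (simp add: grad_def sum_distrib_left algebra_simps)
   have e2: "\<bar>?\<beta> \<bullet> grad z x\<bar> \<le> K * g"
    using Cauchy_Schwarz_ineq2[of ?\<beta> "grad z x"] mult_right_mono[OF K[OF x], of g] unfolding g_def by (simp add: order_trans)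
   \<comment> \<open>A quadratic polynomial in the gradient norm \<open>g\<close>; its discriminant
     condition is the inequality for which \<open>reg_pos\<close> was designed.\<close>
   have "0 \<le> (reg_pos' \<delta> (- z x) * \<nu>) * g\<^sup>2 - (p x * K) * g + K\<^sup>2 / (4 * \<nu>) * (t x * p x)"
   proof (rule quadratic_nonneg)
    show "0 \<le> reg_pos' \<delta> (- z x) * \<nu>" using reg_pos_bounds(3)[OF \<delta>] \<open>0 < \<nu>\<close> by simp
    show "0 \<le> K\<^sup>2 / (4 * \<nu>) * (t x * p x)" using p0 \<open>0 < \<nu>\<close> by simp
    have "(p x)\<^sup>2 * K\<^sup>2 \<le> (reg_pos' \<delta> (- z x) * (t x * p x)) * K\<^sup>2"
     unfolding p_def t_def by (intro mult_right_mono reg_pos_bounds(4)[OF \<delta>]) simp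
    then show "(p x * K)\<^sup>2 \<le> 4 * (reg_pos' \<delta> (- z x) * \<nu>) * (K\<^sup>2 / (4 * \<nu>) * (t x * p x))"
     using \<open>0 < \<nu>\<close> by (simp add: power_mult_distrib algebra_simps)
   qed
   moreover have "reg_pos' \<delta> (- z x) * (\<nu> * g\<^sup>2) \<le> reg_pos' \<delta> (- z x) * (\<Sum>i\<in>UNIV. partial i z x * q i x)"
    using e1 reg_pos_bounds(3)[OF \<delta>] by (intro mult_left_mono)
   moreover have "p x * (?\<beta> \<bullet> grad z x) \<le> p x * (K * g)" using e2 p0 by (intro mult_left_mono) auto
   ultimately have lower: "E x - K\<^sup>2 / (4 * \<nu>) * (t x * p x) \<le> p x * ?L"
    using Eeq by (simp add: algebra_simps)
   have "p x * - \<bar>r x\<bar> \<le> p x * (\<mu> * z x - ?L)" using ineq[OF x] p0 by (intro mult_left_mono)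
   moreover have "p x * z x = - (p x * t x)"
    using reg_pos_bounds(6)[OF \<delta>, of "- z x"] unfolding p_def t_def by simp
   then have "p x * (\<mu> * z x) = - \<mu> * (p x * t x)" by (simp add: algebra_simps)
   ultimately have "p x * ?L \<le> p x * \<bar>r x\<bar> - \<mu> * (t x * p x)" by (simp add: algebra_simps)
   then have "t x * p x \<le> p x * \<bar>r x\<bar> - E x"
    using lower unfolding \<mu> by (simp add: algebra_simps)
   moreover have "p x * \<bar>r x\<bar> \<le> t x * \<bar>r x\<bar>" using p0 by (intro mult_right_mono) auto
   moreover have "(t x)\<^sup>2 - \<delta> * t x \<le> t x * p x" unfolding t_def p_def by (rule reg_pos_bounds[OF \<delta>])
   ultimately show ?thesis by linarith
  qed
  have "(l2 M t)\<^sup>2 = (LINT x|M. (t x)\<^sup>2)" by (simp add: l2_square)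
  also have "\<dots> \<le> (LINT x|M. t x * \<bar>r x\<bar> + \<delta> * t x - E x)"
   by (rule integral_mono) (use sqintD(2)[OF ts] ti trI Ei pw in auto)
  also have "\<dots> = (LINT x|M. t x * \<bar>r x\<bar>) + \<delta> * (LINT x|M. t x)"
   using ti trI Ei E0 by simp
  finally show ?thesis .
 qed
 have "(l2 M t)\<^sup>2 \<le> (LINT x|M. t x * \<bar>r x\<bar>)"
 proof (rule field_le_epsilon)
  fix e :: real assume "0 < e"
  have I: "0 \<le> (LINT x|M. t x)" by (rule integral_nonneg_AE) (simp add: t_def)
  have "(l2 M t)\<^sup>2 \<le> (LINT x|M. t x * \<bar>r x\<bar>) + e / ((LINT x|M. t x) + 1) * (LINT x|M. t x)"
   using I \<open>0 < e\<close> by (intro step) simp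
  also have "e / ((LINT x|M. t x) + 1) * (LINT x|M. t x) \<le> e"
   using I \<open>0 < e\<close> by (simp add: divide_le_eq mult_left_mono)
  finally show "(l2 M t)\<^sup>2 \<le> (LINT x|M. t x * \<bar>r x\<bar>) + e" by simp
 qed
 also have "\<dots> \<le> l2 M t * l2 M r"
  using l2_Cauchy_Schwarz_norm[OF ts r] by (simp add: t_def)
 finally have "l2 M t \<le> l2 M r"
  by (cases "l2 M t = 0") (auto simp: power2_eq_square order_less_le)
 then show ?thesis by (simp add: t_def[abs_def])
qed

end

section \<open>Linear spans, polynomials and the Laplacian on the unit ball\<close>

inductive_set lspan :: "('a => real) set => ('a => real) set" for S :: "('a => real) set" where
 zero: "(\<lambda>x. 0) \<in> lspan S"
| step: "f \<in> S ==> h \<in> lspan S ==> (\<lambda>x. c * f x + h x) \<in> lspan S"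

lemma lspan_base: "f \<in> S ==> f \<in> lspan S"
 using lspan.step[OF _ lspan.zero, of f S 1] by simp

lemma lspan_add: "f \<in> lspan S ==> g \<in> lspan S ==> (\<lambda>x. f x + g x) \<in> lspan S"
proof (induction rule: lspan.induct)
 case (step f h c)
 then show ?case using lspan.step[of f S "\<lambda>x. h x + g x" c] by (simp add: add.assoc)
qed simp

lemma lspan_scale: "f \<in> lspan S ==> (\<lambda>x. c * f x) \<in> lspan S"
proof (induction rule: lspan.induct)
 case zero then show ?case by (simp add: lspan.zero)
next
 case (step f h d)
 then show ?case using lspan.step[of f S "\<lambda>x. c * h x" "c * d"] by (simp add: algebra_simps)
qed

lemma lspan_diff: "f \<in> lspan S ==> g \<in> lspan S ==> (\<lambda>x. f x - g x) \<in> lspan S"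
 using lspan_add[OF _ lspan_scale[of g S "-1"], of f] by simp

lemma lspan_sum: "(\<And>i. i \<in> I ==> f i \<in> lspan S) ==> (\<lambda>x. \<Sum>i\<in>I. f i x) \<in> lspan S"
 by (induction I rule: infinite_finite_induct) (auto intro: lspan_add lspan.zero)

lemma lspan_mono: "f \<in> lspan S ==> S \<subseteq> S' ==> f \<in> lspan S'"
 by (induction rule: lspan.induct) (auto intro: lspan.intros)

lemma lspan_sqint:
 assumes "f \<in> lspan S" "\<And>f. f \<in> S ==> sqint M f"
 shows "sqint M f"
 using assms(1)
proof (induction rule: lspan.induct)
 case (step f h c)
 then show ?case using sqint_add[OF sqint_scaleR[OF assms(2)], of f h c] by simp
qed simp

lemma lspan_orthogonal:
 assumes "p \<in> lspan S" "\<And>f. f \<in> S ==> sqint M f" "sqint M g"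
  "\<And>f. f \<in> S ==> (LINT x|M. g x * f x) = 0"
 shows "(LINT x|M. g x * p x) = 0"
 using assms(1)
proof (induction rule: lspan.induct)
 case (step f h c)
 have "integrable M (\<lambda>x. g x * f x)" "integrable M (\<lambda>x. g x * h x)"
  using step assms lspan_sqint[OF step(2) assms(2)] by (auto intro!: sqint_integrable_mult)
 then have "(LINT x|M. g x * (c * f x + h x)) = c * (LINT x|M. g x * f x) + (LINT x|M. g x * h x)"
  by (simp add: distrib_left mult.left_commute)
 then show ?case using step assms(4) by simp
qed simp

text \<open>Gram-Schmidt by induction on the generators: the new generator is first made orthogonal
  to the old ones, and the component of \<open>g\<close> along the result is then removed.\<close>

lemma lspan_projection:
 assumes "finite S" "\<And>f. f \<in> S ==> sqint M f" "sqint M g"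
 shows "\<exists>p\<in>lspan S. \<forall>f\<in>S. (LINT x|M. (g x - p x) * f x) = 0"
 using assms
proof (induction S arbitrary: g rule: finite_induct)
 case empty then show ?case using lspan.zero by blast
next
 case (insert a S)
 have S: "\<And>f. f \<in> S ==> sqint M f" and a: "sqint M a" using insert.prems by auto
 obtain p where p: "p \<in> lspan S" "\<And>f. f \<in> S ==> (LINT x|M. (g x - p x) * f x) = 0"
  using insert.IH[OF S insert.prems(2)] by blast
 obtain s where s: "s \<in> lspan S" "\<And>f. f \<in> S ==> (LINT x|M. (a x - s x) * f x) = 0"
  using insert.IH[OF S a] by blast
 define g' where "g' x = g x - p x" for x
 define a' where "a' x = a x - s x" for x
 have g': "sqint M g'" and a': "sqint M a'" and sp: "sqint M p" and ss: "sqint M s"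
  unfolding g'_def a'_def using lspan_sqint[OF p(1) S] lspan_sqint[OF s(1) S] insert.prems a
  by (auto intro!: sqint_diff)
 \<comment> \<open>Only a seminorm is available. If \<open>a'\<close> has norm zero it is orthogonal
   to everything by Cauchy-Schwarz, and the coefficient 0 works.\<close>
 define c where "c = (if l2 M a' = 0 then 0 else (LINT x|M. g' x * a' x) / (l2 M a')\<^sup>2)"
 have up: "f \<in> lspan (insert a S)" if "f \<in> lspan S" for f using lspan_mono[OF that] by blast
 have a'S: "a' \<in> lspan (insert a S)"
  unfolding a'_def[abs_def] by (intro lspan_diff lspan_base up s) simp
 have res: "g x - (p x + c * a' x) = g' x - c * a' x" for x by (simp add: g'_def)
 have I: "integrable M (\<lambda>x. g' x * f x)" "integrable M (\<lambda>x. a' x * f x)" if "sqint M f" for f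
  using g' a' that by (auto intro!: sqint_integrable_mult)
 have ex: "(LINT x|M. (g' x - c * a' x) * f x) = (LINT x|M. g' x * f x) - c * (LINT x|M. a' x * f x)" if "sqint M f" for f
  using I[OF that] by (simp add: left_diff_distrib mult.assoc)
 have oS: "(LINT x|M. (g' x - c * a' x) * f x) = 0" if "f \<in> S" for f
  using ex[OF S[OF that]] p(2)[OF that] s(2)[OF that] by (simp add: g'_def a'_def)
 have oa': "(LINT x|M. (g' x - c * a' x) * a' x) = 0"
 proof (cases "l2 M a' = 0")
  case True
  then show ?thesis using l2_Cauchy_Schwarz_real[OF g' a'] by (simp add: c_def)
 next
  case False
  have "(l2 M a')\<^sup>2 = (LINT x|M. a' x * a' x)" unfolding l2_square by (simp add: power2_eq_square)
  moreover from this have "(LINT x|M. a' x * a' x) \<noteq> 0" using False by (metis power_eq_0_iff zero_neq_numeral)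
  ultimately show ?thesis using False unfolding ex[OF a'] by (simp add: c_def)
 qed
 have r: "sqint M (\<lambda>x. g' x - c * a' x)" using sqint_diff[OF g' sqint_scaleR[OF a', of c]] by simp
 have os: "(LINT x|M. (g' x - c * a' x) * s x) = 0"
  by (rule lspan_orthogonal[OF s(1) S r oS])
 have oa: "(LINT x|M. (g' x - c * a' x) * a x) = 0"
 proof -
  have "(LINT x|M. (g' x - c * a' x) * a x) = (LINT x|M. (g' x - c * a' x) * a' x + (g' x - c * a' x) * s x)"
   by (rule Bochner_Integration.integral_cong) (auto simp: a'_def algebra_simps)
  also have "\<dots> = 0" using sqint_integrable_mult[OF r a'] sqint_integrable_mult[OF r ss] oa' os by simp
  finally show ?thesis .
 qed
 show ?case
  by (rule bexI[of _ "\<lambda>x. p x + c * a' x"])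
    (use oS oa in \<open>auto simp: res intro!: lspan_add lspan_scale a'S up[OF p(1)]\<close>)
qed

primrec monomials :: "nat => (real^'d => real) set" where
 "monomials 0 = {\<lambda>x. 1}"
| "monomials (Suc n) = monomials n \<union> (\<Union>i. (\<lambda>f x. x $ i * f x) ` monomials n)"

abbreviation polys :: "nat => (real^'d => real) set" where
 "polys n \<equiv> lspan (monomials n)"

lemma finite_monomials: "finite (monomials n)"
 by (induction n) auto

lemma polys_Suc: "f \<in> polys n ==> f \<in> polys (Suc n)"
 by (erule lspan_mono) simp

lemma polys_mono: "f \<in> polys m ==> m \<le> n ==> f \<in> polys n"
proof (induction n)
 case (Suc n)
 then show ?case by (metis le_Suc_eq polys_Suc)
qed simp

lemma polys_coord: "f \<in> polys n ==> (\<lambda>x. x $ i * f x) \<in> polys (Suc n)"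
proof (induction rule: lspan.induct)
 case (step f h c)
 have "(\<lambda>x. x $ i * f x) \<in> monomials (Suc n)" using step by auto
 from lspan.step[OF this step.IH, of c] show ?case by (simp add: algebra_simps)
qed (auto intro: lspan.zero)

lemma polys_const: "(\<lambda>x. c) \<in> polys n"
proof -
 have "(\<lambda>x. 1) \<in> polys 0" by (rule lspan_base) simp
 from lspan_scale[OF this, of c] show ?thesis by (intro polys_mono[of _ 0 n]) auto
qed

lemma polys_mult: "f \<in> polys n ==> g \<in> polys m ==> (\<lambda>x. f x * g x) \<in> polys (n + m)"
proof -
 have mono: "(\<lambda>x. f x * g x) \<in> polys (n + m)" if "f \<in> monomials n" "g \<in> polys m" for f and g :: "real^'a => real"
  using that(1)
 proof (induction n arbitrary: f)
  case 0 then show ?case using that by simp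
 next
  case (Suc n)
  show ?case
  proof (cases "f \<in> monomials n")
   case True then show ?thesis using Suc.IH polys_Suc by auto
  next
   case False
   then obtain i h where "h \<in> monomials n" "f = (\<lambda>x. x $ i * h x)" using Suc.prems by auto
   then show ?thesis using polys_coord[OF Suc.IH[of h], of i] by (simp add: mult.assoc)
  qed
 qed
 assume "f \<in> polys n" and g: "g \<in> polys m"
 then show ?thesis
 proof (induction rule: lspan.induct)
  case (step f h c)
  have "(\<lambda>x. c * (f x * g x) + h x * g x) \<in> polys (n + m)"
   using step g mono by (intro lspan_add lspan_scale) auto
  then show ?case by (simp add: algebra_simps)
 qed (auto intro: lspan.zero)
qed

text \<open>Connects \<open>polys\<close> with the polynomial functions of the Stone-Weierstrass
  theorem.\<close>

lemma real_polynomial_function_polys: "real_polynomial_function p ==> \<exists>n. p \<in> polys n"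
proof (induction rule: real_polynomial_function.induct)
 case (linear f)
 have "f x = (\<Sum>i\<in>UNIV. x $ i * f (axis i 1))" for x
 proof -
  have "f x = f (\<Sum>i\<in>UNIV. x $ i *\<^sub>R axis i 1)" by (simp add: vector_matrix_mul_rid basis_expansion scalar_mult_eq_scaleR[symmetric])
  also have "\<dots> = (\<Sum>i\<in>UNIV. x $ i * f (axis i 1))"
   using linear by (simp add: bounded_linear.linear linear_sum linear_cmul)
  finally show ?thesis .
 qed
 then have e: "f = (\<lambda>x. \<Sum>i\<in>UNIV. x $ i * f (axis i 1))" by (rule ext)
 have "(\<lambda>x. \<Sum>i\<in>UNIV. x $ i * f (axis i 1)) \<in> polys (Suc 0)"
  by (intro lspan_sum polys_coord polys_const)
 then have "f \<in> polys (Suc 0)" by (subst e)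
 then show ?case by blast
next
 case (const c) then show ?case using polys_const by blast
next
 case (add f g)
 then obtain n m where "f \<in> polys n" "g \<in> polys m" by auto
 then have "f \<in> polys (max n m)" "g \<in> polys (max n m)"
  using polys_mono[of f n "max n m"] polys_mono[of g m "max n m"] by simp_all
 then show ?case using lspan_add by blast
next
 case (mult f g)
 then show ?case using polys_mult by blast
qed

lemma monomials_smooth_compose:
 "f \<in> monomials n ==> (\<And>k. smooth (\<lambda>x. \<Phi> x $ k)) ==> smooth (\<lambda>x. f (\<Phi> x))"
 by (induction n arbitrary: f) (auto intro!: smooth_intros)

lemma polys_smooth_compose:
 assumes "f \<in> polys n" "\<And>k. smooth (\<lambda>x. \<Phi> x $ k)"
 shows "smooth (\<lambda>x. f (\<Phi> x))"
 using assms(1)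
proof (induction rule: lspan.induct)
 case (step f h c)
 show ?case
  by (intro smooth_add smooth_mult smooth_const step.IH monomials_smooth_compose[OF step(1) assms(2)])
qed simp

lemma polys_smooth: "f \<in> polys n ==> smooth f"
 using polys_smooth_compose[of f n "\<lambda>x. x"] by simp

lemma monomials_smooth: "f \<in> monomials n ==> smooth f"
 using polys_smooth lspan_base by blast

text \<open>Each derivative lowers the degree by one, so one multiplication by a coordinate per
  derivative stays within degree \<open>n\<close>. Together with the second-order analogue below,
  this is why \<open>f \<mapsto> lap (\<lambda>x. ball_fn x * f x)\<close> does not raise the
  degree.\<close>

lemma monomials_partial:
 "f \<in> monomials n ==> partial i f \<in> polys n \<and> (\<lambda>x. x $ j * partial i f x) \<in> polys n"
proof (induction n arbitrary: f i j)
 case 0 then show ?case by (auto intro: lspan.zero)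
next
 case (Suc n)
 show ?case
 proof (cases "f \<in> monomials n")
  case True then show ?thesis using Suc.IH polys_Suc by blast
 next
  case False
  then obtain m h where h: "h \<in> monomials n" "f = (\<lambda>x. x $ m * h x)" using Suc.prems by auto
  have p: "partial i f = (\<lambda>x. (if i = m then 1 else 0) * h x + x $ m * partial i h x)"
   unfolding h using monomials_smooth[OF h(1)] by (simp add: partial_smooth_mult)
  have hn: "h \<in> polys n" using h lspan_base by blast
  have "(\<lambda>x. (if i = m then 1 else 0) * (x $ j * h x) + x $ j * (x $ m * partial i h x)) \<in> polys (Suc n)"
   by (intro lspan_add lspan_scale polys_coord hn) (use Suc.IH[OF h(1)] in blast)
  moreover have "(\<lambda>x. (if i = m then 1 else 0) * h x + x $ m * partial i h x) \<in> polys (Suc n)"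
   by (intro lspan_add lspan_scale polys_Suc[OF hn] polys_Suc) (use Suc.IH[OF h(1)] in blast)
  ultimately show ?thesis unfolding p by (simp add: algebra_simps)
 qed
qed

lemma monomials_partial2:
 "f \<in> monomials n ==> partial l (partial i f) \<in> polys n \<and> (\<lambda>x. x $ j * (x $ k * partial l (partial i f) x)) \<in> polys n"
proof (induction n arbitrary: f i j k l)
 case 0 then show ?case by (auto intro: lspan.zero)
next
 case (Suc n)
 show ?case
 proof (cases "f \<in> monomials n")
  case True then show ?thesis using Suc.IH polys_Suc by blast
 next
  case False
  then obtain m h where h: "h \<in> monomials n" "f = (\<lambda>x. x $ m * h x)" using Suc.prems by auto
  have sh: "smooth h" using monomials_smooth[OF h(1)] .
  have p: "partial l (partial i f) = (\<lambda>x. (if i = m then 1 else 0) * partial l h x + ((if l = m then 1 else 0) * partial i h x + x $ m * partial l (partial i h) x))"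
   unfolding h using sh by (simp add: partial_simps smooth_mult smooth_partial)
  note A = monomials_partial[OF h(1)] and B = Suc.IH[OF h(1)]
  have "(\<lambda>x. (if i = m then 1 else 0) * partial l h x + ((if l = m then 1 else 0) * partial i h x + x $ m * partial l (partial i h) x)) \<in> polys (Suc n)"
   by (intro lspan_add lspan_scale polys_coord) (use A B polys_Suc in blast)+
  moreover have "(\<lambda>x. (if i = m then 1 else 0) * (x $ j * (x $ k * partial l h x)) + ((if l = m then 1 else 0) * (x $ j * (x $ k * partial i h x))
     + x $ m * (x $ j * (x $ k * partial l (partial i h) x)))) \<in> polys (Suc n)"
   by (intro lspan_add lspan_scale polys_coord) (use A B in blast)+
  ultimately show ?thesis unfolding p by (simp add: algebra_simps)
 qed
qed

definition ball_fn :: "real^'d => real" where "ball_fn x = x \<bullet> x - 1"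

lemma smooth_ball_fn: "smooth ball_fn"
 unfolding ball_fn_def[abs_def] inner_vec_def by (intro smooth_intros) (auto intro!: smooth_intros)

lemma ball_fn_sublevel: "{x. ball_fn x < 0} = ball 0 1"
proof (rule set_eqI)
 fix x :: "real^'d"
 have "x \<in> {x. ball_fn x < 0} \<longleftrightarrow> (norm x)\<^sup>2 < 1"
  unfolding power2_norm_eq_inner ball_fn_def by auto
 also have "\<dots> \<longleftrightarrow> x \<in> ball 0 1"
  unfolding mem_ball_0 by (simp add: abs_square_less_1)
 finally show "x \<in> {x. ball_fn x < 0} \<longleftrightarrow> x \<in> ball 0 1" .
qed

lemma partial_ball_fn: "partial i ball_fn = (\<lambda>x::real^'d. 2 * x $ i)"
proof -
 have e: "ball_fn = (\<lambda>x::real^'d. (\<Sum>j\<in>UNIV. x $ j * x $ j) - 1)" by (auto simp: ball_fn_def inner_vec_def)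
 have "(\<Sum>j\<in>UNIV. (if i = j then 1 else 0) * x $ j + x $ j * (if i = j then 1 else 0)) = 2 * x $ i" for x :: "real^'d"
  by (simp add: if_distrib[of "\<lambda>c. c * _"] if_distrib[of "\<lambda>c. _ * c"] sum.distrib cong: if_cong)
 then show ?thesis unfolding e
  by (simp only: partial_simps smooth_mult smooth_sum smooth_coord smooth_const partial_coord partial_const diff_0_right)
qed

lemma partial2_ball_fn: "partial j (partial i ball_fn) = (\<lambda>x. if i = j then 2 else 0)"
 unfolding partial_ball_fn using partial_smooth_cmult[OF smooth_coord, of j 2 i] by auto

interpretation unit_ball: convex_sublevel "ball_fn :: real^'d => real"
proof
 show "smooth ball_fn" by (rule smooth_ball_fn)
 show "bounded {x. ball_fn x < 0}" by (simp add: ball_fn_sublevel)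
 fix x \<xi> :: "real^'d"
 have "(\<Sum>i\<in>UNIV. \<Sum>j\<in>UNIV. partial i (partial j ball_fn) x * \<xi> $ i * \<xi> $ j) = (\<Sum>i\<in>UNIV. 2 * (\<xi> $ i)\<^sup>2)"
  by (intro sum.cong refl) (simp add: partial2_ball_fn if_distrib[of "\<lambda>c. c * _"] power2_eq_square cong: if_cong)
 also have "\<dots> \<ge> 0" by (intro sum_nonneg) auto
 finally show "0 \<le> (\<Sum>i\<in>UNIV. \<Sum>j\<in>UNIV. partial i (partial j ball_fn) x * \<xi> $ i * \<xi> $ j)" .
qed

lemma unit_ball_D: "unit_ball.D = ball 0 1"
 by (simp add: unit_ball.D_def ball_fn_sublevel)

lemma lap_ball_fn_mult:
 fixes f :: "real^'d => real"
 assumes "smooth f"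
 shows "lap (\<lambda>x. ball_fn x * f x) = (\<lambda>x. (\<Sum>k\<in>UNIV. \<Sum>j\<in>UNIV. x $ j * (x $ j * partial k (partial k f) x)) - (\<Sum>k\<in>UNIV. partial k (partial k f) x)
   + (\<Sum>k\<in>UNIV. 4 * (x $ k * partial k f x)) + 2 * CARD('d) * f x)"
proof
 fix x
 have "partial k (partial k (\<lambda>x. ball_fn x * f x)) x = ball_fn x * partial k (partial k f) x + 4 * (x $ k * partial k f x) + 2 * f x" for k
  using assms by (simp add: smooth_ball_fn partial_simps smooth_mult smooth_partial partial2_ball_fn) (simp add: partial_ball_fn)
 moreover have "ball_fn x * y = (\<Sum>j\<in>UNIV. x $ j * (x $ j * y)) - y" for y
  by (simp add: ball_fn_def inner_vec_def left_diff_distrib sum_distrib_right mult.assoc)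
 ultimately show "lap (\<lambda>x. ball_fn x * f x) x = (\<Sum>k\<in>UNIV. \<Sum>j\<in>UNIV. x $ j * (x $ j * partial k (partial k f) x)) - (\<Sum>k\<in>UNIV. partial k (partial k f) x)
   + (\<Sum>k\<in>UNIV. 4 * (x $ k * partial k f x)) + 2 * CARD('d) * f x"
  by (simp add: lap_def sum.distrib sum_subtractf)
qed

lemma lap_ball_fn_comb:
 assumes "smooth f" "smooth h"
 shows "lap (\<lambda>x. ball_fn x * (c * f x + h x))
  = (\<lambda>x. c * lap (\<lambda>x. ball_fn x * f x) x + lap (\<lambda>x. ball_fn x * h x) x)"
proof -
 have e: "(\<lambda>x. ball_fn x * (c * f x + h x)) = (\<lambda>x. c * (ball_fn x * f x) + ball_fn x * h x)"
  by (auto simp: algebra_simps)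
 show ?thesis unfolding e lap_def[abs_def] using assms
  by (simp add: smooth_ball_fn partial_smooth_add partial_smooth_cmult smooth_mult smooth_partial sum.distrib sum_distrib_left)
qed

lemma lap_ball_fn_polys:
 assumes "f \<in> polys n" shows "lap (\<lambda>x. ball_fn x * f x) \<in> polys n"
 using assms
proof (induction rule: lspan.induct)
 case zero
 then show ?case by (simp add: lap_def[abs_def] lspan.zero)
next
 case (step f h c)
 have s: "smooth f" "smooth h" using step monomials_smooth polys_smooth by auto
 have "lap (\<lambda>x. ball_fn x * f x) \<in> polys n"
  unfolding lap_ball_fn_mult[OF s(1)]
  by (intro lspan_add lspan_diff lspan_scale lspan_sum)
    (use monomials_partial[OF step(1)] monomials_partial2[OF step(1)] lspan_base[OF step(1)] in blast)+
 moreover note lap_ball_fn_comb[OF s]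
 ultimately show ?case using step.IH by (simp add: lspan_add lspan_scale)
qed

text \<open>\<open>f \<mapsto> \<Delta>((|x|\<^sup>2 - 1) f)\<close> preserves polynomials of degree at most \<open>n\<close>; the part of such a
 polynomial that is orthogonal to the range vanishes by coercivity.\<close>

lemma ball_range_polys:
 fixes p :: "real^'d => real"
 assumes "p \<in> polys n"
 obtains f where "f \<in> polys n" "l2 (lebesgue_on (ball 0 1)) (\<lambda>x. lap (\<lambda>x. ball_fn x * f x) x - p x) = 0"
proof -
 let ?T = "\<lambda>f. lap (\<lambda>x. ball_fn x * f x) :: real^'d => real"
 let ?M = "lebesgue_on (ball 0 1) :: (real^'d) measure"
 have sq: "sqint ?M f" if "smooth f" for f :: "real^'d => real"
  using unit_ball.sqint_smooth[OF that] by (simp add: unit_ball_D)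
 have Tf: "?T f \<in> polys n" if "f \<in> polys n" for f using lap_ball_fn_polys[OF that] .
 have "\<exists>q\<in>lspan (?T ` monomials n). \<forall>f\<in>?T ` monomials n. (LINT x|?M. (p x - q x) * f x) = 0"
  by (rule lspan_projection) (use Tf lspan_base polys_smooth sq assms finite_monomials in blast)+
 then obtain q where q: "q \<in> lspan (?T ` monomials n)"
   "\<And>f. f \<in> monomials n ==> (LINT x|?M. (p x - q x) * ?T f x) = 0" by blast
 have "\<exists>f\<in>polys n. q = ?T f" using q(1)
 proof (induction rule: lspan.induct)
  case zero
  have "?T (\<lambda>x. 0) = (\<lambda>x. 0)" by (simp add: lap_def[abs_def])
  then show ?case by (intro bexI[of _ "\<lambda>x. 0"] lspan.zero) simp
 next
  case (step g h c)
  then obtain f1 f2 where f: "f1 \<in> monomials n" "g = ?T f1" "f2 \<in> polys n" "h = ?T f2" by blast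
  have s: "smooth f1" "smooth f2" using f monomials_smooth polys_smooth by auto
  have "?T (\<lambda>x. c * f1 x + f2 x) = (\<lambda>x. c * ?T f1 x + ?T f2 x)"
   by (rule lap_ball_fn_comb[OF s])
  moreover have "(\<lambda>x. c * f1 x + f2 x) \<in> polys n" using f lspan.step by blast
  ultimately show ?case unfolding f by (intro bexI[of _ "\<lambda>x. c * f1 x + f2 x"]) simp_all
 qed
 then obtain f where f: "f \<in> polys n" "q = ?T f" by blast
 define m where "m x = p x - q x" for x
 have mP: "m \<in> polys n" unfolding m_def[abs_def] using assms f Tf by (intro lspan_diff) auto
 have ms: "smooth m" using polys_smooth[OF mP] .
 have orth: "(LINT x|?M. m x * ?T h x) = 0" if "h \<in> polys n" for h
  using that
 proof (induction rule: lspan.induct)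
  case zero
  have "?T (\<lambda>x. 0) = (\<lambda>x. 0)" by (simp add: lap_def[abs_def])
  then show ?case by simp
 next
  case (step f1 f2 c)
  have s: "smooth f1" "smooth f2" using step monomials_smooth polys_smooth by auto
  have "?T (\<lambda>x. c * f1 x + f2 x) = (\<lambda>x. c * ?T f1 x + ?T f2 x)"
   by (rule lap_ball_fn_comb[OF s])
  then have "(LINT x|?M. m x * ?T (\<lambda>x. c * f1 x + f2 x) x) = (LINT x|?M. c * (m x * ?T f1 x) + m x * ?T f2 x)"
   by (simp add: algebra_simps)
  also have "\<dots> = c * (LINT x|?M. m x * ?T f1 x) + (LINT x|?M. m x * ?T f2 x)"
  proof -
   have i: "integrable ?M (\<lambda>x. m x * ?T f1 x)" "integrable ?M (\<lambda>x. m x * ?T f2 x)"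
    using s by (auto intro!: sqint_integrable_mult sq smooth_intros ms smooth_ball_fn)
   then show ?thesis by simp
  qed
  also have "\<dots> = 0" using q(2)[OF step(1)] step.IH by (simp add: m_def)
  finally show ?case .
 qed
 \<comment> \<open>The Laplacian of \<open>ball_fn\<close> is the constant
   \<open>2 * CARD('d)\<close>. Since \<open>m\<close> is orthogonal to \<open>?T m\<close>,
   coercivity forces its norm to be zero.\<close>
 have "CARD('d) * (l2 ?M m)\<^sup>2 \<le> (LINT x|?M. m x * ?T m x)"
  using unit_ball.lap_coercive[OF ms, of "CARD('d)"] 
  by (simp add: unit_ball_D lap_def partial2_ball_fn)
 then have "l2 ?M m = 0"
  using orth[OF mP] zero_less_card_finite[where 'a='d] by (simp add: mult_le_0_iff)
 then show ?thesis
  using that[OF f(1)] l2_minus_commute[of ?M p q] unfolding f(2)[symmetric] m_def[abs_def] by simp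
qed

text \<open>Polynomials are uniformly dense by the Stone-Weierstrass theorem, and each of them is
  attained up to norm zero. The uniform error is divided by the root of the measure of the ball,
  with 1 added to keep the divisor positive.\<close>

lemma ball_range_dense:
 fixes g :: "real^'d => real"
 assumes "continuous_on (cball 0 1) g" "0 < e"
 obtains f n where "f \<in> polys n" "l2 (lebesgue_on (ball 0 1)) (\<lambda>x. lap (\<lambda>x. ball_fn x * f x) x - g x) < e"
proof -
 let ?M = "lebesgue_on (ball 0 1) :: (real^'d) measure"
 interpret fm: finite_measure ?M using unit_ball.finite_M by (simp add: unit_ball_D)
 define \<mu> where "\<mu> = sqrt (measure ?M (space ?M)) + 1"
 have \<mu>: "\<mu> > 0" by (simp add: \<mu>_def add_nonneg_pos)
 obtain p where p: "real_polynomial_function p" "\<And>x. x \<in> cball 0 1 ==> \<bar>g x - p x\<bar> < e / \<mu>"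
  using Stone_Weierstrass_real_polynomial_function[OF compact_cball assms(1), of "e / \<mu>"] assms(2) \<mu> by auto
 obtain n where n: "p \<in> polys n" using real_polynomial_function_polys[OF p(1)] by blast
 obtain f where f: "f \<in> polys n" "l2 ?M (\<lambda>x. lap (\<lambda>x. ball_fn x * f x) x - p x) = 0"
  using ball_range_polys[OF n] by blast
 have sm: "smooth f" "smooth p" using f n polys_smooth by auto
 have "smooth (\<lambda>x. lap (\<lambda>x. ball_fn x * f x) x - p x)" by (intro smooth_intros smooth_ball_fn sm)
 from unit_ball.sqint_smooth[OF this]
 have s: "sqint ?M (\<lambda>x. lap (\<lambda>x. ball_fn x * f x) x - p x)" by (simp add: unit_ball_D)
 have gm: "g \<in> borel_measurable ?M"
  using assms(1) by (intro continuous_imp_measurable_on_sets_lebesgue continuous_on_subset[of _ g "ball 0 1"]) auto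
 have pg: "(\<lambda>x. p x - g x) \<in> borel_measurable ?M"
  by (rule borel_measurable_diff[OF continuous_borel_measurable_lebesgue_on[OF smooth_continuous_on[OF sm(2)]] gm])
 have bd: "AE x in ?M. norm (p x - g x) \<le> norm (e / \<mu>)"
  using p(2) assms(2) \<mu> by (intro AE_I2) (fastforce simp: abs_minus_commute less_imp_le)
 have cs: "sqint ?M (\<lambda>x. e / \<mu>)" by (rule sqint_bounded[of _ _ "e/\<mu>"]) (use assms \<mu> fm.finite_measure_axioms in auto)
 have spg: "sqint ?M (\<lambda>x. p x - g x)" using sqint_mono[OF cs pg bd] .
 have "l2 ?M (\<lambda>x. p x - g x) \<le> l2 ?M (\<lambda>x. e / \<mu>)" by (rule l2_mono[OF cs pg bd])
 also have "\<dots> = e / \<mu> * sqrt (measure ?M (space ?M))"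
  using assms(2) \<mu> by (simp add: l2_def real_sqrt_mult power_divide real_sqrt_divide)
 also have "\<dots> < e / \<mu> * \<mu>" using assms(2) \<mu> by (intro mult_strict_left_mono) (auto simp: \<mu>_def)
 also have "\<dots> = e" using \<mu> by simp
 finally have "l2 ?M (\<lambda>x. p x - g x) < e" .
 then have "l2 ?M (\<lambda>x. lap (\<lambda>x. ball_fn x * f x) x - g x) < e"
  using l2_triangle[OF s spg] f(2) by simp
 then show ?thesis using that f(1) by blast
qed

section \<open>The chain rule and a smooth convex penalty\<close>

lemma smooth_vec_differentiable:
 fixes \<Phi> :: "real^'d => real^'d"
 assumes "\<And>k. smooth (\<lambda>x. \<Phi> x $ k)"
 shows "(\<Phi> has_derivative (\<lambda>h. \<chi> k. frechet_derivative (\<lambda>x. \<Phi> x $ k) (at x) h)) (at x)"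
proof -
 have "((\<lambda>y. \<Phi> y \<bullet> b) has_derivative (\<lambda>h. (\<chi> k. frechet_derivative (\<lambda>x. \<Phi> x $ k) (at x) h) \<bullet> b)) (at x)"
  if b: "b \<in> Basis" for b
 proof -
  obtain k where "b = axis k 1" using b by (auto simp: Basis_vec_def)
  then show ?thesis
   using has_derivative_frechet[OF smooth_differentiable[OF assms[of k]], of x] by (simp add: inner_axis)
 qed
 then show ?thesis by (subst has_derivative_componentwise_within) blast
qed

lemma partial_compose:
 fixes \<Phi> :: "real^'d => real^'d"
 assumes "smooth f" "\<And>k. smooth (\<lambda>x. \<Phi> x $ k)"
 shows "partial i (\<lambda>x. f (\<Phi> x)) x = (\<Sum>k\<in>UNIV. partial k f (\<Phi> x) * partial i (\<lambda>x. \<Phi> x $ k) x)"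
proof -
 let ?F = "frechet_derivative f (at (\<Phi> x))"
 have lin: "linear ?F" by (simp add: linear_frechet_derivative smooth_differentiable assms)
 have e: "?F v = (\<Sum>k\<in>UNIV. v $ k * ?F (axis k 1))" for v
 proof -
  have "v = (\<Sum>k\<in>UNIV. v $ k *\<^sub>R axis k 1)" by (simp add: basis_expansion scalar_mult_eq_scaleR[symmetric])
  then have "?F v = ?F (\<Sum>k\<in>UNIV. v $ k *\<^sub>R axis k 1)" by simp
  also have "\<dots> = (\<Sum>k\<in>UNIV. v $ k * ?F (axis k 1))" by (simp add: linear_sum[OF lin] linear_cmul[OF lin])
  finally show ?thesis .
 qed
 have "((\<lambda>x. f (\<Phi> x)) has_derivative (\<lambda>h. ?F (\<chi> k. frechet_derivative (\<lambda>x. \<Phi> x $ k) (at x) h))) (at x)"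
  by (rule has_derivative_compose[OF smooth_vec_differentiable[OF assms(2)] has_derivative_frechet[OF smooth_differentiable[OF assms(1)]]])
 from partial_eqI[OF this, of i] show ?thesis
  by (subst (asm) e) (simp add: partial_def mult.commute)
qed

text \<open>A smooth convex substitute for the positive part: it vanishes for
  \<open>t \<le> 0\<close>, and its second derivative is \<open>flat 3\<close>.\<close>

definition conv_fn :: "real => real" where "conv_fn t = t * flat 0 t"

lemma conv_fn_has_derivative: "(conv_fn has_real_derivative flat 0 t + flat 1 t) (at t)"
proof -
 have "(conv_fn has_real_derivative 1 * flat 0 t + (flat 2 t) * t) (at t)"
  unfolding conv_fn_def[abs_def] using DERIV_mult[OF DERIV_ident flat_has_derivative[of 0 t]]
  by (simp add: numeral_2_eq_2 mult.commute)
 moreover have "flat 2 t * t = flat 1 t" by (simp add: flat_def power2_eq_square)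
 ultimately show ?thesis by simp
qed

lemma conv_fn_has_derivative2: "((\<lambda>t. flat 0 t + flat 1 t) has_real_derivative flat 3 t) (at t)"
 using DERIV_add[OF flat_has_derivative[of 0 t] flat_has_derivative[of 1 t]]
 by (simp add: numeral_2_eq_2 numeral_3_eq_3)

lemma conv_fn_nonneg: "0 \<le> conv_fn t"
 by (simp add: conv_fn_def flat_def)

lemma conv_fn_eq_0: "t \<le> 0 ==> conv_fn t = 0"
 by (simp add: conv_fn_def flat_def)

lemma conv_fn_pos: "0 < t ==> 0 < conv_fn t"
 by (simp add: conv_fn_def flat_def)

lemma conv_fn_mono: "s \<le> t ==> conv_fn s \<le> conv_fn t"
 by (rule DERIV_nonneg_imp_nondecreasing)
   (auto intro!: exI conjI conv_fn_has_derivative add_nonneg_nonneg flat_nonneg)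

lemma smooth_conv_fn [smooth_intros]: "smooth g ==> smooth (\<lambda>x. conv_fn (g x))"
 unfolding conv_fn_def by (intro smooth_intros)

section \<open>Deformation of a domain from a ball\<close>

text \<open>As \<open>s\<close> runs from 0 to 1, the sets where \<open>Q s x < 1\<close> lead from
  the ball of radius \<open>1 / sqrt c\<close> to the target domain, \<open>P\<close> being a
  penalty for leaving the half-spaces \<open>l \<bullet> x \<le> 1\<close>. The condition on
  \<open>\<eta>\<close> makes \<open>P\<close> vanish near the origin, so that
  \<open>P x / |x|^2\<close> extends smoothly there.\<close>

locale deformation =
 fixes c \<kappa> \<eta> :: real and \<Lambda> :: "(real^'d) set"
 assumes c: "0 < c" and \<kappa>: "0 \<le> \<kappa>" and \<eta>: "0 < \<eta>" and fin: "finite \<Lambda>"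
  and \<Lambda>: "\<And>l. l \<in> \<Lambda> ==> norm l * \<eta> \<le> 1"
begin

definition P :: "real^'d => real" where
 "P x = \<kappa> * (\<Sum>l\<in>\<Lambda>. conv_fn (l \<bullet> x - 1))"

definition Q :: "real => real^'d => real" where
 "Q s x = c * (x \<bullet> x) + s * P x"

text \<open>This is \<open>P x / |x|^2\<close>. The \<open>flat\<close> term makes the denominator
  positive at the origin and vanishes outside the ball of radius \<open>\<eta>\<close>; inside that
  ball the numerator is zero.\<close>

definition T :: "real^'d => real" where
 "T x = P x * (x \<bullet> x + flat 0 (\<eta>\<^sup>2 - x \<bullet> x)) powr (-1)"

text \<open>The radial factor for which \<open>\<Phi> s x \<bullet> \<Phi> s x = Q s x\<close>, so
  that the domain at parameter \<open>s\<close> is mapped onto the unit ball.\<close>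

definition \<sigma> :: "real => real^'d => real" where
 "\<sigma> s x = (c + s * T x) powr (1/2)"

definition \<Phi> :: "real => real^'d => real^'d" where
 "\<Phi> s x = \<sigma> s x *\<^sub>R x"

lemma P_nonneg: "0 \<le> P x"
 unfolding P_def using \<kappa> by (intro mult_nonneg_nonneg sum_nonneg conv_fn_nonneg)

lemma P_eq_0: "norm x \<le> \<eta> ==> P x = 0"
proof -
 assume x: "norm x \<le> \<eta>"
 have "l \<bullet> x - 1 \<le> 0" if "l \<in> \<Lambda>" for l
  using norm_cauchy_schwarz[of l x] mult_left_mono[OF x, of "norm l"] \<Lambda>[OF that] by simp
 then show ?thesis by (simp add: P_def conv_fn_eq_0)
qed

lemma smooth_P [smooth_intros]: "smooth P"
 unfolding P_def[abs_def] by (intro smooth_intros)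

lemma smooth_dot [smooth_intros]: "smooth (\<lambda>x::real^'d. x \<bullet> x)"
 unfolding inner_vec_def inner_real_def by (intro smooth_intros)

lemma denom_pos: "0 < x \<bullet> x + flat 0 (\<eta>\<^sup>2 - x \<bullet> x)" for x :: "real^'d"
proof (cases "x = 0")
 case True then show ?thesis using \<eta> by (simp add: flat_def)
next
 case False then show ?thesis by (intro add_pos_nonneg flat_nonneg) simp
qed

lemma smooth_T [smooth_intros]: "smooth T"
 unfolding T_def[abs_def] by (intro smooth_intros denom_pos)

lemma T_nonneg: "0 \<le> T x"
 by (simp add: T_def P_nonneg)

lemma T_dot: "T x * (x \<bullet> x) = P x"
proof (cases "norm x \<le> \<eta>")
 case True then show ?thesis by (simp add: T_def P_eq_0)
next
 case False
 then have "\<eta>\<^sup>2 < x \<bullet> x" using \<eta> power_strict_mono[of \<eta> "norm x" 2] by (simp add: power2_norm_eq_inner)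
 moreover from this have x: "0 < x \<bullet> x" using \<eta> by (meson less_trans zero_less_power)
 ultimately have "T x = P x * inverse (x \<bullet> x)" by (simp add: T_def flat_def powr_minus)
 then show ?thesis using x by simp
qed

lemma radicand_pos: "0 \<le> s ==> 0 < c + s * T x"
 using c T_nonneg by (simp add: add_pos_nonneg)

lemma \<sigma>_pos: "0 \<le> s ==> 0 < \<sigma> s x"
 using radicand_pos[of s x] by (simp add: \<sigma>_def)

lemma \<sigma>_square: "0 \<le> s ==> \<sigma> s x * \<sigma> s x = c + s * T x"
 using radicand_pos[of s x] by (simp add: \<sigma>_def powr_add[symmetric])

lemma smooth_\<sigma> [smooth_intros]: "0 \<le> s ==> smooth (\<sigma> s)"
 unfolding \<sigma>_def[abs_def] by (intro smooth_intros radicand_pos)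

lemma \<Phi>_nth: "\<Phi> s x $ k = \<sigma> s x * x $ k"
 by (simp add: \<Phi>_def)

lemma smooth_\<Phi> [smooth_intros]: "0 \<le> s ==> smooth (\<lambda>x. \<Phi> s x $ k)"
 unfolding \<Phi>_nth by (intro smooth_intros)

lemma \<Phi>_dot: "0 \<le> s ==> \<Phi> s x \<bullet> \<Phi> s x = Q s x"
proof -
 assume s: "0 \<le> s"
 have "\<Phi> s x \<bullet> \<Phi> s x = (\<sigma> s x * \<sigma> s x) * (x \<bullet> x)" by (simp add: \<Phi>_def)
 also have "\<dots> = Q s x" using s T_dot[of x] by (simp add: \<sigma>_square Q_def algebra_simps)
 finally show ?thesis .
qed

lemma smooth_Q [smooth_intros]: "smooth (Q s)"
 unfolding Q_def[abs_def] by (intro smooth_intros)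

lemma partial_dot: "partial i (\<lambda>x::real^'d. x \<bullet> x) x = 2 * x $ i"
 using fun_cong[OF partial_ball_fn[of i], of x] partial_smooth_diff[OF smooth_dot smooth_const, of i 1]
 unfolding ball_fn_def[abs_def] by simp

lemma partial_P: "partial i P = (\<lambda>x. \<kappa> * (\<Sum>l\<in>\<Lambda>. (flat 0 (l \<bullet> x - 1) + flat 1 (l \<bullet> x - 1)) * l $ i))"
proof -
 have s: "smooth (\<lambda>x. l \<bullet> x - 1)" for l :: "real^'d" by (intro smooth_intros)
 have "partial i (\<lambda>x. conv_fn (l \<bullet> x - 1)) = (\<lambda>x. (flat 0 (l \<bullet> x - 1) + flat 1 (l \<bullet> x - 1)) * l $ i)" for l :: "real^'d"
  using partial_compose_real[OF conv_fn_has_derivative smooth_differentiable[OF s], of i]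
  by (auto simp: partial_smooth_diff smooth_inner_left)
 then show ?thesis
  unfolding P_def[abs_def] by (simp add: partial_smooth_cmult partial_smooth_sum smooth_intros)
qed

lemma partial2_P: "partial j (partial i P) = (\<lambda>x. \<kappa> * (\<Sum>l\<in>\<Lambda>. flat 3 (l \<bullet> x - 1) * l $ i * l $ j))"
proof -
 have s: "smooth (\<lambda>x. l \<bullet> x - 1)" for l :: "real^'d" by (intro smooth_intros)
 have "partial j (\<lambda>x. flat 0 (l \<bullet> x - 1) + flat 1 (l \<bullet> x - 1)) = (\<lambda>x. flat 3 (l \<bullet> x - 1) * l $ j)" for l :: "real^'d"
  using partial_compose_real[OF conv_fn_has_derivative2 smooth_differentiable[OF s], of j]
  by (auto simp: partial_smooth_diff smooth_inner_left)
 moreover have "smooth (\<lambda>x. flat 0 (l \<bullet> x - 1) + flat 1 (l \<bullet> x - 1))" for l :: "real^'d" by (intro smooth_intros)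
 ultimately show ?thesis
  unfolding partial_P by (simp add: partial_smooth_cmult partial_smooth_sum smooth_intros partial_smooth_mult mult_ac)
qed

definition \<rho> :: "real => real^'d => real" where "\<rho> s x = Q s x - 1"

lemma smooth_\<rho>: "smooth (\<rho> s)"
 unfolding \<rho>_def[abs_def] by (intro smooth_intros)

lemma partial_\<rho>: "partial i (\<rho> s) = (\<lambda>x. 2 * c * x $ i + s * partial i P x)"
 unfolding \<rho>_def[abs_def] Q_def[abs_def] using smooth_dot smooth_P
 by (simp add: partial_simps smooth_intros partial_dot fun_eq_iff)

lemma partial2_\<rho>: "partial j (partial i (\<rho> s)) = (\<lambda>x. (if i = j then 2 * c else 0) + s * partial j (partial i P) x)"
 unfolding partial_\<rho> using smooth_partial[OF smooth_P, of i]
 by (auto simp: partial_simps smooth_intros smooth_mult fun_eq_iff)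

lemma Q_le_norm: "0 \<le> s ==> Q s x \<le> 1 ==> norm x \<le> 1 / sqrt c"
proof -
 assume "0 \<le> s" "Q s x \<le> 1"
 then have "c * (norm x)\<^sup>2 \<le> 1" using mult_nonneg_nonneg[OF \<open>0 \<le> s\<close> P_nonneg[of x]]
  by (simp add: Q_def power2_norm_eq_inner)
 then have "(sqrt c * norm x)\<^sup>2 \<le> 1" using c by (simp add: power_mult_distrib)
 then have "sqrt c * norm x \<le> 1" using c by (simp add: abs_square_le_1)
 then show ?thesis using c by (simp add: field_simps)
qed

lemma convex_sublevel_\<rho>:
 assumes s: "0 \<le> s" shows "convex_sublevel (\<rho> s)"
proof
 show "smooth (\<rho> s)" by (rule smooth_\<rho>)
 show "bounded {x. \<rho> s x < 0}"
  by (rule bounded_subset[OF bounded_cball[of 0 "1 / sqrt c"]]) (use Q_le_norm[OF s] in \<open>auto simp: \<rho>_def\<close>)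
 fix x \<xi> :: "real^'d"
 have pp: "partial i (partial j P) x * \<xi> $ i * \<xi> $ j = (\<Sum>l\<in>\<Lambda>. \<kappa> * flat 3 (l \<bullet> x - 1) * ((l $ i * \<xi> $ i) * (l $ j * \<xi> $ j)))" for i j
  unfolding partial2_P by (simp add: sum_distrib_left sum_distrib_right algebra_simps)
 have "(\<Sum>i\<in>UNIV. \<Sum>j\<in>UNIV. partial i (partial j P) x * \<xi> $ i * \<xi> $ j)
   = (\<Sum>l\<in>\<Lambda>. \<Sum>i\<in>UNIV. \<Sum>j\<in>UNIV. \<kappa> * flat 3 (l \<bullet> x - 1) * ((l $ i * \<xi> $ i) * (l $ j * \<xi> $ j)))"
 proof -
  have "(\<Sum>i\<in>UNIV. \<Sum>j\<in>UNIV. partial i (partial j P) x * \<xi> $ i * \<xi> $ j)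
   = (\<Sum>i\<in>UNIV. \<Sum>l\<in>\<Lambda>. \<Sum>j\<in>UNIV. \<kappa> * flat 3 (l \<bullet> x - 1) * ((l $ i * \<xi> $ i) * (l $ j * \<xi> $ j)))"
   unfolding pp by (intro sum.cong refl sum.swap)
  then show ?thesis by (simp only:) (rule sum.swap)
 qed
 also have "\<dots> = (\<Sum>l\<in>\<Lambda>. \<kappa> * flat 3 (l \<bullet> x - 1) * (l \<bullet> \<xi>)\<^sup>2)"
 proof (intro sum.cong refl)
  fix l
  have "l \<bullet> \<xi> = (\<Sum>i\<in>UNIV. l $ i * \<xi> $ i)" by (simp add: inner_vec_def)
  then have "(l \<bullet> \<xi>)\<^sup>2 = (\<Sum>i\<in>UNIV. \<Sum>j\<in>UNIV. (l $ i * \<xi> $ i) * (l $ j * \<xi> $ j))"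
   by (simp only: power2_eq_square sum_product)
  then show "(\<Sum>i\<in>UNIV. \<Sum>j\<in>UNIV. \<kappa> * flat 3 (l \<bullet> x - 1) * ((l $ i * \<xi> $ i) * (l $ j * \<xi> $ j)))
    = \<kappa> * flat 3 (l \<bullet> x - 1) * (l \<bullet> \<xi>)\<^sup>2"
   by (simp only: sum_distrib_left)
 qed
 also have "\<dots> \<ge> 0" using \<kappa> by (intro sum_nonneg mult_nonneg_nonneg flat_nonneg) auto
 finally have 1: "0 \<le> (\<Sum>i\<in>UNIV. \<Sum>j\<in>UNIV. partial i (partial j P) x * \<xi> $ i * \<xi> $ j)" .
 have "(\<Sum>i\<in>UNIV. \<Sum>j\<in>UNIV. partial i (partial j (\<rho> s)) x * \<xi> $ i * \<xi> $ j)
   = (\<Sum>i\<in>UNIV. \<Sum>j\<in>UNIV. (if j = i then 2 * c * (\<xi> $ i)\<^sup>2 else 0) + s * (partial i (partial j P) x * \<xi> $ i * \<xi> $ j))"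
  unfolding partial2_\<rho> by (intro sum.cong refl) (auto simp: algebra_simps power2_eq_square)
 also have "\<dots> = (\<Sum>i\<in>UNIV. 2 * c * (\<xi> $ i)\<^sup>2) + s * (\<Sum>i\<in>UNIV. \<Sum>j\<in>UNIV. partial i (partial j P) x * \<xi> $ i * \<xi> $ j)"
  by (simp add: sum.distrib sum_distrib_left)
 also have "\<dots> \<ge> 0"
 proof (intro add_nonneg_nonneg mult_nonneg_nonneg s 1)
  show "0 \<le> (\<Sum>i\<in>UNIV. 2 * c * (\<xi> $ i)\<^sup>2)" using c by (intro sum_nonneg) auto
 qed
 finally show "0 \<le> (\<Sum>i\<in>UNIV. \<Sum>j\<in>UNIV. partial i (partial j (\<rho> s)) x * \<xi> $ i * \<xi> $ j)" .
qed

text \<open>Differentiating \<open>\<sigma>^2 |x|^2 = Q\<close> along the ray gives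
  \<open>2 \<sigma> |x|^2\<close> times this expression. The radial derivative of \<open>Q\<close>
  is positive: the quadratic part contributes \<open>2 c |x|^2\<close>, and the penalty terms are
  active only where \<open>l \<bullet> x > 1\<close>.\<close>

lemma radial_derivative_pos:
 assumes s: "0 \<le> s"
 shows "0 < \<sigma> s x + (\<Sum>i\<in>UNIV. x $ i * partial i (\<sigma> s) x)"
proof (cases "x = 0")
 case True then show ?thesis using \<sigma>_pos[OF s] by simp
next
 case False
 let ?r = "\<Sum>i\<in>UNIV. x $ i * partial i (\<sigma> s) x"
 have xx: "0 < x \<bullet> x" using False by simp
 have id: "\<rho> s = (\<lambda>x. \<sigma> s x * \<sigma> s x * (x \<bullet> x) - 1)"
  using \<sigma>_square[OF s] T_dot by (auto simp: \<rho>_def Q_def algebra_simps fun_eq_iff)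
 have "partial i (\<rho> s) x = 2 * \<sigma> s x * partial i (\<sigma> s) x * (x \<bullet> x) + \<sigma> s x * \<sigma> s x * (2 * x $ i)" for i
  unfolding id using smooth_\<sigma>[OF s] smooth_dot by (simp add: partial_simps smooth_mult partial_dot)
 then have e: "x $ i * (2 * c * x $ i + s * partial i P x) = 2 * \<sigma> s x * (x \<bullet> x) * (x $ i * partial i (\<sigma> s) x) + 2 * \<sigma> s x * \<sigma> s x * (x $ i * x $ i)" for i
  unfolding partial_\<rho> by (simp add: algebra_simps)
 have "2 * c * (x \<bullet> x) + s * (\<Sum>i\<in>UNIV. x $ i * partial i P x) = (\<Sum>i\<in>UNIV. x $ i * (2 * c * x $ i + s * partial i P x))"
  by (simp add: inner_vec_def sum.distrib sum_distrib_left algebra_simps)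
 also have "\<dots> = 2 * \<sigma> s x * (x \<bullet> x) * ?r + 2 * \<sigma> s x * \<sigma> s x * (x \<bullet> x)"
  unfolding e by (simp add: inner_vec_def sum.distrib sum_distrib_left)
 finally have eq: "2 * c * (x \<bullet> x) + s * (\<Sum>i\<in>UNIV. x $ i * partial i P x) = 2 * \<sigma> s x * (x \<bullet> x) * (\<sigma> s x + ?r)"
  by (simp add: algebra_simps)
 have "(\<Sum>i\<in>UNIV. x $ i * partial i P x) = (\<Sum>l\<in>\<Lambda>. \<kappa> * (flat 0 (l \<bullet> x - 1) + flat 1 (l \<bullet> x - 1)) * (l \<bullet> x))"
 proof -
  have "x $ i * partial i P x = (\<Sum>l\<in>\<Lambda>. \<kappa> * (flat 0 (l \<bullet> x - 1) + flat 1 (l \<bullet> x - 1)) * (l $ i * x $ i))" for i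
   unfolding partial_P by (simp add: sum_distrib_left mult_ac)
  then have "(\<Sum>i\<in>UNIV. x $ i * partial i P x)
   = (\<Sum>l\<in>\<Lambda>. \<Sum>i\<in>UNIV. \<kappa> * (flat 0 (l \<bullet> x - 1) + flat 1 (l \<bullet> x - 1)) * (l $ i * x $ i))"
   by (simp only:) (rule sum.swap)
  also have "\<dots> = (\<Sum>l\<in>\<Lambda>. \<kappa> * (flat 0 (l \<bullet> x - 1) + flat 1 (l \<bullet> x - 1)) * (l \<bullet> x))"
  proof (intro sum.cong refl)
   fix l
   have "l \<bullet> x = (\<Sum>i\<in>UNIV. l $ i * x $ i)" by (simp add: inner_vec_def)
   then show "(\<Sum>i\<in>UNIV. \<kappa> * (flat 0 (l \<bullet> x - 1) + flat 1 (l \<bullet> x - 1)) * (l $ i * x $ i))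
     = \<kappa> * (flat 0 (l \<bullet> x - 1) + flat 1 (l \<bullet> x - 1)) * (l \<bullet> x)"
    by (simp only: sum_distrib_left)
  qed
  finally show ?thesis .
 qed
 also have "\<dots> \<ge> 0"
 proof (rule sum_nonneg)
  fix l assume "l \<in> \<Lambda>"
  show "0 \<le> \<kappa> * (flat 0 (l \<bullet> x - 1) + flat 1 (l \<bullet> x - 1)) * (l \<bullet> x)"
  proof (cases "l \<bullet> x > 1")
   case True then show ?thesis using \<kappa> by (intro mult_nonneg_nonneg add_nonneg_nonneg flat_nonneg) auto
  next
   case False then show ?thesis by (simp add: flat_def)
  qed
 qed
 finally have "0 < 2 * c * (x \<bullet> x) + s * (\<Sum>i\<in>UNIV. x $ i * partial i P x)"
  using c s xx by (intro add_pos_nonneg mult_pos_pos mult_nonneg_nonneg) auto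
 then have "0 < (2 * \<sigma> s x * (x \<bullet> x)) * (\<sigma> s x + ?r)" unfolding eq .
 moreover have "0 < 2 * \<sigma> s x * (x \<bullet> x)" using \<sigma>_pos[OF s] xx by simp
 ultimately show ?thesis by (rule zero_less_mult_pos)
qed

lemma P_radial_mono: "1 \<le> a ==> P x \<le> P (a *\<^sub>R x)"
proof -
 assume a: "1 \<le> a"
 have "conv_fn (l \<bullet> x - 1) \<le> conv_fn (l \<bullet> (a *\<^sub>R x) - 1)" for l
 proof (cases "0 \<le> l \<bullet> x")
  case True
  then have "l \<bullet> x \<le> a * (l \<bullet> x)" using mult_right_mono[OF a True] by simp
  then show ?thesis by (intro conv_fn_mono) simp
 next
  case False then show ?thesis using conv_fn_nonneg by (simp add: conv_fn_eq_0)
 qed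
 then show ?thesis unfolding P_def using \<kappa> by (intro mult_left_mono sum_mono) auto
qed

lemma Q_radial_strict:
 assumes "0 \<le> s" "1 < a" "x \<noteq> 0" shows "Q s x < Q s (a *\<^sub>R x)"
proof -
 have "1 < a\<^sup>2" using assms(2) by simp
 then have "c * (x \<bullet> x) < c * (a\<^sup>2 * (x \<bullet> x))" using c assms(3) by simp
 moreover have "s * P x \<le> s * P (a *\<^sub>R x)" using assms P_radial_mono by (intro mult_left_mono) auto
 ultimately show ?thesis by (simp add: Q_def power2_eq_square mult.assoc)
qed

text \<open>\<open>\<Phi> s\<close> preserves rays, and its squared length \<open>Q s\<close> is
  strictly increasing along each of them.\<close>

lemma inj_\<Phi>:
 assumes s: "0 \<le> s" shows "inj (\<Phi> s)"
proof (rule injI)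
 fix x y assume e: "\<Phi> s x = \<Phi> s y"
 have Qe: "Q s x = Q s y" using \<Phi>_dot[OF s, of x] \<Phi>_dot[OF s, of y] e by simp
 define a where "a = \<sigma> s x / \<sigma> s y"
 have a: "0 < a" using \<sigma>_pos[OF s] by (simp add: a_def)
 have y: "y = a *\<^sub>R x"
 proof -
  have "\<sigma> s y *\<^sub>R y = \<sigma> s x *\<^sub>R x" using e by (simp add: \<Phi>_def)
  then have "(1 / \<sigma> s y) *\<^sub>R (\<sigma> s y *\<^sub>R y) = (1 / \<sigma> s y) *\<^sub>R (\<sigma> s x *\<^sub>R x)" by simp
  then show ?thesis using \<sigma>_pos[OF s, of y] by (simp add: a_def)
 qed
 show "x = y"
 proof (cases "x = 0")
  case True then show ?thesis using y by simp
 next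
  case False
  have "y \<noteq> 0" "x = (1 / a) *\<^sub>R y" using y a False by auto
  consider "a = 1" | "1 < a" | "1 < 1 / a" using a by (auto simp: field_simps) linarith
  then show ?thesis
  proof cases
   case 1 then show ?thesis using y by simp
  next
   case 2 then show ?thesis using Q_radial_strict[OF s 2 False] Qe y by simp
  next
   case 3 then show ?thesis using Q_radial_strict[OF s 3 \<open>y \<noteq> 0\<close>] Qe \<open>x = (1 / a) *\<^sub>R y\<close> by simp
  qed
 qed
qed

lemma \<Phi>_surj:
 assumes s: "0 \<le> s" shows "\<exists>x. \<Phi> s x = y"
proof (cases "y = 0")
 case True then show ?thesis by (intro exI[of _ 0]) (simp add: \<Phi>_def)
next
 case False
 \<comment> \<open>At this multiple of \<open>y\<close> the quadratic part of \<open>Q\<close> alone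
   reaches \<open>y \<bullet> y\<close>, so the intermediate value theorem finds a preimage on the
   ray through \<open>y\<close>.\<close>
 define R where "R = 1 / sqrt c"
 have R: "0 < R" "c * R\<^sup>2 = 1" using c by (auto simp: R_def power_divide)
 have "continuous_on {0..R} (\<lambda>r. Q s (r *\<^sub>R y))"
  by (rule continuous_on_compose2[of UNIV "Q s" _ "\<lambda>r. r *\<^sub>R y"])
    (auto intro!: continuous_intros smooth_continuous_on smooth_Q)
 moreover have "Q s (0 *\<^sub>R y) \<le> y \<bullet> y" using P_eq_0[of 0] \<eta> by (simp add: Q_def)
 moreover have "y \<bullet> y \<le> Q s (R *\<^sub>R y)"
 proof -
  have "c * (R *\<^sub>R y \<bullet> R *\<^sub>R y) = (c * R\<^sup>2) * (y \<bullet> y)" by (simp add: power2_eq_square)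
  then have "c * (R *\<^sub>R y \<bullet> R *\<^sub>R y) = y \<bullet> y" using R(2) by simp
  then show ?thesis using mult_nonneg_nonneg[OF s P_nonneg[of "R *\<^sub>R y"]] unfolding Q_def by linarith
 qed
 ultimately obtain r where r: "0 \<le> r" "r \<le> R" "Q s (r *\<^sub>R y) = y \<bullet> y"
  using IVT'[of "\<lambda>r. Q s (r *\<^sub>R y)" 0 "y \<bullet> y" R] R(1) by auto
 define a where "a = \<sigma> s (r *\<^sub>R y) * r"
 have a: "0 \<le> a" using \<sigma>_pos[OF s, of "r *\<^sub>R y"] r by (simp add: a_def)
 have e: "\<Phi> s (r *\<^sub>R y) = a *\<^sub>R y" by (simp add: \<Phi>_def a_def)
 have "a\<^sup>2 * (y \<bullet> y) = y \<bullet> y" using \<Phi>_dot[OF s, of "r *\<^sub>R y"] r(3) unfolding e by (simp add: power2_eq_square)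
 then have "a\<^sup>2 = 1" using False by simp
 then have "a = 1" using a by (simp add: power2_eq_1_iff)
 then show ?thesis using e by auto
qed

lemma \<Phi>_image_open: "0 \<le> s ==> \<Phi> s ` {x. \<rho> s x < 0} = ball 0 1"
proof -
 assume s: "0 \<le> s"
 have "y \<in> ball 0 1 \<longleftrightarrow> y \<bullet> y < 1" for y :: "real^'d"
  unfolding mem_ball_0 power2_norm_eq_inner[symmetric] by (simp add: abs_square_less_1)
 then have "x \<in> {x. \<rho> s x < 0} \<longleftrightarrow> \<Phi> s x \<in> ball 0 1" for x using \<Phi>_dot[OF s, of x] by (simp add: \<rho>_def)
 then show ?thesis using \<Phi>_surj[OF s] by (auto simp: image_iff) metis
qed

text \<open>The parameter belongs to the compact set, so that constants obtained by compactness are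
  uniform in \<open>s\<close>.\<close>

definition K :: "(real \<times> (real^'d)) set" where
 "K = {(s, x). 0 \<le> s \<and> s \<le> 1 \<and> Q s x \<le> 1}"

lemma continuous_snd:
 assumes "smooth g" shows "continuous_on S (\<lambda>z. g (snd z))"
 by (rule continuous_on_compose2[OF smooth_continuous_on[OF assms, of UNIV]]) (auto intro!: continuous_intros)

lemma compact_K: "compact K"
proof -
 have "closed K"
 proof -
  have "K = {z. 0 \<le> fst z} \<inter> {z. fst z \<le> 1} \<inter> {z. c * (snd z \<bullet> snd z) + fst z * P (snd z) \<le> 1}"
   by (auto simp: K_def Q_def)
  moreover have "closed {z :: real \<times> (real^'d). c * (snd z \<bullet> snd z) + fst z * P (snd z) \<le> 1}"
   by (intro closed_Collect_le continuous_intros continuous_snd[OF smooth_P])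
  ultimately show ?thesis
   by (auto intro!: closed_Int closed_Collect_le continuous_intros)
 qed
 moreover have "bounded K"
  by (rule bounded_subset[of "{0..1} \<times> cball 0 (1 / sqrt c)"]) (use Q_le_norm in \<open>auto simp: K_def bounded_Times\<close>)
 ultimately show ?thesis by (simp add: compact_eq_bounded_closed)
qed

text \<open>Derivatives of \<open>\<sigma>\<close> and \<open>\<Phi>\<close>, written so as to be jointly continuous in the parameter and the
 space variable.\<close>

definition \<sigma>1 where "\<sigma>1 i s x = s * partial i T x * ((c + s * T x) powr (-1/2)) / 2"
definition \<sigma>2 where "\<sigma>2 j i s x = s * partial j (partial i T) x * ((c + s * T x) powr (-1/2)) / 2
 - s * partial i T x * (s * partial j T x) * ((c + s * T x) powr (-3/2)) / 4"

lemma partial_\<sigma>: "0 \<le> s ==> partial i (\<sigma> s) = \<sigma>1 i s"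
proof -
 assume s: "0 \<le> s"
 have sm: "smooth (\<lambda>x. c + s * T x)" by (intro smooth_intros)
 show ?thesis
  unfolding \<sigma>_def[abs_def] \<sigma>1_def[abs_def] smooth_partial_powr[OF sm radicand_pos[OF s]]
  using smooth_T by (simp add: partial_simps smooth_intros smooth_mult fun_eq_iff)
qed

lemma partial_\<sigma>1: "0 \<le> s ==> partial j (\<sigma>1 i s) = \<sigma>2 j i s"
proof -
 assume s: "0 \<le> s"
 have sm: "smooth (\<lambda>x. c + s * T x)" by (intro smooth_intros)
 have smp: "smooth (\<lambda>x. (c + s * T x) powr a)" for a by (intro smooth_intros radicand_pos[OF s])
 have e: "\<sigma>1 i s = (\<lambda>x. (s / 2) * (partial i T x * ((c + s * T x) powr (-1/2))))" by (auto simp: \<sigma>1_def)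
 have p: "partial j (\<lambda>x. c + s * T x) = (\<lambda>x. s * partial j T x)"
  using smooth_T by (simp add: partial_simps smooth_intros smooth_mult)
 have sT: "smooth (partial i T)" by (rule smooth_partial[OF smooth_T])
 have "partial j (\<sigma>1 i s) = (\<lambda>x. (s / 2) * partial j (\<lambda>x. partial i T x * ((c + s * T x) powr (-1/2))) x)"
  unfolding e by (rule partial_smooth_cmult) (intro smooth_mult sT smp)
 also have "partial j (\<lambda>x. partial i T x * ((c + s * T x) powr (-1/2)))
  = (\<lambda>x. partial j (partial i T) x * (c + s * T x) powr (-1/2)
    + partial i T x * ((-1/2) * (c + s * T x) powr (-1/2 - 1) * (s * partial j T x)))"
  unfolding partial_smooth_mult[OF sT smp] smooth_partial_powr[OF sm radicand_pos[OF s]] p ..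
 finally show ?thesis by (auto simp: \<sigma>2_def[abs_def] fun_eq_iff algebra_simps)
qed

definition J :: "'d => 'd => real => real^'d => real" where
 "J k i s x = \<sigma>1 i s x * x $ k + (if i = k then \<sigma> s x else 0)"

definition J1 :: "'d => 'd => 'd => real => real^'d => real" where
 "J1 k j i s x = \<sigma>2 j i s x * x $ k + (if j = k then \<sigma>1 i s x else 0) + (if i = k then \<sigma>1 j s x else 0)"

text \<open>The Jacobian of \<open>\<Phi> s\<close> is \<open>\<sigma>\<close> times the identity
  plus the rank-one matrix \<open>x \<otimes> \<nabla>\<sigma>\<close>; this is its inverse by the
  Sherman-Morrison formula. The inner denominator is positive by
  \<open>radial_derivative_pos\<close>.\<close>

definition E :: "'d => 'd => real => real^'d => real" where
 "E i k s x = ((if i = k then 1 else 0) - x $ i * \<sigma>1 k s x / (\<sigma> s x + (\<Sum>m\<in>UNIV. x $ m * \<sigma>1 m s x))) / \<sigma> s x"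

lemma partial_\<Phi>: "0 \<le> s ==> partial i (\<lambda>x. \<Phi> s x $ k) = J k i s"
 unfolding \<Phi>_nth J_def[abs_def] using smooth_\<sigma>[of s] partial_\<sigma>[of s]
 by (auto simp: partial_smooth_mult fun_eq_iff)

lemma smooth_\<sigma>1: "0 \<le> s ==> smooth (\<sigma>1 i s)"
 using smooth_partial[OF smooth_\<sigma>] partial_\<sigma> by metis

lemma partial_J: "0 \<le> s ==> partial j (J k i s) = J1 k j i s"
proof -
 assume s: "0 \<le> s"
 have "smooth (\<lambda>x. if i = k then \<sigma> s x else 0)" by (cases "i = k") (auto intro: smooth_intros s)
 moreover have "partial j (\<lambda>x. if i = k then \<sigma> s x else 0) = (\<lambda>x. if i = k then \<sigma>1 j s x else 0)"
  using partial_\<sigma>[OF s] by (cases "i = k") auto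
 ultimately show ?thesis
  unfolding J_def[abs_def] J1_def[abs_def] using smooth_\<sigma>1[OF s] partial_\<sigma>1[OF s]
  by (auto simp: partial_simps smooth_intros smooth_mult fun_eq_iff)
qed

lemma J_E: "0 \<le> s ==> (\<Sum>i\<in>UNIV. J k i s x * E i l s x) = (if k = l then 1 else 0)"
proof -
 assume s: "0 \<le> s"
 define g where "g = (\<Sum>m\<in>UNIV. x $ m * \<sigma>1 m s x)"
 have d: "\<sigma> s x + g \<noteq> 0" using radial_derivative_pos[OF s, of x] partial_\<sigma>[OF s] by (simp add: g_def)
 have s0: "\<sigma> s x \<noteq> 0" using \<sigma>_pos[OF s, of x] by simp
 define h where "h = 1 / (\<sigma> s x + g)"
 have "J k i s x * E i l s x = ((if i = l then \<sigma>1 l s x * x $ k + (if l = k then \<sigma> s x else 0) else 0)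
   - (x $ k * \<sigma>1 l s x * h) * (x $ i * \<sigma>1 i s x) - (if i = k then \<sigma> s x * x $ k * \<sigma>1 l s x * h else 0)) / \<sigma> s x" for i
  by (auto simp: J_def E_def g_def[symmetric] h_def algebra_simps)
 then have "(\<Sum>i\<in>UNIV. J k i s x * E i l s x) = (\<sigma>1 l s x * x $ k + (if l = k then \<sigma> s x else 0)
   - (x $ k * \<sigma>1 l s x * h) * g - \<sigma> s x * x $ k * \<sigma>1 l s x * h) / \<sigma> s x"
  by (simp add: sum_divide_distrib[symmetric] sum_subtractf g_def sum_distrib_left)
 also have "\<dots> = (\<sigma>1 l s x * x $ k * (1 - h * (\<sigma> s x + g)) + (if l = k then \<sigma> s x else 0)) / \<sigma> s x"
  by (simp add: algebra_simps)
 also have "\<dots> = (if k = l then 1 else 0)" using d s0 by (auto simp: h_def)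
 finally show ?thesis .
qed

lemma continuous_radicand_powr:
 "continuous_on K (\<lambda>z. (c + fst z * T (snd z)) powr a)"
proof -
 have "c + fst z * T (snd z) \<noteq> 0" if "z \<in> K" for z
  using radicand_pos[of "fst z" "snd z"] that by (auto simp: K_def)
 then show ?thesis by (intro continuous_on_powr continuous_intros continuous_snd[OF smooth_T]) auto
qed

lemma continuous_\<sigma>: "continuous_on K (\<lambda>z. \<sigma> (fst z) (snd z))"
 unfolding \<sigma>_def by (rule continuous_radicand_powr)

lemma continuous_\<sigma>1: "continuous_on K (\<lambda>z. \<sigma>1 i (fst z) (snd z))"
 unfolding \<sigma>1_def by (intro continuous_intros continuous_radicand_powr continuous_snd[OF smooth_partial[OF smooth_T]]) auto

lemma continuous_\<sigma>2: "continuous_on K (\<lambda>z. \<sigma>2 j i (fst z) (snd z))"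
 unfolding \<sigma>2_def
 by (intro continuous_intros continuous_radicand_powr continuous_snd[OF smooth_partial[OF smooth_T]]
   continuous_snd[OF smooth_partial[OF smooth_partial[OF smooth_T]]]) auto

lemma continuous_J: "continuous_on K (\<lambda>z. J k i (fst z) (snd z))"
 unfolding J_def by (cases "i = k") (auto intro!: continuous_intros continuous_\<sigma>1 continuous_\<sigma>)

lemma continuous_J1: "continuous_on K (\<lambda>z. J1 k j i (fst z) (snd z))"
 unfolding J1_def by (cases "i = k"; cases "j = k") (auto intro!: continuous_intros continuous_\<sigma>1 continuous_\<sigma>2)

lemma continuous_\<Phi>: "continuous_on K (\<lambda>z. \<Phi> (fst z) (snd z))"
 unfolding \<Phi>_def by (intro continuous_intros continuous_\<sigma>)

text \<open>Carrying the parameter along gives a continuous injection on a compact set; its inverse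
  is therefore continuous jointly in parameter and point, which \<open>\<Psi>\<close>
  inherits.\<close>

definition \<Theta> :: "real \<times> (real^'d) => real \<times> (real^'d)" where
 "\<Theta> z = (fst z, \<Phi> (fst z) (snd z))"

definition \<Psi> :: "real => real^'d => real^'d" where
 "\<Psi> s y = snd (the_inv_into K \<Theta> (s, y))"

lemma cball_dot: "y \<in> cball 0 1 \<longleftrightarrow> y \<bullet> y \<le> 1" for y :: "real^'d"
 unfolding mem_cball_0 power2_norm_eq_inner[symmetric] by (simp add: abs_square_le_1)

lemma \<Theta>_image: "\<Theta> ` K = {0..1} \<times> cball 0 1"
proof
 show "\<Theta> ` K \<subseteq> {0..1} \<times> cball 0 1"
  using \<Phi>_dot by (force simp: \<Theta>_def K_def cball_dot simp del: mem_cball_0 mem_cball)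
 show "{0..1} \<times> cball 0 1 \<subseteq> \<Theta> ` K"
 proof
  fix z :: "real \<times> (real^'d)" assume "z \<in> {0..1} \<times> cball 0 1"
  then obtain s y where z: "z = (s, y)" "0 \<le> s" "s \<le> 1" "y \<in> cball 0 1" by auto
  obtain x where x: "\<Phi> s x = y" using \<Phi>_surj[OF z(2)] by blast
  have "Q s x \<le> 1" using \<Phi>_dot[OF z(2), of x] x z(4) by (simp only: cball_dot)
  then have "(s, x) \<in> K" using z by (simp add: K_def)
  then show "z \<in> \<Theta> ` K" using z x by (force simp: \<Theta>_def)
 qed
qed

lemma inj_\<Theta>: "inj_on \<Theta> K"
proof (rule inj_onI)
 fix z w assume "z \<in> K" "w \<in> K" "\<Theta> z = \<Theta> w"
 then have "0 \<le> fst z" "fst z = fst w" "\<Phi> (fst z) (snd z) = \<Phi> (fst z) (snd w)"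
  by (auto simp: \<Theta>_def K_def)
 then show "z = w" using injD[OF inj_\<Phi>] by (auto simp: prod_eq_iff)
qed

lemma \<Psi>:
 assumes "0 \<le> s" "s \<le> 1" "y \<in> cball 0 1"
 shows "(s, \<Psi> s y) \<in> K" "\<Phi> s (\<Psi> s y) = y"
proof -
 have *: "(s, y) \<in> \<Theta> ` K" using assms by (simp add: \<Theta>_image)
 have 1: "the_inv_into K \<Theta> (s, y) \<in> K" "\<Theta> (the_inv_into K \<Theta> (s, y)) = (s, y)"
  using the_inv_into_into[OF inj_\<Theta> * subset_refl] f_the_inv_into_f[OF inj_\<Theta> *] by auto
 then have "fst (the_inv_into K \<Theta> (s, y)) = s" by (simp add: \<Theta>_def)
 then have 2: "the_inv_into K \<Theta> (s, y) = (s, \<Psi> s y)" by (simp add: \<Psi>_def prod_eq_iff)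
 show "(s, \<Psi> s y) \<in> K" "\<Phi> s (\<Psi> s y) = y" using 1 unfolding 2 by (auto simp: \<Theta>_def)
qed

lemma \<Psi>_\<Phi>: "(s, x) \<in> K ==> \<Psi> s (\<Phi> s x) = x"
 using the_inv_into_f_f[OF inj_\<Theta>, of "(s, x)"] by (simp add: \<Theta>_def \<Psi>_def)

lemma continuous_\<Psi>:
 "continuous_on ({0..1} \<times> cball 0 1) (\<lambda>z. \<Psi> (fst z) (snd z))"
proof -
 have "continuous_on K \<Theta>" unfolding \<Theta>_def[abs_def] by (intro continuous_intros continuous_\<Phi>)
 from continuous_on_inv_into[OF this compact_K inj_\<Theta>]
 have "continuous_on ({0..1} \<times> cball 0 1) (the_inv_into K \<Theta>)" by (simp add: \<Theta>_image)
 then show ?thesis unfolding \<Psi>_def by (intro continuous_intros) simp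
qed

end

text \<open>The change of variables theorem of the library requires a well-ordered index type. An
 arbitrary finite index type is replaced by an initial segment of the natural numbers.\<close>

typedef ('d::finite) idx = "{n::nat. n < CARD('d)}"
 by (rule exI[of _ 0]) simp

instantiation idx :: (finite) linorder
begin
definition "less_eq_idx (a :: 'a idx) (b :: 'a idx) \<longleftrightarrow> Rep_idx a \<le> Rep_idx b"
definition "less_idx (a :: 'a idx) (b :: 'a idx) \<longleftrightarrow> Rep_idx a < Rep_idx b"
instance
proof
 fix a b c :: "'a idx"
 show "a < b \<longleftrightarrow> a \<le> b \<and> \<not> b \<le> a" by (simp only: less_eq_idx_def less_idx_def less_le_not_le)
 show "a \<le> a" by (simp only: less_eq_idx_def)
 show "a \<le> b ==> b \<le> c ==> a \<le> c" unfolding less_eq_idx_def by (rule order_trans)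
 show "a \<le> b ==> b \<le> a ==> a = b" unfolding less_eq_idx_def Rep_idx_inject[symmetric] by (rule antisym)
 show "a \<le> b \<or> b \<le> a" unfolding less_eq_idx_def by (rule linear)
qed
end

instance idx :: (finite) wellorder
proof
 fix P :: "'a idx => bool" and a
 assume H: "\<And>x. (\<And>y. y < x ==> P y) ==> P x"
 show "P a"
 proof (induction a rule: measure_induct_rule[of Rep_idx])
  case (less a)
  show ?case by (rule H, rule less) (simp only: less_idx_def)
 qed
qed

lemma idx_image: "(UNIV :: 'd::finite idx set) = Abs_idx ` {n. n < CARD('d)}"
 using type_definition.Abs_image[OF type_definition_idx] by metis

instance idx :: (finite) finite
 by standard (simp add: idx_image)

lemma CARD_idx: "CARD('d::finite idx) = CARD('d)"
 unfolding idx_image by (subst card_image) (auto intro: inj_onI simp: Abs_idx_inject)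

definition pos :: "'d::finite idx => 'd" where "pos = (SOME f. bij f)"

lemma bij_pos: "bij (pos :: 'd::finite idx => 'd)"
proof -
 have "\<exists>f :: 'd idx => 'd. bij f"
  using finite_same_card_bij[of "UNIV :: 'd idx set" "UNIV :: 'd set"] by (simp add: CARD_idx)
 then show ?thesis unfolding pos_def by (rule someI_ex)
qed

lemma pos_inv [simp]: "pos (inv pos i) = i" "inv pos (pos a) = a"
 by (simp_all add: bij_pos bij_is_inj bij_is_surj surj_f_inv_f)

lemma sum_pos: "(\<Sum>a\<in>UNIV. f (pos a)) = (\<Sum>i\<in>UNIV. f i)"
 by (rule sum.reindex_bij_betw) (rule bij_pos)

definition relabel :: "real^'d => real^('d idx)" where "relabel x = (\<chi> a. x $ pos a)"
definition unlabel :: "real^('d idx) => real^'d" where "unlabel y = (\<chi> i. y $ inv pos i)"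

lemma relabel_inverse [simp]: "unlabel (relabel x) = x" "relabel (unlabel y) = y"
 by (simp_all add: relabel_def unlabel_def vec_eq_iff)

lemma bounded_linear_relabel: "bounded_linear relabel"
 by (intro linear_conv_bounded_linear[THEN iffD1] linearI) (auto simp: relabel_def vec_eq_iff)

lemma bounded_linear_unlabel: "bounded_linear unlabel"
 by (intro linear_conv_bounded_linear[THEN iffD1] linearI) (auto simp: unlabel_def vec_eq_iff)

lemma relabel_measurable [measurable]: "relabel \<in> borel_measurable borel"
 using bounded_linear_relabel by (intro borel_measurable_continuous_onI linear_continuous_on)

lemma unlabel_measurable [measurable]: "unlabel \<in> borel_measurable borel"
 using bounded_linear_unlabel by (intro borel_measurable_continuous_onI linear_continuous_on)

text \<open>Renaming coordinates maps boxes to boxes of equal volume, and the volumes of boxes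
  determine Lebesgue measure.\<close>

lemma lborel_relabel: "distr lborel borel (relabel :: real^'d => _) = lborel"
proof (rule lborel_eqI[symmetric])
 fix l u :: "real^('d idx)" assume le: "\<And>b. b \<in> Basis ==> l \<bullet> b \<le> u \<bullet> b"
 have le': "l $ a \<le> u $ a" for a
 proof -
  have "axis a (1::real) \<in> Basis" by (auto simp: Basis_vec_def)
  from le[OF this] show ?thesis by (simp add: inner_axis)
 qed
 have b: "relabel -` box l u = box (unlabel l) (unlabel u)"
  by (auto simp: mem_box_cart relabel_def unlabel_def) (metis pos_inv)+
 have "emeasure (distr lborel borel relabel) (box l u) = emeasure lborel (relabel -` box l u :: (real^'d) set)"
  by (subst emeasure_distr) auto
 also have "\<dots> = (\<Prod>b\<in>Basis. (unlabel u - unlabel l) \<bullet> b)"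
  unfolding b using le' by (subst emeasure_lborel_box) (auto simp: Basis_vec_def inner_axis unlabel_def)
 also have "(\<Prod>b\<in>Basis. (unlabel u - unlabel l) \<bullet> b) = (\<Prod>i\<in>UNIV. u $ inv pos i - l $ inv pos (i::'d))"
  by (subst prod.reindex_bij_betw[of "\<lambda>i. axis i 1" UNIV Basis, symmetric])
    (auto simp: bij_betw_def inj_on_def Basis_vec_def axis_eq_axis inner_axis unlabel_def)
 also have "\<dots> = (\<Prod>a\<in>UNIV. u $ a - l $ a)"
  by (rule prod.reindex_bij_betw[of "inv pos"]) (use bij_pos bij_imp_bij_inv in auto)
 also have "\<dots> = (\<Prod>b\<in>Basis. (u - l) \<bullet> b)"
  by (subst prod.reindex_bij_betw[of "\<lambda>i. axis i 1" UNIV Basis, symmetric])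
    (auto simp: bij_betw_def inj_on_def Basis_vec_def axis_eq_axis inner_axis)
 finally show "emeasure (distr lborel borel relabel) (box l u) = (\<Prod>b\<in>Basis. (u - l) \<bullet> b)" .
qed simp

lemma lborel_integral_relabel:
 fixes F :: "real^'d => real"
 assumes [measurable]: "F \<in> borel_measurable borel"
 shows "(LINT y|lborel. F (unlabel y)) = (LINT x|lborel. F x)"
  "integrable lborel (\<lambda>y. F (unlabel y)) \<longleftrightarrow> integrable lborel F"
proof -
 have [measurable]: "(\<lambda>y. F (unlabel y)) \<in> borel_measurable borel" by measurable
 have "(LINT y|distr lborel borel (relabel :: real^'d => _). F (unlabel y)) = (LINT x|lborel. F (unlabel (relabel x)))"
  by (rule integral_distr) measurable
 then show "(LINT y|lborel. F (unlabel y)) = (LINT x|lborel. F x)" by (simp add: lborel_relabel)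
 have "integrable (distr lborel borel (relabel :: real^'d => _)) (\<lambda>y. F (unlabel y)) \<longleftrightarrow> integrable lborel (\<lambda>x. F (unlabel (relabel x)))"
  by (rule integrable_distr_eq) measurable
 then show "integrable lborel (\<lambda>y. F (unlabel y)) \<longleftrightarrow> integrable lborel F" by (simp add: lborel_relabel)
qed

text \<open>For a derivative \<open>L\<close> this is the absolute Jacobian determinant, taken in
  relabelled coordinates to agree with the well-ordered index type of the change of
  variables.\<close>

definition jac :: "(real^'d => real^'d) => real" where
 "jac L = \<bar>det (\<chi> a b. L (axis (pos b) 1) $ pos a :: real^('d idx)^('d idx))\<bar>"

lemma absolutely_integrable_lborel:
 fixes F :: "'a::euclidean_space => real"
 assumes "F \<in> borel_measurable borel" "S \<in> sets borel"
 shows "F absolutely_integrable_on S \<longleftrightarrow> integrable lborel (\<lambda>x. indicator S x * F x)"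
  "F absolutely_integrable_on S ==> integral S F = (LINT x|lborel. indicator S x * F x)"
proof -
 have m: "(\<lambda>x. indicator S x * F x) \<in> borel_measurable lborel" using assms by auto
 show "F absolutely_integrable_on S \<longleftrightarrow> integrable lborel (\<lambda>x. indicator S x * F x)"
  unfolding set_integrable_def real_scaleR_def using integrable_completion[OF m] by simp
 assume "F absolutely_integrable_on S"
 then have "integral S F = (LINT x:S|lebesgue. F x)" by (simp add: set_lebesgue_integral_eq_integral(2))
 also have "\<dots> = (LINT x|lborel. indicator S x * F x)"
  unfolding set_lebesgue_integral_def real_scaleR_def using integral_completion[OF m] by simp
 finally show "integral S F = (LINT x|lborel. indicator S x * F x)" .
qed

text \<open>The map is conjugated with the relabelling of coordinates, and \<open>lborel\<close>
  integrals are translated to absolute integrability and back.\<close>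

lemma change_of_variables_borel:
 fixes \<Phi> :: "real^'d => real^'d" and f :: "real^'d => real"
 assumes S: "open S" and d: "\<And>x. x \<in> S ==> (\<Phi> has_derivative \<Phi>' x) (at x)" and inj: "inj_on \<Phi> S"
  and B: "\<Phi> ` S \<in> sets borel" and f: "f \<in> borel_measurable borel" 
  and m: "(\<lambda>x. jac (\<Phi>' x) * f (\<Phi> x)) \<in> borel_measurable borel"
  and i: "integrable lborel (\<lambda>x. indicator S x * (jac (\<Phi>' x) * f (\<Phi> x)))"
 shows "integrable lborel (\<lambda>y. indicator (\<Phi> ` S) y * f y)"
  "(LINT y|lborel. indicator (\<Phi> ` S) y * f y) = (LINT x|lborel. indicator S x * (jac (\<Phi>' x) * f (\<Phi> x)))"
proof -
 define g where "g y = relabel (\<Phi> (unlabel y))" for y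
 define g' where "g' y h = relabel (\<Phi>' (unlabel y) (unlabel h))" for y h
 define S' where "S' = (unlabel -` S :: (real^('d idx)) set)"
 have S'r: "S' = relabel ` S" 
  unfolding S'_def by (auto simp: image_iff) (metis relabel_inverse(2))
 have oS': "open S'" unfolding S'_def
  using S bounded_linear_unlabel by (intro open_vimage linear_continuous_on)
 have gS: "g ` S' = unlabel -` (\<Phi> ` S)"
  unfolding g_def S'r by (auto simp: image_iff) (metis relabel_inverse(2))
 have gSb: "g ` S' \<in> sets borel" unfolding gS using B measurable_sets[OF unlabel_measurable B] by simp
 have injg: "inj_on g S'"
 proof (rule inj_onI)
  fix x y assume xy: "x \<in> S'" "y \<in> S'" "g x = g y"
  then have "\<Phi> (unlabel x) = \<Phi> (unlabel y)" unfolding g_def by (metis relabel_inverse(1))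
  then have "unlabel x = unlabel y" using inj_onD[OF inj] xy unfolding S'_def by blast
  then show "x = y" by (metis relabel_inverse(2))
 qed
 have der: "(g has_derivative g' y) (at y within S')" if "y \<in> S'" for y
 proof -
  have "((\<lambda>y. \<Phi> (unlabel y)) has_derivative (\<lambda>h. \<Phi>' (unlabel y) (unlabel h))) (at y)"
   by (rule has_derivative_compose[OF bounded_linear_imp_has_derivative[OF bounded_linear_unlabel]])
     (use d that in \<open>auto simp: S'_def\<close>)
  from bounded_linear.has_derivative[OF bounded_linear_relabel this]
  show ?thesis unfolding g_def[abs_def] g'_def[abs_def] by (rule has_derivative_at_withinI)
 qed
 have jd: "\<bar>det (matrix (g' y))\<bar> = jac (\<Phi>' (unlabel y))" for y
 proof -
  have ax: "unlabel (axis b 1) = axis (pos b) (1::real)" for b :: "'d idx"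
   by (auto simp: unlabel_def axis_def vec_eq_iff)
  show ?thesis unfolding jac_def matrix_def g'_def ax by (simp add: relabel_def)
 qed
 let ?G = "\<lambda>x. jac (\<Phi>' x) * f (\<Phi> x)"
 have mS: "(\<lambda>x. indicator S x * ?G x) \<in> borel_measurable borel"
  using S by (intro borel_measurable_times[OF _ m]) auto
 have mG: "(\<lambda>y. ?G (unlabel y)) \<in> borel_measurable borel"
  using measurable_compose[OF unlabel_measurable m] by simp
 have mf: "(\<lambda>y. f (unlabel y)) \<in> borel_measurable borel" using measurable_compose[OF unlabel_measurable f] by simp
 have indS: "indicator S' y = (indicator S (unlabel y) :: real)" for y by (simp add: S'_def indicator_def)
 have "integrable lborel (\<lambda>y. indicator S' y * ?G (unlabel y))"
  using i lborel_integral_relabel(2)[OF mS] unfolding indS by simp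
 then have A: "(\<lambda>y. ?G (unlabel y)) absolutely_integrable_on S'"
  using absolutely_integrable_lborel(1)[OF mG] oS' by simp
 have I: "integral S' (\<lambda>y. ?G (unlabel y)) = (LINT x|lborel. indicator S x * ?G x)"
  using absolutely_integrable_lborel(2)[OF mG _ A] oS' lborel_integral_relabel(1)[OF mS] unfolding indS by simp
 \<comment> \<open>The change of variables is applied to vector-valued integrands, hence the detour
   through \<open>real^1\<close>.\<close>
 have eq: "(\<lambda>y. \<bar>det (matrix (g' y))\<bar> *\<^sub>R vec (f (unlabel (g y)))) = (\<lambda>y. vec (?G (unlabel y)) :: real^1)"
  by (auto simp: jd g_def vec_eq_iff)
 define F where "F y = (vec (f (unlabel y)) :: real^1)" for y
 have A1: "(\<lambda>y. \<bar>det (matrix (g' y))\<bar> *\<^sub>R F (g y)) absolutely_integrable_on S' \<and>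
   integral S' (\<lambda>y. \<bar>det (matrix (g' y))\<bar> *\<^sub>R F (g y)) = vec (integral S' (\<lambda>y. ?G (unlabel y)))"
  unfolding F_def eq absolutely_integrable_on_1_iff integral_on_1_eq using A by simp
 then have "F absolutely_integrable_on g ` S' \<and> integral (g ` S') F = vec (integral S' (\<lambda>y. ?G (unlabel y)))"
  using has_absolute_integral_change_of_variables[OF _ der injg, of F] oS' by auto
 then have B1: "(\<lambda>y. f (unlabel y)) absolutely_integrable_on g ` S'" 
   and B2: "integral (g ` S') (\<lambda>y. f (unlabel y)) = integral S' (\<lambda>y. ?G (unlabel y))"
  unfolding F_def absolutely_integrable_on_1_iff integral_on_1_eq by (auto simp: vec_eq_iff)
 have indg: "indicator (g ` S') y = (indicator (\<Phi> ` S) (unlabel y) :: real)" for y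
  unfolding gS by (simp add: indicator_def)
 have mB: "(\<lambda>y. indicator (\<Phi> ` S) y * f y) \<in> borel_measurable borel"
  using f B by (intro borel_measurable_times) auto
 show "integrable lborel (\<lambda>y. indicator (\<Phi> ` S) y * f y)"
  using B1 absolutely_integrable_lborel(1)[OF mf gSb] lborel_integral_relabel(2)[OF mB] unfolding indg by simp
 show "(LINT y|lborel. indicator (\<Phi> ` S) y * f y) = (LINT x|lborel. indicator S x * ?G x)"
  using B2 I absolutely_integrable_lborel(2)[OF mf gSb B1] lborel_integral_relabel(1)[OF mB] unfolding indg by simp
qed

text \<open>A one-sided inverse of a square matrix already makes it invertible.\<close>

lemma jac_nonzero:
 fixes L :: "real^'d => real^'d"
 assumes "\<And>k l. (\<Sum>i\<in>UNIV. L (axis i 1) $ k * E i l) = (if k = l then 1 else 0)"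
 shows "0 < jac L"
proof -
 let ?A = "(\<chi> a b. L (axis (pos b) 1) $ pos a) :: real^('d idx)^('d idx)"
 let ?B = "(\<chi> a b. E (pos a) (pos b)) :: real^('d idx)^('d idx)"
 have "(\<Sum>c\<in>UNIV. L (axis (pos c) 1) $ pos a * E (pos c) (pos b)) = (if a = b then 1 else 0)" for a b :: "'d idx"
  using assms[of "pos a" "pos b"] sum_pos[of "\<lambda>i. L (axis i 1) $ pos a * E i (pos b)"] bij_pos[where 'd='d]
  by (auto simp: bij_def inj_eq)
 then have "?A ** ?B = mat 1" by (simp add: matrix_matrix_mult_def mat_def vec_eq_iff)
 then have "invertible ?A" using invertible_right_inverse by blast
 then have "det ?A \<noteq> 0" by (simp add: invertible_det_nz)
 then show ?thesis by (simp add: jac_def)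
qed

section \<open>The Laplacian transported to the unit ball\<close>

lemma continuous_on_compact_sqint:
 fixes f :: "real^'d => 'b::euclidean_space"
 assumes "continuous_on C f" "compact C" "open D" "D \<subseteq> C"
 shows "sqint (lebesgue_on D) f"
proof -
 have "bounded (f ` C)" using assms compact_continuous_image compact_imp_bounded by blast
 then obtain B where B: "\<And>x. x \<in> C ==> norm (f x) \<le> B" by (auto simp: bounded_iff)
 have "f \<in> borel_measurable (lebesgue_on D)"
  using assms by (intro continuous_imp_measurable_on_sets_lebesgue continuous_on_subset[of C f D]) auto
 moreover have "bounded D" using assms bounded_subset compact_imp_bounded by blast
 ultimately show ?thesis
  using assms B by (intro sqint_bounded[of _ f B] lebesgue_on_open_finite AE_I2) auto
qed

context deformation
begin

definition jet :: "(real^'d => real) => real^'d => (real^'d) \<times> (real^'d^'d)" where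
 "jet v y = (grad v y, hess v y)"

text \<open>Maps the gradient and Hessian of \<open>v\<close> to those of \<open>v \<circ> \<Phi> s\<close>.\<close>

definition pull :: "real => real^'d => (real^'d) \<times> (real^'d^'d) => (real^'d) \<times> (real^'d^'d)" where
 "pull s x q = (\<chi> i. \<Sum>k\<in>UNIV. fst q $ k * J k i s x,
  \<chi> j i. (\<Sum>k\<in>UNIV. \<Sum>l\<in>UNIV. snd q $ l $ k * J l j s x * J k i s x) + (\<Sum>k\<in>UNIV. fst q $ k * J1 k j i s x))"

text \<open>At \<open>y = \<Phi> s x\<close> this is the Laplacian of the composition of
  \<open>v\<close> with \<open>\<Phi> s\<close>, expressed through the jet of \<open>v\<close>; thus
  the operators for all parameters act on functions on one and the same ball.\<close>

definition Lop :: "real => (real^'d => real) => real^'d => real" where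
 "Lop s v y = mat 1 \<bullet> snd (pull s (\<Psi> s y) (jet v y))"

lemma linear_pull: "linear (pull s x)"
 by (rule linearI) (simp_all add: pull_def vec_eq_iff sum.distrib sum_distrib_left algebra_simps)

lemma continuous_jet: "smooth v ==> continuous_on S (jet v)"
 unfolding jet_def[abs_def] by (intro continuous_intros continuous_on_grad continuous_on_hess)

lemma smooth_J: "0 \<le> s ==> smooth (J k i s)"
 using smooth_partial[OF smooth_\<Phi>] partial_\<Phi> by metis

lemma smooth_comp: "0 \<le> s ==> p \<in> polys n ==> smooth (\<lambda>x. p (\<Phi> s x))"
 by (erule polys_smooth_compose) (rule smooth_\<Phi>)

lemma jet_comp:
 assumes s: "0 \<le> s" and v: "smooth v" "\<And>k. smooth (\<lambda>x. partial k v (\<Phi> s x))"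
 shows "jet (\<lambda>x. v (\<Phi> s x)) x = pull s x (jet v (\<Phi> s x))"
proof -
 have p: "partial i (\<lambda>x. v (\<Phi> s x)) = (\<lambda>x. \<Sum>k\<in>UNIV. partial k v (\<Phi> s x) * J k i s x)" if "smooth v" for i v
  using partial_compose[OF that smooth_\<Phi>[OF s]] partial_\<Phi>[OF s] by auto
 have "partial j (partial i (\<lambda>x. v (\<Phi> s x))) x =
  (\<Sum>k\<in>UNIV. \<Sum>l\<in>UNIV. partial l (partial k v) (\<Phi> s x) * J l j s x * J k i s x) + (\<Sum>k\<in>UNIV. partial k v (\<Phi> s x) * J1 k j i s x)" for i j
  unfolding p[OF v(1)] using v(2) smooth_J[OF s] p[OF smooth_partial[OF v(1)]] partial_J[OF s]
  by (simp add: partial_smooth_sum smooth_mult partial_smooth_mult sum.distrib sum_distrib_right)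
 then show ?thesis by (simp add: jet_def pull_def grad_def hess_def p[OF v(1)])
qed

text \<open>The map is block triangular: the gradient part is recovered first through the invertible
  Jacobian, and once it vanishes the Hessian part follows by inverting the Jacobian in each of its
  two indices.\<close>

lemma pull_eq_0:
 assumes s: "0 \<le> s" and q: "pull s x q = 0" shows "q = 0"
proof -
 have inj: "p = 0" if "\<And>i. (\<Sum>k\<in>UNIV. p $ k * J k i s x) = 0" for p :: "real^'d"
 proof -
  have "p $ l = (\<Sum>i\<in>UNIV. (\<Sum>k\<in>UNIV. p $ k * J k i s x) * E i l s x)" for l
  proof -
   have "(\<Sum>i\<in>UNIV. (\<Sum>k\<in>UNIV. p $ k * J k i s x) * E i l s x) = (\<Sum>k\<in>UNIV. p $ k * (\<Sum>i\<in>UNIV. J k i s x * E i l s x))"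
    unfolding sum_distrib_right sum_distrib_left mult.assoc by (rule sum.swap)
   then show ?thesis by (simp add: J_E[OF s] if_distrib[of "\<lambda>c. _ * c"] cong: if_cong)
  qed
  then show ?thesis by (simp add: that vec_eq_iff)
 qed
 have 1: "fst q = 0" using q by (intro inj) (simp add: pull_def vec_eq_iff prod_eq_iff)
 have "(\<chi> l. \<Sum>k\<in>UNIV. snd q $ l $ k * J k i s x) = 0" for i
 proof (rule inj)
  fix j
  have "(\<Sum>l\<in>UNIV. (\<chi> l. \<Sum>k\<in>UNIV. snd q $ l $ k * J k i s x) $ l * J l j s x) = (\<Sum>k\<in>UNIV. \<Sum>l\<in>UNIV. snd q $ l $ k * J l j s x * J k i s x)"
   unfolding vec_lambda_beta sum_distrib_right by (subst sum.swap) (simp add: mult_ac)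
  also have "\<dots> = snd (pull s x q) $ j $ i" by (simp add: pull_def 1)
  finally show "(\<Sum>l\<in>UNIV. (\<chi> l. \<Sum>k\<in>UNIV. snd q $ l $ k * J k i s x) $ l * J l j s x) = 0" using q by simp
 qed
 then have "snd q $ l = 0" for l by (intro inj) (simp add: vec_eq_iff)
 then show ?thesis using 1 by (simp add: prod_eq_iff vec_eq_iff)
qed

lemma continuous_pull: "continuous_on (K \<times> UNIV) (\<lambda>z. pull (fst (fst z)) (snd (fst z)) (snd z))"
proof -
 have "continuous_on (K \<times> (UNIV :: ((real^'d) \<times> (real^'d^'d)) set)) (\<lambda>z. f (fst (fst z)) (snd (fst z)))"
  if "continuous_on K (\<lambda>z. f (fst z) (snd z))" for f :: "real => real^'d => real"
  by (rule continuous_on_compose2[OF that]) (auto intro!: continuous_intros)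
 note this[OF continuous_J] this[OF continuous_J1]
 then show ?thesis unfolding pull_def by (intro continuous_intros)
qed

text \<open>Injectivity and compactness give a positive minimum of \<open>norm (pull s x q)\<close>
  over \<open>K\<close> times the unit sphere; linearity in \<open>q\<close> does the rest.\<close>

lemma norm_le_pull:
 obtains C where "0 < C" "\<And>s x q. (s, x) \<in> K ==> norm q \<le> C * norm (pull s x q)"
proof -
 let ?S = "K \<times> sphere 0 1 :: ((real \<times> (real^'d)) \<times> ((real^'d) \<times> (real^'d^'d))) set"
 let ?f = "\<lambda>z. norm (pull (fst (fst z)) (snd (fst z)) (snd z))"
 have "compact ?S" by (intro compact_Times compact_K compact_sphere)
 moreover have "continuous_on ?S ?f" by (intro continuous_on_norm continuous_on_subset[OF continuous_pull]) auto
 moreover have "((0, 0), (axis undefined 1, 0)) \<in> ?S" using P_eq_0[of 0] \<eta> by (simp add: K_def Q_def norm_Pair)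
 ultimately obtain z where z: "z \<in> ?S" "\<And>y. y \<in> ?S ==> ?f z \<le> ?f y" using continuous_attains_inf[of ?S ?f] by blast
 have m: "0 < ?f z" using z(1) pull_eq_0[of "fst (fst z)" "snd (fst z)" "snd z"] by (auto simp: K_def)
 show ?thesis
 proof (rule that[of "1 / ?f z"])
  fix s x and q :: "(real^'d) \<times> (real^'d^'d)" assume K: "(s, x) \<in> K"
  show "norm q \<le> 1 / ?f z * norm (pull s x q)"
  proof (cases "q = 0")
   case False
   then have "?f z \<le> norm (pull s x ((1 / norm q) *\<^sub>R q))" using z(2)[of "((s, x), (1 / norm q) *\<^sub>R q)"] K by simp
   also have "\<dots> = norm (pull s x q) / norm q" unfolding linear_scale[OF linear_pull] by simp
   finally show ?thesis using m False by (simp add: field_simps)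
  qed simp
 qed (use m in simp)
qed

definition Jd :: "real => real^'d => real" where
 "Jd s x = \<bar>det (\<chi> a b. J (pos a) (pos b) s x :: real^('d idx)^('d idx))\<bar>"

lemma continuous_Jd: "continuous_on K (\<lambda>z. Jd (fst z) (snd z))"
 unfolding Jd_def det_def by (intro continuous_intros) (auto intro!: continuous_J)

lemma continuous_Jd_space: "0 \<le> s ==> continuous_on S (Jd s)"
 unfolding Jd_def[abs_def] det_def by (intro continuous_intros) (auto intro!: smooth_continuous_on smooth_J)

lemma Jd_jac:
 assumes "0 \<le> s"
 shows "jac (\<lambda>h. \<chi> k. frechet_derivative (\<lambda>x. \<Phi> s x $ k) (at x) h) = Jd s x"
 unfolding jac_def Jd_def using partial_\<Phi>[OF assms] by (simp add: partial_def[symmetric])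

lemma Jd_pos: "0 \<le> s ==> 0 < Jd s x"
proof -
 assume s: "0 \<le> s"
 have "0 < jac (\<lambda>h. \<chi> k. frechet_derivative (\<lambda>x. \<Phi> s x $ k) (at x) h)"
  by (rule jac_nonzero[where E = "\<lambda>i l. E i l s x"])
    (use J_E[OF s] partial_\<Phi>[OF s] in \<open>simp add: partial_def[symmetric]\<close>)
 then show ?thesis by (simp add: Jd_jac[OF s])
qed

abbreviation Dom :: "real => (real^'d) set" where "Dom s \<equiv> {x. \<rho> s x < 0}"
abbreviation Bm :: "(real^'d) measure" where "Bm \<equiv> lebesgue_on (ball 0 1)"

lemma compact_dom: "0 \<le> s ==> compact {x. Q s x \<le> 1}"
proof -
 assume s: "0 \<le> s"
 have "bounded {x. Q s x \<le> 1}"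
  by (rule bounded_subset[OF bounded_cball[of 0 "1 / sqrt c"]]) (use Q_le_norm[OF s] in auto)
 moreover have "closed {x. Q s x \<le> 1}"
  by (intro closed_Collect_le smooth_continuous_on smooth_Q continuous_on_const)
 ultimately show ?thesis by (simp add: compact_eq_bounded_closed)
qed

lemma open_dom: "open (Dom s)" by (rule smooth_sublevel_open[OF smooth_\<rho>])
lemma dom_subset: "Dom s \<subseteq> {x. Q s x \<le> 1}" by (auto simp: \<rho>_def)

lemma finite_dom: "0 \<le> s ==> finite_measure (lebesgue_on (Dom s))"
 using open_dom convex_sublevel_\<rho> by (intro lebesgue_on_open_finite) (auto simp: convex_sublevel_def sublevel_domain_def)

lemma dom_K: "0 \<le> s ==> s \<le> 1 ==> x \<in> Dom s ==> (s, x) \<in> K"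
 by (auto simp: K_def \<rho>_def)

lemma \<Phi>_dom_ball: "0 \<le> s ==> x \<in> Dom s ==> \<Phi> s x \<in> ball 0 1"
 using \<Phi>_image_open by blast

lemma continuous_\<Phi>_space: "0 \<le> s ==> continuous_on S (\<Phi> s)"
proof -
 assume s: "0 \<le> s"
 have "continuous_on S (\<lambda>x. \<chi> k. \<Phi> s x $ k)" by (intro continuous_intros smooth_continuous_on smooth_\<Phi>[OF s])
 then show ?thesis by simp
qed

lemma integral_pullback:
 assumes s: "0 \<le> s" and f: "continuous_on (ball 0 1) f" and g: "continuous_on {x. Q s x \<le> 1} g"
  and fg: "\<And>x. x \<in> Dom s ==> f (\<Phi> s x) = g x"
 shows "(LINT y|Bm. f y) = (LINT x|lebesgue_on (Dom s). Jd s x * g x)"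
proof -
 define f0 where "f0 y = indicator (ball 0 1) y * f y" for y :: "real^'d"
 have f0m: "f0 \<in> borel_measurable borel"
  unfolding f0_def[abs_def] using borel_measurable_continuous_on_indicator[OF _ f] by simp
 have img: "\<Phi> s ` Dom s = ball 0 1" by (rule \<Phi>_image_open[OF s])
 have Pm: "\<Phi> s \<in> borel_measurable borel" by (intro borel_measurable_continuous_onI continuous_\<Phi>_space s)
 have fPm: "(\<lambda>x. f0 (\<Phi> s x)) \<in> borel_measurable borel" using measurable_compose[OF Pm f0m] by simp
 have Jm: "Jd s \<in> borel_measurable borel" by (intro borel_measurable_continuous_onI continuous_Jd_space s)
 have fgD: "f0 (\<Phi> s x) = g x" if "x \<in> Dom s" for x
  using \<Phi>_dom_ball[OF s that] fg[OF that] by (simp add: f0_def)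
 have "sqint (lebesgue_on (Dom s)) (\<lambda>x. Jd s x * g x)"
  by (rule continuous_on_compact_sqint[OF _ compact_dom[OF s] open_dom dom_subset])
    (intro continuous_intros continuous_Jd_space s g)
 then have i: "integrable (lebesgue_on (Dom s)) (\<lambda>x. Jd s x * g x)" by (rule sqint_integrable[OF finite_dom[OF s]])
 have mD: "Dom s \<in> sets lebesgue" using open_dom by simp
 have bD: "Dom s \<in> sets borel" using open_dom by simp
 have eqD: "(\<lambda>x. indicator (Dom s) x *\<^sub>R (Jd s x * g x)) = (\<lambda>x. indicator (Dom s) x * (Jd s x * f0 (\<Phi> s x)))"
  using fgD by (auto simp: indicator_def fun_eq_iff)
 have m1: "(\<lambda>x. indicator (Dom s) x * (Jd s x * f0 (\<Phi> s x))) \<in> borel_measurable lborel"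
  using bD Jm fPm by (intro borel_measurable_times) auto
 have "integrable lebesgue (\<lambda>x. indicator (Dom s) x *\<^sub>R (Jd s x * g x))"
  using i mD by (subst (asm) integrable_restrict_space) auto
 then have i2: "integrable lborel (\<lambda>x. indicator (Dom s) x * (jac (\<lambda>h. \<chi> k. frechet_derivative (\<lambda>x. \<Phi> s x $ k) (at x) h) * f0 (\<Phi> s x)))"
  unfolding Jd_jac[OF s] eqD using integrable_completion[OF m1] by simp
 have m2: "(\<lambda>x. jac (\<lambda>h. \<chi> k. frechet_derivative (\<lambda>x. \<Phi> s x $ k) (at x) h) * f0 (\<Phi> s x)) \<in> borel_measurable borel"
  unfolding Jd_jac[OF s] by (intro borel_measurable_times Jm fPm)
 have inj: "inj_on (\<Phi> s) (Dom s)" using inj_\<Phi>[OF s] inj_on_subset by blast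
 have bI: "\<Phi> s ` Dom s \<in> sets borel" by (simp add: img)
 have "(LINT y|lborel. indicator (\<Phi> s ` Dom s) y * f0 y) = (LINT x|lborel. indicator (Dom s) x * (jac (\<lambda>h. \<chi> k. frechet_derivative (\<lambda>x. \<Phi> s x $ k) (at x) h) * f0 (\<Phi> s x)))"
  by (rule change_of_variables_borel(2)[OF open_dom smooth_vec_differentiable[OF smooth_\<Phi>[OF s]] inj bI f0m m2 i2])
 also have "\<dots> = (LINT x|lebesgue. indicator (Dom s) x *\<^sub>R (Jd s x * g x))"
  unfolding Jd_jac[OF s] eqD by (rule integral_completion[OF m1, symmetric])
 also have "\<dots> = (LINT x|lebesgue_on (Dom s). Jd s x * g x)"
  by (rule integral_restrict_space[symmetric]) (use mD in auto)
 finally have "(LINT y|lborel. indicator (\<Phi> s ` Dom s) y * f0 y) = (LINT x|lebesgue_on (Dom s). Jd s x * g x)" .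
 moreover have "(\<lambda>y. indicator (\<Phi> s ` Dom s) y * f0 y) = f0" unfolding img by (auto simp: f0_def indicator_def fun_eq_iff)
 moreover have "(LINT y|Bm. f y) = (LINT y|Bm. f0 y)"
  by (rule Bochner_Integration.integral_cong) (auto simp: f0_def)
 moreover have "(LINT y|Bm. f0 y) = (LINT y|lborel. f0 y)"
  by (rule lebesgue_on_integral_vanishing[OF _ f0m]) (auto simp: f0_def)
 ultimately show ?thesis by simp
qed

text \<open>The Jacobian determinant is continuous and positive on the compact \<open>K\<close>,
  which yields two-sided bounds uniform in \<open>s\<close>. Only the norms of \<open>f\<close> and
  \<open>g\<close> are compared, so they may take values in different spaces.\<close>

lemma l2_pullback:
 obtains a b where "0 < a" "0 < b" "\<And>s f g. 0 \<le> s ==> s \<le> 1 ==> continuous_on (ball 0 1) f ==> continuous_on {x. Q s x \<le> 1} g ==>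
  (\<And>x. x \<in> Dom s ==> norm (f (\<Phi> s x) :: 'b::euclidean_space) = norm (g x :: 'c::euclidean_space)) ==>
  l2 (lebesgue_on (Dom s)) g \<le> a * l2 Bm f \<and> l2 Bm f \<le> b * l2 (lebesgue_on (Dom s)) g"
proof -
 have K0: "K \<noteq> {}" using P_eq_0[of 0] \<eta> by (auto simp: K_def Q_def intro!: exI[of _ 0])
 obtain z1 z2 where z: "z1 \<in> K" "\<And>z. z \<in> K ==> Jd (fst z1) (snd z1) \<le> Jd (fst z) (snd z)"
   "z2 \<in> K" "\<And>z. z \<in> K ==> Jd (fst z) (snd z) \<le> Jd (fst z2) (snd z2)"
  using continuous_attains_inf[OF compact_K K0 continuous_Jd] continuous_attains_sup[OF compact_K K0 continuous_Jd] by blast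
 define a b where "a = Jd (fst z1) (snd z1)" "b = Jd (fst z2) (snd z2)"
 have ab: "0 < a" "0 < b" using Jd_pos z(1,3) by (auto simp: a_b_def K_def)
 show ?thesis
 proof (rule that[of "sqrt (1 / a)" "sqrt b"])
  fix s :: real and f :: "real^'d => 'b" and g :: "real^'d => 'c"
  assume s: "0 \<le> s" "s \<le> 1" and f: "continuous_on (ball 0 1) f" and g: "continuous_on {x. Q s x \<le> 1} g"
   and fg: "\<And>x. x \<in> Dom s ==> norm (f (\<Phi> s x)) = norm (g x)"
  let ?M = "lebesgue_on (Dom s)"
  have J: "a \<le> Jd s x" "Jd s x \<le> b" if "x \<in> Dom s" for x using z(2,4)[OF dom_K[OF s that]] by (auto simp: a_b_def)
  have i: "integrable ?M (\<lambda>x. (norm (g x))\<^sup>2)" "integrable ?M (\<lambda>x. Jd s x * (norm (g x))\<^sup>2)"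
   by (rule sqint_integrable[OF finite_dom[OF s(1)] continuous_on_compact_sqint[OF _ compact_dom[OF s(1)] open_dom dom_subset]];
     intro continuous_intros continuous_Jd_space s g)+
  have e: "(l2 Bm f)\<^sup>2 = (LINT x|?M. Jd s x * (norm (g x))\<^sup>2)"
   unfolding l2_square by (rule integral_pullback[OF s(1)]) (auto simp: fg intro!: continuous_intros f g)
  have "(LINT x|?M. a * (norm (g x))\<^sup>2) \<le> (l2 Bm f)\<^sup>2" "(l2 Bm f)\<^sup>2 \<le> (LINT x|?M. b * (norm (g x))\<^sup>2)"
   unfolding e by (rule integral_mono; use i J in \<open>simp add: mult_right_mono\<close>)+
  then have "a * (l2 ?M g)\<^sup>2 \<le> (l2 Bm f)\<^sup>2" "(l2 Bm f)\<^sup>2 \<le> b * (l2 ?M g)\<^sup>2"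
   by (simp_all add: l2_square[of ?M])
  then have "(l2 ?M g)\<^sup>2 \<le> (sqrt (1 / a) * l2 Bm f)\<^sup>2" "(l2 Bm f)\<^sup>2 \<le> (sqrt b * l2 ?M g)\<^sup>2"
   using ab by (simp_all add: power_mult_distrib real_sqrt_pow2 field_simps)
  then show "l2 ?M g \<le> sqrt (1 / a) * l2 Bm f \<and> l2 Bm f \<le> sqrt b * l2 ?M g"
   using ab by (auto intro: power2_le_imp_le)
 qed (use ab in auto)
qed

lemma continuous_slice:
 assumes "continuous_on ({0..1} \<times> cball 0 1) (\<lambda>z. f (fst z) (snd z))" "0 \<le> s" "s \<le> 1"
 shows "continuous_on (cball 0 1) (\<lambda>y. f s y)"
proof -
 have "continuous_on (cball 0 1) (\<lambda>y. (\<lambda>z. f (fst z) (snd z)) (s, y))"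
  by (rule continuous_on_compose2[OF assms(1)]) (use assms(2,3) in \<open>auto intro!: continuous_intros\<close>)
 then show ?thesis by simp
qed

lemma continuous_symbol:
 "continuous_on (({0..1} \<times> cball 0 1) \<times> UNIV) (\<lambda>z. mat 1 \<bullet> snd (pull (fst (fst z)) (\<Psi> (fst (fst z)) (snd (fst z))) (snd z)))"
proof -
 have "continuous_on (({0..1} \<times> cball 0 1) \<times> UNIV) (\<lambda>z. \<Psi> (fst (fst z)) (snd (fst z)))"
  by (rule continuous_on_compose2[OF continuous_\<Psi>]) (auto intro!: continuous_intros)
 then have "continuous_on (({0..1} \<times> cball 0 1) \<times> UNIV)
   (\<lambda>z. (\<lambda>z. pull (fst (fst z)) (snd (fst z)) (snd z)) ((fst (fst z), \<Psi> (fst (fst z)) (snd (fst z))), snd z))"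
  by (intro continuous_on_compose2[OF continuous_pull] continuous_intros) (use \<Psi>(1) in auto)
 then show ?thesis by (auto intro!: continuous_intros)
qed

lemma continuous_Lop:
 assumes "0 \<le> s" "s \<le> 1" "smooth v" shows "continuous_on (cball 0 1) (Lop s v)"
proof -
 have "continuous_on (cball 0 1) (\<lambda>y. (\<lambda>z. mat 1 \<bullet> snd (pull (fst (fst z)) (\<Psi> (fst (fst z)) (snd (fst z))) (snd z))) ((s, y), jet v y))"
  by (rule continuous_on_compose2[OF continuous_symbol]) (use assms in \<open>auto intro!: continuous_intros continuous_jet\<close>)
 then show ?thesis by (simp add: Lop_def[abs_def])
qed

lemma sqint_Bm: "continuous_on (cball 0 1) f ==> sqint Bm (f :: _ => 'b::euclidean_space)"
 by (rule continuous_on_compact_sqint[of "cball 0 1"]) auto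

lemma Lop_\<Phi>:
 assumes "0 \<le> s" "s \<le> 1" "x \<in> Dom s" "smooth v" "\<And>k. smooth (\<lambda>x. partial k v (\<Phi> s x))"
 shows "Lop s v (\<Phi> s x) = lap (\<lambda>x. v (\<Phi> s x)) x"
 unfolding Lop_def \<Psi>_\<Phi>[OF dom_K[OF assms(1-3)]] jet_comp[OF assms(1,4,5), symmetric] by (simp add: jet_def lap_inner)

text \<open>The symbol is uniformly continuous on the compact set of parameters, points and unit
  jets; since \<open>Lop\<close> is linear in the jet, the error scales with its norm.\<close>

lemma Lop_uniform:
 assumes "0 < e"
 obtains d where "0 < d" "\<And>s t v y. 0 \<le> s ==> s \<le> 1 ==> 0 \<le> t ==> t \<le> 1 ==> \<bar>s - t\<bar> < d ==> y \<in> cball 0 1 ==>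
   \<bar>Lop s v y - Lop t v y\<bar> \<le> e * norm (jet v y)"
proof -
 let ?F = "\<lambda>z. mat 1 \<bullet> snd (pull (fst (fst z)) (\<Psi> (fst (fst z)) (snd (fst z))) (snd z))"
 let ?S = "({0..1} \<times> cball 0 1) \<times> sphere 0 1 :: ((real \<times> (real^'d)) \<times> ((real^'d) \<times> (real^'d^'d))) set"
 have "uniformly_continuous_on ?S ?F"
  by (intro compact_uniformly_continuous continuous_on_subset[OF continuous_symbol] compact_Times) auto
 then obtain d where d: "0 < d" "\<And>z z'. z \<in> ?S ==> z' \<in> ?S ==> dist z z' < d ==> dist (?F z) (?F z') < e"
  unfolding uniformly_continuous_on_def using assms by (metis dist_commute)
 show ?thesis
 proof (rule that[OF d(1)])
  fix s t :: real and v and y :: "real^'d"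
  assume h: "0 \<le> s" "s \<le> 1" "0 \<le> t" "t \<le> 1" "\<bar>s - t\<bar> < d" "y \<in> cball 0 1"
  let ?q = "jet v y"
  show "\<bar>Lop s v y - Lop t v y\<bar> \<le> e * norm ?q"
  proof (cases "?q = 0")
   case True then show ?thesis by (simp add: Lop_def linear_0[OF linear_pull])
  next
   case False
   have "dist (?F ((s, y), (1 / norm ?q) *\<^sub>R ?q)) (?F ((t, y), (1 / norm ?q) *\<^sub>R ?q)) < e"
    using h False by (intro d) (auto simp: dist_Pair_Pair dist_real_def)
   moreover have "?F ((r, y), (1 / norm ?q) *\<^sub>R ?q) = Lop r v y / norm ?q" for r
    by (simp add: Lop_def linear_scale[OF linear_pull])
   ultimately have "\<bar>Lop s v y - Lop t v y\<bar> / norm ?q < e" by (simp add: dist_real_def flip: diff_divide_distrib)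
   then show ?thesis using False by (simp add: field_simps)
  qed
 qed
qed

lemma smooth_ball_poly: "p \<in> polys n ==> smooth (\<lambda>y. ball_fn y * p y)"
 by (intro smooth_mult smooth_ball_fn polys_smooth)

lemma ball_fn_polys: "(ball_fn :: real^'d => real) \<in> polys 2"
proof -
 have "(\<lambda>x::real^'d. (\<Sum>i\<in>UNIV. x $ i * (x $ i * 1)) - 1) \<in> polys (Suc (Suc 0))"
  by (intro lspan_diff lspan_sum polys_coord polys_const)
 moreover have "ball_fn = (\<lambda>x::real^'d. (\<Sum>i\<in>UNIV. x $ i * (x $ i * 1)) - 1)"
  by (auto simp: ball_fn_def inner_vec_def)
 ultimately show ?thesis by (simp only: numeral_2_eq_2)
qed

lemma polys_partial: "p \<in> polys n ==> partial k p \<in> polys n" for p :: "real^'d => real"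
proof (induction rule: lspan.induct)
 case zero then show ?case by (simp add: lspan.zero)
next
 case (step f h a)
 have "smooth f" "smooth h" using step monomials_smooth polys_smooth by auto
 then have "partial k (\<lambda>x. a * f x + h x) = (\<lambda>x. a * partial k f x + partial k h x)"
  by (simp add: partial_smooth_add partial_smooth_cmult smooth_mult)
 then show ?case using step monomials_partial[OF step(1)] by (simp add: lspan_add lspan_scale)
qed

lemma smooth_ball_poly_comp:
 assumes "0 \<le> s" "p \<in> polys n"
 shows "smooth (\<lambda>x. partial k (\<lambda>y. ball_fn y * p y) (\<Phi> s x))"
 by (rule smooth_comp[OF assms(1) polys_partial[OF polys_mult[OF ball_fn_polys assms(2)]]])

text \<open>The boundary factor of the ball becomes the boundary factor of the domain, so that
  polynomial multiples of \<open>ball_fn\<close> turn into functions of the form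
  \<open>\<rho> s x * l x\<close>.\<close>

lemma ball_fn_\<Phi>: "0 \<le> s ==> ball_fn (\<Phi> s x) = \<rho> s x"
 by (simp add: ball_fn_def \<rho>_def \<Phi>_dot)

text \<open>The a priori estimate: the Miranda--Talenti inequality on the convex domains \<open>Dom s\<close>,
 transported to the ball with constants uniform in \<open>s\<close> by compactness.\<close>

lemma a_priori:
 obtains C where "0 < C" "\<And>s p n. 0 \<le> s ==> s \<le> 1 ==> p \<in> polys n ==>
  l2 Bm (jet (\<lambda>y. ball_fn y * p y)) \<le> C * l2 Bm (Lop s (\<lambda>y. ball_fn y * p y))"
proof -
 obtain C1 where C1: "0 < C1" "\<And>s x q. (s, x) \<in> K ==> norm q \<le> C1 * norm (pull s x q)" using norm_le_pull by blast
 obtain a where a: "0 < a" "\<And>s f g. 0 \<le> s ==> s \<le> 1 ==> continuous_on (ball 0 1) f ==> continuous_on {x. Q s x \<le> 1} g ==>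
   (\<And>x. x \<in> Dom s ==> norm (f (\<Phi> s x) :: real) = norm (g x :: real)) ==> l2 (lebesgue_on (Dom s)) g \<le> a * l2 Bm f"
  using l2_pullback by metis
 obtain b where b: "0 < b" "\<And>s f g. 0 \<le> s ==> s \<le> 1 ==> continuous_on (ball 0 1) f ==> continuous_on {x. Q s x \<le> 1} g ==>
   (\<And>x. x \<in> Dom s ==> norm (f (\<Phi> s x) :: (real^'d) \<times> (real^'d^'d)) = norm (g x :: (real^'d) \<times> (real^'d^'d))) ==>
   l2 Bm f \<le> b * l2 (lebesgue_on (Dom s)) g"
  using l2_pullback by metis
 define R where "R = 1 / sqrt c"
 have R: "0 < R" using c by (simp add: R_def)
 show ?thesis
 proof (rule that[of "b * C1 * (2 * R + 1) * a"])
  show "0 < b * C1 * (2 * R + 1) * a" using a b C1 R by (simp add: add_pos_pos)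
  fix s :: real and p :: "real^'d => real" and n assume s: "0 \<le> s" "s \<le> 1" and p: "p \<in> polys n"
  interpret dom: convex_sublevel "\<rho> s" by (rule convex_sublevel_\<rho>[OF s(1)])
  have DD: "dom.D = Dom s" by (rule dom.D_def)
  define v where "v = (\<lambda>y. ball_fn y * p y)"
  define w where "w = (\<lambda>x. \<rho> s x * p (\<Phi> s x))"
  have v: "smooth v" "\<And>k. smooth (\<lambda>x. partial k v (\<Phi> s x))"
   unfolding v_def using smooth_ball_poly[OF p] smooth_ball_poly_comp[OF s(1) p] by auto
  have wv: "w = (\<lambda>x. v (\<Phi> s x))" by (simp add: w_def v_def ball_fn_\<Phi>[OF s(1)])
  have sl: "smooth (\<lambda>x. p (\<Phi> s x))" by (rule smooth_comp[OF s(1) p])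
  have w: "smooth w" unfolding w_def by (intro smooth_mult smooth_\<rho> sl)
  have cv: "continuous_on S (\<lambda>x. jet v (\<Phi> s x))" for S
   by (rule continuous_on_compose2[OF continuous_jet[OF v(1), of UNIV] continuous_\<Phi>_space[OF s(1)]]) auto
  have "l2 Bm (jet v) \<le> b * l2 dom.M (\<lambda>x. jet v (\<Phi> s x))"
   unfolding DD by (rule b(2)[OF s continuous_jet[OF v(1)] cv]) simp
  also have "l2 dom.M (\<lambda>x. jet v (\<Phi> s x)) \<le> l2 dom.M (\<lambda>x. C1 *\<^sub>R jet w x)"
  proof (rule l2_mono[OF sqint_scaleR[OF dom.sqint_continuous[OF continuous_jet[OF w]]] sqintD(1)[OF dom.sqint_continuous[OF cv]]], intro AE_I2)
   fix x assume "x \<in> space dom.M"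
   then have "(s, x) \<in> K" using dom_K[OF s] by (simp add: DD)
   then show "norm (jet v (\<Phi> s x)) \<le> norm (C1 *\<^sub>R jet w x)"
    using C1 unfolding wv jet_comp[OF s(1) v] by simp
  qed
  also have "\<dots> = C1 * l2 dom.M (jet w)" unfolding l2_scaleR using C1(1) by simp
  also have "l2 dom.M (jet w) \<le> l2 dom.M (grad w) + l2 dom.M (hess w)"
   unfolding jet_def[abs_def] by (rule l2_Pair_le(3)[OF dom.sqint_grad[OF w] dom.sqint_hess[OF w]])
  also have "\<dots> \<le> 2 * R * l2 dom.M (lap w) + l2 dom.M (lap w)"
  proof (intro add_mono)
   have "norm x \<le> R" if "x \<in> dom.D" for x
    using that Q_le_norm[OF s(1), of x] by (simp add: DD \<rho>_def R_def)
   from dom.gradient_estimate[OF sl this] R show "l2 dom.M (grad w) \<le> 2 * R * l2 dom.M (lap w)" unfolding w_def by simp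
   show "l2 dom.M (hess w) \<le> l2 dom.M (lap w)" using dom.miranda_talenti[OF sl] unfolding w_def .
  qed
  also have "\<dots> = (2 * R + 1) * l2 dom.M (lap w)" by (simp add: distrib_right)
  also have "l2 dom.M (lap w) \<le> a * l2 Bm (Lop s v)"
   unfolding DD
  proof (rule a(2)[OF s])
   show "continuous_on (ball 0 1) (Lop s v)" by (rule continuous_on_subset[OF continuous_Lop[OF s v(1)]]) auto
   show "continuous_on {x. Q s x \<le> 1} (lap w)" by (intro smooth_continuous_on smooth_lap w)
   show "norm (Lop s v (\<Phi> s x)) = norm (lap w x)" if "x \<in> Dom s" for x using Lop_\<Phi>[OF s that v] by (simp add: wv)
  qed
  finally show "l2 Bm (jet (\<lambda>y. ball_fn y * p y)) \<le> b * C1 * (2 * R + 1) * a * l2 Bm (Lop s (\<lambda>y. ball_fn y * p y))"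
   using b C1 R by (simp add: v_def mult.assoc mult_left_mono)
 qed
qed

end

text \<open>Density of the range travels from \<open>t\<close> to \<open>s\<close> when the
  operators differ by a small multiple of the operator at \<open>t\<close>; since \<open>d\<close>
  does not depend on the parameter, finitely many steps lead from 0 to 1. \<open>p\<close> and
  \<open>z\<close> stand for addition and zero on the index set \<open>W\<close>.\<close>

lemma continuity_method:
 fixes T :: "real => 'w => 'a => real"
 assumes sq: "\<And>g. g \<in> G ==> sqint M g"
  and TG: "\<And>s w. 0 \<le> s ==> s \<le> 1 ==> w \<in> W ==> T s w \<in> G"
  and diff: "\<And>f g. f \<in> G ==> g \<in> G ==> (\<lambda>x. f x - g x) \<in> G"
  and zero: "z \<in> W" "\<And>s x. T s z x = 0"
  and add: "\<And>v w. v \<in> W ==> w \<in> W ==> p v w \<in> W" "\<And>s v w x. v \<in> W ==> w \<in> W ==> T s (p v w) x = T s v x + T s w x"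
  and d: "0 < d" "\<And>s t w. 0 \<le> s ==> s \<le> 1 ==> 0 \<le> t ==> t \<le> 1 ==> \<bar>s - t\<bar> < d ==> w \<in> W ==>
    l2 M (\<lambda>x. T s w x - T t w x) \<le> l2 M (T t w) / 5"
  and dense_0: "\<And>g e. g \<in> G ==> 0 < e ==> \<exists>w\<in>W. l2 M (\<lambda>x. T 0 w x - g x) < e"
  and g: "g \<in> G" and e: "0 < e"
 shows "\<exists>w\<in>W. l2 M (\<lambda>x. T 1 w x - g x) < e"
proof -
 define dns where "dns s \<longleftrightarrow> (\<forall>g\<in>G. \<forall>e>0. \<exists>w\<in>W. l2 M (\<lambda>x. T s w x - g x) < e)" for s
 have T0: "l2 M (\<lambda>x. T s z x - g x) = l2 M g" for s g by (simp add: zero)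
 have step: "dns s" if h: "0 \<le> s" "s \<le> 1" "0 \<le> t" "t \<le> 1" "\<bar>s - t\<bar> < d" and D: "dns t" for s t
 proof -
  \<comment> \<open>Relative to the norm of \<open>g\<close>: an approximation with error
    \<open>1/4\<close> leaves \<open>T t w\<close> of norm at most \<open>5/4\<close>, and the
    factor \<open>1/5\<close> turns this into another \<open>1/4\<close>, so the residual is
    halved.\<close>
  have half: "\<exists>w\<in>W. l2 M (\<lambda>x. T s w x - g x) \<le> l2 M g / 2" if g: "g \<in> G" for g
  proof (cases "l2 M g = 0")
   case True then show ?thesis using T0[of s g] zero(1) by (intro bexI[of _ z]) auto
  next
   case False
   then have "0 < l2 M g / 4" by (simp add: order_less_le)
   then obtain w where w: "w \<in> W" "l2 M (\<lambda>x. T t w x - g x) < l2 M g / 4" using D g unfolding dns_def by blast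
   have s': "sqint M (T s w)" "sqint M (T t w)" "sqint M g" using TG h w g sq by auto
   have "l2 M (T t w) \<le> l2 M g + l2 M (\<lambda>x. T t w x - g x)" by (rule l2_triangle_rev[OF s'(2,3)])
   then have "l2 M (T t w) \<le> 5/4 * l2 M g" using w(2) by linarith
   then have "l2 M (\<lambda>x. T s w x - T t w x) \<le> l2 M g / 4" using d(2)[OF h w(1)] by linarith
   then have "l2 M (\<lambda>x. T s w x - g x) \<le> l2 M g / 2"
    using l2_triangle_mid[OF s'(1,3,2)] w(2) by linarith
   then show ?thesis using w(1) by blast
  qed
  \<comment> \<open>The halving is applied again to the residual, and the corrections are added
    up.\<close>
  have it: "\<exists>w\<in>W. l2 M (\<lambda>x. T s w x - g x) \<le> l2 M g / 2 ^ m" if g: "g \<in> G" for g m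
  proof (induction m)
   case 0 then show ?case using T0[of s g] zero(1) by (intro bexI[of _ z]) auto
  next
   case (Suc m)
   then obtain v where v: "v \<in> W" "l2 M (\<lambda>x. T s v x - g x) \<le> l2 M g / 2 ^ m" by blast
   have "(\<lambda>x. g x - T s v x) \<in> G" using diff g TG h v by auto
   from half[OF this] obtain w where w: "w \<in> W" "l2 M (\<lambda>x. T s w x - (g x - T s v x)) \<le> l2 M (\<lambda>x. g x - T s v x) / 2" by blast
   have "(\<lambda>x. T s (p v w) x - g x) = (\<lambda>x. T s w x - (g x - T s v x))" using add(2)[OF v(1) w(1)] by auto
   then have "l2 M (\<lambda>x. T s (p v w) x - g x) \<le> l2 M g / 2 ^ Suc m"
    using w(2) v(2) l2_minus_commute[of M g "T s v"] by simp
   then show ?case using add(1)[OF v(1) w(1)] by blast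
  qed
  show ?thesis
   unfolding dns_def
  proof (intro ballI allI impI)
   fix g and e :: real assume g: "g \<in> G" and e: "0 < e"
   obtain m where m: "l2 M g / e < 2 ^ m" using real_arch_pow[of 2 "l2 M g / e"] by auto
   have "l2 M g / 2 ^ m < e" using m e by (simp add: field_simps)
   then show "\<exists>w\<in>W. l2 M (\<lambda>x. T s w x - g x) < e" using it[OF g, of m] by (meson le_less_trans)
  qed
 qed
 obtain N where N: "1 / real (Suc N) < d" using nat_approx_posE[OF d(1)] by blast
 have "dns (real k / real (Suc N))" if "k \<le> Suc N" for k
  using that
 proof (induction k)
  case 0 then show ?case using dense_0 by (simp add: dns_def)
 next
  case (Suc k)
  have eq: "\<bar>real (Suc k) / real (Suc N) - real k / real (Suc N)\<bar> = 1 / real (Suc N)"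
   by (simp add: diff_divide_distrib[symmetric])
  have le: "real j / real (Suc N) \<le> 1" if "j \<le> Suc N" for j
   using that by (subst divide_le_eq_1_pos) (simp_all del: of_nat_Suc)
  show ?case
  proof (rule step[of _ "real k / real (Suc N)"])
   show "\<bar>real (Suc k) / real (Suc N) - real k / real (Suc N)\<bar> < d" using N by (simp only: eq)
   show "dns (real k / real (Suc N))" using Suc.prems by (intro Suc.IH) simp
  qed (use Suc.prems in \<open>auto intro!: le simp del: of_nat_Suc\<close>)
 qed
 from this[of "Suc N"] have "dns 1" by simp
 then show ?thesis using g e unfolding dns_def by blast
qed

context deformation
begin

lemma Lop_add:
 assumes "smooth v" "smooth w" shows "Lop s (\<lambda>y. v y + w y) y = Lop s v y + Lop s w y"
proof -
 have "jet (\<lambda>y. v y + w y) y = jet v y + jet w y"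
  using assms by (simp add: jet_def grad_def hess_def partial_smooth_add smooth_partial vec_eq_iff)
 then show ?thesis by (simp add: Lop_def linear_add[OF linear_pull] inner_add_right)
qed

text \<open>At parameter 0 the map \<open>\<Phi>\<close> is multiplication by \<open>sqrt c\<close>,
  so the method starts from the Laplacian on the ball.\<close>

lemma Lop_0: "Lop 0 v y = c * lap v y"
proof -
 have "\<sigma> 0 x * \<sigma> 0 x = c" for x using \<sigma>_square[of 0 x] by simp
 moreover have "J k i 0 x = (if i = k then \<sigma> 0 x else 0)" "J1 k j i 0 x = 0" for k j i x
  by (simp_all add: J_def J1_def \<sigma>1_def \<sigma>2_def)
 ultimately show ?thesis
  by (simp add: Lop_def pull_def jet_def lap_inner inner_mat mat_def hess_def sum_distrib_left
    if_distrib[of "\<lambda>c. c * _"] if_distrib[of "\<lambda>c. _ * c"] mult_ac cong: if_cong)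
qed

lemma ball_polys_dense:
 assumes g: "continuous_on (cball 0 1) g" and e: "0 < e"
 shows "\<exists>p\<in>\<Union>n. polys n. l2 Bm (\<lambda>y. Lop 1 (\<lambda>y. ball_fn y * p y) y - g y) < e"
proof -
 obtain C where C: "0 < C" "\<And>s p n. 0 \<le> s ==> s \<le> 1 ==> p \<in> polys n ==>
  l2 Bm (jet (\<lambda>y. ball_fn y * p y)) \<le> C * l2 Bm (Lop s (\<lambda>y. ball_fn y * p y))" using a_priori by blast
 \<comment> \<open>Against the a priori constant \<open>C\<close> this modulus becomes the relative
   factor \<open>1/5\<close> of \<open>continuity_method\<close>.\<close>
 have "0 < 1 / (5 * C)" using C(1) by simp
 then obtain d where d: "0 < d" "\<And>s t v y. 0 \<le> s ==> s \<le> 1 ==> 0 \<le> t ==> t \<le> 1 ==> \<bar>s - t\<bar> < d ==> y \<in> cball 0 1 ==>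
   \<bar>Lop s v y - Lop t v y\<bar> \<le> 1 / (5 * C) * norm (jet v y)" using Lop_uniform by blast
 have bp: "smooth (\<lambda>y. ball_fn y * p y)" if "p \<in> (\<Union>n. polys n)" for p using that smooth_ball_poly by blast
 show ?thesis
 proof (rule continuity_method[where T = "\<lambda>s p. Lop s (\<lambda>y. ball_fn y * p y)" and G = "{g. continuous_on (cball 0 1) g}"
    and z = "\<lambda>x. 0" and p = "\<lambda>v w x. v x + w x" and d = d])
  show "Lop s (\<lambda>y. ball_fn y * 0) x = 0" for s x
  proof -
   have "jet (\<lambda>y. ball_fn y * 0) y = 0" for y by (simp add: jet_def grad_def hess_def prod_eq_iff vec_eq_iff)
   then show ?thesis by (simp add: Lop_def linear_0[OF linear_pull])
  qed
  show "(\<lambda>x. 0) \<in> (\<Union>n. polys n)" using polys_const[of 0 0] by blast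
  fix v w :: "real^'d => real" assume vw: "v \<in> (\<Union>n. polys n)" "w \<in> (\<Union>n. polys n)"
  then obtain n m where "v \<in> polys n" "w \<in> polys m" by blast
  then have "(\<lambda>x. v x + w x) \<in> polys (max n m)"
   using polys_mono[of v n "max n m"] polys_mono[of w m "max n m"] by (intro lspan_add) auto
  then show "(\<lambda>x. v x + w x) \<in> (\<Union>n. polys n)" by blast
  show "Lop s (\<lambda>y. ball_fn y * (v y + w y)) x = Lop s (\<lambda>y. ball_fn y * v y) x + Lop s (\<lambda>y. ball_fn y * w y) x" for s x
   unfolding distrib_left by (rule Lop_add[OF bp[OF vw(1)] bp[OF vw(2)]])
 next
  fix s t and p :: "real^'d => real"
  assume h: "0 \<le> s" "s \<le> 1" "0 \<le> t" "t \<le> 1" "\<bar>s - t\<bar> < d" and "p \<in> (\<Union>n. polys n)"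
  then obtain n where p: "p \<in> polys n" by blast
  define v where "v = (\<lambda>y. ball_fn y * p y)"
  have v: "smooth v" unfolding v_def by (rule smooth_ball_poly[OF p])
  have "l2 Bm (\<lambda>y. Lop s v y - Lop t v y) \<le> l2 Bm (\<lambda>y. (1 / (5 * C)) *\<^sub>R jet v y)"
  proof (rule l2_mono[OF sqint_scaleR[OF sqint_Bm[OF continuous_jet[OF v]]]], intro sqintD(1) sqint_diff sqint_Bm continuous_Lop h v, intro AE_I2)
   fix y assume "y \<in> space Bm"
   then have "y \<in> cball 0 1" by auto
   from d(2)[OF h this, of v] show "norm (Lop s v y - Lop t v y) \<le> norm ((1 / (5 * C)) *\<^sub>R jet v y)" using C(1) by simp
  qed
  also have "\<dots> \<le> 1 / (5 * C) * (C * l2 Bm (Lop t v))"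
   unfolding l2_scaleR using C(2)[OF h(3,4) p] C(1) by (simp add: v_def pos_divide_le_eq mult.commute)
  finally show "l2 Bm (\<lambda>y. Lop s (\<lambda>y. ball_fn y * p y) y - Lop t (\<lambda>y. ball_fn y * p y) y) \<le> l2 Bm (Lop t (\<lambda>y. ball_fn y * p y)) / 5"
   using C(1) by (simp add: v_def)
 next
  fix g :: "real^'d => real" and e :: real assume g: "g \<in> {g. continuous_on (cball 0 1) g}" and e: "0 < e"
  have "continuous_on (cball 0 1) (\<lambda>y. g y / c)" using g c by (auto intro!: continuous_intros)
  then obtain p n where p: "p \<in> polys n" "l2 Bm (\<lambda>x. lap (\<lambda>x. ball_fn x * p x) x - g x / c) < e / c"
   using ball_range_dense[of "\<lambda>y. g y / c" "e / c"] e c by auto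
  have "(\<lambda>y. Lop 0 (\<lambda>y. ball_fn y * p y) y - g y) = (\<lambda>y. c *\<^sub>R (lap (\<lambda>x. ball_fn x * p x) y - g y / c))"
   using c by (auto simp: Lop_0 right_diff_distrib)
  then have "l2 Bm (\<lambda>y. Lop 0 (\<lambda>y. ball_fn y * p y) y - g y) < e"
   using p(2) c by (simp only: l2_scaleR) (simp add: field_simps)
  then show "\<exists>p\<in>\<Union>n. polys n. l2 Bm (\<lambda>y. Lop 0 (\<lambda>y. ball_fn y * p y) y - g y) < e" using p(1) by blast
 qed (use g e d(1) bp in \<open>auto intro!: sqint_Bm continuous_intros continuous_Lop\<close>)
qed

text \<open>The right-hand side is carried to the ball by \<open>\<Psi> 1\<close>, approximated
  there, and the approximant is carried back by \<open>\<Phi> 1\<close>, which changes norms by a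
  bounded factor only.\<close>

lemma range_dense:
 assumes g: "continuous_on {x. Q 1 x \<le> 1} g" and e: "0 < e"
 shows "\<exists>l. smooth l \<and> l2 (lebesgue_on (Dom 1)) (\<lambda>x. lap (\<lambda>x. \<rho> 1 x * l x) x - g x) < e"
proof -
 obtain a b where a: "0 < a" "\<And>s f g. 0 \<le> s ==> s \<le> 1 ==> continuous_on (ball 0 1) f ==> continuous_on {x. Q s x \<le> 1} g ==>
   (\<And>x. x \<in> Dom s ==> norm (f (\<Phi> s x) :: real) = norm (g x :: real)) ==>
   l2 (lebesgue_on (Dom s)) g \<le> a * l2 Bm f \<and> l2 Bm f \<le> b * l2 (lebesgue_on (Dom s)) g"
  using l2_pullback by metis
 have "continuous_on (cball 0 1) (\<lambda>y. g (\<Psi> 1 y))"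
  by (rule continuous_on_compose2[OF g continuous_slice[OF continuous_\<Psi>]]) (use \<Psi>(1)[of 1] in \<open>auto simp: K_def\<close>)
 note cg = this
 obtain n p where p: "p \<in> polys n" "l2 Bm (\<lambda>y. Lop 1 (\<lambda>y. ball_fn y * p y) y - g (\<Psi> 1 y)) < e / a"
  using ball_polys_dense[OF cg, of "e / a"] a(1) e by auto
 define v where "v = (\<lambda>y. ball_fn y * p y)"
 define w where "w = (\<lambda>x. \<rho> 1 x * p (\<Phi> 1 x))"
 have v: "smooth v" "\<And>k. smooth (\<lambda>x. partial k v (\<Phi> 1 x))"
  unfolding v_def using smooth_ball_poly[OF p(1)] smooth_ball_poly_comp[OF _ p(1), of 1] by auto
 have wv: "w = (\<lambda>x. v (\<Phi> 1 x))" by (simp add: w_def v_def ball_fn_\<Phi>)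
 have sl: "smooth (\<lambda>x. p (\<Phi> 1 x))" by (rule smooth_comp[OF _ p(1)]) simp
 have w: "smooth w" unfolding w_def by (intro smooth_mult smooth_\<rho> sl)
 have "l2 (lebesgue_on (Dom 1)) (\<lambda>x. lap w x - g x) \<le> a * l2 Bm (\<lambda>y. Lop 1 v y - g (\<Psi> 1 y))"
 proof (rule a(2)[THEN conjunct1])
  show "continuous_on (ball 0 1) (\<lambda>y. Lop 1 v y - g (\<Psi> 1 y))"
   by (intro continuous_intros continuous_on_subset[OF continuous_Lop[OF _ _ v(1)]] continuous_on_subset[OF cg]) auto
  show "continuous_on {x. Q 1 x \<le> 1} (\<lambda>x. lap w x - g x)"
   by (intro continuous_intros smooth_continuous_on smooth_lap w g)
  show "norm (Lop 1 v (\<Phi> 1 x) - g (\<Psi> 1 (\<Phi> 1 x))) = norm (lap w x - g x)" if "x \<in> Dom 1" for x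
   using Lop_\<Phi>[OF _ _ that v] \<Psi>_\<Phi>[OF dom_K[OF _ _ that]] by (simp add: wv)
 qed auto
 also have "\<dots> < e" using p(2) a(1) by (simp add: v_def field_simps)
 finally show ?thesis using sl unfolding w_def by blast
qed

end

section \<open>Smooth convex exhaustion\<close>

text \<open>A convex function is replaced by a smooth one: outside \<open>\<Omega>\<close> some supporting half-space
 \<open>l \<bullet> x > 1\<close> is entered, and there the penalty \<open>\<kappa> conv_fn (l \<bullet> x - 1)\<close> exceeds \<open>2\<close>.\<close>

definition good_domain :: "(real^'d => real) => bool" where
 "good_domain r \<longleftrightarrow> convex_sublevel r \<and> compact {x. r x \<le> 0} \<and>
  (\<forall>g e. continuous_on {x. r x \<le> 0} g \<longrightarrow> 0 < e \<longrightarrow>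
   (\<exists>l. smooth l \<and> l2 (lebesgue_on {x. r x < 0}) (\<lambda>x. lap (\<lambda>x. r x * l x) x - g x) < e))"

lemma convex_exhaustion_0:
 fixes \<Omega> :: "(real^'d) set"
 assumes "open \<Omega>" "bounded \<Omega>" "convex \<Omega>" "0 \<in> \<Omega>" "compact K" "K \<subseteq> \<Omega>"
 obtains r where "good_domain r" "K \<subseteq> {x. r x < 0}" "{x. r x \<le> 0} \<subseteq> \<Omega>"
proof -
 obtain R where R: "0 < R" "\<And>x. x \<in> \<Omega> ==> norm x \<le> R" using assms(2) by (meson bounded_pos)
 \<comment> \<open>The quadratic part is at most \<open>1/4\<close> on \<open>\<Omega>\<close>, and
   it confines the sublevel set to the ball of radius \<open>2 * R\<close>.\<close>
 define c where "c = 1 / (4 * R\<^sup>2)"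
 have c: "0 < c" using R by (simp add: c_def)
 \<comment> \<open>With the origin in the hull, a strictly separating hyperplane can be normalised
   to level 1; the hull stays in the convex set \<open>\<Omega>\<close>.\<close>
 define K' where "K' = convex hull (insert 0 K)"
 have K': "compact K'" "convex K'" "0 \<in> K'" "K \<subseteq> K'" "K' \<subseteq> \<Omega>"
  unfolding K'_def using assms by (auto intro!: compact_convex_hull hull_inc subset_hull[THEN iffD2] compact_insert
    simp: hull_minimal)
 have sep: "\<exists>l. l \<bullet> y > 1 \<and> (\<forall>x\<in>K'. l \<bullet> x \<le> 1)" if "y \<notin> \<Omega>" for y
 proof -
  have "y \<notin> K'" using that K'(5) by blast
  then obtain a b where ab: "a \<bullet> y < b" "\<forall>x\<in>K'. b < a \<bullet> x"
   using separating_hyperplane_closed_point[OF K'(2) compact_imp_closed[OF K'(1)]] by blast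
  have b: "b < 0" using ab(2) K'(3) by force
  have "(1 / b) *\<^sub>R a \<bullet> y > 1" using ab(1) b by (simp add: field_simps)
  moreover have "(1 / b) *\<^sub>R a \<bullet> x \<le> 1" if "x \<in> K'" for x
   using ab(2) that b by (auto simp: field_simps intro: less_imp_le)
  ultimately show ?thesis by blast
 qed
 \<comment> \<open>The only part of the complement that the quadratic part does not exclude. It is
   compact, hence finitely many half-spaces suffice.\<close>
 define Z where "Z = cball 0 (2 * R) - \<Omega>"
 have Z: "compact Z" unfolding Z_def using assms(1) by (intro compact_diff) auto
 define \<L> where "\<L> = {l. \<forall>x\<in>K'. l \<bullet> x \<le> 1}"
 have "Z \<subseteq> (\<Union>l\<in>\<L>. {y. l \<bullet> y > 1})" using sep by (auto simp: Z_def \<L>_def)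
 then obtain \<Lambda> where \<Lambda>: "\<Lambda> \<subseteq> \<L>" "finite \<Lambda>" "Z \<subseteq> (\<Union>l\<in>\<Lambda>. {y. l \<bullet> y > 1})"
  using compactE_image[OF Z, of \<L> "\<lambda>l. {y. l \<bullet> y > 1}"] by (metis open_halfspace_gt)
 define S where "S y = (\<Sum>l\<in>\<Lambda>. conv_fn (l \<bullet> y - 1))" for y
 have Sc: "continuous_on Z S" unfolding S_def[abs_def] by (intro smooth_continuous_on smooth_intros)
 have Sp: "0 < S y" if "y \<in> Z" for y
 proof -
  obtain l where "l \<in> \<Lambda>" "l \<bullet> y > 1" using \<Lambda>(3) \<open>y \<in> Z\<close> by blast
  then show ?thesis unfolding S_def using \<Lambda>(2) by (intro sum_pos2[of _ l]) (auto simp: conv_fn_pos conv_fn_nonneg)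
 qed
 obtain \<delta> where \<delta>: "0 < \<delta>" "\<And>y. y \<in> Z ==> \<delta> \<le> S y"
 proof (cases "Z = {}")
  case True then show ?thesis using that[of 1] by simp
 next
  case False
  then obtain z where "z \<in> Z" "\<And>y. y \<in> Z ==> S z \<le> S y" using continuous_attains_inf[OF Z False Sc] by blast
  then show ?thesis using that[of "S z"] Sp by blast
 qed
 define \<kappa> where "\<kappa> = 2 / \<delta>"
 \<comment> \<open>\<open>1 / m\<close> serves as the \<open>\<eta>\<close> of the deformation, the
   radius of a ball without penalty; the 1 inserted into the set also covers an empty
   \<open>\<Lambda>\<close>.\<close>
 define m where "m = Max (insert 1 (norm ` \<Lambda>))"
 have m: "1 \<le> m" "\<And>l. l \<in> \<Lambda> ==> norm l \<le> m" unfolding m_def using \<Lambda>(2) by (auto intro: Max_ge)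
 interpret def: deformation c \<kappa> "1 / m" \<Lambda>
  by standard (use c \<delta>(1) m \<Lambda>(2) in \<open>auto simp: \<kappa>_def divide_simps\<close>)
 have P: "def.P x = \<kappa> * S x" for x by (simp add: def.P_def S_def)
 have "good_domain (def.\<rho> 1)"
  unfolding good_domain_def
 proof (intro conjI allI impI)
  show "convex_sublevel (def.\<rho> 1)" by (rule def.convex_sublevel_\<rho>) simp
  have e: "{x. def.\<rho> 1 x \<le> 0} = {x. def.Q 1 x \<le> 1}" by (simp add: def.\<rho>_def)
  show "compact {x. def.\<rho> 1 x \<le> 0}" unfolding e by (rule def.compact_dom) simp
  fix g :: "real^'d => real" and e assume "continuous_on {x. def.\<rho> 1 x \<le> 0} g" "0 < (e::real)"
  then show "\<exists>l. smooth l \<and> l2 (lebesgue_on {x. def.\<rho> 1 x < 0}) (\<lambda>x. lap (\<lambda>x. def.\<rho> 1 x * l x) x - g x) < e"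
   unfolding e by (rule def.range_dense)
 qed
 moreover have "K \<subseteq> {x. def.\<rho> 1 x < 0}"
 proof
  fix x assume "x \<in> K"
  then have x: "x \<in> K'" using K'(4) by blast
  have "S x = 0" unfolding S_def using \<Lambda>(1) x by (intro sum.neutral) (auto simp: conv_fn_eq_0 \<L>_def)
  moreover have "c * (x \<bullet> x) < 1"
  proof -
   have "norm x \<le> R" using x K'(5) R(2) by blast
   then have "x \<bullet> x \<le> R\<^sup>2" by (simp add: power2_norm_eq_inner[symmetric] power_mono)
   then have "c * (x \<bullet> x) \<le> c * R\<^sup>2" using c by simp
   also have "\<dots> < 1" using R(1) by (simp add: c_def)
   finally show ?thesis .
  qed
  ultimately show "x \<in> {x. def.\<rho> 1 x < 0}" by (simp add: def.\<rho>_def def.Q_def P)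
 qed
 moreover have "{x. def.\<rho> 1 x \<le> 0} \<subseteq> \<Omega>"
 proof (rule ccontr)
  assume "\<not> ?thesis"
  then obtain x where x: "def.Q 1 x \<le> 1" "x \<notin> \<Omega>" by (auto simp: def.\<rho>_def)
  have "norm x \<le> 1 / sqrt c" using def.Q_le_norm[OF _ x(1)] by simp
  also have "\<dots> = 2 * R" using R(1) by (simp add: c_def real_sqrt_divide real_sqrt_mult)
  finally have "x \<in> Z" using x(2) by (simp add: Z_def)
  from \<delta>(2)[OF this] have "2 \<le> \<kappa> * S x" using \<delta>(1) by (simp add: \<kappa>_def field_simps)
  moreover have "0 \<le> c * (x \<bullet> x)" using c by simp
  ultimately show False using x(1) by (simp add: def.Q_def P)
 qed
 ultimately show ?thesis by (rule that)
qed

section \<open>Translation of good domains\<close>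

lemma partial_translate:
 assumes "\<And>x. \<phi> differentiable (at x)"
 shows "partial i (\<lambda>x. \<phi> (x - a)) = (\<lambda>x. partial i \<phi> (x - a))"
proof
 fix x
 have "((\<lambda>x. \<phi> (x - a)) has_derivative frechet_derivative \<phi> (at (x - a))) (at x)"
  by (rule has_derivative_compose[OF _ has_derivative_frechet[OF assms], of "\<lambda>x. x - a" "\<lambda>h. h", simplified])
    (auto intro!: derivative_eq_intros)
 then show "partial i (\<lambda>x. \<phi> (x - a)) x = partial i \<phi> (x - a)"
  by (simp add: partial_eqI) (simp add: partial_def)
qed

lemma C_k_translate: "C_k k \<phi> ==> C_k k (\<lambda>x. \<phi> (x - a))"
proof (induction k arbitrary: \<phi>)
 case 0
 then have "continuous_on UNIV \<phi>" by simp
 then have "continuous_on UNIV (\<lambda>x. \<phi> (x - a))"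
  by (rule continuous_on_compose2) (auto intro!: continuous_intros)
 then show ?case by simp
next
 case (Suc k)
 have d: "\<phi> differentiable at x" for x using Suc.prems by simp
 have "(\<lambda>x. \<phi> (x - a)) differentiable at x" for x
  using differentiable_chain_at[of "\<lambda>x. x - a" x \<phi>] d by (auto simp: o_def)
 then show ?case using Suc by (auto simp: partial_translate[OF d])
qed

lemma smooth_translate: "smooth \<phi> ==> smooth (\<lambda>x. \<phi> (x - a))"
 by (simp add: smooth_def C_k_translate)

lemma partial_smooth_translate: "smooth \<phi> ==> partial i (\<lambda>x. \<phi> (x - a)) = (\<lambda>x. partial i \<phi> (x - a))"
 by (rule partial_translate) (rule smooth_differentiable)

lemma lap_translate: "smooth w ==> lap (\<lambda>x. w (x - a)) x = lap w (x - a)"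
 by (simp add: lap_def partial_smooth_translate smooth_partial)

lemma l2_translate:
 fixes f :: "real^'d => real"
 assumes "open D" "continuous_on D f"
 shows "l2 (lebesgue_on {x. x - a \<in> D}) (\<lambda>x. f (x - a)) = l2 (lebesgue_on D) f"
proof -
 define F where "F x = indicator D x *\<^sub>R (f x)\<^sup>2" for x
 have F: "F \<in> borel_measurable borel"
  unfolding F_def[abs_def] by (rule borel_measurable_continuous_on_indicator) (use assms in \<open>auto intro!: continuous_intros\<close>)
 then have Fa: "(\<lambda>x. F (x - a)) \<in> borel_measurable borel" by measurable
 have "continuous_on UNIV (\<lambda>x. x - a)" by (intro continuous_intros)
 from open_vimage[OF assms(1) this] have oa: "open {x. x - a \<in> D}" by (simp add: vimage_def)
 have "(LINT x|lborel. F (x - a)) = (LINT x|distr lborel borel ((+) a). F (x - a))"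
  by (simp add: lborel_distr_plus)
 also have "\<dots> = (LINT x|lborel. F x)" by (subst integral_distr) (use Fa in auto)
 finally have t: "(LINT x|lborel. F (x - a)) = (LINT x|lborel. F x)" .
 have "(LINT x|lebesgue_on {x. x - a \<in> D}. (f (x - a))\<^sup>2) = (LINT x|lebesgue_on {x. x - a \<in> D}. F (x - a))"
  by (rule Bochner_Integration.integral_cong) (auto simp: F_def)
 also have "\<dots> = (LINT x|lborel. F (x - a))"
  by (rule lebesgue_on_integral_vanishing[OF _ Fa]) (use oa in \<open>auto simp: F_def\<close>)
 also have "\<dots> = (LINT x|lebesgue_on D. F x)"
  unfolding t by (rule lebesgue_on_integral_vanishing[OF _ F, symmetric]) (use assms in \<open>auto simp: F_def\<close>)
 also have "\<dots> = (LINT x|lebesgue_on D. (f x)\<^sup>2)"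
  by (rule Bochner_Integration.integral_cong) (auto simp: F_def)
 finally show ?thesis by (simp add: l2_def)
qed

lemma good_domain_translate:
 fixes r :: "real^'d => real"
 assumes "good_domain r" shows "good_domain (\<lambda>x. r (x - a))"
proof -
 interpret convex_sublevel r using assms by (simp add: good_domain_def)
 have tr: "{x. P (x - a)} = (\<lambda>x. x + a) ` {x. P x}" for P :: "real^'d => bool"
  by (auto simp: image_iff intro!: exI[of _ "_ - a"])
 show ?thesis
  unfolding good_domain_def
 proof (intro conjI allI impI)
  show "convex_sublevel (\<lambda>x. r (x - a))"
  proof
   show "smooth (\<lambda>x. r (x - a))" by (rule smooth_translate[OF smooth_\<rho>])
   show "bounded {x. r (x - a) < 0}"
    using bounded_translation[OF bounded_sublevel, of a] unfolding tr[of "\<lambda>x. r x < 0"] by (simp add: add.commute)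
   show "0 \<le> (\<Sum>i\<in>UNIV. \<Sum>j\<in>UNIV. partial i (partial j (\<lambda>x. r (x - a))) x * \<xi> $ i * \<xi> $ j)" for x \<xi>
    using convex_\<rho>[of "x - a"] by (simp add: partial_smooth_translate smooth_\<rho> smooth_partial)
  qed
  show "compact {x. r (x - a) \<le> 0}"
   using compact_translation[of "{x. r x \<le> 0}" a] assms unfolding tr[of "\<lambda>x. r x \<le> 0"] good_domain_def by (simp add: add.commute)
  fix g :: "real^'d => real" and e :: real
  assume g: "continuous_on {x. r (x - a) \<le> 0} g" and e: "0 < e"
  have "continuous_on {x. r x \<le> 0} (\<lambda>x. g (x + a))"
   by (rule continuous_on_compose2[OF g]) (auto intro!: continuous_intros)
  then obtain l where l: "smooth l" "l2 (lebesgue_on {x. r x < 0}) (\<lambda>x. lap (\<lambda>x. r x * l x) x - g (x + a)) < e"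
   using assms e unfolding good_domain_def by blast
  have w: "smooth (\<lambda>x. r x * l x)" by (intro smooth_mult smooth_\<rho> l)
  have "continuous_on {x. r x < 0} (\<lambda>x. lap (\<lambda>x. r x * l x) x - g (x + a))"
   by (intro continuous_intros smooth_continuous_on smooth_lap w continuous_on_compose2[OF g]) auto
  from l2_translate[OF _ this, of a] open_D
  have "l2 (lebesgue_on {x. r (x - a) < 0}) (\<lambda>x. lap (\<lambda>x. r x * l x) (x - a) - g x)
   = l2 (lebesgue_on {x. r x < 0}) (\<lambda>x. lap (\<lambda>x. r x * l x) x - g (x + a))"
   by (simp add: D_def)
  then have "l2 (lebesgue_on {x. r (x - a) < 0}) (\<lambda>x. lap (\<lambda>x. r (x - a) * l (x - a)) x - g x) < e"
   using l(2) lap_translate[OF w, of a] by simp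
  then show "\<exists>l. smooth l \<and> l2 (lebesgue_on {x. r (x - a) < 0}) (\<lambda>x. lap (\<lambda>x. r (x - a) * l x) x - g x) < e"
   using smooth_translate[OF l(1), of a] by (intro exI[of _ "\<lambda>x. l (x - a)"]) simp
 qed
qed

lemma convex_exhaustion:
 fixes \<Omega> :: "(real^'d) set"
 assumes "open \<Omega>" "bounded \<Omega>" "convex \<Omega>" "\<Omega> \<noteq> {}" "compact K" "K \<subseteq> \<Omega>"
 obtains r where "good_domain r" "K \<subseteq> {x. r x < 0}" "{x. r x \<le> 0} \<subseteq> \<Omega>"
proof -
 obtain a where a: "a \<in> \<Omega>" using assms by blast
 have "0 \<in> (\<lambda>x. - a + x) ` \<Omega>" using a by (auto simp: image_iff)
 note T = open_translation[OF assms(1), of "- a"] bounded_translation[OF assms(2), of "- a"]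
  convex_translation[OF assms(3), of "- a"] this compact_translation[OF assms(5), of "- a"] image_mono[OF assms(6)]
 obtain r where r: "good_domain r" "(\<lambda>x. - a + x) ` K \<subseteq> {x. r x < 0}" "{x. r x \<le> 0} \<subseteq> (\<lambda>x. - a + x) ` \<Omega>"
  by (rule convex_exhaustion_0[OF T])
 show ?thesis
 proof (rule that[OF good_domain_translate[OF r(1), of a]])
  show "K \<subseteq> {x. r (x - a) < 0}" using r(2) by auto
  show "{x. r (x - a) \<le> 0} \<subseteq> \<Omega>"
  proof
   fix x assume "x \<in> {x. r (x - a) \<le> 0}"
   then have "x - a \<in> (\<lambda>x. - a + x) ` \<Omega>" using r(3) by blast
   then show "x \<in> \<Omega>" by (auto simp: image_iff)
  qed
 qed
qed

section \<open>Coefficients near the identity\<close>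

lemma norm_mat_1_sq: "(mat 1 :: real^'d^'d) \<bullet> mat 1 = real CARD('d)"
 by (simp add: inner_mat mat_def if_distrib[of "\<lambda>c. c * _"] sum.delta cong: if_cong)

lemma norm_mat_1: "norm (mat 1 :: real^'d^'d) = sqrt (real CARD('d))"
 by (simp add: norm_eq_sqrt_inner norm_mat_1_sq)

lemma hess_add: "smooth v ==> smooth w ==> hess (\<lambda>x. v x + w x) x = hess v x + hess w x"
 by (simp add: hess_def vec_eq_iff partial_smooth_add smooth_partial)

lemma hess_diff: "smooth v ==> smooth w ==> hess (\<lambda>x. v x - w x) x = hess v x - hess w x"
 by (simp add: hess_def vec_eq_iff partial_smooth_diff smooth_partial)

lemma hess_cmult: "smooth w ==> hess (\<lambda>x. c * w x) x = c *\<^sub>R hess w x"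
 by (simp add: hess_def vec_eq_iff partial_smooth_cmult smooth_partial)

lemma hess_zero: "hess (\<lambda>x. 0) x = 0"
 by (simp add: hess_def vec_eq_iff)

lemma hess_sum: "(\<And>k. k \<in> I ==> smooth (w k)) ==> hess (\<lambda>x. \<Sum>k\<in>I. w k x) x = (\<Sum>k\<in>I. hess (w k) x)"
 by (induction I rule: infinite_finite_induct) (auto simp: hess_zero hess_add smooth_sum)

lemma hess_inner_self: "hess (\<lambda>x. x \<bullet> x) x = 2 *\<^sub>R mat 1"
proof -
 have p: "partial j (\<lambda>x. x \<bullet> x) = (\<lambda>x :: real^'a. 2 * x $ j)" for j
  unfolding inner_vec_def by (simp add: partial_simps smooth_mult if_distrib[of "\<lambda>c. c * _"] if_distrib[of "\<lambda>c. _ * c"]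
   sum.distrib cong: if_cong)
 show ?thesis
  by (auto simp: hess_def p vec_eq_iff mat_def partial_simps if_distrib[of "\<lambda>c. _ * c"] cong: if_cong)
qed

lemma continuous_on_matrix_entries:
 fixes b :: "real^'d => real^'d^'d"
 assumes "\<And>i j. smooth (\<lambda>x. b x $ i $ j)" shows "continuous_on S b"
proof -
 have "continuous_on S (\<lambda>x. \<chi> i j. b x $ i $ j)"
  using assms by (intro continuous_on_vec_lambda smooth_continuous_on)
 then show ?thesis by simp
qed

context convex_sublevel
begin

text \<open>\<open>b x \<bullet> hess w x\<close> differs from the Laplacian by at most
  \<open>\<theta> * norm (hess w x)\<close>, and the Miranda-Talenti estimate turns this into
  \<open>\<theta>\<close> times the norm of the Laplacian, which \<open>lap_le_resolvent\<close>
  allows to be absorbed.\<close>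

lemma cordes_estimate:
 assumes l: "smooth l" and b: "\<And>i j. smooth (\<lambda>x. b x $ i $ j)"
  and bI: "\<And>x. x \<in> D ==> norm (b x - mat 1) \<le> \<theta>" and \<theta>: "0 \<le> \<theta>" "\<theta> < 1" and \<mu>: "0 \<le> \<mu>"
 defines "w \<equiv> \<lambda>x. \<rho> x * l x"
 shows "(1 - \<theta>) * l2 M (lap w) \<le> l2 M (\<lambda>x. \<mu> * w x - b x \<bullet> hess w x)"
proof -
 have w: "smooth w" unfolding w_def by (intro smooth_intros smooth_\<rho> l)
 have c: "continuous_on UNIV (\<lambda>x. \<mu> * w x - lap w x)" "continuous_on UNIV (\<lambda>x. \<mu> * w x - b x \<bullet> hess w x)"
  "continuous_on UNIV (\<lambda>x. (b x - mat 1) \<bullet> hess w x)"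
  by (intro continuous_intros smooth_continuous_on w smooth_lap continuous_on_hess continuous_on_matrix_entries b)+
 have "l2 M (\<lambda>x. (\<mu> * w x - lap w x) - (\<mu> * w x - b x \<bullet> hess w x)) = l2 M (\<lambda>x. (b x - mat 1) \<bullet> hess w x)"
  by (simp add: lap_inner inner_diff_left)
 also have "\<dots> \<le> l2 M (\<lambda>x. \<theta> *\<^sub>R hess w x)"
 proof (rule l2_mono[OF sqint_scaleR[OF sqint_hess[OF w]] sqintD(1)[OF sqint_continuous[OF c(3)]]])
  show "AE x in M. norm ((b x - mat 1) \<bullet> hess w x) \<le> norm (\<theta> *\<^sub>R hess w x)"
  proof (intro AE_I2)
   fix x assume "x \<in> space M"
   then have "norm (b x - mat 1) * norm (hess w x) \<le> \<theta> * norm (hess w x)"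
    using bI by (intro mult_right_mono) auto
   then show "norm ((b x - mat 1) \<bullet> hess w x) \<le> norm (\<theta> *\<^sub>R hess w x)"
    using Cauchy_Schwarz_ineq2[of "b x - mat 1" "hess w x"] \<theta> by simp
  qed
 qed
 also have "\<dots> \<le> \<theta> * l2 M (lap w)"
  unfolding l2_scaleR using miranda_talenti[OF l] \<theta> by (simp add: w_def mult_left_mono)
 finally have "l2 M (\<lambda>x. \<mu> * w x - lap w x) \<le> l2 M (\<lambda>x. \<mu> * w x - b x \<bullet> hess w x) + \<theta> * l2 M (lap w)"
  using l2_triangle_rev[OF sqint_continuous[OF c(1)] sqint_continuous[OF c(2)]] by linarith
 then show ?thesis using lap_le_resolvent[OF l \<mu>] by (simp add: w_def left_diff_distrib)
qed

end

text \<open>With \<open>d = CARD('d)\<close>, the trace of the identity is \<open>d\<close>, the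
  deviation is at most \<open>\<theta> * sqrt d\<close>, and
  \<open>sqrt d * (sqrt d - \<theta>) \<ge> 1 - \<theta>\<close> because
  \<open>d \<ge> 1\<close>.\<close>

lemma trace_near_identity:
 fixes b :: "real^'d^'d"
 assumes "norm (b - mat 1) \<le> \<theta>" "0 \<le> \<theta>" "\<theta> < 1" shows "1 - \<theta> \<le> b \<bullet> mat 1"
proof -
 let ?s = "sqrt (real CARD('d))"
 have s: "1 \<le> ?s" by (simp add: Suc_leI)
 have "\<bar>(b - mat 1) \<bullet> mat 1\<bar> \<le> \<theta> * ?s"
  using Cauchy_Schwarz_ineq2[of "b - mat 1" "mat 1"] assms(1) s
  by (smt (verit) mult_right_mono norm_mat_1)
 moreover have "b \<bullet> mat 1 = ?s * ?s + (b - mat 1) \<bullet> mat 1" by (simp add: inner_diff_left norm_mat_1_sq)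
 moreover have "1 * (1 - \<theta>) \<le> ?s * (?s - \<theta>)" using s assms by (intro mult_mono) auto
 ultimately show ?thesis by (simp add: right_diff_distrib mult.commute)
qed

text \<open>The Frobenius norm dominates the operator norm, so the quadratic form deviates from that
  of the identity by at most \<open>\<theta> * (norm \<xi>)^2\<close>.\<close>

lemma ellipticity_near_identity:
 fixes b :: "real^'d^'d"
 assumes "norm (b - mat 1) \<le> \<theta>"
 shows "(1 - \<theta>) * (norm \<xi>)\<^sup>2 \<le> (\<Sum>i\<in>UNIV. \<Sum>j\<in>UNIV. b $ i $ j * \<xi> $ i * \<xi> $ j)"
proof -
 have e: "(\<Sum>i\<in>UNIV. \<Sum>j\<in>UNIV. b $ i $ j * \<xi> $ i * \<xi> $ j) = \<xi> \<bullet> (b *v \<xi>)" for b :: "real^'d^'d"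
  by (simp add: inner_vec_def matrix_vector_mult_def sum_distrib_left algebra_simps)
 have "norm ((b - mat 1) *v \<xi>) \<le> norm (b - mat 1) * norm \<xi>"
 proof (rule power2_le_imp_le)
  have "(norm ((b - mat 1) *v \<xi>))\<^sup>2 = (\<Sum>i\<in>UNIV. ((b - mat 1) $ i \<bullet> \<xi>)\<^sup>2)"
   unfolding norm_vec_square by (simp add: matrix_vector_mult_def inner_vec_def)
  also have "\<dots> \<le> (\<Sum>i\<in>UNIV. (norm ((b - mat 1) $ i))\<^sup>2 * (norm \<xi>)\<^sup>2)"
  proof (rule sum_mono)
   fix i :: 'd
   have "\<bar>(b - mat 1) $ i \<bullet> \<xi>\<bar>\<^sup>2 \<le> (norm ((b - mat 1) $ i) * norm \<xi>)\<^sup>2"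
    by (intro power_mono Cauchy_Schwarz_ineq2) simp
   then show "((b - mat 1) $ i \<bullet> \<xi>)\<^sup>2 \<le> (norm ((b - mat 1) $ i))\<^sup>2 * (norm \<xi>)\<^sup>2"
    by (simp add: power_mult_distrib)
  qed
  also have "\<dots> = (norm (b - mat 1) * norm \<xi>)\<^sup>2"
   unfolding power_mult_distrib sum_distrib_right[symmetric] norm_mat_square norm_vec_square by simp
  finally show "(norm ((b - mat 1) *v \<xi>))\<^sup>2 \<le> (norm (b - mat 1) * norm \<xi>)\<^sup>2" .
 qed simp
 also have "\<dots> \<le> \<theta> * norm \<xi>" using assms by (intro mult_right_mono) auto
 finally have "\<bar>\<xi> \<bullet> ((b - mat 1) *v \<xi>)\<bar> \<le> norm \<xi> * (\<theta> * norm \<xi>)"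
  using Cauchy_Schwarz_ineq2[of \<xi> "(b - mat 1) *v \<xi>"] mult_left_mono[of _ _ "norm \<xi>"] by (smt (verit) norm_ge_zero)
 moreover have "\<xi> \<bullet> (b *v \<xi>) = (norm \<xi>)\<^sup>2 + \<xi> \<bullet> ((b - mat 1) *v \<xi>)"
  by (simp add: matrix_vector_mult_diff_rdistrib inner_diff_right power2_norm_eq_inner)
 moreover have "(1 - \<theta>) * (norm \<xi>)\<^sup>2 = (norm \<xi>)\<^sup>2 - norm \<xi> * (\<theta> * norm \<xi>)"
  by (simp add: power2_eq_square left_diff_distrib)
 ultimately show ?thesis unfolding e by linarith
qed

section \<open>Cordes operators on smooth convex domains\<close>

locale cordes_domain = convex_sublevel \<rho> for \<rho> :: "real^'d => real" +
 fixes b :: "real^'d => real^'d^'d" and \<theta> :: real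
 assumes good: "good_domain \<rho>" and smooth_b: "\<And>i j. smooth (\<lambda>x. b x $ i $ j)"
  and \<theta>: "0 \<le> \<theta>" "\<theta> < 1" and b_near: "\<And>x. x \<in> D ==> norm (b x - mat 1) \<le> \<theta>"
begin

lemma continuous_on_b: "continuous_on S b"
 using smooth_b by (rule continuous_on_matrix_entries)

definition elop :: "(real^'d => real) => real^'d => real" where
 "elop w x = b x \<bullet> hess w x"

lemma continuous_on_elop: "smooth w ==> continuous_on S (elop w)"
 unfolding elop_def[abs_def] by (intro continuous_intros continuous_on_b continuous_on_hess)

lemma elop_diff: "smooth v ==> smooth w ==> elop (\<lambda>x. v x - w x) x = elop v x - elop w x"
 by (simp add: elop_def hess_diff inner_diff_right)

lemma elop_cmult: "smooth w ==> elop (\<lambda>x. c * w x) x = c * elop w x"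
 by (simp add: elop_def hess_cmult)

lemma smooth_w: "smooth l ==> smooth (\<lambda>x. \<rho> x * l x)"
 by (intro smooth_intros smooth_\<rho>)

lemma compact_sublevel: "compact {x. \<rho> x \<le> 0}"
 using good by (simp add: good_domain_def)

lemma sqint_continuous_on: "continuous_on {x. \<rho> x \<le> 0} f ==> sqint M (f :: real^'d => real)"
 by (rule continuous_on_compact_sqint[OF _ compact_sublevel open_D]) (auto simp: D_def)

text \<open>Continuity method from minus the Laplacian to the full operator. The parameter
  multiplies both the deviation \<open>b x - mat 1\<close> and the zero-order term, so the Cordes
  estimate holds with the same constant all along.\<close>

lemma resolvent_dense:
 assumes \<mu>: "0 \<le> \<mu>" and g: "continuous_on {x. \<rho> x \<le> 0} g" and e: "0 < e"
 shows "\<exists>l. smooth l \<and> l2 M (\<lambda>x. \<mu> * (\<rho> x * l x) - elop (\<lambda>x. \<rho> x * l x) x - g x) < e"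
proof -
 obtain R where R: "0 < R" "\<And>x. x \<in> D ==> norm x \<le> R"
  using bounded_D by (meson bounded_normE)
 define bs where "bs s x = mat 1 + s *\<^sub>R (b x - mat 1)" for s x
 define T where "T s l x = (s * \<mu>) * (\<rho> x * l x) - bs s x \<bullet> hess (\<lambda>x. \<rho> x * l x) x" for s l x
 have bss: "smooth (\<lambda>x. bs s x $ i $ j)" for s i j
  unfolding bs_def vector_add_component vector_scaleR_component vector_minus_component real_scaleR_def
  by (intro smooth_intros smooth_b)
 have bsI: "norm (bs s x - mat 1) \<le> \<theta>" if "0 \<le> s" "s \<le> 1" "x \<in> D" for s x
  using mult_mono[OF that(2) b_near[OF that(3)]] that by (simp add: bs_def)
 have Tc: "continuous_on S (T s l)" if "smooth l" for s l S
  unfolding T_def[abs_def]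
  by (intro continuous_intros smooth_continuous_on smooth_\<rho> that continuous_on_hess smooth_w continuous_on_matrix_entries bss)
 have est: "(1 - \<theta>) * l2 M (lap (\<lambda>x. \<rho> x * l x)) \<le> l2 M (T s l)" if "smooth l" "0 \<le> s" "s \<le> 1" for s l
  unfolding T_def[abs_def] by (rule cordes_estimate[OF that(1) bss bsI \<theta>]) (use that \<mu> in auto)
 \<comment> \<open>\<open>4 * R^2 * \<mu> + 1\<close> bounds the change per unit of the parameter
   relative to the Laplacian, by the Poincare and gradient estimates for the zero-order term and by
   Miranda-Talenti for the other; \<open>1 - \<theta>\<close> is the coercivity constant and 5 the
   factor of \<open>continuity_method\<close>.\<close>
 define d where "d = (1 - \<theta>) / (5 * (4 * R\<^sup>2 * \<mu> + 1))"
 have d: "0 < d" using R \<theta> \<mu> by (auto simp: d_def intro!: divide_pos_pos add_nonneg_pos)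
 have "\<exists>l\<in>Collect smooth. l2 M (\<lambda>x. T 1 l x - g x) < e"
 proof (rule continuity_method[where G = "{g. continuous_on {x. \<rho> x \<le> 0} g}" and z = "\<lambda>x. 0" and p = "\<lambda>v w x. v x + w x" and d = d])
  show "T s (\<lambda>x. 0) x = 0" for s x by (simp add: T_def hess_zero)
  show "T s (\<lambda>x. v x + w x) x = T s v x + T s w x" if "v \<in> Collect smooth" "w \<in> Collect smooth" for s v w x
   using that by (simp add: T_def distrib_left hess_add smooth_w inner_add_right)
  show "\<exists>l\<in>Collect smooth. l2 M (\<lambda>x. T 0 l x - h x) < \<epsilon>" if h: "h \<in> {g. continuous_on {x. \<rho> x \<le> 0} g}" "0 < \<epsilon>" for h \<epsilon>
  proof -
   have "continuous_on {x. \<rho> x \<le> 0} (\<lambda>x. - h x)" using h by (auto intro!: continuous_intros)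
   then obtain l where l: "smooth l" "l2 M (\<lambda>x. lap (\<lambda>x. \<rho> x * l x) x - - h x) < \<epsilon>"
    using good h(2) unfolding good_domain_def D_def by blast
   have eq: "(\<lambda>x. T 0 l x - h x) = (\<lambda>x. - (lap (\<lambda>x. \<rho> x * l x) x - - h x))"
    by (auto simp: T_def bs_def lap_inner)
   have "l2 M (\<lambda>x. T 0 l x - h x) < \<epsilon>" unfolding eq l2_uminus by (rule l(2))
   then show ?thesis using l(1) by (intro bexI[of _ l]) auto
  qed
  fix s t and l :: "real^'d => real"
  assume st: "0 \<le> s" "s \<le> 1" "0 \<le> t" "t \<le> 1" "\<bar>s - t\<bar> < d" and "l \<in> Collect smooth"
  then have l: "smooth l" by simp
  let ?w = "\<lambda>x. \<rho> x * l x"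
  have w: "smooth ?w" using l by (rule smooth_w)
  have eq: "(\<lambda>x. T s l x - T t l x) = (\<lambda>x. (s - t) *\<^sub>R (\<mu> * ?w x - (b x - mat 1) \<bullet> hess ?w x))"
   by (auto simp: T_def bs_def inner_add_left inner_diff_left algebra_simps)
  have c: "continuous_on UNIV (\<lambda>x. (b x - mat 1) \<bullet> hess ?w x)"
   by (intro continuous_intros continuous_on_hess w continuous_on_b)
  have 1: "l2 M (\<lambda>x. (b x - mat 1) \<bullet> hess ?w x) \<le> l2 M (hess ?w)"
  proof (rule l2_mono[OF sqint_hess[OF w] sqintD(1)[OF sqint_continuous[OF c]]], intro AE_I2)
   fix x assume "x \<in> space M"
   then have "norm (b x - mat 1) * norm (hess ?w x) \<le> 1 * norm (hess ?w x)"
    using b_near[of x] \<theta> by (intro mult_right_mono) auto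
   then show "norm ((b x - mat 1) \<bullet> hess ?w x) \<le> norm (hess ?w x)"
    using Cauchy_Schwarz_ineq2[of "b x - mat 1" "hess ?w x"] by simp
  qed
  have "l2 M ?w \<le> 2 * R * l2 M (grad ?w)" by (rule poincare[OF l R(2)])
  also have "\<dots> \<le> 2 * R * (2 * R * l2 M (lap ?w))" using R gradient_estimate[OF l R(2)] by (intro mult_left_mono) auto
  finally have 2: "l2 M ?w \<le> 4 * R\<^sup>2 * l2 M (lap ?w)" by (simp add: power2_eq_square)
  have "l2 M (\<lambda>x. \<mu> * ?w x - (b x - mat 1) \<bullet> hess ?w x) \<le> l2 M (\<lambda>x. \<mu> *\<^sub>R ?w x) + l2 M (\<lambda>x. (b x - mat 1) \<bullet> hess ?w x)"
   using l2_triangle_diff[OF sqint_scaleR[OF sqint_smooth[OF w], of \<mu>] sqint_continuous[OF c]] by simp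
  also have "\<dots> \<le> (4 * R\<^sup>2 * \<mu> + 1) * l2 M (lap ?w)"
   unfolding l2_scaleR using \<mu> 1 mult_left_mono[OF 2 \<mu>] miranda_talenti[OF l] by (simp add: algebra_simps)
  finally have "l2 M (\<lambda>x. T s l x - T t l x) \<le> d * ((4 * R\<^sup>2 * \<mu> + 1) * l2 M (lap ?w))"
   unfolding eq l2_scaleR using st(5) by (intro mult_mono) auto
  also have "\<dots> = (1 - \<theta>) * l2 M (lap ?w) / 5"
  proof -
   have "k / (5 * m) * (m * y) = k * y / 5" if "0 < m" for k m y :: real using that by simp
   moreover have "0 < 4 * R\<^sup>2 * \<mu> + 1" using \<mu> by (intro add_nonneg_pos) auto
   ultimately show ?thesis unfolding d_def by blast
  qed
  finally show "l2 M (\<lambda>x. T s l x - T t l x) \<le> l2 M (T t l) / 5" using est[OF l st(3,4)] by linarith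
 qed (use Tc g e d in \<open>auto intro!: continuous_intros smooth_add sqint_continuous_on\<close>)
 then obtain l where "smooth l" "l2 M (\<lambda>x. T 1 l x - g x) < e" by auto
 then show ?thesis by (intro exI[of _ l]) (simp add: T_def bs_def elop_def)
qed

text \<open>The solution of \<open>- elop v = g\<close> is produced by the resolvent iteration
 \<open>\<mu> w\<^sub>k\<^sub>+\<^sub>1 - elop w\<^sub>k\<^sub>+\<^sub>1 = \<mu> w\<^sub>k\<close>, \<open>\<mu> w\<^sub>0 - elop w\<^sub>0 = g\<close>, as \<open>v = \<Sum>w\<^sub>k\<close>. Only for large \<open>\<mu>\<close>
 is the comparison principle available, and comparison with the paraboloid \<open>\<psi>\<close> shows that
 \<open>w\<^sub>k\<close> decays geometrically.\<close>

lemma approximate_nonneg_solution: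
 assumes g: "continuous_on UNIV g" "\<And>x. x \<in> D ==> 0 \<le> g x" "\<And>x. x \<in> D ==> g x \<le> 1" and \<eta>: "0 < \<eta>"
 obtains l where "smooth l" "l2 M (\<lambda>x. max (- (\<rho> x * l x)) 0) \<le> \<eta>"
  "l2 M (\<lambda>x. - elop (\<lambda>x. \<rho> x * l x) x - g x) \<le> \<eta>"
proof -
 obtain R where R: "0 < R" "\<And>x. x \<in> D ==> norm x \<le> R"
  using bounded_D by (meson bounded_normE)
 have "continuous_on UNIV (\<lambda>x. \<chi> j. \<Sum>i\<in>UNIV. partial i (\<lambda>x. b x $ i $ j) x)"
  by (intro continuous_intros smooth_continuous_on smooth_partial smooth_b)
 then obtain K where K: "\<And>x. x \<in> D ==> norm (\<chi> j. \<Sum>i\<in>UNIV. partial i (\<lambda>x. b x $ i $ j) x) \<le> K"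
  using continuous_bounded_on[OF _ bounded_D] by blast
 define \<mu> where "\<mu> = K\<^sup>2 / (4 * (1 - \<theta>)) + 1"
 have \<mu>: "1 \<le> \<mu>" using \<theta> by (simp add: \<mu>_def)
 define neg where "neg z x = max (- z x) 0" for z :: "real^'d => real" and x
 have neg_sq: "sqint M (neg z)" if "smooth z" for z
  unfolding neg_def[abs_def] by (intro sqint_continuous continuous_intros smooth_continuous_on that)
 \<comment> \<open>The previous iterate enters the right-hand side through its negative part only,
   and its error is passed on with the factor \<open>\<mu>\<close>.\<close>
 have comp: "l2 M (neg z) \<le> \<mu> * l2 M (neg y) + l2 M r"
  if z: "smooth z" "smooth S" "\<And>x. x \<in> D ==> \<rho> x * S x \<le> z x" and y: "smooth y" and r: "sqint M r"
   and ineq: "\<And>x. x \<in> D ==> - (\<mu> * neg y x + \<bar>r x\<bar>) \<le> \<mu> * z x - elop z x" for z y S r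
 proof -
  have s: "sqint M (\<lambda>x. \<mu> *\<^sub>R neg y x)" "sqint M (\<lambda>x. \<bar>r x\<bar>)"
   using sqint_scaleR[OF neg_sq[OF y]] sqint_norm[OF r] by auto
  have "l2 M (neg z) \<le> l2 M (\<lambda>x. \<mu> *\<^sub>R neg y x + \<bar>r x\<bar>)"
   unfolding neg_def[of z, abs_def]
  proof (rule comparison[where b = "\<lambda>i j x. b x $ i $ j" and \<nu> = "1 - \<theta>" and \<mu> = \<mu> and K = K and S = S])
   show "(1 - \<theta>) * (norm \<xi>)\<^sup>2 \<le> (\<Sum>i\<in>UNIV. \<Sum>j\<in>UNIV. b x $ i $ j * \<xi> $ i * \<xi> $ j)" if "x \<in> D" for x \<xi>
    by (rule ellipticity_near_identity[OF b_near[OF that]])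
   show "- \<bar>\<mu> *\<^sub>R neg y x + \<bar>r x\<bar>\<bar> \<le> \<mu> * z x - (\<Sum>i\<in>UNIV. \<Sum>j\<in>UNIV. b x $ i $ j * partial i (partial j z) x)" if "x \<in> D" for x
    using ineq[OF that] \<mu> by (simp add: elop_def inner_mat hess_def neg_def)
  qed (use smooth_b \<theta> K z sqint_add[OF s] \<mu>_def in auto)
  also have "\<dots> \<le> l2 M (\<lambda>x. \<mu> *\<^sub>R neg y x) + l2 M (\<lambda>x. \<bar>r x\<bar>)" by (rule l2_triangle[OF s])
  also have "\<dots> = \<mu> * l2 M (neg y) + l2 M r" using \<mu> by (simp only: l2_scaleR) (simp add: l2_def)
  finally show ?thesis .
 qed
 \<comment> \<open>The paraboloid is at least 1 on the domain, and \<open>c\<close> is small enough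
   for \<open>- elop \<psi> x \<ge> c * \<psi> x\<close>, the trace of \<open>b x\<close> being at
   least \<open>1 - \<theta>\<close>.\<close>
 define C where "C = 1 + R\<^sup>2"
 define c where "c = 2 * (1 - \<theta>) / C"
 define \<psi> where "\<psi> x = C - x \<bullet> x" for x :: "real^'d"
 have C: "1 \<le> C" by (simp add: C_def)
 have c: "0 < c" using C \<theta> by (simp add: c_def)
 have sI: "smooth (\<lambda>x :: real^'d. x \<bullet> x)" unfolding inner_vec_def by (simp, intro smooth_intros)
 have \<psi>s: "smooth \<psi>" unfolding \<psi>_def by (intro smooth_intros sI)
 have \<psi>1: "1 \<le> \<psi> x" if "x \<in> D" for x
  using power_mono[OF R(2)[OF that], of 2] by (simp add: \<psi>_def C_def power2_norm_eq_inner)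
 have L\<psi>: "c * \<psi> x \<le> - elop \<psi> x" if "x \<in> D" for x
 proof -
  have "hess (\<lambda>x. C) x = 0" by (simp add: hess_def vec_eq_iff)
  then have "- elop \<psi> x = 2 * (b x \<bullet> mat 1)"
   unfolding elop_def \<psi>_def[abs_def] by (simp add: hess_diff sI hess_inner_self)
  then have "2 * (1 - \<theta>) \<le> - elop \<psi> x" using trace_near_identity[OF b_near[OF that] \<theta>] by simp
  moreover have "c * \<psi> x \<le> c * C" using c by (simp add: \<psi>_def)
  ultimately show ?thesis using C by (simp add: c_def)
 qed
 \<comment> \<open>\<open>B * q ^ n * \<psi> x\<close> is a barrier for the iteration:
   \<open>B * (\<mu> + c) = 1\<close> dominates \<open>g \<le> 1\<close> at the start, and
   \<open>q * (\<mu> + c) = \<mu>\<close> reproduces the recursion.\<close>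
 define B where "B = 1 / (\<mu> + c)"
 define q where "q = \<mu> / (\<mu> + c)"
 have q: "0 < q" "q < 1" and B: "0 < B" "B * (\<mu> + c) = 1" and Bq: "q * (\<mu> + c) = \<mu>" using \<mu> c by (auto simp: q_def B_def)
 define P where "P = l2 M \<psi>"
 have "(\<lambda>N. \<mu> * (B * q ^ N * P)) \<longlonglongrightarrow> \<mu> * (B * 0 * P)"
  using q by (intro tendsto_intros LIMSEQ_realpow_zero) auto
 then have "\<forall>\<^sub>F N in sequentially. \<mu> * (B * q ^ N * P) < \<eta> / 2" using \<eta> by (intro order_tendstoD(2)) auto
 then obtain N where N: "\<mu> * (B * q ^ N * P) < \<eta> / 2" by (meson eventually_sequentially order_refl)
 \<comment> \<open>The number of iterations is fixed before the tolerance \<open>e\<close>: the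
   comparison for the \<open>n\<close>-th iterate amplifies residuals by at most
   \<open>(\<mu> + 1) ^ n\<close>, and the sums over \<open>n \<le> N\<close> must stay below
   fractions of \<open>\<eta>\<close>.\<close>
 define Z where "Z = (real N + 3) * (\<mu> + 1) ^ Suc N * 4"
 have Z: "0 < Z" unfolding Z_def using \<mu> by simp
 define e where "e = \<eta> / Z"
 have e: "0 < e" using \<eta> Z by (simp add: e_def)
 define w where "w l = (\<lambda>x. \<rho> x * l x)" for l
 have ws: "smooth (w l)" if "smooth l" for l unfolding w_def using that by (rule smooth_w)
 define Q where "Q l h x = \<mu> * w l x - elop (w l) x - h x" for l h x
 have res: "\<exists>l. smooth l \<and> l2 M (Q l h) < e" if "continuous_on UNIV h" for h
  using resolvent_dense[of \<mu> h e] continuous_on_subset[OF that] \<mu> e by (auto simp: Q_def[abs_def] w_def)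
 have "\<exists>l. \<forall>n. (smooth (l n) \<and> (n = 0 \<longrightarrow> l2 M (Q (l n) g) < e)) \<and> l2 M (Q (l (Suc n)) (\<lambda>x. \<mu> * w (l n) x)) < e"
 proof (rule dependent_nat_choice)
  show "\<exists>l. smooth l \<and> (0 = (0::nat) \<longrightarrow> l2 M (Q l g) < e)" using res[OF g(1)] by simp
  fix l and n :: nat assume "smooth l \<and> (n = 0 \<longrightarrow> l2 M (Q l g) < e)"
  then have "continuous_on UNIV (\<lambda>x. \<mu> * w l x)" by (intro continuous_intros smooth_continuous_on ws) auto
  from res[OF this] show "\<exists>l'. (smooth l' \<and> (Suc n = 0 \<longrightarrow> l2 M (Q l' g) < e)) \<and> l2 M (Q l' (\<lambda>x. \<mu> * w l x)) < e" by simp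
 qed
 then obtain l where l: "\<And>n. smooth (l n)" "l2 M (Q (l 0) g) < e"
  "\<And>n. l2 M (Q (l (Suc n)) (\<lambda>x. \<mu> * w (l n) x)) < e" by auto
 define W where "W n = w (l n)" for n
 define h where "h n = (case n of 0 => g | Suc k => (\<lambda>x. \<mu> * W k x))" for n
 define r where "r n x = \<mu> * W n x - elop (W n) x - h n x" for n x
 have W: "smooth (W n)" for n unfolding W_def by (rule ws[OF l(1)])
 have Wl: "W n x = \<rho> x * l n x" for n x by (simp add: W_def w_def)
 have hc: "continuous_on UNIV (h n)" for n
  by (cases n) (auto simp: h_def intro!: g smooth_continuous_on smooth_mult W)
 have rc: "sqint M (r n)" for n
  unfolding r_def[abs_def] by (intro sqint_continuous continuous_intros hc continuous_on_elop W smooth_continuous_on)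
 have re: "l2 M (r n) < e" for n
  using l(2,3) by (cases n) (auto simp: r_def[abs_def] Q_def[abs_def] h_def W_def)
 \<comment> \<open>Stated for a general sequence because it serves twice, for the iterates and for
   their distance below the barrier.\<close>
 have iter: "l2 M (neg (y n)) \<le> e * (\<mu> + 1) ^ n"
  if y: "\<And>n. smooth (y n)" and S: "\<And>n. smooth (S n)" "\<And>n x. x \<in> D ==> \<rho> x * S n x \<le> y n x"
   and y0: "\<And>x. x \<in> D ==> - \<bar>r 0 x\<bar> \<le> \<mu> * y 0 x - elop (y 0) x"
   and ySuc: "\<And>n x. x \<in> D ==> \<mu> * y n x - \<bar>r (Suc n) x\<bar> \<le> \<mu> * y (Suc n) x - elop (y (Suc n)) x" for y S n
 proof (induction n)
  case 0
  have "l2 M (neg (y 0)) \<le> \<mu> * l2 M (neg (\<lambda>x. 0)) + l2 M (r 0)"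
   by (rule comp[OF y S _ rc]) (use y0 in \<open>simp_all add: neg_def\<close>)
  moreover have "l2 M (neg (\<lambda>x. 0)) = 0" by (simp add: neg_def[abs_def] l2_def)
  ultimately show ?case using re[of 0] by simp
 next
  case (Suc n)
  have "l2 M (neg (y (Suc n))) \<le> \<mu> * l2 M (neg (y n)) + l2 M (r (Suc n))"
  proof (rule comp[OF y S y rc])
   fix x assume "x \<in> D"
   have "\<mu> * (- neg (y n) x) \<le> \<mu> * y n x" using \<mu> by (intro mult_left_mono) (auto simp: neg_def)
   then show "- (\<mu> * neg (y n) x + \<bar>r (Suc n) x\<bar>) \<le> \<mu> * y (Suc n) x - elop (y (Suc n)) x"
    using ySuc[OF \<open>x \<in> D\<close>, of n] by simp
  qed
  also have "l2 M (r (Suc n)) \<le> e * (\<mu> + 1) ^ n"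
   using order_trans[OF less_imp_le[OF re[of "Suc n"]], of "e * (\<mu> + 1) ^ n"] e \<mu> one_le_power[of "\<mu> + 1" n] by simp
  also have "\<mu> * l2 M (neg (y n)) \<le> \<mu> * (e * (\<mu> + 1) ^ n)" using Suc \<mu> by (intro mult_left_mono) auto
  finally show ?case by (simp add: algebra_simps)
 qed
 have lower: "l2 M (neg (W n)) \<le> e * (\<mu> + 1) ^ n" for n
 proof (rule iter[where S = l])
  show "- \<bar>r 0 x\<bar> \<le> \<mu> * W 0 x - elop (W 0) x" if "x \<in> D" for x using g(2)[OF that] by (simp add: r_def h_def)
  show "\<rho> x * l n x \<le> W n x" for n x by (simp add: Wl)
 qed (simp_all add: W l(1) r_def h_def)
 define z where "z n x = B * q ^ n * \<psi> x - W n x" for n x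
 have Lz: "B * q ^ n * ((\<mu> + c) * \<psi> x) - (\<mu> * W n x - elop (W n) x) \<le> \<mu> * z n x - elop (z n) x" if "x \<in> D" for n x
 proof -
  have "B * q ^ n * ((\<mu> + c) * \<psi> x) \<le> B * q ^ n * (\<mu> * \<psi> x - elop \<psi> x)"
   using L\<psi>[OF that] B q by (intro mult_left_mono) (auto simp: distrib_right)
  then show ?thesis
   unfolding z_def[abs_def] elop_diff[OF smooth_mult[OF smooth_const \<psi>s] W] elop_cmult[OF \<psi>s] by (simp add: algebra_simps)
 qed
 have zs: "smooth (z n)" for n unfolding z_def by (intro smooth_intros \<psi>s W)
 have upper: "l2 M (neg (z n)) \<le> e * (\<mu> + 1) ^ n" for n
 proof (rule iter[OF zs smooth_uminus[OF l(1)]])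
  fix x assume x: "x \<in> D"
  show "\<rho> x * (- l n x) \<le> z n x" for n using B q \<psi>1[OF x] by (simp add: z_def Wl)
  have "(B * (\<mu> + c)) * \<psi> x - g x - r 0 x \<le> \<mu> * z 0 x - elop (z 0) x"
   using Lz[OF x, of 0] by (simp add: r_def h_def mult.assoc)
  then show "- \<bar>r 0 x\<bar> \<le> \<mu> * z 0 x - elop (z 0) x"
   using g(3)[OF x] \<psi>1[OF x] unfolding B(2) by simp
  fix n
  have "B * q ^ Suc n * ((\<mu> + c) * \<psi> x) = B * q ^ n * (q * (\<mu> + c)) * \<psi> x" by (simp add: mult.assoc mult.left_commute)
  then show "\<mu> * z n x - \<bar>r (Suc n) x\<bar> \<le> \<mu> * z (Suc n) x - elop (z (Suc n)) x"
   using Lz[OF x, of "Suc n"] unfolding Bq by (simp add: z_def[of n] r_def h_def algebra_simps)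
 qed
 define k where "k x = (\<Sum>n\<le>N. l n x)" for x
 have wk: "\<rho> x * k x = (\<Sum>n\<le>N. W n x)" for x by (simp add: k_def Wl sum_distrib_left)
 have eN: "(real N + 1) * (e * (\<mu> + 1) ^ N) \<le> \<eta> / 4" "(real N + 1) * e \<le> \<eta> / 4" "\<mu> * (2 * (e * (\<mu> + 1) ^ N)) \<le> \<eta> / 4"
 proof -
  have p: "1 \<le> (\<mu> + 1) ^ n" for n using \<mu> by (intro one_le_power) auto
  have Zle: "a * e \<le> \<eta> / 4" if "a \<le> (real N + 3) * (\<mu> + 1) ^ Suc N" for a
  proof -
   have "a * e \<le> (Z / 4) * e" using that e by (intro mult_right_mono) (auto simp: Z_def)
   then show ?thesis using Z by (simp add: e_def)
  qed
  have "(real N + 1) * (\<mu> + 1) ^ N \<le> (real N + 3) * (\<mu> + 1) ^ Suc N"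
   using \<mu> by (intro mult_mono power_increasing) auto
  from Zle[OF this] show "(real N + 1) * (e * (\<mu> + 1) ^ N) \<le> \<eta> / 4" by (simp add: mult_ac)
  have "(real N + 1) * 1 \<le> (real N + 3) * (\<mu> + 1) ^ Suc N"
   using \<mu> p[of "Suc N"] by (intro mult_mono) (auto simp del: power_Suc)
  from Zle[OF this] show "(real N + 1) * e \<le> \<eta> / 4" by simp
  have "\<mu> * (2 * (\<mu> + 1) ^ N) \<le> (\<mu> + 1) * ((real N + 3) * (\<mu> + 1) ^ N)"
   using \<mu> by (intro mult_mono) auto
  then have "\<mu> * (2 * (\<mu> + 1) ^ N) \<le> (real N + 3) * (\<mu> + 1) ^ Suc N" by (simp add: mult_ac)
  from Zle[OF this] show "\<mu> * (2 * (e * (\<mu> + 1) ^ N)) \<le> \<eta> / 4" by (simp add: mult_ac)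
 qed
 have l2s: "l2 M (\<lambda>x. \<Sum>n\<le>m. f n x) \<le> (\<Sum>n\<le>m. l2 M (f n))" if "\<And>n. sqint M (f n)" for f :: "nat => real^'d => real" and m
 proof (induction m)
  case (Suc m)
  have "l2 M (\<lambda>x. \<Sum>n\<le>Suc m. f n x) \<le> l2 M (\<lambda>x. \<Sum>n\<le>m. f n x) + l2 M (f (Suc m))"
   using l2_triangle[OF sqint_sum that, of "{..m}" f] that by simp
  then show ?case using Suc by simp
 qed simp
 show ?thesis
 proof (rule that[of k])
  show "smooth k" unfolding k_def by (intro smooth_intros l)
  have "l2 M (\<lambda>x. max (- (\<rho> x * k x)) 0) \<le> l2 M (\<lambda>x. \<Sum>n\<le>N. neg (W n) x)"
  proof (rule l2_mono[OF sqint_sum[OF neg_sq[OF W]]], rule sqintD(1)[OF sqint_continuous])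
   show "continuous_on UNIV (\<lambda>x. max (- (\<rho> x * k x)) 0)"
    unfolding wk by (intro continuous_intros smooth_continuous_on W)
   show "AE x in M. norm (max (- (\<rho> x * k x)) 0) \<le> norm (\<Sum>n\<le>N. neg (W n) x)"
   proof (intro AE_I2)
    fix x
    have "(\<Sum>n\<le>N. - neg (W n) x) \<le> (\<Sum>n\<le>N. W n x)" by (intro sum_mono) (auto simp: neg_def)
    moreover have "0 \<le> (\<Sum>n\<le>N. neg (W n) x)" by (intro sum_nonneg) (auto simp: neg_def)
    ultimately show "norm (max (- (\<rho> x * k x)) 0) \<le> norm (\<Sum>n\<le>N. neg (W n) x)" unfolding wk sum_negf by simp
   qed
  qed
  also have "\<dots> \<le> (\<Sum>n\<le>N. e * (\<mu> + 1) ^ N)"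
  proof (rule order_trans[OF l2s[OF neg_sq[OF W]] sum_mono])
   fix n assume "n \<in> {..N}"
   then have "e * (\<mu> + 1) ^ n \<le> e * (\<mu> + 1) ^ N" using \<mu> e by (intro mult_left_mono power_increasing) auto
   then show "l2 M (neg (W n)) \<le> e * (\<mu> + 1) ^ N" using lower[of n] by linarith
  qed
  also have "\<dots> \<le> \<eta>" using eN(1) \<eta> by (simp add: add.commute)
  finally show "l2 M (\<lambda>x. max (- (\<rho> x * k x)) 0) \<le> \<eta>" .
  \<comment> \<open>Telescoping: the equation for the sum is violated only by the last term
    \<open>\<mu> * W m x\<close> and by the residuals.\<close>
  have tel: "(\<Sum>n\<le>m. - elop (W n) x) = g x - \<mu> * W m x + (\<Sum>n\<le>m. r n x)" for m x
   by (induction m) (auto simp: r_def h_def)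
  have el: "- elop (\<lambda>x. \<rho> x * k x) x - g x = (\<Sum>n\<le>N. r n x) - \<mu> *\<^sub>R W N x" for x
  proof -
   have "elop (\<lambda>x. \<rho> x * k x) x = (\<Sum>n\<le>N. elop (W n) x)"
    unfolding wk elop_def by (subst hess_sum) (auto simp: W inner_sum_right)
   then show ?thesis using tel[of x N] by (simp add: sum_negf)
  qed
  have WN: "l2 M (W N) \<le> B * q ^ N * P + 2 * (e * (\<mu> + 1) ^ N)"
  proof -
   have sq: "sqint M (\<lambda>x. (B * q ^ N) *\<^sub>R \<psi> x)" "sqint M (\<lambda>x. neg (z N) x + neg (W N) x)"
    using sqint_scaleR[OF sqint_smooth[OF \<psi>s]] sqint_add[OF neg_sq[OF zs] neg_sq[OF W]] by auto
   have "l2 M (W N) \<le> l2 M (\<lambda>x. (B * q ^ N) *\<^sub>R \<psi> x + (neg (z N) x + neg (W N) x))"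
   proof (rule l2_mono[OF sqint_add[OF sq] sqintD(1)[OF sqint_smooth[OF W]]], intro AE_I2)
    fix x assume "x \<in> space M"
    then have "0 \<le> B * q ^ N * \<psi> x" using \<psi>1[of x] B q by simp
    then show "norm (W N x) \<le> norm ((B * q ^ N) *\<^sub>R \<psi> x + (neg (z N) x + neg (W N) x))"
     by (auto simp: neg_def z_def)
   qed
   also have "\<dots> \<le> l2 M (\<lambda>x. (B * q ^ N) *\<^sub>R \<psi> x) + (l2 M (neg (z N)) + l2 M (neg (W N)))"
    using l2_triangle[OF sq] l2_triangle[OF neg_sq[OF zs[of N]] neg_sq[OF W[of N]]] by linarith
   also have "l2 M (\<lambda>x. (B * q ^ N) *\<^sub>R \<psi> x) = B * q ^ N * P"
    unfolding l2_scaleR P_def using B q by simp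
   finally show ?thesis using lower[of N] upper[of N] by linarith
  qed
  have "l2 M (\<lambda>x. - elop (\<lambda>x. \<rho> x * k x) x - g x) \<le> l2 M (\<lambda>x. \<Sum>n\<le>N. r n x) + l2 M (\<lambda>x. \<mu> *\<^sub>R W N x)"
   unfolding el by (rule l2_triangle_diff[OF sqint_sum[OF rc] sqint_scaleR[OF sqint_smooth[OF W]]])
  also have "l2 M (\<lambda>x. \<Sum>n\<le>N. r n x) \<le> (\<Sum>n\<le>N. e)"
   by (rule order_trans[OF l2s[OF rc] sum_mono]) (use re in \<open>auto intro: less_imp_le\<close>)
  also have "l2 M (\<lambda>x. \<mu> *\<^sub>R W N x) \<le> \<mu> * (B * q ^ N * P + 2 * (e * (\<mu> + 1) ^ N))"
   unfolding l2_scaleR using WN \<mu> by (simp add: mult_left_mono)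
  also have "(\<Sum>n\<le>N. e) + \<mu> * (B * q ^ N * P + 2 * (e * (\<mu> + 1) ^ N)) \<le> \<eta>"
   using eN(2,3) N by (simp add: distrib_left add.commute)
  finally show "l2 M (\<lambda>x. - elop (\<lambda>x. \<rho> x * k x) x - g x) \<le> \<eta>" by simp
 qed
qed

end

section \<open>Components and dominated convergence in the square-integrable functions\<close>

lemma smooth_prod [smooth_intros]: "(\<And>i. i \<in> I ==> smooth (f i)) ==> smooth (\<lambda>x. \<Prod>i\<in>I. f i x)"
 by (induction I rule: infinite_finite_induct) (auto intro: smooth_mult)

lemma sqint_vec_iff:
 fixes f :: "'a => 'b::euclidean_space^'d"
 shows "sqint M f \<longleftrightarrow> (\<forall>i. sqint M (\<lambda>x. f x $ i))"
proof
 assume f: "sqint M f"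
 have "(\<lambda>x. f x $ i) \<in> borel_measurable M" for i
  using borel_measurable_continuous_on[OF continuous_on_component[OF continuous_on_id] sqintD(1)[OF f]] .
 then show "\<forall>i. sqint M (\<lambda>x. f x $ i)"
  by (intro allI sqint_mono[OF f] AE_I2 Finite_Cartesian_Product.norm_nth_le)
next
 assume f: "\<forall>i. sqint M (\<lambda>x. f x $ i)"
 have "sqint M (\<lambda>x. axis i (f x $ i))" for i
 proof -
  have "continuous_on UNIV (\<lambda>y::'b. if j = i then y else 0)" for j :: 'd by (cases "j = i") auto
  then have "continuous_on UNIV (\<lambda>y::'b. axis i y :: 'b^'d)"
   unfolding axis_def by (intro continuous_on_vec_lambda)
  from borel_measurable_continuous_on[OF this sqintD(1)[OF spec[OF f, of i]]]
  show ?thesis by (rule sqint_mono[OF spec[OF f, of i]]) (simp add: norm_eq_sqrt_inner inner_axis_axis)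
 qed
 then have "sqint M (\<lambda>x. \<Sum>i\<in>UNIV. axis i (f x $ i))" by (intro sqint_sum)
 moreover have "(\<Sum>i\<in>UNIV. axis i (y $ i)) = y" for y :: "'b^'d"
  by (simp add: vec_eq_iff sum_component axis_def sum.delta cong: if_cong)
 ultimately show "sqint M f" by simp
qed

lemma l2_vec_square:
 fixes f :: "'a => 'b::euclidean_space^'d"
 assumes "sqint M f" shows "(l2 M f)\<^sup>2 = (\<Sum>i\<in>UNIV. (l2 M (\<lambda>x. f x $ i))\<^sup>2)"
proof -
 have n: "(norm (f x))\<^sup>2 = (\<Sum>i\<in>UNIV. (norm (f x $ i))\<^sup>2)" for x
  unfolding power2_norm_eq_inner inner_vec_def ..
 show ?thesis
  unfolding l2_square n using assms by (intro Bochner_Integration.integral_sum) (auto simp: sqint_vec_iff)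
qed

lemma sqint_cong_AE:
 assumes "sqint M f" "g \<in> borel_measurable M" "AE x in M. f x = g x" shows "sqint M g"
 using assms(3) by (intro sqint_mono[OF assms(1,2)]) (auto elim: eventually_mono)

lemma tendsto_l2_dominated:
 fixes f :: "nat => 'a => 'b::euclidean_space"
 assumes "\<And>n. f n \<in> borel_measurable M" "sqint M W" "\<And>n. AE x in M. norm (f n x) \<le> norm (W x)"
  "AE x in M. (\<lambda>n. f n x) \<longlonglongrightarrow> 0"
 shows "(\<lambda>n. l2 M (f n)) \<longlonglongrightarrow> 0"
proof -
 have "(\<lambda>n. LINT x|M. (norm (f n x))\<^sup>2) \<longlonglongrightarrow> (LINT x|M. 0)"
 proof (rule integral_dominated_convergence[where w = "\<lambda>x. (norm (W x))\<^sup>2"])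
  show "AE x in M. (\<lambda>n. (norm (f n x))\<^sup>2) \<longlonglongrightarrow> 0"
   using assms(4)
  proof eventually_elim
   case (elim x)
   show ?case using tendsto_power[OF tendsto_norm_zero[OF elim], of 2] by simp
  qed
  show "AE x in M. norm ((norm (f n x))\<^sup>2) \<le> (norm (W x))\<^sup>2" for n
   using assms(3)[of n] by eventually_elim (simp add: power_mono)
 qed (use assms in auto)
 then have "(\<lambda>n. sqrt (LINT x|M. (norm (f n x))\<^sup>2)) \<longlonglongrightarrow> sqrt 0" by (intro tendsto_real_sqrt) simp
 then show ?thesis by (simp add: l2_def)
qed

section \<open>Solvability of the dual problem\<close>

locale bounded_open =
 fixes \<Omega> :: "(real^'d) set"
 assumes open_\<Omega>: "open \<Omega>" and bounded_\<Omega>: "bounded \<Omega>"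
begin

abbreviation M where "M \<equiv> lebesgue_on \<Omega>"

lemma finite_M: "finite_measure M" using open_\<Omega> bounded_\<Omega> by (rule lebesgue_on_open_finite)

lemma lebesgue_\<Omega>: "\<Omega> \<in> sets lebesgue" using open_\<Omega> by simp

lemma L2_iff: "g \<in> L2 \<Omega> \<longleftrightarrow> sqint M g"
 by (simp add: L2_def sqint_def)

lemma L2_inner_self: "L2_inner \<Omega> g g = (l2 M g)\<^sup>2"
 unfolding l2_square by (simp add: L2_inner_def power2_eq_square)

lemma test_smooth: "\<phi> \<in> test_functions \<Omega> ==> smooth \<phi>"
 by (simp add: test_functions_def smooth_def)

lemma test_functionI:
 assumes "smooth \<phi>" "compact K" "K \<subseteq> \<Omega>" "\<And>x. x \<notin> K ==> \<phi> x = 0"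
 shows "\<phi> \<in> test_functions \<Omega>"
proof -
 have "closure {x. \<phi> x \<noteq> 0} \<subseteq> K"
  using assms by (intro closure_minimal compact_imp_closed) auto
 then show ?thesis
  using assms compact_Int_closed[of K "closure {x. \<phi> x \<noteq> 0}"]
  by (simp add: test_functions_def smooth_def Int_absorb1 subset_trans[of _ K \<Omega>])
qed

lemma sqint_continuous: "continuous_on UNIV (f :: real^'d => 'b::euclidean_space) ==> sqint M f"
 using continuous_sqint open_\<Omega> bounded_\<Omega> by blast

lemma sqint_smooth: "smooth f ==> sqint M f"
 by (intro sqint_continuous smooth_continuous_on)

lemma sqint_test: "\<phi> \<in> test_functions \<Omega> ==> sqint M \<phi>"
 by (intro sqint_smooth test_smooth)

lemma sqint_test_partial: "\<phi> \<in> test_functions \<Omega> ==> sqint M (partial i \<phi>)"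
 by (intro sqint_smooth smooth_partial test_smooth)

lemma sqint_test_grad: "\<phi> \<in> test_functions \<Omega> ==> sqint M (grad \<phi>)"
 by (intro sqint_continuous continuous_on_grad test_smooth)

lemma locally_integrable_sqint: "sqint M g ==> locally_integrable \<Omega> g"
 unfolding locally_integrable_def
proof (intro allI impI)
 fix K assume g: "sqint M g" and K: "compact K \<and> K \<subseteq> \<Omega>"
 have "set_integrable lebesgue \<Omega> g"
  using sqint_integrable[OF finite_M g] lebesgue_\<Omega>
  by (simp add: integrable_restrict_space set_integrable_def)
 then show "g absolutely_integrable_on K" using K by (auto intro!: set_integrable_subset[of lebesgue \<Omega> g K] borel_compact)
qed

text \<open>Products of \<open>flat 0\<close> cut-offs approximate indicators of boxes, so
  \<open>g\<close> has zero integral over every box in \<open>\<Omega>\<close>; differentiating the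
  integral along shrinking cubes gives \<open>g = 0\<close> a.e.\<close>

lemma fundamental_lemma:
 assumes g: "integrable M g" and z: "\<And>\<phi>. \<phi> \<in> test_functions \<Omega> ==> (LINT x|M. g x * \<phi> x) = 0"
 shows "AE x in M. g x = 0"
proof -
 have box0: "integral (cbox a b) g = 0" if ab: "cbox a b \<subseteq> \<Omega>" for a b
 proof -
  define \<phi> where "\<phi> n x = (\<Prod>i\<in>UNIV. flat 0 (real n * (x $ i - a $ i)) * flat 0 (real n * (b $ i - x $ i)))" for n and x :: "real^'d"
  have \<phi>s: "smooth (\<phi> n)" for n unfolding \<phi>_def by (intro smooth_intros)
  have \<phi>0: "\<phi> n x = 0" if out: "x \<notin> box a b" for n x
  proof -
   obtain i where "\<not> (a $ i < x $ i \<and> x $ i < b $ i)" using out by (auto simp: mem_box_cart)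
   then have "real n * (x $ i - a $ i) \<le> 0 \<or> real n * (b $ i - x $ i) \<le> 0"
    by (auto intro: mult_nonneg_nonpos)
   then have "flat 0 (real n * (x $ i - a $ i)) * flat 0 (real n * (b $ i - x $ i)) = 0"
    by (auto simp: flat_def)
   then show ?thesis unfolding \<phi>_def by (intro prod_zero) auto
  qed
  have \<phi>1: "\<bar>\<phi> n x\<bar> \<le> 1" for n x
   unfolding \<phi>_def abs_prod abs_mult using flat_nonneg flat_le_one[of 0]
   by (intro prod_le_1) (auto intro!: mult_le_one)
  have lim: "(\<lambda>n. \<phi> n x) \<longlonglongrightarrow> indicator (box a b) x" for x
  proof (cases "x \<in> box a b")
   case True
   then have "(\<lambda>n. \<phi> n x) \<longlonglongrightarrow> (\<Prod>i\<in>(UNIV::'d set). 1 * 1)"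
    unfolding \<phi>_def by (intro tendsto_prod tendsto_mult filterlim_compose[OF flat_0_at_top filterlim_scaled_at_top])
     (auto simp: mem_box_cart)
   then show ?thesis using True by simp
  qed (simp add: \<phi>0)
  have \<phi>t: "\<phi> n \<in> test_functions \<Omega>" for n
   by (rule test_functionI[OF \<phi>s compact_cbox ab]) (use \<phi>0 box_subset_cbox in blast)
  have "(\<lambda>n. LINT x|M. g x * \<phi> n x) \<longlonglongrightarrow> (LINT x|M. g x * indicator (box a b) x)"
  proof (rule integral_dominated_convergence[where w = "\<lambda>x. \<bar>g x\<bar>"])
   show "AE x in M. (\<lambda>n. g x * \<phi> n x) \<longlonglongrightarrow> g x * indicator (box a b) x"
    by (intro AE_I2 tendsto_intros lim)
   show "AE x in M. norm (g x * \<phi> n x) \<le> \<bar>g x\<bar>" for n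
    using \<phi>1 by (intro AE_I2) (simp add: abs_mult mult_left_le)
   have "box a b \<inter> \<Omega> \<in> sets M" using open_\<Omega> by (intro sets_restrict_space_iff[THEN iffD2]) auto
   then have "indicat_real (box a b) \<in> borel_measurable M" by (simp add: borel_measurable_indicator_iff Int_commute)
   then show "(\<lambda>x. g x * indicator (box a b) x) \<in> borel_measurable M"
    using g by (intro borel_measurable_times) auto
   show "(\<lambda>x. g x * \<phi> n x) \<in> borel_measurable M" for n
    using g sqintD(1)[OF sqint_smooth[OF \<phi>s]] by (intro borel_measurable_times) auto
  qed (use g in auto)
  then have "(LINT x|M. g x * indicator (box a b) x) = 0"
   using z[OF \<phi>t] LIMSEQ_unique[OF _ tendsto_const] by auto
  moreover have bs: "box a b \<subseteq> \<Omega>" using box_subset_cbox ab by blast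
  have "(LINT x|M. g x * indicator (box a b) x) = (LINT x|lebesgue_on (box a b). g x)"
   using lebesgue_\<Omega> bs by (subst (1 2) integral_restrict_space)
    (auto intro!: Bochner_Integration.integral_cong simp: indicator_def)
  moreover have "integrable (lebesgue_on (box a b)) g"
   using g lebesgue_\<Omega> bs set_integrable_subset[of lebesgue \<Omega> g "box a b"]
   by (simp add: integrable_restrict_space set_integrable_def)
  from lebesgue_integral_eq_integral[OF this] have "(LINT x|lebesgue_on (box a b). g x) = integral (cbox a b) g"
   by (simp add: integral_open_interval)
  ultimately show ?thesis by simp
 qed
 define f where "f x = (if x \<in> \<Omega> then g x else 0)" for x
 have "f integrable_on UNIV"
  using integrable_on_lebesgue_on[OF g lebesgue_\<Omega>] unfolding f_def integrable_restrict_UNIV .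
 then have "f integrable_on cbox a b" for a b by (rule integrable_on_subcbox) auto
 then obtain N where N: "negligible N"
  "\<And>x e. x \<notin> N ==> 0 < e ==> \<exists>d>0. \<forall>h. 0 < h \<and> h < d \<longrightarrow>
    norm (integral (cbox x (x + h *\<^sub>R One)) f /\<^sub>R h ^ DIM(real^'d) - f x) < e"
  using integrable_ccontinuous_explicit by blast
 have "g x = 0" if x: "x \<in> \<Omega>" "x \<notin> N" for x
 proof (rule ccontr)
  assume "g x \<noteq> 0"
  then obtain d where d: "0 < d" "\<And>h. 0 < h ==> h < d ==>
    norm (integral (cbox x (x + h *\<^sub>R One)) f /\<^sub>R h ^ DIM(real^'d) - f x) < \<bar>g x\<bar>"
   using N(2)[OF x(2), of "\<bar>g x\<bar>"] by auto
  obtain e where e: "0 < e" "ball x e \<subseteq> \<Omega>" using open_\<Omega> x openE by blast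
  define h where "h = min (d / 2) (e / (2 * real CARD('d)))"
  have h: "0 < h" "h < d" "h * real CARD('d) < e" using d e by (auto simp: h_def min_def field_simps)
  have sub: "cbox x (x + h *\<^sub>R One) \<subseteq> \<Omega>"
  proof
   fix y assume y: "y \<in> cbox x (x + h *\<^sub>R One)"
   have "\<bar>(y - x) $ i\<bar> \<le> h" for i
   proof -
    have "x $ i \<le> y $ i" "y $ i \<le> (x + h *\<^sub>R One) $ i" using y by (auto simp: mem_box_cart)
    moreover have "(One :: real^'d) $ i = 1"
     by (simp add: cart_eq_inner_axis inner_sum_left_Basis axis_in_Basis_iff)
    ultimately show ?thesis by simp
   qed
   then have "norm (y - x) \<le> (\<Sum>i\<in>(UNIV::'d set). h)"
    by (intro order_trans[OF norm_le_l1_cart] sum_mono) auto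
   then have "dist x y < e" using h by (simp add: dist_norm norm_minus_commute mult.commute)
   then show "y \<in> \<Omega>" using e by auto
  qed
  have "integral (cbox x (x + h *\<^sub>R One)) f = integral (cbox x (x + h *\<^sub>R One)) g"
   by (rule Henstock_Kurzweil_Integration.integral_cong) (use sub in \<open>auto simp: f_def\<close>)
  then show False using d(2)[OF h(1,2)] box0[OF sub] x by (simp add: f_def)
 qed
 then have "{x \<in> space M. g x \<noteq> 0} \<subseteq> N" by auto
 moreover have "negligible {x \<in> space M. g x \<noteq> 0}" using N(1) calculation negligible_subset by blast
 ultimately have "AE x in lebesgue. x \<in> \<Omega> \<longrightarrow> g x = 0"
  by (auto simp: negligible_iff_null_sets intro: AE_I'[where N = "{x \<in> \<Omega>. g x \<noteq> 0}"])
 then show ?thesis using lebesgue_\<Omega> by (simp add: AE_restrict_space_iff)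
qed

end

lemma partial_zero_outside:
 assumes "compact K" "\<And>x. x \<notin> K ==> \<phi> x = 0" "x \<notin> K"
 shows "partial i \<phi> x = 0"
proof -
 have "open (- K)" using assms(1) by (simp add: open_Compl compact_imp_closed)
 then have "(\<phi> has_derivative (\<lambda>h. 0)) (at x)"
  using assms has_derivative_transform_within_open[of "\<lambda>x. 0" "\<lambda>h. 0" x UNIV "- K" \<phi>] by auto
 then show ?thesis by (simp add: partial_eqI)
qed

text \<open>The product \<open>f x * \<phi> x\<close> has compact support, so its derivative
  integrates to zero over the whole space and, vanishing outside \<open>K\<close>, over
  \<open>S\<close>.\<close>

lemma integration_by_parts:
 fixes f \<phi> :: "real^'d => real"
 assumes f: "smooth f" and \<phi>: "smooth \<phi>" "compact K" "\<And>x. x \<notin> K ==> \<phi> x = 0" and S: "K \<subseteq> S" "open S" "bounded S"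
 shows "(LINT x|lebesgue_on S. f x * partial i \<phi> x) = - (LINT x|lebesgue_on S. partial i f x * \<phi> x)"
proof -
 have s: "smooth (\<lambda>x. f x * \<phi> x)" by (intro smooth_intros f \<phi>)
 have p: "partial i (\<lambda>x. f x * \<phi> x) x = partial i f x * \<phi> x + f x * partial i \<phi> x" for x
  by (simp add: partial_smooth_mult f \<phi>)
 obtain R where R: "\<And>x. x \<in> K ==> norm x \<le> R" using compact_imp_bounded[OF \<phi>(2)] by (auto simp: bounded_iff)
 have "(LINT x|lborel. partial i (\<lambda>x. f x * \<phi> x) x) = 0"
  by (rule integral_partial_compact_support[OF smooth_differentiable[OF s] smooth_continuous_on[OF smooth_partial[OF s]]])
    (use \<phi>(3) R in force)
 moreover have "(LINT x|lebesgue_on S. partial i (\<lambda>x. f x * \<phi> x) x) = (LINT x|lborel. partial i (\<lambda>x. f x * \<phi> x) x)"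
 proof (rule lebesgue_on_integral_vanishing)
  show "partial i (\<lambda>x. f x * \<phi> x) \<in> borel_measurable borel"
   by (intro borel_measurable_continuous_onI smooth_continuous_on smooth_partial s)
  fix x assume "x \<notin> S"
  then show "partial i (\<lambda>x. f x * \<phi> x) x = 0"
   using S \<phi>(3) by (intro partial_zero_outside[OF \<phi>(2)]) auto
 qed (use S in auto)
 moreover have "integrable (lebesgue_on S) (\<lambda>x. partial i f x * \<phi> x)" "integrable (lebesgue_on S) (\<lambda>x. f x * partial i \<phi> x)"
  by (intro continuous_integrable S smooth_continuous_on smooth_mult smooth_partial f \<phi>)+
 ultimately show ?thesis by (simp add: p)
qed

section \<open>Weak gradients and the space V\<close>

context bounded_open
begin

lemma test_compact:
 assumes "\<phi> \<in> test_functions \<Omega>"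
 obtains K where "compact K" "K \<subseteq> \<Omega>" "\<And>x. x \<notin> K ==> \<phi> x = 0"
proof (rule that[of "closure {x. \<phi> x \<noteq> 0}"])
 show "\<phi> x = 0" if "x \<notin> closure {x. \<phi> x \<noteq> 0}" for x
  using that closure_subset[of "{x. \<phi> x \<noteq> 0}"] by blast
qed (use assms in \<open>auto simp: test_functions_def\<close>)

text \<open>A relation to an explicitly given gradient in place of the chosen representative
  \<open>weak_partial\<close>; it is stable under sums, multiples and changes on null sets.\<close>

definition wgrad :: "(real^'d => real) => (real^'d => real^'d) => bool" where
 "wgrad v p \<longleftrightarrow> sqint M v \<and> sqint M p \<and>
  (\<forall>\<phi>\<in>test_functions \<Omega>. \<forall>i. (LINT x|M. v x * partial i \<phi> x) = - (LINT x|M. p x $ i * \<phi> x))"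

lemma sqint_component: "sqint M p ==> sqint M (\<lambda>x. p x $ i :: 'b::euclidean_space)"
 by (simp add: sqint_vec_iff)

lemma wgrad_sqint: "wgrad v p ==> sqint M v" "wgrad v p ==> sqint M p"
 by (simp_all add: wgrad_def)

lemma wgrad_smooth:
 assumes "smooth w" shows "wgrad w (grad w)"
 unfolding wgrad_def
proof (intro conjI ballI allI)
 fix \<phi> i assume "\<phi> \<in> test_functions \<Omega>"
 moreover from this obtain K where "compact K" "K \<subseteq> \<Omega>" "\<And>x. x \<notin> K ==> \<phi> x = 0" using test_compact by blast
 ultimately show "(LINT x|M. w x * partial i \<phi> x) = - (LINT x|M. grad w x $ i * \<phi> x)"
  using integration_by_parts[OF assms test_smooth _ _ _ open_\<Omega> bounded_\<Omega>] by (simp add: grad_def)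
qed (intro sqint_smooth sqint_continuous continuous_on_grad assms)+

lemma wgrad_add:
 assumes "wgrad v p" "wgrad w q" shows "wgrad (\<lambda>x. v x + w x) (\<lambda>x. p x + q x)"
 unfolding wgrad_def
proof (intro conjI ballI allI)
 fix \<phi> i assume \<phi>: "\<phi> \<in> test_functions \<Omega>"
 note I = sqint_integrable_mult[OF _ sqint_test[OF \<phi>]] sqint_integrable_mult[OF _ sqint_test_partial[OF \<phi>]]
 show "(LINT x|M. (v x + w x) * partial i \<phi> x) = - (LINT x|M. (p x + q x) $ i * \<phi> x)"
  using assms \<phi> by (simp add: wgrad_def distrib_right I sqint_component)
qed (use assms in \<open>auto simp: wgrad_def intro: sqint_add\<close>)

lemma wgrad_cmult:
 assumes "wgrad v p" shows "wgrad (\<lambda>x. c * v x) (\<lambda>x. c *\<^sub>R p x)"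
 using assms sqint_scaleR[of M v c] by (auto simp: wgrad_def mult.assoc intro: sqint_scaleR)

lemma wgrad_cong:
 assumes v: "wgrad v p" and v': "v' \<in> borel_measurable M" "AE x in M. v x = v' x"
  and p': "p' \<in> borel_measurable M" "AE x in M. p x = p' x"
 shows "wgrad v' p'"
proof -
 have s: "sqint M v'" "sqint M p'" using sqint_cong_AE[OF _ v'] sqint_cong_AE[OF _ p'] v by (auto simp: wgrad_def)
 show ?thesis
  unfolding wgrad_def
 proof (intro conjI ballI allI s)
  fix \<phi> i assume \<phi>: "\<phi> \<in> test_functions \<Omega>"
  note I = sqint_integrable_mult[OF _ sqint_test[OF \<phi>], THEN borel_measurable_integrable]
   sqint_integrable_mult[OF _ sqint_test_partial[OF \<phi>], THEN borel_measurable_integrable]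
  have "(LINT x|M. v' x * partial i \<phi> x) = (LINT x|M. v x * partial i \<phi> x)"
   by (rule integral_cong_AE) (use v v' s I in \<open>auto simp: wgrad_def elim: eventually_mono\<close>)
  moreover have "(LINT x|M. p' x $ i * \<phi> x) = (LINT x|M. p x $ i * \<phi> x)"
   by (rule integral_cong_AE)
     (use p' I(1)[OF sqint_component[OF s(2)]] I(1)[OF sqint_component[OF wgrad_sqint(2)[OF v]]] in \<open>auto elim: eventually_mono\<close>)
  ultimately show "(LINT x|M. v' x * partial i \<phi> x) = - (LINT x|M. p' x $ i * \<phi> x)"
   using v \<phi> by (simp add: wgrad_def)
 qed
qed

text \<open>The choice in \<open>weak_partial\<close> is harmless: by the fundamental lemma, any two
  weak derivatives agree a.e.\<close>

lemma weak_partial_AE_eq: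
 assumes "wgrad v p"
 shows "sqint M (weak_partial \<Omega> i v)" "has_weak_partial \<Omega> i v (weak_partial \<Omega> i v)"
  "AE x in M. weak_partial \<Omega> i v x = p x $ i"
proof -
 have "(\<lambda>x. p x $ i) \<in> L2 \<Omega> \<and> has_weak_partial \<Omega> i v (\<lambda>x. p x $ i)"
  using assms by (auto simp: wgrad_def has_weak_partial_def L2_iff sqint_component intro: locally_integrable_sqint)
 from someI[of "\<lambda>g. g \<in> L2 \<Omega> \<and> has_weak_partial \<Omega> i v g", OF this]
 have g: "weak_partial \<Omega> i v \<in> L2 \<Omega>" "has_weak_partial \<Omega> i v (weak_partial \<Omega> i v)"
  by (simp_all add: weak_partial_def)
 then show s: "sqint M (weak_partial \<Omega> i v)" and "has_weak_partial \<Omega> i v (weak_partial \<Omega> i v)" by (simp_all add: L2_iff)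
 have p: "sqint M (\<lambda>x. p x $ i)" using assms by (auto simp: wgrad_def sqint_component)
 have "AE x in M. weak_partial \<Omega> i v x - p x $ i = 0"
 proof (rule fundamental_lemma[OF sqint_integrable[OF finite_M sqint_diff[OF s p]]])
  fix \<phi> assume \<phi>: "\<phi> \<in> test_functions \<Omega>"
  show "(LINT x|M. (weak_partial \<Omega> i v x - p x $ i) * \<phi> x) = 0"
   using g(2) assms \<phi> by (simp add: left_diff_distrib sqint_integrable_mult[OF _ sqint_test] s p has_weak_partial_def wgrad_def)
 qed
 then show "AE x in M. weak_partial \<Omega> i v x = p x $ i" by simp
qed

lemma sobolev_H1_iff: "v \<in> sobolev_H1 \<Omega> \<longleftrightarrow> (\<exists>p. wgrad v p)"
proof
 assume "v \<in> sobolev_H1 \<Omega>"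
 then have v: "sqint M v" and "\<forall>i. \<exists>g. sqint M g \<and> has_weak_partial \<Omega> i v g"
  by (auto simp: sobolev_H1_def L2_iff Bex_def)
 then obtain g where g: "\<And>i. sqint M (g i)" "\<And>i. has_weak_partial \<Omega> i v (g i)" by metis
 then have "wgrad v (\<lambda>x. \<chi> i. g i x)" using v by (auto simp: wgrad_def has_weak_partial_def sqint_vec_iff)
 then show "\<exists>p. wgrad v p" by blast
next
 assume "\<exists>p. wgrad v p"
 then show "v \<in> sobolev_H1 \<Omega>"
  using weak_partial_AE_eq(1,2) wgrad_sqint(1) unfolding sobolev_H1_def L2_iff Bex_def by blast
qed

lemma wgrad_weak_partial:
 assumes "v \<in> sobolev_H1 \<Omega>" shows "wgrad v (\<lambda>x. \<chi> i. weak_partial \<Omega> i v x)"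
proof -
 obtain p where p: "wgrad v p" using assms sobolev_H1_iff by blast
 have "AE x in M. \<forall>i. weak_partial \<Omega> i v x = p x $ i"
  using weak_partial_AE_eq(3)[OF p] by (intro AE_finite_allI[of UNIV, simplified]) auto
 then show ?thesis
  using weak_partial_AE_eq(1)[OF p] wgrad_sqint(1)[OF p]
  by (intro wgrad_cong[OF p] sqintD(1)[of _ "\<lambda>x. \<chi> i. weak_partial \<Omega> i v x"])
    (auto simp: sqint_vec_iff vec_eq_iff elim!: eventually_mono)
qed

lemma H1_norm_eq:
 assumes "wgrad v p" shows "H1_norm \<Omega> v = l2 M (\<lambda>x. (v x, p x))"
proof -
 note w = weak_partial_AE_eq[OF assms]
 have "l2 M (weak_partial \<Omega> i v) = l2 M (\<lambda>x. p x $ i)" for i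
  using w(1,3) wgrad_sqint(2)[OF assms] by (intro l2_cong_AE) (auto dest: sqint_component)
 then have "H1_norm \<Omega> v = sqrt ((l2 M v)\<^sup>2 + (l2 M p)\<^sup>2)"
  by (simp add: H1_norm_def L2_inner_self l2_vec_square[OF wgrad_sqint(2)[OF assms]])
 then show ?thesis by (simp flip: sqint_Pair(2)[OF wgrad_sqint[OF assms]])
qed

text \<open>Encodes \<open>v \<in> H\<^sup>1\<^sub>0(\<Omega>)\<close> with weak gradient \<open>p\<close>.\<close>

definition closure_test :: "(real^'d => real) => (real^'d => real^'d) => bool" where
 "closure_test v p \<longleftrightarrow> sqint M v \<and> sqint M p \<and>
  (\<forall>e>0. \<exists>\<phi>\<in>test_functions \<Omega>. l2 M (\<lambda>x. (v x - \<phi> x, p x - grad \<phi> x)) < e)"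

text \<open>An element of \<open>V_space\<close> with its first and second derivatives. As in
  \<open>weak_hessian\<close>, the entry \<open>P x $ i $ j\<close> is the derivative in direction
  \<open>i\<close> of the \<open>j\<close>-th partial derivative.\<close>

definition V_triple :: "(real^'d => real) => (real^'d => real^'d) => (real^'d => real^'d^'d) => bool" where
 "V_triple v p P \<longleftrightarrow> wgrad v p \<and> (\<forall>j. wgrad (\<lambda>x. p x $ j) (\<lambda>x. \<chi> i. P x $ i $ j)) \<and> closure_test v p"

lemma closure_test_iff:
 assumes "wgrad v p"
 shows "closure_test v p \<longleftrightarrow> (\<exists>\<phi>. (\<forall>k. \<phi> k \<in> test_functions \<Omega>) \<and> (\<lambda>k. H1_norm \<Omega> (\<lambda>x. v x - \<phi> k x)) \<longlonglongrightarrow> 0)"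
proof -
 have N: "H1_norm \<Omega> (\<lambda>x. v x - \<phi> x) = l2 M (\<lambda>x. (v x - \<phi> x, p x - grad \<phi> x))" if "\<phi> \<in> test_functions \<Omega>" for \<phi>
  using H1_norm_eq[OF wgrad_add[OF assms wgrad_cmult[OF wgrad_smooth[OF test_smooth[OF that]], of "-1"]]] by simp
 show ?thesis
 proof
  assume "closure_test v p"
  then have "\<forall>k::nat. \<exists>\<phi>. \<phi> \<in> test_functions \<Omega> \<and> l2 M (\<lambda>x. (v x - \<phi> x, p x - grad \<phi> x)) < 1 / real (Suc k)"
   unfolding closure_test_def by (meson of_nat_0_less_iff zero_less_Suc zero_less_divide_1_iff)
  from choice[OF this] obtain \<phi> where \<phi>: "\<And>k. \<phi> k \<in> test_functions \<Omega>"
   "\<And>k. l2 M (\<lambda>x. (v x - \<phi> k x, p x - grad (\<phi> k) x)) < 1 / real (Suc k)" by blast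
  have "(\<lambda>k. H1_norm \<Omega> (\<lambda>x. v x - \<phi> k x)) \<longlonglongrightarrow> 0"
  proof (rule tendsto_sandwich[OF _ _ tendsto_const LIMSEQ_inverse_real_of_nat])
   show "\<forall>\<^sub>F k in sequentially. H1_norm \<Omega> (\<lambda>x. v x - \<phi> k x) \<le> inverse (real (Suc k))"
    using \<phi>(2) by (intro always_eventually) (auto simp: N[OF \<phi>(1)] inverse_eq_divide intro: less_imp_le)
  qed (simp add: N[OF \<phi>(1)])
  then show "\<exists>\<phi>. (\<forall>k. \<phi> k \<in> test_functions \<Omega>) \<and> (\<lambda>k. H1_norm \<Omega> (\<lambda>x. v x - \<phi> k x)) \<longlonglongrightarrow> 0" using \<phi>(1) by blast
 next
  assume "\<exists>\<phi>. (\<forall>k. \<phi> k \<in> test_functions \<Omega>) \<and> (\<lambda>k. H1_norm \<Omega> (\<lambda>x. v x - \<phi> k x)) \<longlonglongrightarrow> 0"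
  then obtain \<phi> where \<phi>: "\<And>k. \<phi> k \<in> test_functions \<Omega>" "(\<lambda>k. H1_norm \<Omega> (\<lambda>x. v x - \<phi> k x)) \<longlonglongrightarrow> 0" by blast
  have "\<exists>\<phi>\<in>test_functions \<Omega>. l2 M (\<lambda>x. (v x - \<phi> x, p x - grad \<phi> x)) < e" if "0 < e" for e
  proof -
   have "\<forall>\<^sub>F k in sequentially. H1_norm \<Omega> (\<lambda>x. v x - \<phi> k x) < e" using order_tendstoD(2)[OF \<phi>(2) that] .
   then obtain k where "H1_norm \<Omega> (\<lambda>x. v x - \<phi> k x) < e" by (meson eventually_sequentially order_refl)
   then show ?thesis using N[OF \<phi>(1)] \<phi>(1) by (intro bexI[of _ "\<phi> k"]) auto
  qed
  then show "closure_test v p" using wgrad_sqint[OF assms] by (simp add: closure_test_def)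
 qed
qed

lemma V_triple_weak:
 assumes "v \<in> V_space \<Omega>"
 shows "V_triple v (\<lambda>x. \<chi> i. weak_partial \<Omega> i v x) (weak_hessian \<Omega> v)"
proof -
 have v: "v \<in> sobolev_H1 \<Omega>" "\<And>i. weak_partial \<Omega> i v \<in> sobolev_H1 \<Omega>" "v \<in> sobolev_H10 \<Omega>"
  using assms by (auto simp: V_space_def sobolev_H2_def)
 note w = wgrad_weak_partial[OF v(1)]
 then show ?thesis
  using wgrad_weak_partial[OF v(2)] v(3) closure_test_iff[OF w]
  by (simp add: V_triple_def weak_hessian_def sobolev_H10_def)
qed

lemma V_triple_V_space:
 assumes "V_triple v p P"
 shows "v \<in> V_space \<Omega>" "AE x in M. weak_hessian \<Omega> v x = P x" "H2_norm \<Omega> v = l2 M (\<lambda>x. (v x, p x, P x))"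
proof -
 have w: "wgrad v p" and wj: "\<And>j. wgrad (\<lambda>x. p x $ j) (\<lambda>x. \<chi> i. P x $ i $ j)" and c: "closure_test v p"
  using assms by (simp_all add: V_triple_def)
 \<comment> \<open>The second choice in \<open>weak_hessian\<close> is applied to the result of the
   first; the latter differs from \<open>p x $ j\<close> only on a null set, which
   \<open>wgrad\<close> ignores.\<close>
 have w2: "wgrad (weak_partial \<Omega> j v) (\<lambda>x. \<chi> i. P x $ i $ j)" for j
  using weak_partial_AE_eq[OF w, of j] wgrad_sqint(2)[OF wj]
  by (intro wgrad_cong[OF wj]) (auto elim: eventually_mono)
 show "v \<in> V_space \<Omega>"
  using w w2 c closure_test_iff[OF w] by (auto simp: V_space_def sobolev_H2_def sobolev_H10_def sobolev_H1_iff)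
 note e = weak_partial_AE_eq[OF w2]
 have "AE x in M. \<forall>i j. weak_partial \<Omega> i (weak_partial \<Omega> j v) x = P x $ i $ j"
  using e(3) by (intro AE_finite_allI[of UNIV, simplified]) auto
 then show "AE x in M. weak_hessian \<Omega> v x = P x"
  by eventually_elim (simp add: weak_hessian_def vec_eq_iff)
 have sP: "sqint M P" using wgrad_sqint(2)[OF wj] by (simp add: sqint_vec_iff)
 note sp = wgrad_sqint[OF w]
 have 1: "l2 M (weak_partial \<Omega> i v) = l2 M (\<lambda>x. p x $ i)" for i
  using weak_partial_AE_eq(1,3)[OF w] sp(2) by (intro l2_cong_AE) (auto dest: sqint_component)
 have 2: "l2 M (weak_partial \<Omega> i (weak_partial \<Omega> j v)) = l2 M (\<lambda>x. P x $ i $ j)" for i j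
  using e(1,3) sqint_component[OF sqint_component[OF sP]] by (intro l2_cong_AE) auto
 have "H2_norm \<Omega> v = sqrt ((l2 M v)\<^sup>2 + (l2 M p)\<^sup>2 + (l2 M P)\<^sup>2)"
  by (simp add: H2_norm_def L2_inner_self 1 2 l2_vec_square[OF sp(2)] l2_vec_square[OF sP]
    l2_vec_square[OF sqint_component[OF sP]])
 then show "H2_norm \<Omega> v = l2 M (\<lambda>x. (v x, p x, P x))"
  by (simp add: add.assoc flip: sqint_Pair(2)[OF sp(1) sqint_Pair(1)[OF sp(2) sP]] sqint_Pair(2)[OF sp(2) sP])
qed

lemma V_triple_sqint: "V_triple v p P ==> sqint M P"
 using wgrad_sqint(2) by (fastforce simp: V_triple_def sqint_vec_iff)

lemma sqint_weak_hessian: "v \<in> V_space \<Omega> ==> sqint M (weak_hessian \<Omega> v)"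
 using V_triple_weak V_triple_sqint by blast

lemma test_add:
 assumes "\<phi> \<in> test_functions \<Omega>" "\<psi> \<in> test_functions \<Omega>"
 shows "(\<lambda>x. \<phi> x + \<psi> x) \<in> test_functions \<Omega>"
proof -
 obtain K where "compact K" "K \<subseteq> \<Omega>" "\<And>x. x \<notin> K ==> \<phi> x = 0" using test_compact[OF assms(1)] by blast
 moreover obtain L where "compact L" "L \<subseteq> \<Omega>" "\<And>x. x \<notin> L ==> \<psi> x = 0" using test_compact[OF assms(2)] by blast
 ultimately show ?thesis
  by (intro test_functionI[of _ "K \<union> L", OF smooth_add[OF assms[THEN test_smooth]]]) auto
qed

lemma test_cmult:
 assumes "\<phi> \<in> test_functions \<Omega>" shows "(\<lambda>x. c * \<phi> x) \<in> test_functions \<Omega>"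
proof -
 obtain K where "compact K" "K \<subseteq> \<Omega>" "\<And>x. x \<notin> K ==> \<phi> x = 0" using test_compact[OF assms] by blast
 then show ?thesis by (intro test_functionI[of _ K, OF smooth_mult[OF smooth_const test_smooth[OF assms]]]) auto
qed

lemma test_zero: "(\<lambda>x. 0) \<in> test_functions \<Omega>"
 by (rule test_functionI[of _ "{}"]) auto

lemma grad_add: "smooth v ==> smooth w ==> grad (\<lambda>x. v x + w x) x = grad v x + grad w x"
 by (simp add: grad_def vec_eq_iff partial_smooth_add)

lemma grad_cmult: "smooth w ==> grad (\<lambda>x. c * w x) x = c *\<^sub>R grad w x"
 by (simp add: grad_def vec_eq_iff partial_smooth_cmult)

lemma closure_test_add:
 assumes "closure_test v p" "closure_test w q" shows "closure_test (\<lambda>x. v x + w x) (\<lambda>x. p x + q x)"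
 unfolding closure_test_def
proof (intro conjI allI impI)
 have s: "sqint M v" "sqint M p" "sqint M w" "sqint M q" using assms by (auto simp: closure_test_def)
 then show "sqint M (\<lambda>x. v x + w x)" "sqint M (\<lambda>x. p x + q x)" by (auto intro: sqint_add)
 fix e :: real assume "0 < e"
 then have e: "0 < e / 2" by simp
 obtain \<phi> \<psi> where \<phi>: "\<phi> \<in> test_functions \<Omega>" "l2 M (\<lambda>x. (v x - \<phi> x, p x - grad \<phi> x)) < e / 2"
  and \<psi>: "\<psi> \<in> test_functions \<Omega>" "l2 M (\<lambda>x. (w x - \<psi> x, q x - grad \<psi> x)) < e / 2"
  using assms e unfolding closure_test_def by meson
 have "l2 M (\<lambda>x. (v x - \<phi> x, p x - grad \<phi> x) + (w x - \<psi> x, q x - grad \<psi> x)) < e"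
  using l2_triangle[of M "\<lambda>x. (v x - \<phi> x, p x - grad \<phi> x)" "\<lambda>x. (w x - \<psi> x, q x - grad \<psi> x)"] \<phi> \<psi>
   s sqint_test sqint_test_grad by (simp add: sqint_Pair_iff sqint_diff)
 then have "l2 M (\<lambda>x. (v x + w x - (\<phi> x + \<psi> x), p x + q x - grad (\<lambda>x. \<phi> x + \<psi> x) x)) < e"
  by (simp add: grad_add test_smooth \<phi> \<psi> algebra_simps)
 then show "\<exists>\<phi>\<in>test_functions \<Omega>. l2 M (\<lambda>x. (v x + w x - \<phi> x, p x + q x - grad \<phi> x)) < e"
  using test_add[OF \<phi>(1) \<psi>(1)] by (intro bexI[of _ "\<lambda>x. \<phi> x + \<psi> x"])
qed

lemma closure_test_cmult:
 assumes "closure_test v p" shows "closure_test (\<lambda>x. c * v x) (\<lambda>x. c *\<^sub>R p x)"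
 unfolding closure_test_def
proof (intro conjI allI impI)
 have s: "sqint M v" "sqint M p" using assms by (auto simp: closure_test_def)
 then show "sqint M (\<lambda>x. c * v x)" "sqint M (\<lambda>x. c *\<^sub>R p x)" using sqint_scaleR[of M v c] by (auto intro: sqint_scaleR)
 fix e :: real assume "0 < e"
 then have e: "0 < e / (\<bar>c\<bar> + 1)" by simp
 obtain \<phi> where \<phi>: "\<phi> \<in> test_functions \<Omega>" "l2 M (\<lambda>x. (v x - \<phi> x, p x - grad \<phi> x)) < e / (\<bar>c\<bar> + 1)"
  using assms e unfolding closure_test_def by meson
 have "l2 M (\<lambda>x. c *\<^sub>R (v x - \<phi> x, p x - grad \<phi> x)) \<le> (\<bar>c\<bar> + 1) * l2 M (\<lambda>x. (v x - \<phi> x, p x - grad \<phi> x))"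
  unfolding l2_scaleR by (intro mult_right_mono) auto
 also have "\<dots> < e" using \<phi>(2) by (simp add: field_simps)
 finally have "l2 M (\<lambda>x. (c * v x - c * \<phi> x, c *\<^sub>R p x - grad (\<lambda>x. c * \<phi> x) x)) < e"
  by (simp add: grad_cmult test_smooth \<phi> algebra_simps)
 then show "\<exists>\<phi>\<in>test_functions \<Omega>. l2 M (\<lambda>x. (c * v x - \<phi> x, c *\<^sub>R p x - grad \<phi> x)) < e"
  using test_cmult[OF \<phi>(1)] by (intro bexI[of _ "\<lambda>x. c * \<phi> x"])
qed

lemma V_triple_add:
 assumes "V_triple v p P" "V_triple w q Q" shows "V_triple (\<lambda>x. v x + w x) (\<lambda>x. p x + q x) (\<lambda>x. P x + Q x)"
proof -
 have eq: "(\<chi> i. (P x + Q x) $ i $ j) = (\<chi> i. P x $ i $ j) + (\<chi> i. Q x $ i $ j)" for x j by (simp add: vec_eq_iff)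
 have "wgrad (\<lambda>x. (p x + q x) $ j) (\<lambda>x. \<chi> i. (P x + Q x) $ i $ j)" for j
  unfolding eq vector_add_component[of "p _"] using assms by (intro wgrad_add) (auto simp: V_triple_def)
 then show ?thesis using assms by (auto simp: V_triple_def intro: wgrad_add closure_test_add)
qed

lemma V_triple_cmult:
 assumes "V_triple v p P" shows "V_triple (\<lambda>x. c * v x) (\<lambda>x. c *\<^sub>R p x) (\<lambda>x. c *\<^sub>R P x)"
proof -
 have eq: "(\<chi> i. (c *\<^sub>R P x) $ i $ j) = c *\<^sub>R (\<chi> i. P x $ i $ j)" for x j by (simp add: vec_eq_iff)
 have "wgrad (\<lambda>x. (c *\<^sub>R p x) $ j) (\<lambda>x. \<chi> i. (c *\<^sub>R P x) $ i $ j)" for j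
  unfolding eq vector_scaleR_component[of _ "p _"] real_scaleR_def using assms by (intro wgrad_cmult) (auto simp: V_triple_def)
 then show ?thesis using assms by (auto simp: V_triple_def intro: wgrad_cmult closure_test_cmult)
qed

lemma V_triple_zero: "V_triple (\<lambda>x. 0) (\<lambda>x. 0) (\<lambda>x. 0)"
proof -
 have [simp]: "grad (\<lambda>x. 0) x = 0" "(\<chi> i. (0 :: real)) = (0 :: real^'d)" for x
  by (simp_all add: grad_def vec_eq_iff)
 have "l2 M (\<lambda>x. (0::real, 0::real^'d)) = 0" by (simp add: l2_def)
 then show ?thesis using test_zero by (auto simp: V_triple_def wgrad_def closure_test_def intro!: bexI[of _ "\<lambda>x. 0"])
qed

lemma V_space_add:
 assumes "v \<in> V_space \<Omega>" "w \<in> V_space \<Omega>"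
 shows "(\<lambda>x. v x + w x) \<in> V_space \<Omega>"
  "AE x in M. weak_hessian \<Omega> (\<lambda>x. v x + w x) x = weak_hessian \<Omega> v x + weak_hessian \<Omega> w x"
 using V_triple_V_space(1,2)[OF V_triple_add[OF assms[THEN V_triple_weak]]] .

lemma V_space_cmult:
 assumes "v \<in> V_space \<Omega>"
 shows "(\<lambda>x. c * v x) \<in> V_space \<Omega>" "AE x in M. weak_hessian \<Omega> (\<lambda>x. c * v x) x = c *\<^sub>R weak_hessian \<Omega> v x"
 using V_triple_V_space(1,2)[OF V_triple_cmult[OF assms[THEN V_triple_weak]]] .

lemma V_space_diff:
 assumes "v \<in> V_space \<Omega>" "w \<in> V_space \<Omega>"
 shows "(\<lambda>x. v x - w x) \<in> V_space \<Omega>"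
  "AE x in M. weak_hessian \<Omega> (\<lambda>x. v x - w x) x = weak_hessian \<Omega> v x - weak_hessian \<Omega> w x"
 using V_triple_V_space(1,2)[OF V_triple_add[OF V_triple_weak[OF assms(1)] V_triple_cmult[OF V_triple_weak[OF assms(2)], of "-1"]]]
 by simp_all

end

section \<open>Approximation of measurable data and extension by zero\<close>

lemma smooth_real_polynomial_function: "real_polynomial_function p ==> smooth p"
 using real_polynomial_function_polys polys_smooth by blast

lemma smooth_polynomial_matrix:
 fixes h :: "real^'d => real^'d^'d"
 assumes "polynomial_function h" shows "smooth (\<lambda>x. h x $ i $ j)"
proof -
 have "bounded_linear (\<lambda>y :: real^'d^'d. y $ i $ j)"
  by (rule bounded_linear_compose[OF bounded_linear_vec_nth bounded_linear_vec_nth])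
 then show ?thesis using assms by (auto simp: polynomial_function_def o_def intro: smooth_real_polynomial_function)
qed

lemma flat_2_mult: "flat 2 t * t = flat 1 t"
 by (simp add: flat_def power2_eq_square)

context bounded_open
begin

lemma AE_not_in_negligible:
 assumes "negligible N" shows "AE x in M. x \<notin> N"
proof -
 have "AE x in lebesgue. x \<notin> N" using assms by (intro AE_not_in) (simp add: negligible_iff_null_sets)
 then have "AE x in lebesgue. x \<in> \<Omega> \<longrightarrow> x \<notin> N" by eventually_elim simp
 then show ?thesis using lebesgue_\<Omega> by (simp add: AE_restrict_space_iff)
qed

text \<open>Continuous approximants are projected onto \<open>S\<close>; the closest-point map is
  continuous and fixes the limit, so convergence survives while the constraint holds at every
  point.\<close>

lemma measurable_continuous_approximation:
 fixes f :: "real^'d => 'b::euclidean_space"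
 assumes f: "f \<in> borel_measurable M" and S: "closed S" "convex S" "S \<noteq> {}" and fS: "AE x in M. f x \<in> S"
 obtains h where "\<And>n. continuous_on UNIV (h n)" "\<And>n x. h n x \<in> S" "AE x in M. (\<lambda>n. h n x) \<longlonglongrightarrow> f x"
proof -
 have "f measurable_on \<Omega>" using f lebesgue_\<Omega> by (simp add: measurable_on_iff_borel_measurable)
 then obtain N g where N: "negligible N" and g: "\<And>n. continuous_on UNIV (g n)"
  "\<And>x. x \<notin> N ==> (\<lambda>n. g n x) \<longlonglongrightarrow> (if x \<in> \<Omega> then f x else 0)"
  unfolding measurable_on_def by blast
 have cp: "continuous_on UNIV (closest_point S)" by (rule continuous_on_closest_point[OF S(2,1,3)])
 show ?thesis
 proof (rule that[of "\<lambda>n x. closest_point S (g n x)"])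
  show "continuous_on UNIV (\<lambda>x. closest_point S (g n x))" for n
   by (rule continuous_on_compose2[OF cp g(1)]) simp
  show "closest_point S (g n x) \<in> S" for n x by (rule closest_point_in_set[OF S(1,3)])
  show "AE x in M. (\<lambda>n. closest_point S (g n x)) \<longlonglongrightarrow> f x"
   using fS AE_not_in_negligible[OF N] AE_space
  proof eventually_elim
   case (elim x)
   then have "(\<lambda>n. closest_point S (g n x)) \<longlonglongrightarrow> closest_point S (f x)"
    using g(2)[of x] continuous_on_tendsto_compose[OF cp, of "\<lambda>n. g n x" "f x"] by simp
   then show ?case using closest_point_self[OF elim(1)] by simp
  qed
 qed
qed

text \<open>The gap between \<open>\<theta>\<close> and \<open>\<theta>'\<close> pays for the
  polynomial approximation error on the compact closure, and errors that shrink with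
  \<open>n\<close> preserve the a.e. limit.\<close>

lemma smooth_matrix_approximation:
 fixes B :: "real^'d => real^'d^'d"
 assumes B: "B \<in> borel_measurable M" "AE x in M. norm (B x - mat 1) \<le> \<theta>" and \<theta>: "0 \<le> \<theta>" "\<theta> < \<theta>'"
 obtains h where "\<And>n i j. smooth (\<lambda>x. h n x $ i $ j)" "\<And>n x. x \<in> \<Omega> ==> norm (h n x - mat 1) \<le> \<theta>'"
  "AE x in M. (\<lambda>n. h n x) \<longlonglongrightarrow> B x"
proof -
 have BS: "AE x in M. B x \<in> cball (mat 1) \<theta>"
  using B(2) by eventually_elim (simp add: dist_norm norm_minus_commute)
 obtain c where c: "\<And>n. continuous_on UNIV (c n)" "\<And>n x. c n x \<in> cball (mat 1) \<theta>" "AE x in M. (\<lambda>n. c n x) \<longlonglongrightarrow> B x"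
  by (rule measurable_continuous_approximation[OF B(1) closed_cball convex_cball _ BS]) (use \<theta> in auto)
 have cc: "compact (closure \<Omega>)" using bounded_\<Omega> by simp
 have "\<exists>p. polynomial_function p \<and> (\<forall>x\<in>closure \<Omega>. norm (c n x - p x) < (\<theta>' - \<theta>) / real (Suc n))" for n
  by (rule Stone_Weierstrass_polynomial_function[OF cc continuous_on_subset[OF c(1)]]) (use \<theta> in auto)
 then obtain h where h: "\<And>n. polynomial_function (h n)" "\<And>n x. x \<in> closure \<Omega> ==> norm (c n x - h n x) < (\<theta>' - \<theta>) / real (Suc n)"
  by metis
 show ?thesis
 proof (rule that[of h])
  show "smooth (\<lambda>x. h n x $ i $ j)" for n i j by (rule smooth_polynomial_matrix[OF h(1)])
  fix n x assume "x \<in> \<Omega>"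
  then have "norm (c n x - h n x) < (\<theta>' - \<theta>) / real (Suc n)" using h(2) closure_subset by blast
  also have "\<dots> \<le> \<theta>' - \<theta>" using \<theta> by (simp add: divide_le_eq mult_le_cancel_left1)
  finally have "norm (h n x - c n x) \<le> \<theta>' - \<theta>" by (simp add: norm_minus_commute)
  moreover have "norm (c n x - mat 1) \<le> \<theta>" using c(2)[of n x] by (simp add: dist_norm norm_minus_commute)
  ultimately show "norm (h n x - mat 1) \<le> \<theta>'" using norm_triangle_ineq[of "h n x - c n x" "c n x - mat 1"] by simp
 next
  show "AE x in M. (\<lambda>n. h n x) \<longlonglongrightarrow> B x"
   using c(3) AE_space
  proof eventually_elim
   case (elim x)
   then have x: "x \<in> closure \<Omega>" using closure_subset by auto
   have "(\<lambda>n. c n x - h n x) \<longlonglongrightarrow> 0"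
   proof (rule Lim_null_comparison[OF always_eventually])
    show "\<forall>n. norm (c n x - h n x) \<le> (\<theta>' - \<theta>) * (1 / real (Suc n))" using h(2)[OF x] by (auto intro: less_imp_le)
    show "(\<lambda>n. (\<theta>' - \<theta>) * (1 / real (Suc n))) \<longlonglongrightarrow> 0"
     using tendsto_mult_right_zero[OF LIMSEQ_inverse_real_of_nat] by (simp add: inverse_eq_divide)
   qed
   from tendsto_diff[OF elim(1) this] show ?case by simp
  qed
 qed
qed

context
 fixes S :: "(real^'d) set"
 assumes S: "open S" "S \<subseteq> \<Omega>"
begin

lemma indicator_mult_subset: "indicat_real \<Omega> x * indicat_real S x = indicat_real S x"
 using S by (auto simp: indicator_def)

lemma integral_indicator:
 fixes F :: "real^'d => 'b::euclidean_space"
 shows "(LINT x|M. indicator S x *\<^sub>R F x) = (LINT x|lebesgue_on S. F x)"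
 using lebesgue_\<Omega> S by (simp add: integral_restrict_space indicator_mult_subset)

lemma sqint_indicator:
 fixes F :: "real^'d => 'b::euclidean_space"
 assumes F: "sqint (lebesgue_on S) F"
 shows "sqint M (\<lambda>x. indicator S x *\<^sub>R F x)" "l2 M (\<lambda>x. indicator S x *\<^sub>R F x) = l2 (lebesgue_on S) F"
proof -
 have n: "(norm (indicat_real S x *\<^sub>R F x))\<^sup>2 = indicat_real S x *\<^sub>R (norm (F x))\<^sup>2" for x
  by (simp add: indicator_def)
 have "(\<lambda>x. indicator S x *\<^sub>R F x) \<in> borel_measurable M"
  using F lebesgue_\<Omega> S by (simp add: sqint_def borel_measurable_restrict_space_iff indicator_mult_subset)
 moreover have "integrable M (\<lambda>x. (norm (indicat_real S x *\<^sub>R F x))\<^sup>2)"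
  unfolding n using sqintD(2)[OF F] lebesgue_\<Omega> S
  by (simp add: integrable_restrict_space indicator_mult_subset mult.assoc[symmetric])
 ultimately show "sqint M (\<lambda>x. indicator S x *\<^sub>R F x)" by (simp add: sqint_def)
 show "l2 M (\<lambda>x. indicator S x *\<^sub>R F x) = l2 (lebesgue_on S) F"
  unfolding l2_def n integral_indicator ..
qed

end

text \<open>The cut-offs are \<open>flat 0 (- n * r)\<close>. In the gradient, the derivative of the
  cut-off meets the factor \<open>r\<close> of \<open>w\<close> and becomes
  \<open>flat 1 (- n * r)\<close>, which is at most 1 and tends to 0 on the sublevel set; dominated
  convergence applies.\<close>

lemma closure_test_sublevel:
 fixes r l :: "real^'d => real"
 assumes r: "smooth r" and l: "smooth l" and c: "compact {x. r x \<le> 0}" "{x. r x \<le> 0} \<subseteq> \<Omega>"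
 defines "w \<equiv> \<lambda>x. r x * l x"
 shows "closure_test (\<lambda>x. indicator {x. r x < 0} x *\<^sub>R w x) (\<lambda>x. indicator {x. r x < 0} x *\<^sub>R grad w x)"
proof -
 have w: "smooth w" unfolding w_def by (intro smooth_intros r l)
 have S: "open {x. r x < 0}" "{x. r x < 0} \<subseteq> \<Omega>" using smooth_sublevel_open[OF r] c(2) by auto
 have b: "bounded {x. r x < 0}" using S(2) bounded_\<Omega> bounded_subset by blast
 have sq: "sqint M (\<lambda>x. indicator {x. r x < 0} x *\<^sub>R w x)" "sqint M (\<lambda>x. indicator {x. r x < 0} x *\<^sub>R grad w x)"
  by (intro sqint_indicator(1) S continuous_sqint b smooth_continuous_on continuous_on_grad w)+
 define \<phi> where "\<phi> n x = flat 0 (- real n * r x) * w x" for n x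
 have \<phi>: "\<phi> n \<in> test_functions \<Omega>" for n
 proof (rule test_functionI[OF _ c])
  show "smooth (\<phi> n)" unfolding \<phi>_def by (intro smooth_intros r w)
  show "\<phi> n x = 0" if "x \<notin> {x. r x \<le> 0}" for x
   using that by (simp add: \<phi>_def flat_def mult_less_0_iff)
 qed
 have g\<phi>: "grad (\<phi> n) x = flat 0 (- real n * r x) *\<^sub>R grad w x + (flat 1 (- real n * r x) * l x) *\<^sub>R grad r x" for n x
 proof -
  have s: "smooth (\<lambda>x. - real n * r x)" by (intro smooth_intros r)
  have D: "(flat 0 has_real_derivative flat 2 (- real n * r x)) (at (- real n * r x))"
   using flat_has_derivative[of 0] by (simp add: numeral_2_eq_2)
  have p: "partial k (\<lambda>x. flat 0 (- real n * r x)) x = flat 2 (- real n * r x) * (- real n * partial k r x)" for k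
   using partial_compose_real[OF D smooth_differentiable[OF s], of k] partial_smooth_cmult[OF r, of k "- real n"] by simp
  have "partial k (\<phi> n) x = flat 0 (- real n * r x) * partial k w x + (flat 1 (- real n * r x) * l x) * partial k r x" for k
  proof -
   have "partial k (\<phi> n) x = partial k (\<lambda>x. flat 0 (- real n * r x)) x * w x + flat 0 (- real n * r x) * partial k w x"
    using partial_smooth_mult[OF smooth_flat[OF s, of 0] w, of k] by (simp add: \<phi>_def[abs_def] mult.commute)
   also have "partial k (\<lambda>x. flat 0 (- real n * r x)) x * w x = (flat 2 (- real n * r x) * (- real n * r x)) * l x * partial k r x"
    unfolding p by (simp add: w_def)
   finally show ?thesis unfolding flat_2_mult by simp
  qed
  then show ?thesis by (simp add: grad_def vec_eq_iff)
 qed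
 define F where "F n x = (indicator {x. r x < 0} x *\<^sub>R w x - \<phi> n x, indicator {x. r x < 0} x *\<^sub>R grad w x - grad (\<phi> n) x)" for n x
 have "(\<lambda>n. l2 M (F n)) \<longlonglongrightarrow> 0"
 proof (rule tendsto_l2_dominated[OF _ _ AE_I2 AE_I2])
  show "F n \<in> borel_measurable M" for n
   unfolding F_def by (intro sqintD(1) sqint_Pair(1) sqint_diff sq sqint_test sqint_test_grad \<phi>)
  show "sqint M (\<lambda>x. \<bar>w x\<bar> + (norm (grad w x) + \<bar>l x\<bar> * norm (grad r x)))"
   by (intro sqint_continuous continuous_intros smooth_continuous_on continuous_on_grad w l r)
  fix x
  have F0: "F n x = 0" if "\<not> r x < 0" for n
   using that by (auto simp: F_def \<phi>_def g\<phi> flat_def mult_less_0_iff zero_prod_def)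
  have F1: "F n x = ((1 - flat 0 (- real n * r x)) * w x,
    (1 - flat 0 (- real n * r x)) *\<^sub>R grad w x - (flat 1 (- real n * r x) * l x) *\<^sub>R grad r x)" if "r x < 0" for n
   using that by (simp add: F_def \<phi>_def g\<phi> algebra_simps)
  show "norm (F n x) \<le> norm (\<bar>w x\<bar> + (norm (grad w x) + \<bar>l x\<bar> * norm (grad r x)))" for n
  proof (cases "r x < 0")
   case True
   have f0: "\<bar>1 - flat 0 (- real n * r x)\<bar> \<le> 1" "\<bar>flat 1 (- real n * r x)\<bar> \<le> 1"
    using flat_nonneg[of 0] flat_le_one[of 0] flat_nonneg[of 1] flat_le_one[of 1] by (auto simp: abs_le_iff)
   have "norm (F n x) \<le> \<bar>(1 - flat 0 (- real n * r x)) * w x\<bar>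
    + (norm ((1 - flat 0 (- real n * r x)) *\<^sub>R grad w x) + norm ((flat 1 (- real n * r x) * l x) *\<^sub>R grad r x))"
    unfolding F1[OF True] by (intro order_trans[OF norm_Pair_le] add_mono norm_triangle_ineq4) simp
   also have "\<dots> \<le> \<bar>w x\<bar> + (norm (grad w x) + \<bar>l x\<bar> * norm (grad r x))"
    unfolding abs_mult norm_scaleR using f0
    by (intro add_mono mult_left_le_one_le mult_right_mono) auto
   finally show ?thesis by simp
  qed (simp add: F0)
  show "(\<lambda>n. F n x) \<longlonglongrightarrow> 0"
  proof (cases "r x < 0")
   case True
   then have "filterlim (\<lambda>n. - real n * r x) at_top sequentially"
    using filterlim_scaled_at_top[of "- r x"] by simp
   then have "(\<lambda>n. F n x) \<longlonglongrightarrow> ((1 - 1) * w x, (1 - 1) *\<^sub>R grad w x - (0 * l x) *\<^sub>R grad r x)"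
    unfolding F1[OF True]
    by (intro tendsto_intros filterlim_compose[OF flat_0_at_top] filterlim_compose[OF flat_1_at_top])
   then show ?thesis by (simp add: zero_prod_def)
  qed (simp add: F0)
 qed
 then have "\<exists>\<phi>\<in>test_functions \<Omega>. l2 M (\<lambda>x. (indicator {x. r x < 0} x *\<^sub>R w x - \<phi> x, indicator {x. r x < 0} x *\<^sub>R grad w x - grad \<phi> x)) < e"
  if "0 < e" for e
 proof -
  have "\<forall>\<^sub>F n in sequentially. l2 M (F n) < e" using order_tendstoD(2)[OF \<open>(\<lambda>n. l2 M (F n)) \<longlonglongrightarrow> 0\<close> that] .
  then obtain n where "l2 M (F n) < e" by (meson eventually_sequentially order_refl)
  then show ?thesis using \<phi> by (intro bexI[of _ "\<phi> n"]) (auto simp: F_def[abs_def])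
 qed
 then show ?thesis using sq by (simp add: closure_test_def)
qed

end

context bounded_open
begin

lemma closure_test_limit:
 assumes c: "\<And>k::nat. closure_test (v k) (p k)" and s: "sqint M v'" "sqint M p'"
  and lim: "(\<lambda>k. l2 M (\<lambda>x. (v k x - v' x, p k x - p' x))) \<longlonglongrightarrow> 0"
 shows "closure_test v' p'"
 unfolding closure_test_def
proof (intro conjI allI impI s)
 fix e :: real assume "0 < e"
 then have e: "0 < e / 2" by simp
 have "\<forall>\<^sub>F k in sequentially. l2 M (\<lambda>x. (v k x - v' x, p k x - p' x)) < e / 2" using order_tendstoD(2)[OF lim e] .
 then obtain k where k: "l2 M (\<lambda>x. (v k x - v' x, p k x - p' x)) < e / 2" by (meson eventually_sequentially order_refl)
 obtain \<phi> where \<phi>: "\<phi> \<in> test_functions \<Omega>" "l2 M (\<lambda>x. (v k x - \<phi> x, p k x - grad \<phi> x)) < e / 2"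
  using c[of k] e unfolding closure_test_def by meson
 have sk: "sqint M (v k)" "sqint M (p k)" using c[of k] by (auto simp: closure_test_def)
 have "l2 M (\<lambda>x. (v' x - \<phi> x, p' x - grad \<phi> x)) < e"
  using l2_triangle_diff[of M "\<lambda>x. (v k x - \<phi> x, p k x - grad \<phi> x)" "\<lambda>x. (v k x - v' x, p k x - p' x)"] k \<phi> s sk
   sqint_test sqint_test_grad by (simp add: sqint_Pair_iff sqint_diff)
 then show "\<exists>\<phi>\<in>test_functions \<Omega>. l2 M (\<lambda>x. (v' x - \<phi> x, p' x - grad \<phi> x)) < e" using \<phi>(1) by blast
qed

text \<open>The last bound depends only on \<open>R\<close>, \<open>\<theta>\<close> and the measure
  of \<open>\<Omega>\<close>, neither on the subdomain nor on derivatives of \<open>b\<close>: it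
  comes from the Cordes estimate with \<open>\<mu> = 0\<close>, Miranda-Talenti, the gradient
  estimate and Poincare.\<close>

lemma approximate_solution_on_subdomain:
 assumes r: "good_domain r" "{x. r x \<le> 0} \<subseteq> \<Omega>" and b: "\<And>i j. smooth (\<lambda>x. b x $ i $ j)"
  "\<And>x. x \<in> \<Omega> ==> norm (b x - mat 1) \<le> \<theta>" and \<theta>: "0 \<le> \<theta>" "\<theta> < 1"
  and g: "continuous_on UNIV g" "\<And>x. 0 \<le> g x" "\<And>x. g x \<le> 1" and \<eta>: "0 < \<eta>" "\<eta> \<le> 1"
  and R: "0 \<le> R" "\<And>x. x \<in> \<Omega> ==> norm x \<le> R"
 defines "S \<equiv> lebesgue_on {x. r x < 0}"
 obtains w where "\<exists>l. smooth l \<and> w = (\<lambda>x. r x * l x)" "l2 S (\<lambda>x. max (- w x) 0) \<le> \<eta>"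
  "l2 S (\<lambda>x. - (b x \<bullet> hess w x) - g x) \<le> \<eta>"
  "l2 S (\<lambda>x. (w x, grad w x, hess w x)) \<le> (4 * R\<^sup>2 + 2 * R + 1) * ((l2 M (\<lambda>x. 1 :: real) + 1) / (1 - \<theta>))"
proof -
 have sub: "{x. r x < 0} \<subseteq> \<Omega>" using r(2) by auto
 interpret cs: convex_sublevel r using r(1) by (simp add: good_domain_def)
 interpret cordes_domain r b \<theta>
  by unfold_locales (use r b \<theta> sub in \<open>auto simp: cs.D_def\<close>)
 have D: "cs.D = {x. r x < 0}" by (simp add: cs.D_def)
 obtain l where l: "smooth l" "l2 S (\<lambda>x. max (- (r x * l x)) 0) \<le> \<eta>" "l2 S (\<lambda>x. - elop (\<lambda>x. r x * l x) x - g x) \<le> \<eta>"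
  using approximate_nonneg_solution[of g \<eta>] g \<eta>(1) unfolding S_def D by blast
 define w where "w = (\<lambda>x. r x * l x)"
 have w: "smooth w" unfolding w_def by (rule smooth_w[OF l(1)])
 have RD: "x \<in> cs.D ==> norm x \<le> R" for x using R(2) sub by (auto simp: D)
 have sq: "sqint S (elop w)" "sqint S g" "sqint S w" "sqint S (grad w)" "sqint S (hess w)"
  unfolding S_def D[symmetric] by (intro cs.sqint_continuous continuous_on_elop w g smooth_continuous_on continuous_on_grad continuous_on_hess)+
 have "l2 S g = l2 M (\<lambda>x. indicator {x. r x < 0} x *\<^sub>R g x)"
  using sqint_indicator(2)[OF cs.open_D[unfolded D] sub sq(2)[unfolded S_def]] by (simp add: S_def)
 also have "\<dots> \<le> l2 M (\<lambda>x. 1 :: real)"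
  by (rule l2_mono[OF sqint_continuous sqintD(1)[OF sqint_indicator(1)[OF cs.open_D[unfolded D] sub sq(2)[unfolded S_def]]]])
    (use g in \<open>auto simp: indicator_def\<close>)
 finally have gl: "l2 S g \<le> l2 M (\<lambda>x. 1 :: real)" .
 have "(1 - \<theta>) * l2 S (lap w) \<le> l2 S (\<lambda>x. - elop w x)"
  using cs.cordes_estimate[OF l(1) smooth_b b_near \<theta>, of 0] by (simp add: S_def D w_def elop_def[abs_def])
 also have "\<dots> \<le> l2 S g + l2 S (\<lambda>x. - elop w x - g x)" by (rule l2_triangle_rev[OF sqint_uminus[OF sq(1)] sq(2)])
 finally have "(1 - \<theta>) * l2 S (lap w) \<le> l2 M (\<lambda>x. 1 :: real) + 1" using gl l(3) \<eta> by (simp add: w_def)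
 then have lap: "l2 S (lap w) \<le> (l2 M (\<lambda>x. 1 :: real) + 1) / (1 - \<theta>)" using \<theta> by (simp add: field_simps)
 have h: "l2 S (hess w) \<le> l2 S (lap w)" using cs.miranda_talenti[OF l(1)] by (simp add: S_def D w_def)
 have gr: "l2 S (grad w) \<le> 2 * R * l2 S (lap w)"
  using cs.gradient_estimate[OF l(1) RD R(1)] by (simp add: S_def D w_def)
 have "l2 S w \<le> 2 * R * l2 S (grad w)" using cs.poincare[OF l(1) RD] by (simp add: S_def D w_def)
 also have "\<dots> \<le> 2 * R * (2 * R * l2 S (lap w))" using R(1) gr by (intro mult_left_mono) auto
 finally have w0: "l2 S w \<le> 4 * R\<^sup>2 * l2 S (lap w)" by (simp add: power2_eq_square)
 have "l2 S (\<lambda>x. (w x, grad w x, hess w x)) \<le> l2 S w + (l2 S (grad w) + l2 S (hess w))"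
  using l2_Pair_le(3)[OF sq(3) sqint_Pair(1)[OF sq(4,5)]] l2_Pair_le(3)[OF sq(4,5)] by linarith
 also have "\<dots> \<le> (4 * R\<^sup>2 + 2 * R + 1) * l2 S (lap w)" using w0 gr h by (simp add: algebra_simps)
 also have "\<dots> \<le> (4 * R\<^sup>2 + 2 * R + 1) * ((l2 M (\<lambda>x. 1 :: real) + 1) / (1 - \<theta>))"
  using lap R(1) by (intro mult_left_mono) auto
 finally show ?thesis using l by (intro that[of w]) (auto simp: w_def elop_def)
qed

text \<open>Solutions on an exhausting sequence of smooth convex subdomains are extended by zero; a weak
 cluster point in \<open>L\<^sup>2\<close> of the extended triples \<open>(w, \<nabla>w, D\<^sup>2w)\<close> solves the limit problem.\<close>

lemma dual_solution:
 assumes cv: "convex \<Omega>" "\<Omega> \<noteq> {}" and k: "sqint M k"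
  and B: "B \<in> borel_measurable M" "AE x in M. norm (B x - mat 1) \<le> \<theta>" and \<theta>: "0 \<le> \<theta>" "\<theta> < 1"
  and g: "g \<in> borel_measurable M" "AE x in M. g x \<in> {0..1}"
 obtains v p P where "V_triple v p P" "AE x in M. 0 \<le> v x"
  "(LINT x|M. k x * (- (B x \<bullet> P x))) = (LINT x|M. k x * g x)"
proof -
 obtain C where C: "\<And>n::nat. compact (C n)" "\<And>n. C n \<subseteq> \<Omega>" "\<And>K. compact K ==> K \<subseteq> \<Omega> ==> \<exists>N. \<forall>n\<ge>N. K \<subseteq> C n"
  using open_Union_compact_subsets[OF open_\<Omega>] by metis
 have "\<exists>r. good_domain r \<and> C n \<subseteq> {x. r x < 0} \<and> {x. r x \<le> 0} \<subseteq> \<Omega>" for n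
  using convex_exhaustion[OF open_\<Omega> bounded_\<Omega> cv C(1,2)] by metis
 then obtain r where r: "\<And>n. good_domain (r n)" "\<And>n. C n \<subseteq> {x. r n x < 0}" "\<And>n. {x. r n x \<le> 0} \<subseteq> \<Omega>"
  by metis
 \<comment> \<open>Leaves room between \<open>\<theta>\<close> and 1 for smoothing the
   coefficients.\<close>
 define \<theta>' where "\<theta>' = (1 + \<theta>) / 2"
 have \<theta>': "0 \<le> \<theta>'" "\<theta>' < 1" "\<theta> < \<theta>'" using \<theta> by (auto simp: \<theta>'_def)
 obtain b where b: "\<And>n i j. smooth (\<lambda>x. b n x $ i $ j)" "\<And>n x. x \<in> \<Omega> ==> norm (b n x - mat 1) \<le> \<theta>'"
  "AE x in M. (\<lambda>n. b n x) \<longlonglongrightarrow> B x"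
  using smooth_matrix_approximation[OF B \<theta>(1) \<theta>'(3)] by blast
 obtain h where h: "\<And>n. continuous_on UNIV (h n)" "\<And>n x. h n x \<in> {0..1}" "AE x in M. (\<lambda>n. h n x) \<longlonglongrightarrow> g x"
  by (rule measurable_continuous_approximation[OF g(1) _ _ _ g(2)]) auto
 obtain R where R: "0 < R" "\<And>x. x \<in> \<Omega> ==> norm x \<le> R" using bounded_\<Omega> by (meson bounded_normE)
 define S where "S n = {x. r n x < 0}" for n
 define Q where "Q = (4 * R\<^sup>2 + 2 * R + 1) * ((l2 M (\<lambda>x. 1 :: real) + 1) / (1 - \<theta>'))"
 define sol where "sol n w \<longleftrightarrow> (\<exists>l. smooth l \<and> w = (\<lambda>x. r n x * l x)) \<and> l2 (lebesgue_on (S n)) (\<lambda>x. max (- w x) 0) \<le> 1 / real (Suc n) \<and>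
  l2 (lebesgue_on (S n)) (\<lambda>x. - (b n x \<bullet> hess w x) - h n x) \<le> 1 / real (Suc n) \<and>
  l2 (lebesgue_on (S n)) (\<lambda>x. (w x, grad w x, hess w x)) \<le> Q" for n w
 have "\<exists>w. sol n w" for n
 proof -
  have g01: "0 \<le> h n x" "h n x \<le> 1" for x using h(2)[of n x] by auto
  show ?thesis
   by (rule approximate_solution_on_subdomain[OF r(1)[of n] r(3)[of n] b(1)[of n] b(2)[of _ n] \<theta>'(1,2) h(1)[of n] g01 _ _ _ R(2), where \<eta> = "1 / real (Suc n)"])
     (use R(1) in \<open>auto simp: sol_def S_def Q_def\<close>)
 qed
 then obtain w where "\<And>n. sol n (w n)" by metis
 then have w: "\<And>n. \<exists>l. smooth l \<and> w n = (\<lambda>x. r n x * l x)"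
  "\<And>n. l2 (lebesgue_on (S n)) (\<lambda>x. max (- w n x) 0) \<le> 1 / real (Suc n)"
  "\<And>n. l2 (lebesgue_on (S n)) (\<lambda>x. - (b n x \<bullet> hess (w n) x) - h n x) \<le> 1 / real (Suc n)"
  "\<And>n. l2 (lebesgue_on (S n)) (\<lambda>x. (w n x, grad (w n) x, hess (w n) x)) \<le> Q"
  by (auto simp: sol_def)
 have rs: "smooth (r n)" for n
  using r(1) unfolding good_domain_def convex_sublevel_def sublevel_domain_def by blast
 have ws: "smooth (w n)" for n
 proof -
  obtain l where "smooth l" "w n = (\<lambda>x. r n x * l x)" using w(1) by blast
  then show ?thesis using smooth_mult[OF rs[of n]] by simp
 qed
 have So: "open (S n)" and SO: "S n \<subseteq> \<Omega>" for n using smooth_sublevel_open[OF rs] r(3)[of n] by (auto simp: S_def)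
 have Sb: "bounded (S n)" for n using SO bounded_\<Omega> bounded_subset by blast
 note ind = sqint_indicator[OF So SO] integral_indicator[OF So SO]
 have SqS: "continuous_on UNIV f ==> sqint (lebesgue_on (S n)) f" for n and f :: "real^'d => 'z::euclidean_space"
  using continuous_sqint So Sb by blast
 define X where "X n x = indicator (S n) x *\<^sub>R (w n x, grad (w n) x, hess (w n) x)" for n x
 have jc: "continuous_on UNIV (\<lambda>x. (w n x, grad (w n) x, hess (w n) x))" for n
  by (intro continuous_intros smooth_continuous_on continuous_on_grad continuous_on_hess ws)
 have X: "sqint M (X n)" "l2 M (X n) \<le> Q" for n
  unfolding X_def[abs_def] ind(2)[OF SqS[OF jc]] by (rule ind(1)[OF SqS[OF jc]] w(4))+
 obtain Z Y where Z: "sqint M Z" and Y: "\<And>k. Y k \<in> tail_hull X k" and YZ: "(\<lambda>k. l2 M (\<lambda>x. Y k x - Z x)) \<longlonglongrightarrow> 0"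
  by (rule l2_cluster_point[OF finite_M X]) (rule that)
 have Ys: "sqint M (Y k)" for k using tail_hull_sqint[OF Y X(1)] .
 define v where "v x = fst (Z x)" for x
 define p where "p x = fst (snd (Z x))" for x
 define P where "P x = snd (snd (Z x))" for x
 have Zeq: "Z = (\<lambda>x. (v x, p x, P x))" by (simp add: v_def p_def P_def)
 have vs: "sqint M v" "sqint M p" "sqint M P" using Z unfolding Zeq by (simp_all add: sqint_Pair_iff)
 have comps: "sqint M (\<lambda>x. fst (f x))" "sqint M (\<lambda>x. fst (snd (f x)))" "sqint M (\<lambda>x. snd (snd (f x)))"
  if "sqint M f" for f :: "real^'d => real \<times> (real^'d) \<times> (real^'d^'d)"
  using that sqint_Pair_iff[of M "\<lambda>x. fst (f x)" "\<lambda>x. snd (f x)"] sqint_Pair_iff[of M "\<lambda>x. fst (snd (f x))" "\<lambda>x. snd (snd (f x))"]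
  by simp_all
 have weak: "(LINT x|M. F x \<bullet> Z x) = c"
  if "sqint M F" "(\<lambda>n. LINT x|lebesgue_on (S n). F x \<bullet> (w n x, grad (w n) x, hess (w n) x)) \<longlonglongrightarrow> c" for F c
 proof (rule cluster_point_inner[OF X(1) Y Z that(1) YZ])
  have "(LINT x|M. F x \<bullet> X n x) = (LINT x|lebesgue_on (S n). F x \<bullet> (w n x, grad (w n) x, hess (w n) x))" for n
   using ind(3)[of n "\<lambda>x. F x \<bullet> (w n x, grad (w n) x, hess (w n) x)"] unfolding X_def inner_scaleR_right real_scaleR_def .
  then show "(\<lambda>n. LINT x|M. F x \<bullet> X n x) \<longlonglongrightarrow> c" using that(2) by simp
 qed
 \<comment> \<open>The support of a test function eventually lies inside \<open>S n\<close>, where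
   integration by parts is exact; the identities defining weak derivatives thus pass to
   \<open>Z\<close>.\<close>
 have parts: "(LINT x|M. F x \<bullet> Z x) = 0"
  if \<phi>: "\<phi> \<in> test_functions \<Omega>" and F: "sqint M F" and f: "\<And>n. smooth (f n)"
   "\<And>n x. F x \<bullet> (w n x, grad (w n) x, hess (w n) x) = f n x * partial i \<phi> x + partial i (f n) x * \<phi> x" for \<phi> F f i
 proof (rule weak[OF F])
  obtain K where K: "compact K" "K \<subseteq> \<Omega>" "\<And>x. x \<notin> K ==> \<phi> x = 0" using test_compact[OF \<phi>] by blast
  obtain N where N: "\<And>n. N \<le> n ==> K \<subseteq> C n" using C(3)[OF K(1,2)] by blast
  have "(LINT x|lebesgue_on (S n). F x \<bullet> (w n x, grad (w n) x, hess (w n) x)) = 0" if "N \<le> n" for n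
  proof -
   have KS: "K \<subseteq> S n" using N[OF that] r(2)[of n] by (auto simp: S_def)
   have "integrable (lebesgue_on (S n)) (\<lambda>x. partial i (f n) x * \<phi> x)" "integrable (lebesgue_on (S n)) (\<lambda>x. f n x * partial i \<phi> x)"
    by (intro continuous_integrable So Sb smooth_continuous_on smooth_mult smooth_partial f test_smooth[OF \<phi>])+
   then show ?thesis
    using integration_by_parts[OF f(1) test_smooth[OF \<phi>] K(1,3) KS So Sb, where i = i] unfolding f(2) by simp
  qed
  then show "(\<lambda>n. LINT x|lebesgue_on (S n). F x \<bullet> (w n x, grad (w n) x, hess (w n) x)) \<longlonglongrightarrow> 0"
   by (intro tendsto_eventually) (auto simp: eventually_sequentially)
 qed
 have int: "integrable M (\<lambda>x. u x * \<phi> x)" "integrable M (\<lambda>x. u x * partial i \<phi> x)" if "sqint M u" "\<phi> \<in> test_functions \<Omega>" for u \<phi> i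
  using that by (auto intro: sqint_integrable_mult sqint_test sqint_test_partial)
 have "wgrad v p"
  unfolding wgrad_def
 proof (intro conjI ballI allI vs)
  fix \<phi> i assume \<phi>: "\<phi> \<in> test_functions \<Omega>"
  have sm: "smooth \<phi>" using \<phi> by (rule test_smooth)
  \<comment> \<open>Pairing with \<open>F\<close> packs both sides of the weak derivative identity
    into one scalar product with the triple.\<close>
  define F where "F x = (partial i \<phi> x, \<phi> x *\<^sub>R axis i 1 :: real^'d, 0 :: real^'d^'d)" for x
  have "(LINT x|M. F x \<bullet> Z x) = 0"
  proof (rule parts[OF \<phi>, of F w i])
   show "sqint M F" unfolding F_def
    by (intro sqint_continuous continuous_intros smooth_continuous_on smooth_partial sm)
  qed (auto simp: ws F_def inner_axis' grad_def mult.commute)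
  then have "(LINT x|M. v x * partial i \<phi> x + p x $ i * \<phi> x) = 0"
   by (simp add: F_def Zeq inner_axis' mult.commute)
  then show "(LINT x|M. v x * partial i \<phi> x) = - (LINT x|M. p x $ i * \<phi> x)"
   using vs \<phi> by (simp add: int sqint_component)
 qed
 moreover have "wgrad (\<lambda>x. p x $ j) (\<lambda>x. \<chi> i. P x $ i $ j)" for j
  unfolding wgrad_def
 proof (intro conjI ballI allI)
  show "sqint M (\<lambda>x. p x $ j)" "sqint M (\<lambda>x. \<chi> i. P x $ i $ j)"
   using vs by (auto simp: sqint_vec_iff)
  fix \<phi> i assume \<phi>: "\<phi> \<in> test_functions \<Omega>"
  have sm: "smooth \<phi>" using \<phi> by (rule test_smooth)
  define F where "F x = (0 :: real, partial i \<phi> x *\<^sub>R axis j 1 :: real^'d, \<phi> x *\<^sub>R axis i (axis j 1) :: real^'d^'d)" for x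
  have "(LINT x|M. F x \<bullet> Z x) = 0"
  proof (rule parts[OF \<phi>, of F "\<lambda>n. partial j (w n)" i])
   show "sqint M F" unfolding F_def
    by (intro sqint_continuous continuous_intros smooth_continuous_on smooth_partial sm)
  qed (auto simp: ws smooth_partial F_def inner_axis' grad_def hess_def mult.commute)
  then have "(LINT x|M. p x $ j * partial i \<phi> x + P x $ i $ j * \<phi> x) = 0"
   by (simp add: F_def Zeq inner_axis' mult.commute)
  then show "(LINT x|M. p x $ j * partial i \<phi> x) = - (LINT x|M. (\<chi> i. P x $ i $ j) $ i * \<phi> x)"
   using vs \<phi> by (simp add: int sqint_component)
 qed
 moreover have "closure_test v p"
 proof (rule closure_test_limit[OF _ vs(1,2)])
  have "closure_test (\<lambda>x. fst (f x)) (\<lambda>x. fst (snd (f x)))" if "f \<in> tail_hull X k" for f k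
   using that
  proof (induction rule: tail_hull.induct)
   case (base n)
   obtain l where l: "smooth l" "w n = (\<lambda>x. r n x * l x)" using w(1) by blast
   have "compact {x. r n x \<le> 0}" using r(1) by (simp add: good_domain_def)
   from closure_test_sublevel[OF rs l(1) this r(3)] show ?case by (simp add: X_def S_def l(2))
  next
   case (mid f g)
   from closure_test_cmult[OF closure_test_add[OF mid(3,4)], of "1/2"] show ?case by simp
  qed
  then show "closure_test (\<lambda>x. fst (Y k x)) (\<lambda>x. fst (snd (Y k x)))" for k using Y by blast
  show "(\<lambda>k. l2 M (\<lambda>x. (fst (Y k x) - v x, fst (snd (Y k x)) - p x))) \<longlonglongrightarrow> 0"
  proof (rule tendsto_sandwich[OF _ _ tendsto_const YZ])
   show "\<forall>\<^sub>F k in sequentially. l2 M (\<lambda>x. (fst (Y k x) - v x, fst (snd (Y k x)) - p x)) \<le> l2 M (\<lambda>x. Y k x - Z x)"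
   proof (intro always_eventually allI l2_mono[OF sqint_diff[OF Ys Z]] AE_I2)
    fix k x
    show "(\<lambda>x. (fst (Y k x) - v x, fst (snd (Y k x)) - p x)) \<in> borel_measurable M"
     by (intro sqintD(1) sqint_Pair(1) sqint_diff comps Ys vs)
    have "norm (fst z, fst (snd z)) \<le> norm z" for z :: "real \<times> (real^'d) \<times> (real^'d^'d)"
     by (cases z) (simp add: norm_Pair)
    from this[of "Y k x - Z x"]
    show "norm (fst (Y k x) - v x, fst (snd (Y k x)) - p x) \<le> norm (Y k x - Z x)"
     by (simp add: v_def p_def)
   qed
  qed simp
 qed
 ultimately have "V_triple v p P" by (simp add: V_triple_def)
 moreover have "AE x in M. 0 \<le> v x"
 proof -
  define neg where "neg u x = max (- u x) 0" for u :: "real^'d => real" and x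
  have negs: "sqint M (neg u)" if "sqint M u" for u
   unfolding neg_def[abs_def] by (rule sqint_mono[OF that]) (use that in auto)
  \<comment> \<open>The negative part is convex, so the bound on its norm passes to
    midpoints.\<close>
  have hull: "l2 M (neg (\<lambda>x. fst (f x))) \<le> 1 / real (Suc k)" if "f \<in> tail_hull X k" for f k
   using that
  proof (induction rule: tail_hull.induct)
   case (base n)
   have "neg (\<lambda>x. fst (X n x)) = (\<lambda>x. indicator (S n) x *\<^sub>R max (- w n x) 0)"
    by (auto simp: neg_def X_def indicator_def)
   then have "l2 M (neg (\<lambda>x. fst (X n x))) = l2 (lebesgue_on (S n)) (\<lambda>x. max (- w n x) 0)"
    using ind(2)[OF SqS, of "\<lambda>x. max (- w n x) 0" n] by (simp add: continuous_intros smooth_continuous_on ws)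
   also have "\<dots> \<le> 1 / real (Suc n)" by (rule w(2))
   also have "\<dots> \<le> 1 / real (Suc k)" using base by (simp add: frac_le)
   finally show ?case .
  next
   case (mid f g)
   note fg = tail_hull_sqint[OF mid(1) X(1)] tail_hull_sqint[OF mid(2) X(1)]
   have s: "sqint M (neg (\<lambda>x. fst (f x)))" "sqint M (neg (\<lambda>x. fst (g x)))" "sqint M (neg (\<lambda>x. fst ((1/2) *\<^sub>R (f x + g x))))"
    using negs[OF comps(1)[OF fg(1)]] negs[OF comps(1)[OF fg(2)]] negs[OF comps(1)[OF sqint_scaleR[OF sqint_add[OF fg]]]] .
   have "l2 M (neg (\<lambda>x. fst ((1/2) *\<^sub>R (f x + g x)))) \<le> l2 M (\<lambda>x. (1/2) *\<^sub>R (neg (\<lambda>x. fst (f x)) x + neg (\<lambda>x. fst (g x)) x))"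
    by (rule l2_mono[OF sqint_scaleR[OF sqint_add[OF s(1,2)]] sqintD(1)[OF s(3)]], intro AE_I2) (auto simp: neg_def max_def field_simps)
   also have "\<dots> \<le> 1/2 * (l2 M (neg (\<lambda>x. fst (f x))) + l2 M (neg (\<lambda>x. fst (g x))))"
    unfolding l2_scaleR using l2_triangle[OF s(1,2)] by simp
   finally show ?case using mid(3,4) by simp
  qed
  have "l2 M (neg v) \<le> 1 / real (Suc k) + l2 M (\<lambda>x. Y k x - Z x)" for k
  proof -
   have s: "sqint M (neg (\<lambda>x. fst (Y k x)))" "sqint M (\<lambda>x. norm (Y k x - Z x))"
    by (intro negs comps Ys sqint_norm sqint_diff Z)+
   have "l2 M (neg v) \<le> l2 M (\<lambda>x. neg (\<lambda>x. fst (Y k x)) x + norm (Y k x - Z x))"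
   proof (rule l2_mono[OF sqint_add[OF s] sqintD(1)[OF negs[OF vs(1)]]], intro AE_I2)
    fix x
    have "\<bar>fst (Y k x) - v x\<bar> \<le> norm (Y k x - Z x)"
     using norm_fst_le[of "fst (Y k x - Z x)" "snd (Y k x - Z x)"] unfolding prod.collapse by (simp add: v_def)
    then show "norm (neg v x) \<le> norm (neg (\<lambda>x. fst (Y k x)) x + norm (Y k x - Z x))"
     by (auto simp: neg_def max_def)
   qed
   also have "\<dots> \<le> l2 M (neg (\<lambda>x. fst (Y k x))) + l2 M (\<lambda>x. norm (Y k x - Z x))" by (rule l2_triangle[OF s])
   finally show ?thesis using hull[OF Y, of k] by (simp add: l2_def)
  qed
  moreover have "(\<lambda>k. 1 / real (Suc k) + l2 M (\<lambda>x. Y k x - Z x)) \<longlonglongrightarrow> 0 + 0"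
   using LIMSEQ_inverse_real_of_nat YZ by (intro tendsto_add) (simp_all add: inverse_eq_divide)
  ultimately have "l2 M (neg v) \<le> 0" by (intro tendsto_lowerbound[of _ 0 sequentially]) auto
  then have "(LINT x|M. (norm (neg v x))\<^sup>2) = 0" using l2_square[of M "neg v"] l2_nonneg[of M "neg v"] by simp
  then have "AE x in M. (norm (neg v x))\<^sup>2 = 0"
   using negs[OF vs(1)] by (subst (asm) integral_nonneg_eq_0_iff_AE) auto
  then show ?thesis by eventually_elim (simp add: neg_def max_def split: if_splits)
 qed
 moreover have "(LINT x|M. k x * (- (B x \<bullet> P x))) = (LINT x|M. k x * g x)"
 proof -
  have Bm: "B \<in> borel_measurable M" by (rule B)
  define b1 where "b1 = \<theta> + norm (mat 1 :: real^'d^'d)"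
  have Bb: "AE x in M. norm (B x) \<le> b1"
   using B(2)
  proof eventually_elim
   case (elim x)
   then show ?case using norm_triangle_sub[of "B x" "mat 1"] by (simp add: b1_def)
  qed
  have kB: "sqint M (\<lambda>x. - (k x *\<^sub>R B x))"
  proof (rule sqint_mono[OF sqint_scaleR[OF k, of b1]])
   show "(\<lambda>x. - (k x *\<^sub>R B x)) \<in> borel_measurable M" using k Bm by auto
   show "AE x in M. norm (- (k x *\<^sub>R B x)) \<le> norm (b1 *\<^sub>R k x)"
    using Bb
   proof eventually_elim
    case (elim x)
    then show ?case using mult_left_mono[OF order_trans[OF elim abs_ge_self], of "\<bar>k x\<bar>"] by (simp add: abs_mult mult.commute[of "\<bar>b1\<bar>"])
   qed
  qed
  define F where "F x = (0 :: real, 0 :: real^'d, - (k x *\<^sub>R B x))" for x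
  have "(LINT x|M. F x \<bullet> Z x) = (LINT x|M. k x * g x)"
  proof (rule weak)
   show "sqint M F" unfolding F_def using kB by (simp add: sqint_Pair_iff)
   define Hn where "Hn n x = indicator (S n) x *\<^sub>R hess (w n) x" for n x
   have Hs: "sqint M (Hn n)" "l2 M (Hn n) \<le> Q" for n
   proof -
    show s: "sqint M (Hn n)" unfolding Hn_def[abs_def] by (intro ind(1) SqS continuous_on_hess ws)
    have "l2 M (Hn n) \<le> l2 M (X n)"
    proof (rule l2_mono[OF X(1) sqintD(1)[OF s]], intro AE_I2)
     fix x
     have "norm (snd (snd z)) \<le> norm z" for z :: "real \<times> (real^'d) \<times> (real^'d^'d)"
      using norm_snd_le[of "snd z" "fst z"] norm_snd_le[of "snd (snd z)" "fst (snd z)"] unfolding prod.collapse by linarith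
     from this[of "X n x"] show "norm (Hn n x) \<le> norm (X n x)" by (simp add: Hn_def X_def)
    qed
    then show "l2 M (Hn n) \<le> Q" using X(2)[of n] by linarith
   qed
   define E where "E n x = indicator (S n) x *\<^sub>R (- (b n x \<bullet> hess (w n) x) - h n x)" for n x
   have bc: "continuous_on UNIV (b n)" for n by (rule continuous_on_matrix_entries[OF b(1)])
   have Es: "sqint M (E n)" "l2 M (E n) \<le> 1 / real (Suc n)" for n
   proof -
    have "continuous_on UNIV (\<lambda>x. - (b n x \<bullet> hess (w n) x) - h n x)"
     by (intro continuous_intros bc continuous_on_hess ws h)
    from ind(1,2)[OF SqS[OF this, of n]] w(3)[of n] show "sqint M (E n)" "l2 M (E n) \<le> 1 / real (Suc n)"
     by (simp_all add: E_def[abs_def])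
   qed
   \<comment> \<open>The coefficients converge only a.e. and the Hessians are merely bounded.
     Multiplied by the fixed \<open>k\<close>, the coefficient error tends to zero in norm by
     dominated convergence, and the bounded factor \<open>Hn n\<close> is then harmless.\<close>
   define G where "G n x = k x *\<^sub>R (b n x - B x)" for n x
   have bn1: "AE x in M. norm (b n x - B x) \<le> 2" for n
    using B(2) AE_space
   proof eventually_elim
    case (elim x)
    then have "norm (b n x - mat 1) \<le> \<theta>'" using b(2) by simp
    then show ?case using elim norm_triangle_ineq4[of "b n x - mat 1" "B x - mat 1"] \<theta> \<theta>' by simp
   qed
   have Gb: "AE x in M. norm (G n x) \<le> norm (2 *\<^sub>R k x)" for n
    using bn1[of n]
   proof eventually_elim
    case (elim x)
    then show ?case using mult_left_mono[OF elim, of "\<bar>k x\<bar>"] by (simp add: G_def mult.commute[of 2])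
   qed
   have Gm: "G n \<in> borel_measurable M" for n
    unfolding G_def[abs_def] using k Bm continuous_borel_measurable_lebesgue_on[OF bc] by (intro borel_measurable_scaleR borel_measurable_diff) auto
   have Gs: "sqint M (G n)" for n by (rule sqint_mono[OF sqint_scaleR[OF k] Gm Gb])
   have G0: "(\<lambda>n. l2 M (G n)) \<longlonglongrightarrow> 0"
   proof (rule tendsto_l2_dominated[OF Gm sqint_scaleR[OF k] Gb])
    show "AE x in M. (\<lambda>n. G n x) \<longlonglongrightarrow> 0"
     using b(3)
    proof eventually_elim
     case (elim x)
     from tendsto_scaleR[OF tendsto_const tendsto_diff[OF elim tendsto_const], of "k x" "B x"] show ?case by (simp add: G_def)
    qed
   qed
   have t1: "(\<lambda>n. LINT x|M. k x * E n x) \<longlonglongrightarrow> 0"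
   proof (rule Lim_null_comparison[OF always_eventually])
    show "\<forall>n. norm (LINT x|M. k x * E n x) \<le> l2 M k * (1 / real (Suc n))"
     using l2_Cauchy_Schwarz_real[OF k Es(1)] mult_left_mono[OF Es(2), of "l2 M k"] by (auto intro: order_trans)
    show "(\<lambda>n. l2 M k * (1 / real (Suc n))) \<longlonglongrightarrow> 0"
     using tendsto_mult_right_zero[OF LIMSEQ_inverse_real_of_nat] by (simp add: inverse_eq_divide)
   qed
   have t2: "(\<lambda>n. LINT x|M. G n x \<bullet> Hn n x) \<longlonglongrightarrow> 0"
   proof (rule Lim_null_comparison[OF always_eventually])
    show "\<forall>n. norm (LINT x|M. G n x \<bullet> Hn n x) \<le> l2 M (G n) * Q"
     using order_trans[OF l2_Cauchy_Schwarz[OF Gs Hs(1)] mult_left_mono[OF Hs(2) l2_nonneg]] by simp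
    show "(\<lambda>n. l2 M (G n) * Q) \<longlonglongrightarrow> 0" using tendsto_mult_left_zero[OF G0] by simp
   qed
   have hm: "(\<lambda>x. indicator (S n) x *\<^sub>R h n x) \<in> borel_measurable M" for n
    by (intro sqintD(1) ind(1) SqS h)
   have t3: "(\<lambda>n. LINT x|M. k x * (indicator (S n) x *\<^sub>R h n x)) \<longlonglongrightarrow> (LINT x|M. k x * g x)"
   proof (rule integral_dominated_convergence[where w = "\<lambda>x. \<bar>k x\<bar>"])
    show "(\<lambda>x. k x * g x) \<in> borel_measurable M" "(\<lambda>x. k x * (indicator (S n) x *\<^sub>R h n x)) \<in> borel_measurable M" for n
     using k g hm by auto
    show "integrable M (\<lambda>x. \<bar>k x\<bar>)" using sqint_integrable[OF finite_M k] by simp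
    show "AE x in M. norm (k x * (indicator (S n) x *\<^sub>R h n x)) \<le> \<bar>k x\<bar>" for n
     using h(2) by (intro AE_I2) (auto simp: indicator_def abs_mult mult_left_le)
    show "AE x in M. (\<lambda>n. k x * (indicator (S n) x *\<^sub>R h n x)) \<longlonglongrightarrow> k x * g x"
     using h(3) AE_space
    proof eventually_elim
     case (elim x)
     obtain N where N: "\<And>n. N \<le> n ==> {x} \<subseteq> C n" using C(3)[of "{x}"] elim(2) by auto
     then have "\<forall>\<^sub>F n in sequentially. indicat_real (S n) x = 1"
      using r(2) by (intro eventually_sequentiallyI[of N]) (fastforce simp: S_def)
     then have "(\<lambda>n. indicat_real (S n) x) \<longlonglongrightarrow> 1" by (rule tendsto_eventually)
     from tendsto_mult[OF tendsto_const tendsto_scaleR[OF this elim(1)], of "k x"] show ?case by simp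
    qed
   qed
   \<comment> \<open>Splits the pairing into the residual of the approximate equation, the
     coefficient error and the data.\<close>
   have eq: "(LINT x|lebesgue_on (S n). F x \<bullet> (w n x, grad (w n) x, hess (w n) x))
    = (LINT x|M. k x * E n x) + (LINT x|M. G n x \<bullet> Hn n x) + (LINT x|M. k x * (indicator (S n) x *\<^sub>R h n x))" for n
   proof -
    have sh: "sqint M (\<lambda>x. indicator (S n) x *\<^sub>R h n x)" by (intro ind(1) SqS h)
    have "(LINT x|lebesgue_on (S n). F x \<bullet> (w n x, grad (w n) x, hess (w n) x))
     = (LINT x|M. indicator (S n) x *\<^sub>R (F x \<bullet> (w n x, grad (w n) x, hess (w n) x)))" by (rule ind(3)[symmetric])
    also have "\<dots> = (LINT x|M. k x * E n x + G n x \<bullet> Hn n x + k x * (indicator (S n) x *\<^sub>R h n x))"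
     by (rule Bochner_Integration.integral_cong)
       (auto simp: F_def E_def G_def Hn_def indicator_def inner_diff_left algebra_simps)
    finally show ?thesis
     using sqint_integrable_mult[OF k Es(1)] sqint_integrable_inner[OF Gs Hs(1)] sqint_integrable_mult[OF k sh] by simp
   qed
   show "(\<lambda>n. LINT x|lebesgue_on (S n). F x \<bullet> (w n x, grad (w n) x, hess (w n) x)) \<longlonglongrightarrow> (LINT x|M. k x * g x)"
    unfolding eq using tendsto_add[OF tendsto_add[OF t1 t2] t3] by simp
  qed
  then show ?thesis by (simp add: F_def Zeq)
 qed
 ultimately show ?thesis by (rule that)
qed

end

section \<open>Countable sets of controls, symmetric parts and rescaled matrices\<close>

lemma compact_countable_dense:
 fixes A :: "'c::metric_space set"
 assumes "compact A"
 obtains C where "countable C" "C \<subseteq> A" "A \<subseteq> closure C"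
proof -
 have "\<forall>e>0. \<exists>k. finite k \<and> k \<subseteq> A \<and> A \<subseteq> (\<Union>x\<in>k. ball x e)"
  using seq_compact_imp_totally_bounded compact_imp_seq_compact assms by blast
 then have "\<exists>k. finite k \<and> k \<subseteq> A \<and> A \<subseteq> (\<Union>x\<in>k. ball x (1 / real (Suc n)))" for n by simp
 then obtain k where k: "\<And>n. finite (k n)" "\<And>n. k n \<subseteq> A" "\<And>n. A \<subseteq> (\<Union>x\<in>k n. ball x (1 / real (Suc n)))" by metis
 show ?thesis
 proof (rule that[of "\<Union>n. k n"])
  show "countable (\<Union>n. k n)" using k(1) by (simp add: countable_finite)
  show "A \<subseteq> closure (\<Union>n. k n)"
  proof
   fix x assume x: "x \<in> A"
   show "x \<in> closure (\<Union>n. k n)"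
    unfolding closure_approachable
   proof (intro allI impI)
    fix e :: real assume "0 < e"
    then obtain n where n: "1 / real (Suc n) < e" using nat_approx_posE by blast
    obtain y where "y \<in> k n" "x \<in> ball y (1 / real (Suc n))" using k(3)[of n] x by blast
    then show "\<exists>y\<in>\<Union>n. k n. dist y x < e" using n by (auto intro!: bexI[of _ y])
   qed
  qed
 qed (use k in blast)
qed

lemma transpose_inner: "transpose X \<bullet> transpose Y = X \<bullet> (Y :: real^'d^'d)"
 unfolding inner_mat transpose_def by (simp, rule sum.swap)

text \<open>Weak Hessians enter as arbitrary matrices, whereas \<open>subdiff_M\<close> quantifies
  over symmetric ones; the symmetric part bridges the two, because symmetric coefficients do not see
  the difference.\<close>

definition sym_part :: "real^'d^'d => real^'d^'d" where
 "sym_part N = (1/2) *\<^sub>R (N + transpose N)"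

lemma transpose_add: "transpose (X + Y) = transpose X + transpose (Y :: real^'d^'d)"
 by (simp add: transpose_def vec_eq_iff)

lemma sym_part_in_sym_mats: "sym_part N \<in> sym_mats"
 by (simp add: sym_part_def sym_mats_def transpose_scalar transpose_add add.commute scalar_matrix_assoc[symmetric])

lemma sym_mats_inner_sym_part: "B \<in> sym_mats ==> B \<bullet> sym_part N = B \<bullet> N"
 using transpose_inner[of B N] by (simp add: sym_part_def sym_mats_def inner_add_right)

text \<open>The factor \<open>(b \<bullet> mat 1) / (b \<bullet> b)\<close> makes the multiple of
  \<open>b\<close> the orthogonal projection of the identity. With \<open>d = CARD('d)\<close>, the
  squared distance is \<open>d - (tr b)^2 / |b|^2\<close>, and the Cordes condition bounds the
  quotient below by \<open>d - 1 + \<epsilon>\<close>.\<close>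

lemma cordes_scaled_near_identity:
 fixes b :: "real^'d^'d"
 assumes \<epsilon>: "0 < \<epsilon>" "\<epsilon> \<le> 1" and T: "0 < b \<bullet> mat 1" and c: "norm b * sqrt (real CARD('d) - 1 + \<epsilon>) \<le> b \<bullet> mat 1"
 shows "norm (((b \<bullet> mat 1) / (b \<bullet> b)) *\<^sub>R b - mat 1) \<le> sqrt (1 - \<epsilon>)"
proof -
 have b: "0 < b \<bullet> b" using T by auto
 have d: "0 \<le> real CARD('d) - 1 + \<epsilon>" using \<epsilon> by (simp add: Suc_leI)
 have "(norm b * sqrt (real CARD('d) - 1 + \<epsilon>))\<^sup>2 \<le> (b \<bullet> mat 1)\<^sup>2"
  using c d by (intro power_mono) auto
 then have "(b \<bullet> b) * (real CARD('d) - 1 + \<epsilon>) \<le> (b \<bullet> mat 1)\<^sup>2"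
  using d by (simp add: power_mult_distrib power2_norm_eq_inner)
 then have "real CARD('d) - 1 + \<epsilon> \<le> (b \<bullet> mat 1)\<^sup>2 / (b \<bullet> b)" using b by (simp add: field_simps)
 moreover have "(norm (((b \<bullet> mat 1) / (b \<bullet> b)) *\<^sub>R b - mat 1))\<^sup>2 = real CARD('d) - (b \<bullet> mat 1)\<^sup>2 / (b \<bullet> b)"
  unfolding power2_norm_eq_inner
  using b by (simp add: inner_diff_left inner_diff_right norm_mat_1_sq inner_commute[of "mat 1" b] power2_eq_square)
 ultimately show ?thesis by (intro real_le_rsqrt) simp
qed

section \<open>The Hamiltonian\<close>

locale hjb = bounded_open \<Omega> for \<Omega> :: "(real^'d) set" +
 fixes A :: "'c::metric_space set" and a :: "real^'d => 'c => real^'d^'d" and f :: "real^'d => 'c => real"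
  and \<nu>l \<nu>u \<epsilon> :: real
 assumes convex_\<Omega>: "convex \<Omega>" and A: "compact A" "A \<noteq> {}"
  and cont_a: "continuous_on (closure \<Omega> \<times> A) (\<lambda>(x, \<alpha>). a x \<alpha>)"
  and \<nu>: "0 < \<nu>l" "\<nu>l \<le> \<nu>u" and \<epsilon>: "0 < \<epsilon>" "\<epsilon> \<le> 1"
  and cordes: "\<And>x \<alpha>. x \<in> closure \<Omega> ==> \<alpha> \<in> A ==> a x \<alpha> \<in> cordes \<nu>l \<nu>u \<epsilon>"
  and cont_f: "continuous_on (closure \<Omega> \<times> A) (\<lambda>(x, \<alpha>). f x \<alpha>)"
begin

abbreviation H where "H \<equiv> hamiltonian A a f"

lemma compact_domain: "compact (closure \<Omega> \<times> A)"
 using A bounded_\<Omega> by (intro compact_Times) auto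

text \<open>One bound for \<open>a\<close> and \<open>f\<close>, by compactness. It is also the
  Lipschitz constant of \<open>H\<close> in the matrix argument and the norm bound for
  subgradients.\<close>

definition Ca where "Ca = (SOME C. 0 \<le> C \<and> (\<forall>x\<in>\<Omega>. \<forall>\<alpha>\<in>A. norm (a x \<alpha>) \<le> C \<and> \<bar>f x \<alpha>\<bar> \<le> C))"

lemma Ca: "0 \<le> Ca" "x \<in> \<Omega> ==> \<alpha> \<in> A ==> norm (a x \<alpha>) \<le> Ca" "x \<in> \<Omega> ==> \<alpha> \<in> A ==> \<bar>f x \<alpha>\<bar> \<le> Ca"
proof -
 have "bounded ((\<lambda>(x, \<alpha>). a x \<alpha>) ` (closure \<Omega> \<times> A))" "bounded ((\<lambda>(x, \<alpha>). f x \<alpha>) ` (closure \<Omega> \<times> A))"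
  using compact_continuous_image[OF _ compact_domain] cont_a cont_f compact_imp_bounded by blast+
 then obtain B1 B2 where B: "0 < B1" "\<And>z. z \<in> closure \<Omega> \<times> A ==> norm (a (fst z) (snd z)) \<le> B1"
  "\<And>z. z \<in> closure \<Omega> \<times> A ==> norm (f (fst z) (snd z)) \<le> B2"
  unfolding bounded_pos by (auto simp: case_prod_beta) blast
 have "norm (a x \<alpha>) \<le> max B1 B2 \<and> \<bar>f x \<alpha>\<bar> \<le> max B1 B2" if "x \<in> \<Omega>" "\<alpha> \<in> A" for x \<alpha>
  using B(2,3)[of "(x, \<alpha>)"] that closure_subset by fastforce
 then have "\<exists>C\<ge>0. \<forall>x\<in>\<Omega>. \<forall>\<alpha>\<in>A. norm (a x \<alpha>) \<le> C \<and> \<bar>f x \<alpha>\<bar> \<le> C"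
  using B(1) by (intro exI[of _ "max B1 B2"]) auto
 from someI_ex[OF this] show "0 \<le> Ca" "x \<in> \<Omega> ==> \<alpha> \<in> A ==> norm (a x \<alpha>) \<le> Ca" "x \<in> \<Omega> ==> \<alpha> \<in> A ==> \<bar>f x \<alpha>\<bar> \<le> Ca"
  by (auto simp: Ca_def)
qed

lemma a_inner_le: "x \<in> \<Omega> ==> \<alpha> \<in> A ==> \<bar>a x \<alpha> \<bullet> N\<bar> \<le> Ca * norm N"
 using Cauchy_Schwarz_ineq2[of "a x \<alpha>" N] mult_right_mono[OF Ca(2), of x \<alpha> "norm N"] by simp

lemma H_bdd: "x \<in> \<Omega> ==> bdd_above ((\<lambda>\<alpha>. - (a x \<alpha> \<bullet> N) - f x \<alpha>) ` A)"
 using a_inner_le[of x _ N] Ca(3)[of x] by (intro bdd_aboveI2[of _ _ "Ca * norm N + Ca"]) (smt (verit))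

lemma H_ge: "x \<in> \<Omega> ==> \<alpha> \<in> A ==> - (a x \<alpha> \<bullet> N) - f x \<alpha> \<le> H x N"
 unfolding hamiltonian_def by (rule cSUP_upper[OF _ H_bdd])

lemma H_le: "(\<And>\<alpha>. \<alpha> \<in> A ==> - (a x \<alpha> \<bullet> N) - f x \<alpha> \<le> c) ==> H x N \<le> c"
 unfolding hamiltonian_def using A(2) by (rule cSUP_least)

lemma H_diff_le:
 assumes "x \<in> \<Omega>" "\<And>\<alpha>. \<alpha> \<in> A ==> - (a x \<alpha> \<bullet> (N - N')) \<le> c" shows "H x N \<le> H x N' + c"
proof (rule H_le)
 fix \<alpha> assume "\<alpha> \<in> A"
 then show "- (a x \<alpha> \<bullet> N) - f x \<alpha> \<le> H x N' + c"
  using assms H_ge[of x \<alpha> N'] by (force simp: inner_diff_right)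
qed

lemma H_Lipschitz:
 assumes "x \<in> \<Omega>" shows "\<bar>H x N - H x N'\<bar> \<le> Ca * norm (N - N')"
proof -
 have "H x N \<le> H x N' + Ca * norm (N - N')" for N N'
  using a_inner_le[OF assms, of _ "N - N'"] by (intro H_diff_le assms) (smt (verit))
 from this[of N N'] this[of N' N] show ?thesis by (simp add: norm_minus_commute abs_le_iff)
qed

lemma H_convex:
 assumes "x \<in> \<Omega>" "0 \<le> s" "0 \<le> t" "s + t = 1"
 shows "H x (s *\<^sub>R N + t *\<^sub>R N') \<le> s * H x N + t * H x N'"
proof (rule H_le)
 fix \<alpha> assume \<alpha>: "\<alpha> \<in> A"
 have t: "t = 1 - s" using assms by simp
 have "- (a x \<alpha> \<bullet> (s *\<^sub>R N + t *\<^sub>R N')) - f x \<alpha> = s * (- (a x \<alpha> \<bullet> N) - f x \<alpha>) + t * (- (a x \<alpha> \<bullet> N') - f x \<alpha>)"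
  unfolding t by (simp add: inner_add_right algebra_simps)
 also have "\<dots> \<le> s * H x N + t * H x N'"
  using assms \<alpha> by (intro add_mono mult_left_mono H_ge) auto
 finally show "- (a x \<alpha> \<bullet> (s *\<^sub>R N + t *\<^sub>R N')) - f x \<alpha> \<le> s * H x N + t * H x N'" .
qed

lemma a_sym: "x \<in> \<Omega> ==> \<alpha> \<in> A ==> a x \<alpha> \<in> sym_mats"
 using cordes closure_subset by (fastforce simp: cordes_def sym_psd_mats_def)

lemma H_cong_sym_part:
 assumes "x \<in> \<Omega>" "sym_part N = sym_part N'" shows "H x N = H x N'"
proof -
 have "a x \<alpha> \<bullet> N = a x \<alpha> \<bullet> N'" if "\<alpha> \<in> A" for \<alpha>
  using sym_mats_inner_sym_part[OF a_sym[OF assms(1) that]] assms(2) by metis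
 then show ?thesis unfolding hamiltonian_def by (intro SUP_cong) auto
qed

text \<open>By continuity in the control, the supremum may be taken over a countable dense set of
  controls, which keeps measurability.\<close>

lemma measurable_H:
 assumes N: "N \<in> borel_measurable M" shows "(\<lambda>x. H x (N x)) \<in> borel_measurable M"
proof -
 obtain C where C: "countable C" "C \<subseteq> A" "A \<subseteq> closure C" using compact_countable_dense[OF A(1)] .
 have clC: "closure C = A" using C closure_minimal[OF C(2) compact_imp_closed[OF A(1)]] by blast
 have C0: "C \<noteq> {}" using A(2) clC by auto
 have eq: "H x (N x) = (SUP \<alpha>\<in>C. - (a x \<alpha> \<bullet> N x) - f x \<alpha>)" if x: "x \<in> \<Omega>" for x
 proof (rule antisym)
  have xc: "x \<in> closure \<Omega>" using x closure_subset by blast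
  have bC: "bdd_above ((\<lambda>\<alpha>. - (a x \<alpha> \<bullet> N x) - f x \<alpha>) ` C)" using bdd_above_mono[OF H_bdd[OF x] image_mono[OF C(2)]] .
  have "continuous_on A (\<lambda>\<alpha>. a x \<alpha>)" "continuous_on A (\<lambda>\<alpha>. f x \<alpha>)"
   using continuous_on_compose2[OF cont_a, of A "\<lambda>\<alpha>. (x, \<alpha>)"] continuous_on_compose2[OF cont_f, of A "\<lambda>\<alpha>. (x, \<alpha>)"] xc
   by (auto simp: continuous_on_Pair)
  then have c: "continuous_on (closure C) (\<lambda>\<alpha>. - (a x \<alpha> \<bullet> N x) - f x \<alpha>)" unfolding clC by (intro continuous_intros)
  show "H x (N x) \<le> (SUP \<alpha>\<in>C. - (a x \<alpha> \<bullet> N x) - f x \<alpha>)"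
  proof (rule H_le)
   fix \<alpha> assume "\<alpha> \<in> A"
   then have "\<alpha> \<in> closure C" using clC by simp
   from continuous_le_on_closure[OF c this] show "- (a x \<alpha> \<bullet> N x) - f x \<alpha> \<le> (SUP \<alpha>\<in>C. - (a x \<alpha> \<bullet> N x) - f x \<alpha>)"
    using cSUP_upper[OF _ bC] by blast
  qed
  show "(SUP \<alpha>\<in>C. - (a x \<alpha> \<bullet> N x) - f x \<alpha>) \<le> H x (N x)"
   using C0 C(2) H_ge[OF x] by (intro cSUP_least) auto
 qed
 have "(\<lambda>x. SUP \<alpha>\<in>C. - (a x \<alpha> \<bullet> N x) - f x \<alpha>) \<in> borel_measurable M"
 proof (rule borel_measurable_cSUP[OF C(1)])
  fix \<alpha> assume "\<alpha> \<in> C"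
  then have "\<alpha> \<in> A" using C(2) by blast
  then have "continuous_on \<Omega> (\<lambda>x. a x \<alpha>)" "continuous_on \<Omega> (\<lambda>x. f x \<alpha>)"
   using continuous_on_compose2[OF cont_a, of \<Omega> "\<lambda>x. (x, \<alpha>)"] continuous_on_compose2[OF cont_f, of \<Omega> "\<lambda>x. (x, \<alpha>)"] closure_subset
   by (auto simp: continuous_on_Pair)
  then have "(\<lambda>x. a x \<alpha>) \<in> borel_measurable M" "(\<lambda>x. f x \<alpha>) \<in> borel_measurable M"
   using lebesgue_\<Omega> by (auto intro: continuous_imp_measurable_on_sets_lebesgue)
  then show "(\<lambda>x. - (a x \<alpha> \<bullet> N x) - f x \<alpha>) \<in> borel_measurable M" using N by (intro borel_measurable_diff borel_measurable_uminus borel_measurable_inner)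
 next
  fix x assume "x \<in> space M"
  then show "bdd_above ((\<lambda>\<alpha>. - (a x \<alpha> \<bullet> N x) - f x \<alpha>) ` C)" using bdd_above_mono[OF H_bdd image_mono[OF C(2)]] by simp
 qed
 then show ?thesis by (rule measurable_cong[THEN iffD1, rotated]) (simp add: eq)
qed

lemma sqint_H_diff:
 assumes "sqint M N" "sqint M N'" shows "sqint M (\<lambda>x. H x (N x) - H x (N' x))"
proof (rule sqint_mono[OF sqint_scaleR[OF sqint_diff[OF assms], of Ca]])
 show "(\<lambda>x. H x (N x) - H x (N' x)) \<in> borel_measurable M" using assms by (intro borel_measurable_diff measurable_H) auto
 show "AE x in M. norm (H x (N x) - H x (N' x)) \<le> norm (Ca *\<^sub>R (N x - N' x))"
  using H_Lipschitz Ca(1) by (intro AE_I2) simp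
qed

text \<open>Moving from \<open>M0\<close> in direction \<open>N\<close> raises \<open>H\<close> by
  at most \<open>c\<close>, so linear inequalities satisfied by all \<open>a x \<alpha>\<close> pass
  to \<open>b\<close>: it behaves like an element of the closed convex hull of the control
  matrices.\<close>

lemma subdiff_le:
 assumes b: "- b \<in> subdiff_M A a f x M0" and x: "x \<in> \<Omega>" and le: "\<And>\<alpha>. \<alpha> \<in> A ==> - (a x \<alpha> \<bullet> N) \<le> c"
 shows "- (b \<bullet> N) \<le> c"
proof -
 have s: "- b \<in> sym_mats" and sub: "\<And>M'. M' \<in> sym_mats ==> H x M0 + - b \<bullet> (M' - M0) \<le> H x M'"
  using b by (auto simp: subdiff_M_def)
 have "H x M0 + - b \<bullet> (sym_part (M0 + N) - M0) \<le> H x (sym_part (M0 + N))"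
  by (rule sub[OF sym_part_in_sym_mats])
 also have "H x (sym_part (M0 + N)) = H x (M0 + N)"
  by (rule H_cong_sym_part[OF x]) (use sym_part_in_sym_mats[of "M0 + N"] in \<open>simp add: sym_part_def sym_mats_def flip: scaleR_add_left\<close>)
 also have "\<dots> \<le> H x M0 + c" by (rule H_diff_le[OF x]) (simp add: le)
 also have "- b \<bullet> (sym_part (M0 + N) - M0) = - (b \<bullet> N)"
  using sym_mats_inner_sym_part[OF s, of "M0 + N"] by (simp add: inner_diff_right inner_add_right)
 finally show ?thesis by simp
qed

text \<open>The three conditions describe convex sets, and each is read off from one direction in
  \<open>subdiff_le\<close>: \<open>mat 1\<close>, minus the unit matrix along \<open>b\<close>, and
  a combination of both.\<close>

lemma subdiff_cordes:
 assumes b: "- b \<in> subdiff_M A a f x M0" and x: "x \<in> \<Omega>"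
 shows "real CARD('d) * \<nu>l \<le> b \<bullet> mat 1" "norm b \<le> Ca" "norm b * sqrt (real CARD('d) - 1 + \<epsilon>) \<le> b \<bullet> mat 1"
proof -
 have tr: "real CARD('d) * \<nu>l \<le> a x \<alpha> \<bullet> mat 1 \<and> norm (a x \<alpha>) * sqrt (real CARD('d) - 1 + \<epsilon>) \<le> a x \<alpha> \<bullet> mat 1" if "\<alpha> \<in> A" for \<alpha>
 proof -
  have c: "a x \<alpha> \<in> cordes \<nu>l \<nu>u \<epsilon>" using cordes x that closure_subset by blast
  have t: "a x \<alpha> \<bullet> mat 1 = trace (a x \<alpha>)"
   by (simp add: inner_mat mat_def trace_def if_distrib[of "\<lambda>c. _ * c"] cong: if_cong)
  have "\<nu>l \<le> a x \<alpha> $ i $ i" for i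
  proof -
   have "\<nu>l * (norm (axis i 1 :: real^'d))\<^sup>2 \<le> axis i 1 \<bullet> (a x \<alpha> *v axis i 1)" using c unfolding cordes_def by blast
   then show ?thesis by (simp add: matrix_vector_mul_component inner_axis' matrix_vector_mult_basis column_def)
  qed
  then have T: "real CARD('d) * \<nu>l \<le> trace (a x \<alpha>)"
   unfolding trace_def using sum_mono[of UNIV "\<lambda>i. \<nu>l" "\<lambda>i. a x \<alpha> $ i $ i"] by simp
  moreover have "0 < real CARD('d) * \<nu>l" using \<nu> by simp
  ultimately have T0: "0 < trace (a x \<alpha>)" by linarith
  have "1 \<le> real CARD('d)" by (simp add: Suc_leI)
  then have s: "0 < sqrt (real CARD('d) - 1 + \<epsilon>)" using \<epsilon> by (intro real_sqrt_gt_zero) linarith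
  have "norm (a x \<alpha>) / trace (a x \<alpha>) \<le> 1 / sqrt (real CARD('d) - 1 + \<epsilon>)" using c by (simp add: cordes_def)
  then have "norm (a x \<alpha>) * sqrt (real CARD('d) - 1 + \<epsilon>) \<le> trace (a x \<alpha>)"
   using T0 s by (simp add: field_simps)
  then show ?thesis using T by (simp add: t)
 qed
 have "- (b \<bullet> mat 1) \<le> - (real CARD('d) * \<nu>l)"
  by (rule subdiff_le[OF b x]) (use tr in auto)
 then show T: "real CARD('d) * \<nu>l \<le> b \<bullet> mat 1" by simp
 then have b0: "b \<noteq> 0" using \<nu> by (auto simp: mult_le_0_iff)
 \<comment> \<open>Testing along \<open>b\<close> linearises the norm:
   \<open>b \<bullet> n = norm b\<close>, while
   \<open>a x \<alpha> \<bullet> n \<le> norm (a x \<alpha>)\<close>.\<close>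
 define n where "n = (1 / norm b) *\<^sub>R b"
 have n: "norm n = 1" "b \<bullet> n = norm b" using b0 by (auto simp: n_def dot_square_norm power2_eq_square)
 have an: "a x \<alpha> \<bullet> n \<le> norm (a x \<alpha>)" for \<alpha> using norm_cauchy_schwarz[of "a x \<alpha>" n] n by simp
 have "- (b \<bullet> - n) \<le> Ca"
  by (rule subdiff_le[OF b x]) (use an Ca(2)[OF x] in \<open>auto intro: order_trans\<close>)
 then show "norm b \<le> Ca" using n by simp
 define s where "s = sqrt (real CARD('d) - 1 + \<epsilon>)"
 have "- (b \<bullet> (mat 1 - s *\<^sub>R n)) \<le> 0"
 proof (rule subdiff_le[OF b x])
  fix \<alpha> assume "\<alpha> \<in> A"
  have "0 \<le> s" using \<epsilon> by (simp add: s_def Suc_leI)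
  then have "s * (a x \<alpha> \<bullet> n) \<le> s * norm (a x \<alpha>)" using an by (intro mult_left_mono)
  then show "- (a x \<alpha> \<bullet> (mat 1 - s *\<^sub>R n)) \<le> 0" using tr[OF \<open>\<alpha> \<in> A\<close>] by (simp add: inner_diff_right s_def mult.commute)
 qed
 then show "norm b * sqrt (real CARD('d) - 1 + \<epsilon>) \<le> b \<bullet> mat 1" using n by (simp add: inner_diff_right s_def mult.commute)
qed

end

text \<open>A sublinear functional that is bounded below by a multiple of the norm dominates a continuous
 linear one: if \<open>f\<close> minimises \<open>q N + \<parallel>N\<parallel>\<^sup>2 / 2\<close>, then \<open>- f\<close> represents it.\<close>

lemma sublinear_majorizes_inner:
 fixes q :: "('a => 'b::euclidean_space) => real"
 assumes M: "finite_measure M"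
  and lower: "\<And>N. sqint M N ==> - K * l2 M N \<le> q N"
  and sub: "\<And>N N'. sqint M N ==> sqint M N' ==> q (\<lambda>x. N x + N' x) \<le> q N + q N'"
  and hom: "\<And>N s. sqint M N ==> 0 < s ==> q (\<lambda>x. s *\<^sub>R N x) \<le> s * q N"
 obtains R where "sqint M R" "\<And>N. sqint M N ==> (LINT x|M. R x \<bullet> N x) \<le> q N"
proof -
 define J where "J N = q N + (l2 M N)\<^sup>2 / 2" for N
 have bdd: "- K\<^sup>2 / 2 \<le> J N" if "N \<in> {N. sqint M N}" for N
  using lower[of N] that sum_squares_ge_zero[of "l2 M N - K" 0] by (simp add: J_def power2_eq_square algebra_simps)
 obtain F f where F: "\<And>n. F n \<in> {N. sqint M N}" "(\<lambda>n. J (F n)) \<longlonglongrightarrow> Inf (J ` {N. sqint M N})"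
  and f: "sqint M f" "(\<lambda>n. l2 M (\<lambda>x. F n x - f x)) \<longlonglongrightarrow> 0"
 proof (rule l2_minimizing_sequence[where C = "{N. sqint M N}" and J = J and c = "1/8" and L = "- K\<^sup>2 / 2"])
  show "{N. sqint M N} \<noteq> ({} :: ('a => 'b) set)" using sqint_zero by blast
  show "(\<lambda>x. (1/2) *\<^sub>R (f x + g x)) \<in> {N. sqint M N}" if "f \<in> {N. sqint M N}" "g \<in> {N. sqint M N}" for f g
   using that by (auto intro: sqint_scaleR sqint_add)
  \<comment> \<open>The gap \<open>1/8\<close> comes from the quadratic term alone; \<open>q\<close>
    contributes midpoint convexity.\<close>
  show "J (\<lambda>x. (1/2) *\<^sub>R (f x + g x)) \<le> (J f + J g) / 2 - 1/8 * (l2 M (\<lambda>x. f x - g x))\<^sup>2"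
   if "f \<in> {N. sqint M N}" "g \<in> {N. sqint M N}" for f g
  proof -
   have "q (\<lambda>x. (1/2) *\<^sub>R (f x + g x)) \<le> 1/2 * (q f + q g)"
    using hom[of "\<lambda>x. f x + g x" "1/2"] sub[of f g] that sqint_add[of M f g] by simp
   then show ?thesis using l2_parallelogram[of M f g] that by (simp add: J_def field_simps)
  qed
 qed (use M bdd that in auto)
 have Inf: "Inf (J ` {N. sqint M N}) \<le> J N" if "sqint M N" for N
  by (rule cInf_lower[OF _ bdd_belowI2[of _ "- K\<^sup>2 / 2"]]) (use that bdd in auto)
 have main: "0 \<le> q N + (LINT x|M. f x \<bullet> N x)" if N: "sqint M N" for N
 proof (rule field_le_epsilon)
  fix e :: real assume e: "0 < e"
  define s where "s = e / ((l2 M N)\<^sup>2 + 1)"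
  have s: "0 < s" using e by (simp add: s_def add_nonneg_pos)
  have sN: "s * (l2 M N)\<^sup>2 \<le> e"
   using e by (simp add: s_def divide_le_eq add_nonneg_pos mult_left_mono)
  \<comment> \<open>The competitor perturbs \<open>F n\<close> rather than \<open>f\<close>, because
    no semicontinuity of \<open>q\<close> is at hand; the limit in \<open>n\<close> is taken
    afterwards.\<close>
  have step: "Inf (J ` {N. sqint M N}) \<le> J (F n) + s * (q N + (LINT x|M. N x \<bullet> F n x) + e / 2)" for n
  proof -
   have Fn: "sqint M (F n)" and sc: "sqint M (\<lambda>x. s *\<^sub>R N x)" using F(1) sqint_scaleR[OF N] by auto
   have "Inf (J ` {N. sqint M N}) \<le> J (\<lambda>x. F n x + s *\<^sub>R N x)" by (rule Inf[OF sqint_add[OF Fn sc]])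
   also have "\<dots> \<le> (q (F n) + s * q N) + (l2 M (\<lambda>x. F n x + s *\<^sub>R N x))\<^sup>2 / 2"
    unfolding J_def using sub[OF Fn sc] hom[OF N s] by simp
   also have "(l2 M (\<lambda>x. F n x + s *\<^sub>R N x))\<^sup>2 = (l2 M (F n))\<^sup>2 + 2 * s * (LINT x|M. N x \<bullet> F n x) + s * (s * (l2 M N)\<^sup>2)"
    unfolding l2_add_square[OF Fn sc] l2_scaleR by (simp add: power_mult_distrib power2_eq_square inner_commute)
   also have "(q (F n) + s * q N) + ((l2 M (F n))\<^sup>2 + 2 * s * (LINT x|M. N x \<bullet> F n x) + s * (s * (l2 M N)\<^sup>2)) / 2
    = J (F n) + s * (q N + (LINT x|M. N x \<bullet> F n x) + s * (l2 M N)\<^sup>2 / 2)"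
    by (simp add: J_def field_simps)
   also have "\<dots> \<le> J (F n) + s * (q N + (LINT x|M. N x \<bullet> F n x) + e / 2)"
    using s sN by (intro add_left_mono mult_left_mono) auto
   finally show ?thesis .
  qed
  have Fs: "\<And>n. sqint M (F n)" using F(1) by simp
  have "(\<lambda>n. J (F n) + s * (q N + (LINT x|M. N x \<bullet> F n x) + e / 2)) \<longlonglongrightarrow>
   Inf (J ` {N. sqint M N}) + s * (q N + (LINT x|M. N x \<bullet> f x) + e / 2)"
   by (intro tendsto_intros F(2) l2_tendsto_inner[OF Fs f(1) N f(2)])
  from tendsto_lowerbound[OF this, of "Inf (J ` {N. sqint M N})"] step
  have "0 \<le> s * (q N + (LINT x|M. N x \<bullet> f x) + e / 2)" by simp
  then show "0 \<le> q N + (LINT x|M. f x \<bullet> N x) + e" using s e by (simp add: zero_le_mult_iff inner_commute)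
 qed
 show ?thesis
 proof (rule that[OF sqint_uminus[OF f(1)]])
  show "(LINT x|M. - f x \<bullet> N x) \<le> q N" if "sqint M N" for N using main[OF that] by simp
 qed
qed

text \<open>A linear functional on a subspace of \<open>L\<^sup>2\<close> (given by its graph \<open>\<Gamma>\<close>) that is dominated by a
 Lipschitz convex function extends to a dominated element of \<open>L\<^sup>2\<close>.\<close>

lemma dominated_extension:
 fixes h :: "('a => 'b::euclidean_space) => real"
 assumes M: "finite_measure M"
  and lip: "\<And>N N'. sqint M N ==> sqint M N' ==> h N \<le> h N' + K * l2 M (\<lambda>x. N x - N' x)"
  and conv: "\<And>N N' s t. sqint M N ==> sqint M N' ==> 0 \<le> s ==> 0 \<le> t ==> s + t = 1 ==>
   h (\<lambda>x. s *\<^sub>R N x + t *\<^sub>R N' x) \<le> s * h N + t * h N'"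
  and h0: "h (\<lambda>x. 0) = 0"
  and \<Gamma>0: "((\<lambda>x. 0), 0) \<in> \<Gamma>" and \<Gamma>: "\<And>E c. (E, c) \<in> \<Gamma> ==> sqint M E" "\<And>E c. (E, c) \<in> \<Gamma> ==> c \<le> h E"
  and comb: "\<And>E c E' c' s t. (E, c) \<in> \<Gamma> ==> (E', c') \<in> \<Gamma> ==> ((\<lambda>x. s *\<^sub>R E x + t *\<^sub>R E' x), s * c + t * c') \<in> \<Gamma>"
 obtains R where "sqint M R" "\<And>N. sqint M N ==> (LINT x|M. R x \<bullet> N x) \<le> h N"
  "\<And>E c. (E, c) \<in> \<Gamma> ==> (LINT x|M. R x \<bullet> E x) = c"
proof -
 \<comment> \<open>The infimum over \<open>Q N\<close> is a sublinear minorant of \<open>h\<close>: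
   the scaling by \<open>t\<close> makes it homogeneous, and the shift by \<open>E\<close> brings it
   below \<open>c\<close> on the graph, where linearity then yields equality.\<close>
 define Q where "Q N = {(h (\<lambda>x. t *\<^sub>R N x - E x) + c) / t | t E c. 0 < t \<and> (E, c) \<in> \<Gamma>}" for N
 define q where "q N = Inf (Q N)" for N
 have neg: "((\<lambda>x. - E x), - c) \<in> \<Gamma>" if "(E, c) \<in> \<Gamma>" for E c
  using comb[OF that that, of "-1" 0] by simp
 have QI: "(h (\<lambda>x. t *\<^sub>R N x - E x) + c) / t \<in> Q N" if "0 < t" "(E, c) \<in> \<Gamma>" for t N E c
  using that by (auto simp: Q_def)
 have Qne: "Q N \<noteq> {}" for N using QI[of 1, OF _ \<Gamma>0] by fastforce
 have Qlow: "- K * l2 M N \<le> y" if N: "sqint M N" and y: "y \<in> Q N" for N y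
 proof -
  obtain t E c where t: "0 < t" "(E, c) \<in> \<Gamma>" "y = (h (\<lambda>x. t *\<^sub>R N x - E x) + c) / t" using y by (auto simp: Q_def)
  have sE: "sqint M E" using \<Gamma> t by blast
  have "- c \<le> h (\<lambda>x. - E x)" using \<Gamma>(2)[OF neg[OF t(2)]] .
  also have "\<dots> \<le> h (\<lambda>x. t *\<^sub>R N x - E x) + K * l2 M (\<lambda>x. - E x - (t *\<^sub>R N x - E x))"
   by (intro lip sqint_uminus sqint_diff sqint_scaleR N sE)
  also have "l2 M (\<lambda>x. - E x - (t *\<^sub>R N x - E x)) = t * l2 M N"
   using t(1) l2_scaleR[of M "- t" N] by simp
  finally show ?thesis unfolding t(3) using t(1) by (simp add: field_simps)
 qed
 have bdd: "bdd_below (Q N)" if "sqint M N" for N using Qlow[OF that] by (rule bdd_belowI)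
 have qle: "q N \<le> y" if "sqint M N" "y \<in> Q N" for N y
  unfolding q_def using that by (intro cInf_lower bdd)
 have qge: "c \<le> q N" if "\<And>y. y \<in> Q N ==> c \<le> y" for N c
  unfolding q_def using that by (intro cInf_greatest Qne)
 obtain R where R: "sqint M R" "\<And>N. sqint M N ==> (LINT x|M. R x \<bullet> N x) \<le> q N"
 proof (rule sublinear_majorizes_inner[OF M, of K q])
  show "- K * l2 M N \<le> q N" if "sqint M N" for N using Qlow[OF that] by (rule qge)
  show "q (\<lambda>x. N x + N' x) \<le> q N + q N'" if N: "sqint M N" "sqint M N'" for N N'
  proof -
   have le: "q (\<lambda>x. N x + N' x) \<le> y + y'" if "y \<in> Q N" "y' \<in> Q N'" for y y'
   proof -
    obtain t E c where t: "0 < t" "(E, c) \<in> \<Gamma>" "y = (h (\<lambda>x. t *\<^sub>R N x - E x) + c) / t" using \<open>y \<in> Q N\<close> by (auto simp: Q_def)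
    obtain t' E' c' where t': "0 < t'" "(E', c') \<in> \<Gamma>" "y' = (h (\<lambda>x. t' *\<^sub>R N' x - E' x) + c') / t'" using \<open>y' \<in> Q N'\<close> by (auto simp: Q_def)
    \<comment> \<open>The weights give both scalings the common value \<open>\<tau>\<close>, so that
      convexity of \<open>h\<close> applies to the two arguments.\<close>
    define s where "s = t' / (t + t')"
    define s' where "s' = t / (t + t')"
    define \<tau> where "\<tau> = t * t' / (t + t')"
    have s: "0 \<le> s" "0 \<le> s'" "s + s' = 1" "0 < \<tau>" "s * t = \<tau>" "s' * t' = \<tau>" "s / \<tau> = 1 / t" "s' / \<tau> = 1 / t'"
     using t t' by (auto simp: s_def s'_def \<tau>_def divide_simps)
    have sq: "sqint M (\<lambda>x. t *\<^sub>R N x - E x)" "sqint M (\<lambda>x. t' *\<^sub>R N' x - E' x)"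
     using N \<Gamma>(1) t t' by (auto intro!: sqint_diff sqint_scaleR)
    have "\<tau> *\<^sub>R (N x + N' x) - (s *\<^sub>R E x + s' *\<^sub>R E' x) = s *\<^sub>R (t *\<^sub>R N x - E x) + s' *\<^sub>R (t' *\<^sub>R N' x - E' x)" for x
     using s(5,6) by (simp add: scaleR_diff_right scaleR_add_right)
    then have "h (\<lambda>x. \<tau> *\<^sub>R (N x + N' x) - (s *\<^sub>R E x + s' *\<^sub>R E' x)) \<le> s * h (\<lambda>x. t *\<^sub>R N x - E x) + s' * h (\<lambda>x. t' *\<^sub>R N' x - E' x)"
     using conv[OF sq s(1-3)] by simp
    then have "(h (\<lambda>x. \<tau> *\<^sub>R (N x + N' x) - (s *\<^sub>R E x + s' *\<^sub>R E' x)) + (s * c + s' * c')) / \<tau>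
      \<le> (s * (h (\<lambda>x. t *\<^sub>R N x - E x) + c) + s' * (h (\<lambda>x. t' *\<^sub>R N' x - E' x) + c')) / \<tau>"
     using s(4) by (intro divide_right_mono) (auto simp: algebra_simps)
    also have "\<dots> = s / \<tau> * (h (\<lambda>x. t *\<^sub>R N x - E x) + c) + s' / \<tau> * (h (\<lambda>x. t' *\<^sub>R N' x - E' x) + c')"
     by (simp add: add_divide_distrib)
    also have "\<dots> = y + y'" unfolding s(7,8) t(3) t'(3) by simp
    finally show ?thesis
     using qle[OF sqint_add[OF N] QI[OF s(4) comb[OF t(2) t'(2)]]] by (rule order_trans[rotated])
   qed
   have "q (\<lambda>x. N x + N' x) - y \<le> q N'" if "y \<in> Q N" for y
    by (rule qge) (use le[OF that] in force)
   then have "q (\<lambda>x. N x + N' x) - q N' \<le> q N" by (intro qge) force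
   then show ?thesis by simp
  qed
  show "q (\<lambda>x. s *\<^sub>R N x) \<le> s * q N" if N: "sqint M N" and s: "0 < s" for N s
  proof -
   have "q (\<lambda>x. s *\<^sub>R N x) / s \<le> q N"
   proof (rule qge)
    fix y assume "y \<in> Q N"
    then obtain t E c where t: "0 < t" "(E, c) \<in> \<Gamma>" "y = (h (\<lambda>x. t *\<^sub>R N x - E x) + c) / t" by (auto simp: Q_def)
    have "q (\<lambda>x. s *\<^sub>R N x) \<le> (h (\<lambda>x. (t / s) *\<^sub>R (s *\<^sub>R N x) - E x) + c) / (t / s)"
     using t s by (intro qle sqint_scaleR N QI) auto
    also have "\<dots> = s * y" using t s by (simp add: field_simps)
    finally show "q (\<lambda>x. s *\<^sub>R N x) / s \<le> y" using s by (simp add: field_simps)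
   qed
   then show ?thesis using s by (simp add: field_simps)
  qed
 qed (rule that)
 have upper: "(LINT x|M. R x \<bullet> E x) \<le> c" if "(E, c) \<in> \<Gamma>" for E c
 proof -
  have "q E \<le> c" using qle[OF \<Gamma>(1)[OF that] QI[of 1, OF _ that]] h0 by simp
  then show ?thesis using R(2)[OF \<Gamma>(1)[OF that]] by linarith
 qed
 show ?thesis
 proof (rule that[OF R(1)])
  fix N :: "'a => 'b" assume N: "sqint M N"
  show "(LINT x|M. R x \<bullet> N x) \<le> h N" using R(2)[OF N] qle[OF N QI[of 1, OF _ \<Gamma>0]] by simp
 next
  fix E c assume E: "(E, c) \<in> \<Gamma>"
  show "(LINT x|M. R x \<bullet> E x) = c" using upper[OF E] upper[OF neg[OF E]] by simp
 qed
qed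

lemma AE_nonpos_from_integrals:
 fixes g :: "'a => real"
 assumes g: "integrable M g" and le: "\<And>E. E \<in> sets M ==> (LINT x|M. indicator E x * g x) \<le> 0"
 shows "AE x in M. g x \<le> 0"
proof -
 let ?E = "{x \<in> space M. 0 < g x}"
 have E: "?E \<in> sets M" using g by measurable
 have i: "integrable M (\<lambda>x. indicator ?E x * g x)" using integrable_real_mult_indicator[OF E g] by (simp add: mult.commute)
 have "(LINT x|M. indicator ?E x * g x) = 0"
  using le[OF E] by (intro antisym Bochner_Integration.integral_nonneg_AE AE_I2) (auto simp: indicator_def)
 then have "AE x in M. indicator ?E x * g x = 0"
  using i by (subst (asm) integral_nonneg_eq_0_iff_AE) (auto simp: indicator_def)
 then show ?thesis using AE_space by eventually_elim (auto simp: indicator_def split: if_splits)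
qed

section \<open>The two implications\<close>

context hjb
begin

lemma sqint_inner_bounded:
 fixes b N :: "real^'d => real^'d^'d"
 assumes "b \<in> borel_measurable M" "AE x in M. norm (b x) \<le> C" "sqint M N"
 shows "sqint M (\<lambda>x. b x \<bullet> N x)"
proof (rule sqint_mono[OF sqint_scaleR[OF assms(3), of C]])
 show "AE x in M. norm (b x \<bullet> N x) \<le> norm (C *\<^sub>R N x)"
  using assms(2)
 proof eventually_elim
  case (elim x)
  then have "norm (b x) * norm (N x) \<le> \<bar>C\<bar> * norm (N x)" by (intro mult_right_mono) auto
  then show ?case using Cauchy_Schwarz_ineq2[of "b x" "N x"] by simp
 qed
qed (use assms in auto)

text \<open>Rescaling \<open>b\<close> by \<open>tr b / |b|\<^sup>2\<close> brings it within \<open>\<surd>(1 - \<epsilon>)\<close> of the identity, so that the dual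
 problem is solvable with right-hand side the indicator of the negativity set.\<close>

lemma weight_nonneg:
 assumes b: "b \<in> borel_measurable M" "AE x in M. - b x \<in> subdiff_M A a f x (W x)" and m: "sqint M m"
  and pos: "\<And>v. v \<in> V_space \<Omega> ==> AE x in M. 0 \<le> v x ==> 0 \<le> (LINT x|M. m x * (- b x \<bullet> weak_hessian \<Omega> v x))"
 shows "AE x in M. 0 \<le> m x"
proof (cases "\<Omega> = {}")
 case True then show ?thesis by (intro AE_I2) simp
next
 case False
 define T where "T x = b x \<bullet> mat 1" for x
 define \<theta> where "\<theta> = sqrt (1 - \<epsilon>)"
 have \<theta>: "0 \<le> \<theta>" "\<theta> < 1" using \<epsilon> real_sqrt_less_mono[of "1 - \<epsilon>" 1] by (auto simp: \<theta>_def)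
 have dn: "0 < real CARD('d) * \<nu>l" using \<nu> by simp
 have bx: "AE x in M. real CARD('d) * \<nu>l \<le> T x \<and> norm (b x) \<le> Ca \<and> norm (b x) * sqrt (real CARD('d) - 1 + \<epsilon>) \<le> T x"
  using b(2) AE_space
 proof eventually_elim
  case (elim x)
  then show ?case using subdiff_cordes[OF elim(1)] by (simp add: T_def)
 qed
 define k where "k x = ((b x \<bullet> b x) / T x) *\<^sub>R m x" for x
 define B where "B x = (T x / (b x \<bullet> b x)) *\<^sub>R b x" for x
 have Tm: "T \<in> borel_measurable M" unfolding T_def using b by (intro borel_measurable_inner) auto
 have bm: "(\<lambda>x. b x \<bullet> b x) \<in> borel_measurable M" using b by (intro borel_measurable_inner)
 have k: "sqint M k"
  unfolding k_def
 proof (rule sqint_bounded_mult[OF _ _ m])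
  show "(\<lambda>x. (b x \<bullet> b x) / T x) \<in> borel_measurable M" using bm Tm by (intro borel_measurable_divide)
  show "AE x in M. \<bar>(b x \<bullet> b x) / T x\<bar> \<le> Ca\<^sup>2 / (real CARD('d) * \<nu>l)"
   using bx
  proof eventually_elim
   case (elim x)
   then have "b x \<bullet> b x \<le> Ca\<^sup>2" "0 < T x" using power_mono[of "norm (b x)" Ca 2] dn by (auto simp: power2_norm_eq_inner)
   then show ?case using elim dn by (auto intro!: frac_le)
  qed
 qed
 have B: "B \<in> borel_measurable M" unfolding B_def using b bm Tm by (intro borel_measurable_scaleR borel_measurable_divide)
 have Bn: "AE x in M. norm (B x - mat 1) \<le> \<theta>"
  using bx
 proof eventually_elim
  case (elim x)
  then show ?case unfolding B_def T_def \<theta>_def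
   using \<epsilon> dn by (intro cordes_scaled_near_identity) auto
 qed
 \<comment> \<open>\<open>k\<close> and \<open>m\<close> have the same sign a.e., so up to a null
   set this is the indicator of the set where \<open>m\<close> is negative.\<close>
 define g where "g x = indicat_real {..<0} (k x)" for x
 have gm: "g \<in> borel_measurable M" unfolding g_def using k by (intro measurable_compose[OF sqintD(1)[OF k]] borel_measurable_indicator) auto
 obtain v p P where V: "V_triple v p P" "AE x in M. 0 \<le> v x" "(LINT x|M. k x * (- (B x \<bullet> P x))) = (LINT x|M. k x * g x)"
  by (rule dual_solution[OF convex_\<Omega> False k B Bn \<theta> gm]) (auto simp: g_def indicator_def intro: that)
 have v: "v \<in> V_space \<Omega>" and Pv: "AE x in M. weak_hessian \<Omega> v x = P x" using V_triple_V_space[OF V(1)] by auto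
 have "(LINT x|M. m x * (- b x \<bullet> weak_hessian \<Omega> v x)) = (LINT x|M. k x * (- (B x \<bullet> P x)))"
 proof (rule integral_cong_AE)
  show "(\<lambda>x. m x * (- b x \<bullet> weak_hessian \<Omega> v x)) \<in> borel_measurable M"
   using m b sqintD(1)[OF sqint_weak_hessian[OF v]] by (intro borel_measurable_times borel_measurable_inner borel_measurable_uminus) auto
  show "(\<lambda>x. k x * (- (B x \<bullet> P x))) \<in> borel_measurable M"
   using k B sqintD(1)[OF V_triple_sqint[OF V(1)]] by (intro borel_measurable_times borel_measurable_inner borel_measurable_uminus) auto
  show "AE x in M. m x * (- b x \<bullet> weak_hessian \<Omega> v x) = k x * (- (B x \<bullet> P x))"
   using bx Pv
  proof eventually_elim
   case (elim x)
   then have "T x \<noteq> 0" "b x \<bullet> b x \<noteq> 0" using dn by (auto simp: T_def)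
   then show ?case using elim by (simp add: k_def B_def)
  qed
 qed
 then have kg: "0 \<le> (LINT x|M. k x * g x)" using pos[OF v V(2)] V(3) by simp
 have kgn: "k x * g x \<le> 0" for x by (simp add: g_def indicator_def)
 have "sqint M (\<lambda>x. g x *\<^sub>R k x)"
  by (rule sqint_bounded_mult[OF gm _ k, of 1]) (simp add: g_def indicator_def)
 then have ki: "integrable M (\<lambda>x. - (k x * g x))"
  using sqint_integrable[OF finite_M] by (simp add: mult.commute)
 have "(LINT x|M. - (k x * g x)) = 0"
  using kg kgn by (intro antisym Bochner_Integration.integral_nonneg_AE AE_I2) auto
 then have "AE x in M. k x * g x = 0"
  using ki kgn by (subst (asm) integral_nonneg_eq_0_iff_AE) auto
 then show ?thesis
  using bx
 proof eventually_elim
  case (elim x)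
  have "0 \<le> k x" using elim(1) by (auto simp: g_def indicator_def split: if_splits)
  moreover have "0 < T x" "0 < b x \<bullet> b x" using elim(2) dn by (auto simp: T_def)
  ultimately show ?case by (simp add: k_def zero_le_mult_iff zero_le_divide_iff)
 qed
qed

lemma hamiltonian_op_integral:
 "L2_inner \<Omega> m (\<lambda>x. hamiltonian_op \<Omega> A a f v x - hamiltonian_op \<Omega> A a f u x)
  = (LINT x|M. m x * (H x (weak_hessian \<Omega> v x) - H x (weak_hessian \<Omega> u x)))"
 by (simp add: L2_inner_def hamiltonian_op_def)

lemma PDI_imp_VI:
 assumes G: "nonneg_distr \<Omega> G" and P: "PDI_solution \<Omega> A a f F G u m"
 shows "VI_solution \<Omega> A a f F G u m"
proof -
 obtain b where u: "u \<in> V_space \<Omega>" and m: "sqint M m" and HF: "AE x in M. hamiltonian_op \<Omega> A a f u x = F m x"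
  and b: "(\<lambda>x. - b x) \<in> DH \<Omega> A a f u" and bG: "\<And>v. v \<in> V_space \<Omega> ==> L2_inner \<Omega> m (\<lambda>x. - b x \<bullet> weak_hessian \<Omega> v x) = G v"
  using P by (auto simp: PDI_solution_def L2_iff)
 obtain C where bm: "(\<lambda>x. - b x) \<in> borel_measurable M" and bC: "AE x in M. norm (- b x) \<le> C"
  and sub: "AE x in M. - b x \<in> subdiff_M A a f x (weak_hessian \<Omega> u x)"
  using b by (auto simp: DH_def Linf_sym_def)
 have bm': "b \<in> borel_measurable M" using borel_measurable_uminus[OF bm] by simp
 have mpos: "AE x in M. 0 \<le> m x"
 proof (rule weight_nonneg[OF bm' sub m])
  show "0 \<le> (LINT x|M. m x * (- b x \<bullet> weak_hessian \<Omega> v x))" if "v \<in> V_space \<Omega>" "AE x in M. 0 \<le> v x" for v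
   using bG[OF that(1)] G that by (simp add: nonneg_distr_def L2_inner_def)
 qed
 have "G (\<lambda>x. v x - u x) \<le> L2_inner \<Omega> m (\<lambda>x. hamiltonian_op \<Omega> A a f v x - hamiltonian_op \<Omega> A a f u x)"
  if v: "v \<in> V_space \<Omega>" for v
 proof -
  note d = V_space_diff[OF v u]
  have "G (\<lambda>x. v x - u x) = (LINT x|M. m x * (- b x \<bullet> weak_hessian \<Omega> (\<lambda>x. v x - u x) x))"
   using bG[OF d(1)] by (simp add: L2_inner_def)
  also have "\<dots> \<le> (LINT x|M. m x * (H x (weak_hessian \<Omega> v x) - H x (weak_hessian \<Omega> u x)))"
  proof (rule integral_mono_AE)
   show "integrable M (\<lambda>x. m x * (- b x \<bullet> weak_hessian \<Omega> (\<lambda>x. v x - u x) x))"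
    by (rule sqint_integrable_mult[OF m sqint_inner_bounded[OF bm bC sqint_weak_hessian[OF d(1)]]])
   show "integrable M (\<lambda>x. m x * (H x (weak_hessian \<Omega> v x) - H x (weak_hessian \<Omega> u x)))"
    by (intro sqint_integrable_mult m sqint_H_diff sqint_weak_hessian u v)
   show "AE x in M. m x * (- b x \<bullet> weak_hessian \<Omega> (\<lambda>x. v x - u x) x) \<le> m x * (H x (weak_hessian \<Omega> v x) - H x (weak_hessian \<Omega> u x))"
    using mpos sub d(2) AE_space
   proof eventually_elim
    case (elim x)
    let ?U = "weak_hessian \<Omega> u x" and ?V = "weak_hessian \<Omega> v x"
    \<comment> \<open>The subgradient inequality is tested at the symmetric part of the Hessian of
      \<open>v\<close>; neither \<open>H\<close> nor the symmetric matrix \<open>- b x\<close>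
      notices the replacement.\<close>
    have s: "- b x \<in> sym_mats" and "H x ?U + - b x \<bullet> (sym_part ?V - ?U) \<le> H x (sym_part ?V)"
     using elim(2) sym_part_in_sym_mats by (auto simp: subdiff_M_def)
    moreover have "H x (sym_part ?V) = H x ?V"
     by (rule H_cong_sym_part) (use elim(4) sym_part_in_sym_mats[of ?V] in \<open>auto simp: sym_part_def sym_mats_def simp flip: scaleR_add_left\<close>)
    moreover have "- b x \<bullet> (sym_part ?V - ?U) = - b x \<bullet> (?V - ?U)"
     using sym_mats_inner_sym_part[OF s, of ?V] by (simp add: inner_diff_right)
    ultimately show ?case using elim(1,3) by (intro mult_left_mono) auto
   qed
  qed
  finally show ?thesis by (simp add: hamiltonian_op_integral)
 qed
 then show ?thesis using u m mpos HF by (simp add: VI_solution_def L2_nonneg_def L2_iff)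
qed

lemma VI_imp_PDI:
 assumes G: "G \<in> V_dual \<Omega>" and S: "VI_solution \<Omega> A a f F G u m"
 shows "PDI_solution \<Omega> A a f F G u m"
proof -
 have u: "u \<in> V_space \<Omega>" and m: "sqint M m" and mpos: "AE x in M. 0 \<le> m x"
  and HF: "AE x in M. hamiltonian_op \<Omega> A a f u x = F m x"
  and VI: "\<And>v. v \<in> V_space \<Omega> ==> G (\<lambda>x. v x - u x) \<le> (LINT x|M. m x * (H x (weak_hessian \<Omega> v x) - H x (weak_hessian \<Omega> u x)))"
  using S by (auto simp: VI_solution_def L2_nonneg_def L2_iff hamiltonian_op_integral)
 have Gadd: "\<And>v w. v \<in> V_space \<Omega> ==> w \<in> V_space \<Omega> ==> G (\<lambda>x. v x + w x) = G v + G w"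
  and Gmult: "\<And>c v. v \<in> V_space \<Omega> ==> G (\<lambda>x. c * v x) = c * G v"
  using G by (auto simp: V_dual_def)
 define U where "U = weak_hessian \<Omega> u"
 have U: "sqint M U" unfolding U_def by (rule sqint_weak_hessian[OF u])
 define \<mu> where "\<mu> x = (if 0 < m x then m x else 1)" for x
 have \<mu>0: "0 < \<mu> x" for x by (simp add: \<mu>_def)
 have pm: "{x \<in> space M. 0 < m x} \<in> sets M"
  by (rule borel_measurable_less[OF borel_measurable_const sqintD(1)[OF m]])
 have \<mu>: "sqint M \<mu>"
 proof (rule sqint_mono[OF sqint_add[OF sqint_norm[OF m] sqint_continuous[of "\<lambda>x. 1 :: real"]]])
  show "\<mu> \<in> borel_measurable M" unfolding \<mu>_def using m pm by (intro measurable_If) auto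
 qed (auto simp: \<mu>_def)
 define h where "h N = (LINT x|M. \<mu> x * (H x (U x + N x) - H x (U x)))" for N
 have hi: "integrable M (\<lambda>x. \<mu> x * (H x (U x + N x) - H x (U x)))" if "sqint M N" for N
  by (intro sqint_integrable_mult \<mu> sqint_H_diff sqint_add U that)
 define K where "K = l2 M \<mu> * Ca"
 define W where "W v x = indicator {x. 0 < m x} x *\<^sub>R weak_hessian \<Omega> v x" for v x
 \<comment> \<open>A relation and not a function: that \<open>G v\<close> depends on
   \<open>W v\<close> alone is not known at this point and emerges from the domination.\<close>
 define \<Gamma> where "\<Gamma> = {(E, c). sqint M E \<and> (\<exists>v\<in>V_space \<Omega>. c = G v \<and> (AE x in M. E x = W v x))}"
 have Wm: "sqint M (W v)" if "v \<in> V_space \<Omega>" for v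
 proof (rule sqint_mono[OF sqint_weak_hessian[OF that]])
  have "(\<lambda>x. (if 0 < m x then 1 else 0) *\<^sub>R weak_hessian \<Omega> v x) \<in> borel_measurable M"
   using pm sqintD(1)[OF sqint_weak_hessian[OF that]] by (intro borel_measurable_scaleR measurable_If) auto
  then show "W v \<in> borel_measurable M" by (simp add: W_def[abs_def] indicator_def of_bool_def)
 qed (auto simp: W_def indicator_def)
 \<comment> \<open>The variational inequality is used at \<open>u + v\<close>. Where
   \<open>m > 0\<close> the two weights agree; elsewhere, a.e., both integrands vanish because
   \<open>m = 0\<close> and \<open>E = 0\<close>.\<close>
 have h\<Gamma>: "c \<le> h E" if Ec: "(E, c) \<in> \<Gamma>" for E c
 proof -
  obtain v where v: "v \<in> V_space \<Omega>" "c = G v" "AE x in M. E x = W v x" and E: "sqint M E" using Ec by (auto simp: \<Gamma>_def)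
  note uv = V_space_add[OF u v(1)]
  have "G v \<le> (LINT x|M. m x * (H x (weak_hessian \<Omega> (\<lambda>x. u x + v x) x) - H x (U x)))"
   using VI[OF uv(1)] by (simp add: U_def)
  also have "\<dots> = h E"
   unfolding h_def
  proof (rule integral_cong_AE)
   show "(\<lambda>x. m x * (H x (weak_hessian \<Omega> (\<lambda>x. u x + v x) x) - H x (U x))) \<in> borel_measurable M"
    by (intro borel_measurable_integrable sqint_integrable_mult m sqint_H_diff sqint_weak_hessian uv U)
   show "(\<lambda>x. \<mu> x * (H x (U x + E x) - H x (U x))) \<in> borel_measurable M"
    using hi[OF E] by (rule borel_measurable_integrable)
   show "AE x in M. m x * (H x (weak_hessian \<Omega> (\<lambda>x. u x + v x) x) - H x (U x)) = \<mu> x * (H x (U x + E x) - H x (U x))"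
    using uv(2) v(3) mpos by eventually_elim (auto simp: \<mu>_def W_def U_def indicator_def)
  qed
  finally show ?thesis by (simp add: v(2))
 qed
 obtain R where R: "sqint M R" "\<And>N. sqint M N ==> (LINT x|M. R x \<bullet> N x) \<le> h N"
  "\<And>E c. (E, c) \<in> \<Gamma> ==> (LINT x|M. R x \<bullet> E x) = c"
 proof (rule dominated_extension[OF finite_M, of h K \<Gamma>])
  show "h N \<le> h N' + K * l2 M (\<lambda>x. N x - N' x)" if N: "sqint M N" "sqint M N'" for N N'
  proof -
   have d: "sqint M (\<lambda>x. H x (U x + N x) - H x (U x + N' x))" by (intro sqint_H_diff sqint_add U N)
   have "h N - h N' = (LINT x|M. \<mu> x * (H x (U x + N x) - H x (U x + N' x)))"
    unfolding h_def using hi[OF N(1)] hi[OF N(2)]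
    by (subst Bochner_Integration.integral_diff[symmetric]) (auto simp: algebra_simps)
   also have "\<dots> \<le> l2 M \<mu> * l2 M (\<lambda>x. H x (U x + N x) - H x (U x + N' x))"
    using l2_Cauchy_Schwarz_real[OF \<mu> d] by linarith
   also have "l2 M (\<lambda>x. H x (U x + N x) - H x (U x + N' x)) \<le> l2 M (\<lambda>x. Ca *\<^sub>R (N x - N' x))"
   proof (rule l2_mono[OF sqint_scaleR[OF sqint_diff[OF N]] sqintD(1)[OF d]], intro AE_I2)
    fix x assume "x \<in> space M"
    then show "norm (H x (U x + N x) - H x (U x + N' x)) \<le> norm (Ca *\<^sub>R (N x - N' x))"
     using H_Lipschitz[of x "U x + N x" "U x + N' x"] Ca(1) by simp
   qed
   finally show ?thesis using Ca(1) by (simp add: l2_scaleR K_def mult.assoc mult_left_mono)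
  qed
  show "h (\<lambda>x. s *\<^sub>R N x + t *\<^sub>R N' x) \<le> s * h N + t * h N'"
   if N: "sqint M N" "sqint M N'" and st: "0 \<le> s" "0 \<le> t" "s + t = 1" for N N' s t
  proof -
   have t: "t = 1 - s" using st by simp
   have sq: "sqint M (\<lambda>x. s *\<^sub>R N x + t *\<^sub>R N' x)" by (intro sqint_add sqint_scaleR N)
   have "h (\<lambda>x. s *\<^sub>R N x + t *\<^sub>R N' x)
    \<le> (LINT x|M. s * (\<mu> x * (H x (U x + N x) - H x (U x))) + t * (\<mu> x * (H x (U x + N' x) - H x (U x))))"
    unfolding h_def
   proof (rule integral_mono[OF hi[OF sq]])
    show "integrable M (\<lambda>x. s * (\<mu> x * (H x (U x + N x) - H x (U x))) + t * (\<mu> x * (H x (U x + N' x) - H x (U x))))"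
     using hi[OF N(1)] hi[OF N(2)] by simp
    fix x assume "x \<in> space M"
    then have "H x (s *\<^sub>R (U x + N x) + t *\<^sub>R (U x + N' x)) \<le> s * H x (U x + N x) + t * H x (U x + N' x)"
     using st by (intro H_convex) auto
    moreover have "s *\<^sub>R (U x + N x) + t *\<^sub>R (U x + N' x) = U x + (s *\<^sub>R N x + t *\<^sub>R N' x)"
     unfolding t by (simp add: algebra_simps)
    ultimately have "H x (U x + (s *\<^sub>R N x + t *\<^sub>R N' x)) - H x (U x)
      \<le> s * (H x (U x + N x) - H x (U x)) + t * (H x (U x + N' x) - H x (U x))"
     unfolding t by (simp add: algebra_simps)
    from mult_left_mono[OF this less_imp_le[OF \<mu>0[of x]]]
    show "\<mu> x * (H x (U x + (s *\<^sub>R N x + t *\<^sub>R N' x)) - H x (U x))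
      \<le> s * (\<mu> x * (H x (U x + N x) - H x (U x))) + t * (\<mu> x * (H x (U x + N' x) - H x (U x)))"
     by (simp add: algebra_simps)
   qed
   also have "\<dots> = s * h N + t * h N'"
    unfolding h_def using hi[OF N(1)] hi[OF N(2)] by simp
   finally show ?thesis .
  qed
  show "h (\<lambda>x. 0) = 0" by (simp add: h_def)
  have z: "(\<lambda>x. 0) \<in> V_space \<Omega>" "AE x in M. weak_hessian \<Omega> (\<lambda>x. 0) x = 0" using V_triple_V_space(1,2)[OF V_triple_zero] .
  moreover have "G (\<lambda>x. 0) = 0" using Gmult[OF z(1), of 0] by simp
  ultimately show "((\<lambda>x. 0), 0) \<in> \<Gamma>"
   by (auto simp: \<Gamma>_def W_def intro!: bexI[of _ "\<lambda>x. 0"] elim!: eventually_mono)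
  show "((\<lambda>x. s *\<^sub>R E x + t *\<^sub>R E' x), s * c + t * c') \<in> \<Gamma>" if Ec: "(E, c) \<in> \<Gamma>" "(E', c') \<in> \<Gamma>" for E c E' c' s t
  proof -
   obtain v where v: "v \<in> V_space \<Omega>" "c = G v" "AE x in M. E x = W v x" "sqint M E" using Ec(1) by (auto simp: \<Gamma>_def)
   obtain w where w: "w \<in> V_space \<Omega>" "c' = G w" "AE x in M. E' x = W w x" "sqint M E'" using Ec(2) by (auto simp: \<Gamma>_def)
   note sv = V_space_cmult[OF v(1), of s] and tw = V_space_cmult[OF w(1), of t]
   note vw = V_space_add[OF sv(1) tw(1)]
   have "AE x in M. s *\<^sub>R E x + t *\<^sub>R E' x = W (\<lambda>x. s * v x + t * w x) x"
    using v(3) w(3) sv(2) tw(2) vw(2) by eventually_elim (simp add: W_def scaleR_add_right mult.commute)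
   moreover have "s * c + t * c' = G (\<lambda>x. s * v x + t * w x)"
    using Gadd[OF sv(1) tw(1)] by (simp add: Gmult v w)
   ultimately show ?thesis using vw(1) v(4) w(4) unfolding \<Gamma>_def
    by (auto intro!: bexI[of _ "\<lambda>x. s * v x + t * w x"] sqint_add sqint_scaleR)
  qed
 qed (use h\<Gamma> in \<open>auto simp: \<Gamma>_def intro: that\<close>)
 have local: "AE x in M. R x \<bullet> N \<le> \<mu> x * (H x (U x + N) - H x (U x))" for N :: "real^'d^'d"
 proof -
  have Ns: "sqint M (\<lambda>x. N)" by (intro sqint_continuous continuous_on_const)
  have i: "integrable M (\<lambda>x. R x \<bullet> N)" using sqint_integrable_inner[OF R(1) Ns] .
  have "AE x in M. R x \<bullet> N - \<mu> x * (H x (U x + N) - H x (U x)) \<le> 0"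
  proof (rule AE_nonpos_from_integrals)
   show "integrable M (\<lambda>x. R x \<bullet> N - \<mu> x * (H x (U x + N) - H x (U x)))"
    using i hi[OF Ns] by (rule Bochner_Integration.integrable_diff)
   fix E assume E: "E \<in> sets M"
   have NE: "sqint M (\<lambda>x. indicator E x *\<^sub>R N)"
    by (rule sqint_bounded_mult[OF _ _ Ns, of _ 1]) (use E in \<open>auto simp: indicator_def\<close>)
   have 1: "integrable M (\<lambda>x. indicator E x * (R x \<bullet> N))" "integrable M (\<lambda>x. indicator E x * (\<mu> x * (H x (U x + N) - H x (U x))))"
    using integrable_real_mult_indicator[OF E i] integrable_real_mult_indicator[OF E hi[OF Ns]] by (simp_all add: mult.commute)
   have "h (\<lambda>x. indicator E x *\<^sub>R N) = (LINT x|M. indicator E x * (\<mu> x * (H x (U x + N) - H x (U x))))"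
    unfolding h_def by (intro Bochner_Integration.integral_cong) (auto simp: indicator_def)
   then have "(LINT x|M. indicator E x * (R x \<bullet> N)) \<le> (LINT x|M. indicator E x * (\<mu> x * (H x (U x + N) - H x (U x))))"
    using R(2)[OF NE] by simp
   then show "(LINT x|M. indicator E x * (R x \<bullet> N - \<mu> x * (H x (U x + N) - H x (U x)))) \<le> 0"
    using 1 by (simp add: right_diff_distrib)
  qed
  then show ?thesis by simp
 qed
 \<comment> \<open>A countable dense set of matrices allows one exceptional null set for all of
   them; Lipschitz continuity of \<open>H\<close> in the matrix reaches the others.\<close>
 obtain D :: "(real^'d^'d) set" where D: "countable D" "\<And>X. open X ==> X \<noteq> {} ==> \<exists>d\<in>D. d \<in> X"
  by (rule countable_dense_setE) (rule that)
 have Dd: "closure D = UNIV"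
 proof -
  have "\<exists>d\<in>D. dist d N < e" if "0 < e" for N and e :: real
   using D(2)[of "ball N e"] that by (force simp: dist_commute)
  then show ?thesis by (auto simp: closure_approachable)
 qed
 have "AE x in M. \<forall>N\<in>D. R x \<bullet> N \<le> \<mu> x * (H x (U x + N) - H x (U x))"
  using local D(1) by (simp add: AE_ball_countable)
 then have all: "AE x in M. \<forall>N. R x \<bullet> N \<le> \<mu> x * (H x (U x + N) - H x (U x))"
  using AE_space
 proof eventually_elim
  case (elim x)
  show ?case
  proof
   fix N
   have "(Ca)-lipschitz_on UNIV (\<lambda>N. H x (U x + N))"
    using H_Lipschitz[of x] elim(2) Ca(1) by (intro lipschitz_onI) (auto simp: dist_norm, metis add_diff_cancel_left)
   then have "continuous_on UNIV (\<lambda>N. H x (U x + N))" by (rule lipschitz_on_continuous_on)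
   then have c: "continuous_on (closure D) (\<lambda>N. R x \<bullet> N - \<mu> x * (H x (U x + N) - H x (U x)))"
    unfolding Dd by (intro continuous_intros)
   have "R x \<bullet> N - \<mu> x * (H x (U x + N) - H x (U x)) \<le> 0"
    by (rule continuous_le_on_closure[OF c]) (use elim(1) Dd in auto)
   then show "R x \<bullet> N \<le> \<mu> x * (H x (U x + N) - H x (U x))" by simp
  qed
 qed
 define b where "b x = - ((1 / \<mu> x) *\<^sub>R R x)" for x
 have bm: "(\<lambda>x. - b x) \<in> borel_measurable M"
  unfolding b_def minus_minus using \<mu> R(1) by (intro borel_measurable_scaleR borel_measurable_divide) auto
 have sub: "AE x in M. - b x \<in> sym_mats \<and> norm (- b x) \<le> Ca \<and> - b x \<in> subdiff_M A a f x (U x)"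
  using all AE_space
 proof eventually_elim
  case (elim x)
  have le: "- b x \<bullet> N \<le> H x (U x + N) - H x (U x)" for N
   using elim(1) \<mu>0[of x] by (simp add: b_def divide_le_eq mult.commute)
  have x: "x \<in> \<Omega>" using elim(2) by simp
  \<comment> \<open>Twice the antisymmetric part of \<open>- b x\<close>. \<open>H\<close> does not
    change along antisymmetric directions, so the domination in the directions \<open>N\<close> and
    \<open>- N\<close> forces \<open>N\<close> to be orthogonal to \<open>- b x\<close>, hence to
    itself.\<close>
  define N where "N = - b x - transpose (- b x)"
  have "H x (U x + N') = H x (U x)" if "transpose N' = - N'" for N'
   by (rule H_cong_sym_part[OF x]) (simp add: sym_part_def transpose_add that)
  moreover have tt: "transpose (X - Y) = transpose X - transpose (Y :: real^'d^'d)" "transpose (- X) = - transpose X" for X Y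
   by (simp_all add: transpose_def vec_eq_iff)
  have "transpose N = - N" "transpose (- N) = - (- N)" by (simp_all add: N_def tt)
  ultimately have "H x (U x + N) = H x (U x)" "H x (U x + - N) = H x (U x)" by blast+
  then have bN: "- b x \<bullet> N = 0" using le[of N] le[of "- N"] by simp
  have "N \<bullet> N = - b x \<bullet> N + - transpose (- b x) \<bullet> N" by (simp add: N_def inner_diff_left inner_add_left)
  also have "- transpose (- b x) \<bullet> N = - b x \<bullet> N"
   using transpose_inner[of "- b x" N] \<open>transpose N = - N\<close> by simp
  finally have "N = 0" using bN by simp
  then have sym: "- b x \<in> sym_mats" by (simp add: N_def sym_mats_def)
  \<comment> \<open>Choosing the direction \<open>- b x\<close> itself turns the Lipschitz bound for
    \<open>H\<close> into the essential bound required by \<open>Linf_sym\<close>.\<close>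
  have "norm (- b x) * norm (- b x) \<le> Ca * norm (- b x)"
   using le[of "- b x"] H_Lipschitz[OF x, of "U x + - b x" "U x"] by (simp add: dot_square_norm power2_eq_square)
  then have "norm (- b x) \<le> Ca" using Ca(1) by (cases "b x = 0") auto
  moreover have "H x (U x) + - b x \<bullet> (M' - U x) \<le> H x M'" for M' using le[of "M' - U x"] by simp
  ultimately show ?case using sym by (auto simp: subdiff_M_def)
 qed
 have "L2_inner \<Omega> m (\<lambda>x. - b x \<bullet> weak_hessian \<Omega> v x) = G v" if v: "v \<in> V_space \<Omega>" for v
 proof -
  have bC: "AE x in M. norm (- b x) \<le> Ca" using sub by eventually_elim simp
  have "(W v, G v) \<in> \<Gamma>" using v Wm by (auto simp: \<Gamma>_def)
  then have "G v = (LINT x|M. R x \<bullet> W v x)" using R(3) by simp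
  also have "\<dots> = (LINT x|M. m x * (- b x \<bullet> weak_hessian \<Omega> v x))"
  proof (rule integral_cong_AE)
   show "(\<lambda>x. R x \<bullet> W v x) \<in> borel_measurable M" using R(1) Wm[OF v] by (intro borel_measurable_inner) auto
   show "(\<lambda>x. m x * (- b x \<bullet> weak_hessian \<Omega> v x)) \<in> borel_measurable M"
    by (intro borel_measurable_integrable sqint_integrable_mult m sqint_inner_bounded[OF bm bC] sqint_weak_hessian v)
   show "AE x in M. R x \<bullet> W v x = m x * (- b x \<bullet> weak_hessian \<Omega> v x)"
    using mpos by eventually_elim (auto simp: W_def b_def \<mu>_def indicator_def)
  qed
  finally show ?thesis by (simp add: L2_inner_def)
 qed
 moreover have "(\<lambda>x. - b x) \<in> DH \<Omega> A a f u"
  using bm sub unfolding DH_def Linf_sym_def U_def by (auto elim: eventually_mono)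
 ultimately show ?thesis using u m HF by (auto simp: PDI_solution_def L2_iff)
qed

end

theorem corollary3p2:
  fixes \<Omega> :: "(real^'d) set"
    and A :: "'c::metric_space set"
    and a :: "real^'d \<Rightarrow> 'c \<Rightarrow> real^'d^'d"
    and f :: "real^'d \<Rightarrow> 'c \<Rightarrow> real"
    and F :: "(real^'d \<Rightarrow> real) \<Rightarrow> (real^'d \<Rightarrow> real)"
    and G :: "(real^'d \<Rightarrow> real) \<Rightarrow> real"
    and u m :: "real^'d \<Rightarrow> real"
    and \<nu>l \<nu>u \<epsilon> :: real
  assumes "open \<Omega>" and "bounded \<Omega>" and "convex \<Omega>"
    and "compact A" and "A \<noteq> {}"
    and "continuous_on (closure \<Omega> \<times> A) (\<lambda>(x, \<alpha>). a x \<alpha>)"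
    and "0 < \<nu>l" and "\<nu>l \<le> \<nu>u" and "0 < \<epsilon>" and "\<epsilon> \<le> 1"
    and "\<And>x \<alpha>. x \<in> closure \<Omega> \<Longrightarrow> \<alpha> \<in> A \<Longrightarrow> a x \<alpha> \<in> cordes \<nu>l \<nu>u \<epsilon>"
    and "continuous_on (closure \<Omega> \<times> A) (\<lambda>(x, \<alpha>). f x \<alpha>)"
    and "L2_operator \<Omega> F"
    and "G \<in> V_dual \<Omega>" and "nonneg_distr \<Omega> G"
  shows "PDI_solution \<Omega> A a f F G u m \<longleftrightarrow> VI_solution \<Omega> A a f F G u m"
proof -
 interpret hjb \<Omega> A a f \<nu>l \<nu>u \<epsilon>
  by unfold_locales (use assms in auto)
 show ?thesis using PDI_imp_VI VI_imp_PDI assms by blast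
qed

end
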